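(* For every $\bm{f}\in\bm{L}^1(\mathbb{S})$, $\bm{u}=\bm{P}_e\bm{f}$ converges non-tangentially to $\bm{f}$ almost everywhere on $\mathbb{S}$, i.e. $\lim_{x\in\Gamma_\xi,\,x\to\xi}\bm{u}(x)=\bm{f}(\xi)$ for $\sigma$-a.e. $\xi\in\mathbb{S}$. In particular this holds for every $\bm{u}\in\bm{h}^p_e(\mathbb{B})$, $1<p\le\infty$ (with $\bm{f}$ the function such that $\bm{u}=\bm{P}_e\bm{f}$). Moreover, every $\bm{u}\in\bm{h}^1_e(\mathbb{B})$ has non-tangential limits $\sigma$-almost everywhere on $\mathbb{S}$.
   Context: $\mathbb{B}$ is the open unit ball of $\mathbb{R}^3$, $\mathbb{S}$ the unit sphere, $\sigma$ surface measure. Lamé constants $\mu>0$, $2\mu+\lambda>0$; $\Delta^*\bm{u}=\mu\Delta\bm{u}+(\lambda+\mu)\nabla\,\mathrm{div}\,\bm{u}$. $\bm{h}^p_e(\mathbb{B})$ ($1\le p<\infty$): solutions of $\Delta^*\bm{u}=0$ with $\sup_{0\le r<1}\|\bm{u}(r\cdot)\|_{\bm{L}^p(\mathbb{S})}<\infty$; $\bm{h}^\infty_e$: bounded solutions. Every $\bm{u}\in\bm{h}^p_e$, $1<p\le\infty$, is of the form $\bm{P}_e\bm{f}$ with $\bm{f}\in\bm{L}^p(\mathbb{S})$. With $\beta=\frac{\lambda+\mu}{2\lambda+6\mu}$, $\alpha=\frac{\lambda+2\mu}{\lambda+3\mu}$, $P(x,\eta)=\frac{1}{4\pi}\frac{1-|x|^2}{|x-\eta|^3}$,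 $\Phi(x,\eta)=\frac{1}{4\pi}\int_0^1\big(\frac{1-t^2|x|^2}{(1-2tx\cdot\eta+t^2|x|^2)^{3/2}}-1-3tx\cdot\eta\big)\frac{dt}{t^{1+\alpha}}$, the elastic Poisson kernel is $\mathcal{P}_e(x,\eta)=P(x,\eta)\mathcal{I}+\mathcal{L}(x,\eta)$ with $\mathcal{L}_{ij}=\beta(1-|x|^2)\partial_{x_i}\partial_{x_j}\Phi$, and $\bm{P}_e\bm{f}(x)=\int_{\mathbb{S}}\mathcal{P}_e(x,\eta)\bm{f}(\eta)d\sigma(\eta)$. $\Gamma_\xi=\mathbb{B}\cap\mathrm{conv}(\{\xi\}\cup\{|x|\le1/2\})$ for $\xi\in\mathbb{S}$. *)

theory Defs
  imports "HOL-Analysis.Analysis"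
begin

type_synonym vec3 = "real ^ 3"

text \<open>Surface measure on the unit sphere S of R^3, defined via the cone construction:
  sigma(A) = 3 * Lebesgue volume of the cone {t x : 0 < t <= 1, x in A}.
  This coincides with the usual surface (2-dimensional Hausdorff) measure; total mass 4 pi.\<close>
definition sphere_measure :: "vec3 measure" where
  "sphere_measure =
     density (distr (restrict_space lborel (ball 0 1 - {0}))
                    (restrict_space borel (sphere 0 1)) (\<lambda>x. x /\<^sub>R norm x))
             (\<lambda>_. ennreal 3)"

definition pd :: "3 \<Rightarrow> (vec3 \<Rightarrow> real) \<Rightarrow> vec3 \<Rightarrow> real" where
  "pd i g x = frechet_derivative g (at x) (axis i 1)"

definition C2_on :: "vec3 set \<Rightarrow> (vec3 \<Rightarrow> real) \<Rightarrow> bool" where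
  "C2_on S g \<longleftrightarrow> (\<forall>x\<in>S. g differentiable (at x))
     \<and> (\<forall>j. \<forall>x\<in>S. pd j g differentiable (at x))
     \<and> (\<forall>i j. continuous_on S (pd i (pd j g)))"

definition divg :: "(vec3 \<Rightarrow> vec3) \<Rightarrow> vec3 \<Rightarrow> real" where
  "divg u x = (\<Sum>i\<in>UNIV. pd i (\<lambda>y. u y $ i) x)"

definition lame_op :: "real \<Rightarrow> real \<Rightarrow> (vec3 \<Rightarrow> vec3) \<Rightarrow> vec3 \<Rightarrow> vec3" where
  "lame_op la mu u x = (\<chi> k. mu * (\<Sum>i\<in>UNIV. pd i (pd i (\<lambda>y. u y $ k)) x)
                              + (la + mu) * pd k (divg u) x)"

definition lame_solution :: "real \<Rightarrow> real \<Rightarrow> (vec3 \<Rightarrow> vec3) \<Rightarrow> bool" where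
  "lame_solution la mu u \<longleftrightarrow> (\<forall>k. C2_on (ball 0 1) (\<lambda>y. u y $ k))
      \<and> (\<forall>x\<in>ball 0 1. lame_op la mu u x = 0)"

definition hpe :: "real \<Rightarrow> real \<Rightarrow> real \<Rightarrow> (vec3 \<Rightarrow> vec3) set" where
  "hpe la mu p = {u. lame_solution la mu u \<and>
      (\<exists>C::real. \<forall>r\<in>{0..<1}.
          (\<integral>\<^sup>+ \<eta>. ennreal (norm (u (r *\<^sub>R \<eta>)) powr p) \<partial>sphere_measure) \<le> ennreal C)}"

definition hinfe :: "real \<Rightarrow> real \<Rightarrow> (vec3 \<Rightarrow> vec3) set" where
  "hinfe la mu = {u. lame_solution la mu u \<and> bounded (u ` ball 0 1)}"

definition Lp_sphere :: "real \<Rightarrow> (vec3 \<Rightarrow> vec3) set" where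
  "Lp_sphere p = {f. f \<in> borel_measurable sphere_measure \<and>
      (\<integral>\<^sup>+ \<eta>. ennreal (norm (f \<eta>) powr p) \<partial>sphere_measure) < \<infinity>}"

definition Linf_sphere :: "(vec3 \<Rightarrow> vec3) set" where
  "Linf_sphere = {f. f \<in> borel_measurable sphere_measure \<and>
      (\<exists>C. AE \<eta> in sphere_measure. norm (f \<eta>) \<le> C)}"

definition beta_e :: "real \<Rightarrow> real \<Rightarrow> real" where
  "beta_e la mu = (la + mu) / (2 * la + 6 * mu)"

definition alpha_e :: "real \<Rightarrow> real \<Rightarrow> real" where
  "alpha_e la mu = (la + 2 * mu) / (la + 3 * mu)"

definition poisson_kernel :: "vec3 \<Rightarrow> vec3 \<Rightarrow> real" where
  "poisson_kernel x \<eta> = (1 - (norm x)\<^sup>2) / (4 * pi * norm (x - \<eta>) ^ 3)"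

definition Phi_e :: "real \<Rightarrow> vec3 \<Rightarrow> vec3 \<Rightarrow> real" where
  "Phi_e al x \<eta> = 1 / (4 * pi) * integral {0..1} (\<lambda>t.
      ((1 - t\<^sup>2 * (norm x)\<^sup>2) / (1 - 2 * t * (x \<bullet> \<eta>) + t\<^sup>2 * (norm x)\<^sup>2) powr (3/2)
        - 1 - 3 * t * (x \<bullet> \<eta>)) / t powr (1 + al))"

definition elastic_kernel :: "real \<Rightarrow> real \<Rightarrow> vec3 \<Rightarrow> vec3 \<Rightarrow> real ^ 3 ^ 3" where
  "elastic_kernel la mu x \<eta> = (\<chi> i j.
      (if i = j then poisson_kernel x \<eta> else 0)
      + beta_e la mu * (1 - (norm x)\<^sup>2) *
          pd i (pd j (\<lambda>y. Phi_e (alpha_e la mu) y \<eta>)) x)"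

definition elastic_poisson :: "real \<Rightarrow> real \<Rightarrow> (vec3 \<Rightarrow> vec3) \<Rightarrow> vec3 \<Rightarrow> vec3" where
  "elastic_poisson la mu f x = (\<integral>\<eta>. elastic_kernel la mu x \<eta> *v f \<eta> \<partial>sphere_measure)"

definition Gamma :: "vec3 \<Rightarrow> vec3 set" where
  "Gamma \<xi> = ball 0 1 \<inter> convex hull (insert \<xi> (cball 0 (1/2)))"

end

theory Submission
  imports Defs "HOL-Probability.Helly_Selection"
begin

text \<open>The elastic kernel is dominated by a multiple of \<open>(1 - norm x) / norm (x - \<eta>) ^ 3\<close>. Splitting
  the sphere into dyadic rings around \<open>\<xi>\<close>, the integral of this majorant against a measure tends to
  0 nontangentially wherever the measure has vanishing surface density. Applied to
  \<open>\<bar>f - f \<xi>\<bar>\<close> at Lebesgue points, and together with the fact that the kernel reproduces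
  constants, this gives the limits of elastic Poisson integrals.

  An elastic Poisson integral solves the Lame system, and a Caccioppoli estimate shows that a solution
  decaying at the boundary vanishes; hence every dilate \<open>u (r x)\<close> of a solution is the Poisson
  integral of its values on the sphere. For bounded \<open>L\<^sup>p\<close> means these values have weak limits
  as \<open>r\<close> tends to 1, obtained from Helly's theorem on the line through a space-filling curve, so \<open>u\<close> is the
  Poisson integral of finite measures. For \<open>p > 1\<close> these are absolutely continuous by uniform
  integrability. For \<open>p = 1\<close> the singular parts have vanishing density almost everywhere, so they
  do not contribute to the limit.\<close>

section \<open>Partial derivatives and $C^n$ functions\<close>

text \<open>The correction to the Poisson kernel is \<open>1 - |x|^2\<close> times an average, along
  the ray from 0 to \<open>x\<close>, of second derivatives of the Poisson kernel. These have size
  \<open>|y - e|^-4\<close>, and averaging along the ray gains one power; this is the source of the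
  majorant. No maximum principle is at hand for the system, so uniqueness rests on energy. For
  \<open>la + mu < 0\<close> the energy density need not be nonnegative pointwise; it is controlled
  only after integration, by exchanging derivatives in the squared divergence. The energy argument
  asks for decay at the boundary like a power of \<open>1 - |x|\<close> above 1/2. The dilates
  provide it: their Lipschitz boundary values pay for the singularity of the kernel up to a
  logarithm, and giving away a quarter of a power leaves 3/4. Uniqueness serves twice: for
  \<open>la = -1\<close>, \<open>mu = 1\<close> the system is three copies of Laplace's equation,
  and together with rotation invariance this normalizes the Poisson kernel.\<close>

lemma pd_eqI:
  assumes "(g has_derivative (\<lambda>h. G \<bullet> h)) (at x)"
  shows "pd i g x = G $ i"
  unfolding pd_def frechet_derivative_at[OF assms, symmetric] by (simp add: inner_axis)

lemma pd_has_derivative: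
  assumes "g differentiable (at x)"
  shows "(g has_derivative (\<lambda>h. (\<chi> i. pd i g x) \<bullet> h)) (at x)"
proof -
  have d: "(g has_derivative frechet_derivative g (at x)) (at x)"
    using assms frechet_derivative_works by blast
  then interpret bounded_linear "frechet_derivative g (at x)" by (rule has_derivative_bounded_linear)
  have "frechet_derivative g (at x) h = (\<chi> i. pd i g x) \<bullet> h" for h
  proof -
    have "(\<Sum>i\<in>UNIV. (h $ i) *\<^sub>R axis i 1) = h"
      using basis_expansion[of h] by (simp only: scalar_mult_eq_scaleR)
    then have "frechet_derivative g (at x) h = frechet_derivative g (at x) (\<Sum>i\<in>UNIV. (h $ i) *\<^sub>R axis i 1)"
      by (simp only:)
    also have "\<dots> = (\<Sum>i\<in>UNIV. (h $ i) *\<^sub>R frechet_derivative g (at x) (axis i 1))"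
      by (simp only: sum scaleR)
    finally show ?thesis by (simp add: inner_vec_def pd_def mult.commute)
  qed
  then have "frechet_derivative g (at x) = (\<lambda>h. (\<chi> i. pd i g x) \<bullet> h)" by blast
  with d show ?thesis by simp
qed

lemma pd_has_derivative_iff:
  "(g has_derivative (\<lambda>h. G \<bullet> h)) (at x) \<longleftrightarrow> g differentiable (at x) \<and> (\<forall>i. pd i g x = G $ i)"
proof safe
  assume d: "g differentiable (at x)" and p: "\<forall>i. pd i g x = G $ i"
  then have "(\<chi> i. pd i g x) = G" by (simp add: vec_eq_iff)
  then show "(g has_derivative (\<lambda>h. G \<bullet> h)) (at x)" using pd_has_derivative[OF d] by simp
qed (auto simp: pd_eqI differentiable_def)

text \<open>\<open>frechet_derivative\<close> is a choice among all derivatives. The proof shows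
  that both functions have the same derivatives at \<open>x\<close>, possibly none, so the choices
  coincide without any differentiability assumption.\<close>

lemma pd_cong_open:
  assumes "open S" "x \<in> S" "\<And>y. y \<in> S \<Longrightarrow> f y = g y"
  shows "pd i f x = pd i g x"
proof -
  have "(f has_derivative D) (at x) \<longleftrightarrow> (g has_derivative D) (at x)" for D
    using has_derivative_transform_within_open[of f D x UNIV S g]
      has_derivative_transform_within_open[of g D x UNIV S f] assms by auto
  then show ?thesis by (simp add: pd_def frechet_derivative_def)
qed

lemma differentiable_cong_open:
  assumes "open S" "x \<in> S" "\<And>y. y \<in> S \<Longrightarrow> f y = g y" 
  shows "f differentiable (at x) \<longleftrightarrow> g differentiable (at x)"
proof -
  have "(f has_derivative D) (at x) \<longleftrightarrow> (g has_derivative D) (at x)" for D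
    using has_derivative_transform_within_open[of f D x UNIV S g]
      has_derivative_transform_within_open[of g D x UNIV S f] assms by auto
  then show ?thesis by (simp add: differentiable_def)
qed

lemma pd_const [simp]: "pd i (\<lambda>x. c) x = 0"
  by (simp add: pd_def)

lemma pd_coord: "pd i (\<lambda>y. y $ j) x = (if i = j then 1 else 0)"
proof -
  have "((\<lambda>y::vec3. y $ j) has_derivative (\<lambda>h. axis j 1 \<bullet> h)) (at x)"
    using bounded_linear_imp_has_derivative[OF bounded_linear_vec_nth, of j "at x"] by (simp add: inner_axis')
  from pd_eqI[OF this] show ?thesis by (simp add: axis_def)
qed

lemma pd_add:
  assumes "f differentiable (at x)" "g differentiable (at x)"
  shows "pd i (\<lambda>y. f y + g y) x = pd i f x + pd i g x"
proof -
  have "((\<lambda>y. f y + g y) has_derivative (\<lambda>h. ((\<chi> i. pd i f x) + (\<chi> i. pd i g x)) \<bullet> h)) (at x)"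
    using has_derivative_add[OF assms[THEN pd_has_derivative]] by (simp add: inner_add_left)
  from pd_eqI[OF this] show ?thesis by simp
qed

lemma pd_mult:
  assumes "f differentiable (at x)" "g differentiable (at x)"
  shows "pd i (\<lambda>y. f y * g y) x = pd i f x * g x + f x * pd i g x"
proof -
  have "((\<lambda>y. f y * g y) has_derivative (\<lambda>h. (g x *\<^sub>R (\<chi> i. pd i f x) + f x *\<^sub>R (\<chi> i. pd i g x)) \<bullet> h)) (at x)"
    using has_derivative_mult[OF assms[THEN pd_has_derivative]]
    by (simp add: inner_add_left algebra_simps)
  from pd_eqI[OF this] show ?thesis by simp
qed

lemma pd_cmult:
  assumes "f differentiable (at x)"
  shows "pd i (\<lambda>y. c * f y) x = c * pd i f x"
  using pd_mult[of "\<lambda>_. c" x f] assms by simp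

lemma pd_diff:
  assumes "f differentiable (at x)" "g differentiable (at x)"
  shows "pd i (\<lambda>y. f y - g y) x = pd i f x - pd i g x"
  using pd_add[OF assms(1), of "\<lambda>y. (-1) * g y"] pd_cmult[OF assms(2), of i "-1"] assms
  by (auto simp: differentiable_cmult_left_iff)

lemma pd_sum:
  assumes "finite A" "\<And>a. a \<in> A \<Longrightarrow> f a differentiable (at x)"
  shows "pd i (\<lambda>y. \<Sum>a\<in>A. f a y) x = (\<Sum>a\<in>A. pd i (f a) x)"
  using assms
proof (induction A rule: finite_induct)
  case (insert a A)
  have "(\<lambda>y. \<Sum>a\<in>A. f a y) differentiable (at x)"
    using insert by (intro differentiable_sum) auto
  then show ?case using insert pd_add[of "f a" x "\<lambda>y. \<Sum>a\<in>A. f a y" i] by simp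
qed simp

lemma pd_comp:
  assumes "(m has_real_derivative m') (at (g x))" "g differentiable (at x)"
  shows "pd i (\<lambda>y. m (g y)) x = m' * pd i g x" "(\<lambda>y. m (g y)) differentiable (at x)"
proof -
  let ?G = "\<chi> i. pd i g x"
  have "(m has_derivative (\<lambda>h. m' * h)) (at (g x))"
    using assms(1) by (simp add: has_field_derivative_def)
  from has_derivative_compose[OF pd_has_derivative[OF assms(2)] this]
  have "((\<lambda>y. m (g y)) has_derivative (\<lambda>h. m' * (?G \<bullet> h))) (at x)" .
  moreover have "(\<lambda>h. m' * (?G \<bullet> h)) = (\<lambda>h. (m' *\<^sub>R ?G) \<bullet> h)" by (rule ext) (simp only: inner_scaleR_left)
  ultimately have *: "((\<lambda>y. m (g y)) has_derivative (\<lambda>h. (m' *\<^sub>R ?G) \<bullet> h)) (at x)" by (simp only:)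
  show "pd i (\<lambda>y. m (g y)) x = m' * pd i g x" unfolding pd_eqI[OF *] by simp
  show "(\<lambda>y. m (g y)) differentiable (at x)" using * unfolding differentiable_def by blast
qed

lemma pd_scale:
  assumes "g differentiable (at (t *\<^sub>R x))"
  shows "pd i (\<lambda>y. g (t *\<^sub>R y)) x = t * pd i g (t *\<^sub>R x)" "(\<lambda>y. g (t *\<^sub>R y)) differentiable (at x)"
proof -
  let ?G = "\<chi> i. pd i g (t *\<^sub>R x)"
  have "((\<lambda>y::vec3. t *\<^sub>R y) has_derivative (\<lambda>y. t *\<^sub>R y)) (at x)"
    by (rule bounded_linear_imp_has_derivative[OF bounded_linear_scaleR_right])
  from has_derivative_compose[OF this pd_has_derivative[OF assms]]
  have "((\<lambda>y. g (t *\<^sub>R y)) has_derivative (\<lambda>h. ?G \<bullet> (t *\<^sub>R h))) (at x)" .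
  moreover have "(\<lambda>h. ?G \<bullet> (t *\<^sub>R h)) = (\<lambda>h. (t *\<^sub>R ?G) \<bullet> h)" by (rule ext) (simp only: inner_scaleR_left inner_scaleR_right)
  ultimately have *: "((\<lambda>y. g (t *\<^sub>R y)) has_derivative (\<lambda>h. (t *\<^sub>R ?G) \<bullet> h)) (at x)" by (simp only:)
  show "pd i (\<lambda>y. g (t *\<^sub>R y)) x = t * pd i g (t *\<^sub>R x)" unfolding pd_eqI[OF *] by simp
  show "(\<lambda>y. g (t *\<^sub>R y)) differentiable (at x)" using * unfolding differentiable_def by blast
qed

section \<open>Functions with n continuous partial derivatives\<close>

fun Ck :: "nat \<Rightarrow> vec3 set \<Rightarrow> (vec3 \<Rightarrow> real) \<Rightarrow> bool" where
  "Ck 0 S g \<longleftrightarrow> continuous_on S g"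
| "Ck (Suc n) S g \<longleftrightarrow> (\<forall>x\<in>S. g differentiable (at x)) \<and> (\<forall>i. Ck n S (pd i g))"

lemma C2_on_iff_Ck: "C2_on S g \<longleftrightarrow> Ck 2 S g"
  by (auto simp: C2_on_def numeral_2_eq_2)

lemma Ck_differentiable: "Ck n S g \<Longrightarrow> 0 < n \<Longrightarrow> x \<in> S \<Longrightarrow> g differentiable (at x)"
  by (cases n) auto

lemma Ck_pd: "Ck (Suc n) S g \<Longrightarrow> Ck n S (pd i g)"
  by auto

lemma Ck_continuous: "Ck n S g \<Longrightarrow> continuous_on S g"
  by (cases n) (auto intro!: continuous_at_imp_continuous_on differentiable_imp_continuous_within)

lemma Ck_cong:
  assumes "open S" "\<And>x. x \<in> S \<Longrightarrow> f x = g x"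
  shows "Ck n S f \<longleftrightarrow> Ck n S g"
  using assms(2)
proof (induction n arbitrary: f g)
  case 0
  then show ?case by (simp cong: continuous_on_cong)
next
  case (Suc n)
  have "Ck n S (pd i f) \<longleftrightarrow> Ck n S (pd i g)" for i
    using pd_cong_open[OF assms(1) _ Suc.prems] by (intro Suc.IH) auto
  then show ?case using differentiable_cong_open[OF assms(1) _ Suc.prems] by auto
qed

lemma Ck_subset: "Ck n S g \<Longrightarrow> T \<subseteq> S \<Longrightarrow> Ck n T g"
  by (induction n arbitrary: g) (auto intro: continuous_on_subset)

lemma Ck_Suc_D: "Ck (Suc n) S g \<Longrightarrow> Ck n S g"
  by (induction n arbitrary: g) (auto intro!: continuous_at_imp_continuous_on differentiable_imp_continuous_within)

lemma Ck_mono: "Ck n S g \<Longrightarrow> m \<le> n \<Longrightarrow> Ck m S g"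
proof (induction n)
  case (Suc n)
  then show ?case using Ck_Suc_D le_Suc_eq by blast
qed auto

lemma Ck_Un: "Ck n S g \<Longrightarrow> Ck n T g \<Longrightarrow> open S \<Longrightarrow> open T \<Longrightarrow> Ck n (S \<union> T) g"
  by (induction n arbitrary: g) (auto intro: continuous_on_open_Un)

lemma Ck_const [simp]: "Ck n S (\<lambda>x. c)"
proof (induction n arbitrary: c)
  case (Suc n)
  have "pd i (\<lambda>x. c) = (\<lambda>x. 0)" for i by auto
  then show ?case using Suc by simp
qed simp

lemma Ck_coord [simp]: "Ck n S (\<lambda>x. x $ j)"
proof (cases n)
  case (Suc m)
  have "pd i (\<lambda>x. x $ j) = (\<lambda>x. if i = j then 1 else 0)" for i by (auto simp: pd_coord)
  then show ?thesis using Suc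
    by (auto intro!: bounded_linear_imp_differentiable bounded_linear_vec_nth)
qed (auto intro!: continuous_intros)

lemma Ck_add: "open S \<Longrightarrow> Ck n S f \<Longrightarrow> Ck n S g \<Longrightarrow> Ck n S (\<lambda>x. f x + g x)"
proof (induction n arbitrary: f g)
  case (Suc n)
  have "Ck n S (pd i (\<lambda>x. f x + g x))" for i
    by (subst Ck_cong[OF Suc.prems(1), of _ "\<lambda>x. pd i f x + pd i g x"])
      (use Suc in \<open>auto simp: pd_add\<close>)
  then show ?case using Suc.prems by auto
qed (auto intro!: continuous_intros)

lemma Ck_mult: "open S \<Longrightarrow> Ck n S f \<Longrightarrow> Ck n S g \<Longrightarrow> Ck n S (\<lambda>x. f x * g x)"
proof (induction n arbitrary: f g)
  case (Suc n)
  have "Ck n S (pd i (\<lambda>x. f x * g x))" for i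
    by (subst Ck_cong[OF Suc.prems(1), of _ "\<lambda>x. pd i f x * g x + f x * pd i g x"])
      (use Suc Ck_Suc_D in \<open>auto simp: pd_mult intro!: Ck_add\<close>)
  then show ?case using Suc.prems by auto
qed (auto intro!: continuous_intros)

lemma Ck_cmult: "open S \<Longrightarrow> Ck n S f \<Longrightarrow> Ck n S (\<lambda>x. c * f x)"
  by (simp add: Ck_mult)

lemma Ck_diff: "open S \<Longrightarrow> Ck n S f \<Longrightarrow> Ck n S g \<Longrightarrow> Ck n S (\<lambda>x. f x - g x)"
  using Ck_add[of S n f "\<lambda>x. -1 * g x"] Ck_cmult[of S n g "-1"] by simp

lemma Ck_sum: "open S \<Longrightarrow> finite A \<Longrightarrow> (\<And>a. a \<in> A \<Longrightarrow> Ck n S (f a)) \<Longrightarrow> Ck n S (\<lambda>x. \<Sum>a\<in>A. f a x)"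
  apply (rotate_tac 1)
  apply (induction A rule: finite_induct)
  apply (auto intro: Ck_add)
  done

text \<open>The outer function comes as the sequence \<open>m\<close> of its successive derivatives,
  because the induction differentiates once and continues with the shifted sequence.\<close>

lemma Ck_comp:
  assumes "open S" "\<And>k t. k < n \<Longrightarrow> (m k has_real_derivative m (Suc k) t) (at t)"
    "continuous_on UNIV (m n)" "Ck n S g"
  shows "Ck n S (\<lambda>x. m 0 (g x))"
  using assms(2-)
proof (induction n arbitrary: m)
  case 0
  then show ?case by (auto intro: continuous_on_compose2)
next
  case (Suc n)
  have d: "(m 0 has_real_derivative m (Suc 0) t) (at t)" for t using Suc.prems(1) by blast
  have g: "x \<in> S \<Longrightarrow> g differentiable (at x)" for x using Suc.prems by auto
  have "Ck n S (pd i (\<lambda>x. m 0 (g x)))" for i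
  proof (subst Ck_cong[OF assms(1)])
    show "x \<in> S \<Longrightarrow> pd i (\<lambda>x. m 0 (g x)) x = m (Suc 0) (g x) * pd i g x" for x
      by (rule pd_comp(1)[OF d g])
    have "Ck n S (\<lambda>x. m (Suc 0) (g x))"
      using Suc.IH[of "\<lambda>k. m (Suc k)"] Suc.prems Ck_Suc_D by auto
    then show "Ck n S (\<lambda>x. m (Suc 0) (g x) * pd i g x)"
      using Suc.prems by (auto intro!: Ck_mult[OF assms(1)])
  qed
  then show ?case using pd_comp(2)[OF d g] by simp
qed

lemma Ck_scale:
  assumes "open S" "\<And>x. x \<in> S \<Longrightarrow> t *\<^sub>R x \<in> T" "Ck n T g"
  shows "Ck n S (\<lambda>x. g (t *\<^sub>R x))"
  using assms(3)
proof (induction n arbitrary: g)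
  case 0
  then show ?case using assms by (auto intro!: continuous_intros continuous_on_compose2[of T g])
next
  case (Suc n)
  have d: "x \<in> S \<Longrightarrow> g differentiable (at (t *\<^sub>R x))" for x using Suc.prems assms by auto
  have "Ck n S (pd i (\<lambda>x. g (t *\<^sub>R x)))" for i
    by (subst Ck_cong[OF assms(1), of _ "\<lambda>x. t * pd i g (t *\<^sub>R x)"])
      (use Suc pd_scale[OF d] in \<open>auto intro!: Ck_cmult[OF assms(1)]\<close>)
  then show ?case using pd_scale[OF d] by simp
qed

text \<open>Dominated convergence along sequences. The local bound \<open>g\<close> on the gradient
  makes \<open>F\<close> Lipschitz in \<open>x\<close> with constant \<open>g w\<close>, so the
  remainder of the first-order expansion divided by the length of the increment is at most
  \<open>2 * g w\<close>.\<close>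

lemma leibniz_bochner:
  fixes F :: "vec3 \<Rightarrow> 'w \<Rightarrow> real" and F' :: "vec3 \<Rightarrow> 'w \<Rightarrow> vec3"
  assumes S: "x \<in> S" "open S"
    and der: "\<And>x w. x \<in> S \<Longrightarrow> w \<in> space M \<Longrightarrow> ((\<lambda>x. F x w) has_derivative (\<lambda>h. F' x w \<bullet> h)) (at x)"
    and int: "\<And>x. x \<in> S \<Longrightarrow> integrable M (F x)"
    and meas: "\<And>x. x \<in> S \<Longrightarrow> F' x \<in> borel_measurable M"
    and bd: "ball x e \<subseteq> S" "e > 0" "integrable M g" "\<And>y w. y \<in> ball x e \<Longrightarrow> w \<in> space M \<Longrightarrow> norm (F' y w) \<le> g w"
  shows "integrable M (F' x) \<and>
    ((\<lambda>x. \<integral>w. F x w \<partial>M) has_derivative (\<lambda>h. (\<integral>w. F' x w \<partial>M) \<bullet> h)) (at x)"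
proof -
  have x_ball: "x \<in> ball x e" by (simp add: bd(2))
  have i': "integrable M (F' x)"
  proof (rule Bochner_Integration.integrable_bound[OF bd(3) meas[OF S(1)]], rule AE_I2)
    fix w assume "w \<in> space M"
    then have "norm (F' x w) \<le> g w" by (rule bd(4)[OF x_ball])
    then show "norm (F' x w) \<le> norm (g w)" by simp
  qed
  have lip: "norm (F y w - F x w) \<le> g w * norm (y - x)" if "y \<in> ball x e" "w \<in> space M" for y w
  proof (rule differentiable_bound[where f = "\<lambda>y. F y w" and x = y and y = x and B = "g w" and f' = "\<lambda>z h. F' z w \<bullet> h" and S = "ball x e"])
    fix z assume "z \<in> ball x e"
    show "((\<lambda>y. F y w) has_derivative (\<lambda>h. F' z w \<bullet> h)) (at z within ball x e)"
      by (rule has_derivative_at_withinI, rule der) (use bd(1) that(2) \<open>z \<in> ball x e\<close> in auto)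
    show "onorm (\<lambda>h. F' z w \<bullet> h) \<le> g w"
    proof (rule onorm_le)
      fix h
      have "norm (F' z w \<bullet> h) \<le> norm (F' z w) * norm h" using Cauchy_Schwarz_ineq2[of "F' z w" h] by simp
      also have "\<dots> \<le> g w * norm h" using bd(4)[OF \<open>z \<in> ball x e\<close> that(2)] by (rule mult_right_mono) simp
      finally show "norm (F' z w \<bullet> h) \<le> g w * norm h" .
    qed
  next
    show "y \<in> ball x e" by fact
    show "x \<in> ball x e" by (rule x_ball)
  qed simp
  have "((\<lambda>y. ((\<integral>w. F y w \<partial>M) - (\<integral>w. F x w \<partial>M) - (\<integral>w. F' x w \<partial>M) \<bullet> (y - x)) /\<^sub>R norm (y - x)) \<longlongrightarrow> 0) (at x)"
    unfolding tendsto_at_iff_sequentially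
  proof safe
    fix X :: "nat \<Rightarrow> vec3" assume X: "\<forall>i. X i \<in> UNIV - {x}" "X \<longlonglongrightarrow> x"
    have "eventually (\<lambda>n. X n \<in> ball x e) sequentially"
      using X(2) bd(2) by (simp add: tendsto_iff dist_commute)
    \<comment> \<open>From index \<open>N\<close> on the sequence stays in the ball where the bound
      holds. The shifted sequence \<open>Y\<close> is used below, and \<open>LIMSEQ_offset\<close>
      undoes the shift.\<close>
    then obtain N where N: "\<And>n. n \<ge> N \<Longrightarrow> X n \<in> ball x e" by (auto simp: eventually_sequentially)
    define Y where "Y n = X (n + N)" for n
    have Y: "Y n \<in> ball x e" "Y n \<noteq> x" "Y n \<in> S" for n using N[of "n + N"] X bd(1) by (auto simp: Y_def)
    have Yl: "Y \<longlonglongrightarrow> x" unfolding Y_def using X(2) by (rule LIMSEQ_ignore_initial_segment)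
    define q where "q n w = (F (Y n) w - F x w - F' x w \<bullet> (Y n - x)) / norm (Y n - x)" for n w
    have "(\<lambda>n. \<integral>w. q n w \<partial>M) \<longlonglongrightarrow> (\<integral>w. 0 \<partial>M)"
    proof (rule integral_dominated_convergence[where w = "\<lambda>w. 2 * g w"])
      show "AE w in M. (\<lambda>n. q n w) \<longlonglongrightarrow> 0"
      proof (rule AE_I2)
        fix w assume "w \<in> space M"
        from der[OF S(1) this]
        have "((\<lambda>y. (F y w - F x w - F' x w \<bullet> (y - x)) /\<^sub>R norm (y - x)) \<longlongrightarrow> 0) (at x)"
          by (simp add: has_derivative_def)
        then have "((\<lambda>y. (F y w - F x w - F' x w \<bullet> (y - x)) /\<^sub>R norm (y - x)) \<circ> Y) \<longlonglongrightarrow> 0"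
          unfolding tendsto_at_iff_sequentially using Y Yl by auto
        then show "(\<lambda>n. q n w) \<longlonglongrightarrow> 0" by (simp add: o_def q_def divide_inverse mult.commute)
      qed
      show "AE w in M. norm (q n w) \<le> 2 * g w" for n
      proof (rule AE_I2)
        fix w assume w: "w \<in> space M"
        have "\<bar>F (Y n) w - F x w - F' x w \<bullet> (Y n - x)\<bar> \<le> \<bar>F (Y n) w - F x w\<bar> + \<bar>F' x w \<bullet> (Y n - x)\<bar>" by linarith
        also have "\<dots> \<le> g w * norm (Y n - x) + norm (F' x w) * norm (Y n - x)"
          using lip[OF Y(1)[of n] w] Cauchy_Schwarz_ineq2[of "F' x w" "Y n - x"] by simp
        also have "\<dots> \<le> g w * norm (Y n - x) + g w * norm (Y n - x)"
        proof -
          have "norm (F' x w) \<le> g w" by (rule bd(4)[OF x_ball w])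
          then show ?thesis by (simp add: mult_right_mono)
        qed
        finally show "norm (q n w) \<le> 2 * g w" using Y(2)[of n] by (simp add: q_def divide_simps)
      qed
      show "q n \<in> borel_measurable M" for n
      proof -
        have [measurable]: "F (Y n) \<in> borel_measurable M" "F x \<in> borel_measurable M" "F' x \<in> borel_measurable M"
          using borel_measurable_integrable[OF int[OF Y(3)[of n]]] borel_measurable_integrable[OF int[OF S(1)]] meas[OF S(1)] .
        show ?thesis unfolding q_def by measurable
      qed
      show "integrable M (\<lambda>w. 2 * g w)" using bd(3) by simp
    qed simp
    moreover have "(\<integral>w. q n w \<partial>M) = ((\<integral>w. F (Y n) w \<partial>M) - (\<integral>w. F x w \<partial>M) - (\<integral>w. F' x w \<partial>M) \<bullet> (Y n - x)) /\<^sub>R norm (Y n - x)" for n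
      unfolding q_def using int[OF Y(3)[of n]] int[OF S(1)] i'
      by (simp add: divide_inverse mult.commute)
    ultimately have "(\<lambda>n. ((\<integral>w. F (X (n+N)) w \<partial>M) - (\<integral>w. F x w \<partial>M) - (\<integral>w. F' x w \<partial>M) \<bullet> (X (n+N) - x)) /\<^sub>R norm (X (n+N) - x)) \<longlonglongrightarrow> 0"
      by (simp add: Y_def)
    then show "((\<lambda>y. ((\<integral>w. F y w \<partial>M) - (\<integral>w. F x w \<partial>M) - (\<integral>w. F' x w \<partial>M) \<bullet> (y - x)) /\<^sub>R norm (y - x)) \<circ> X) \<longlonglongrightarrow> 0"
      unfolding o_def by (rule LIMSEQ_offset)
  qed
  with i' show ?thesis
    by (simp add: has_derivative_def bounded_linear_inner_right)
qed

section \<open>Symmetry of second derivatives and integration by parts\<close>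

lemma pd_line:
  assumes "g differentiable (at (y + s *\<^sub>R axis i 1))"
  shows "((\<lambda>s. g (y + s *\<^sub>R axis i 1)) has_real_derivative pd i g (y + s *\<^sub>R axis i 1)) (at s)"
proof -
  have "((\<lambda>s. y + s *\<^sub>R axis i (1::real)) has_derivative (\<lambda>s. s *\<^sub>R axis i 1)) (at s)"
    by (auto intro!: derivative_eq_intros)
  from has_derivative_compose[OF this pd_has_derivative[OF assms]]
  have "((\<lambda>s. g (y + s *\<^sub>R axis i 1)) has_derivative
      (\<lambda>h. (\<chi> k. pd k g (y + s *\<^sub>R axis i 1)) \<bullet> (h *\<^sub>R axis i 1))) (at s)" .
  moreover have "(\<lambda>h. (\<chi> k. pd k g (y + s *\<^sub>R axis i 1)) \<bullet> (h *\<^sub>R axis i 1))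
      = (*) (pd i g (y + s *\<^sub>R axis i 1))"
    by (auto simp: inner_axis fun_eq_iff)
  ultimately show ?thesis by (simp add: has_field_derivative_def)
qed

text \<open>The mean value theorem is applied twice: in direction \<open>i\<close> to the increment
  along \<open>j\<close>, then in direction \<open>j\<close> to \<open>pd i g\<close>. The second
  difference on the left is symmetric in \<open>i\<close> and \<open>j\<close>, the right side is
  not visibly so.\<close>

lemma second_difference:
  assumes S: "\<And>y. norm (y - x) \<le> 2 * t \<Longrightarrow> y \<in> S" and g: "Ck 2 S g" and t: "0 < t"
  shows "\<exists>\<xi>. norm (\<xi> - x) \<le> 2 * t \<and>
    g (x + t *\<^sub>R axis i 1 + t *\<^sub>R axis j 1) - g (x + t *\<^sub>R axis i 1) - g (x + t *\<^sub>R axis j 1) + g x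
      = t\<^sup>2 * pd j (pd i g) \<xi>"
proof -
  have N: "norm (a *\<^sub>R axis i (1::real) + b *\<^sub>R axis j 1 :: vec3) \<le> 2 * t" if "\<bar>a\<bar> \<le> t" "\<bar>b\<bar> \<le> t" for a b
    using norm_triangle_ineq[of "a *\<^sub>R axis i (1::real) :: vec3" "b *\<^sub>R axis j 1"] that by simp
  have inS: "x + a *\<^sub>R axis i (1::real) + b *\<^sub>R axis j 1 \<in> S" if "\<bar>a\<bar> \<le> t" "\<bar>b\<bar> \<le> t" for a b
    using N[OF that] by (intro S) (simp add: algebra_simps)
  have d: "g differentiable (at y)" "pd i g differentiable (at y)" if "y \<in> S" for y
    using g that by (auto simp: numeral_2_eq_2)
  define \<phi> where "\<phi> s = g (x + t *\<^sub>R axis j 1 + s *\<^sub>R axis i 1) - g (x + s *\<^sub>R axis i 1)" for s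
  have "(\<phi> has_real_derivative (pd i g (x + t *\<^sub>R axis j 1 + s *\<^sub>R axis i 1) - pd i g (x + s *\<^sub>R axis i 1))) (at s)"
    if "0 \<le> s" "s \<le> t" for s
    unfolding \<phi>_def 
    by (intro DERIV_diff pd_line d) (use inS[of s t] inS[of s 0] that t in \<open>auto simp: algebra_simps\<close>)
  from MVT2[OF t this] obtain s where s: "0 < s" "s < t"
    "\<phi> t - \<phi> 0 = t * (pd i g (x + t *\<^sub>R axis j 1 + s *\<^sub>R axis i 1) - pd i g (x + s *\<^sub>R axis i 1))"
    by auto
  define \<psi> where "\<psi> r = pd i g (x + s *\<^sub>R axis i 1 + r *\<^sub>R axis j 1)" for r
  have "(\<psi> has_real_derivative pd j (pd i g) (x + s *\<^sub>R axis i 1 + r *\<^sub>R axis j 1)) (at r)"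
    if "0 \<le> r" "r \<le> t" for r
    unfolding \<psi>_def by (intro pd_line d inS) (use that s in auto)
  from MVT2[OF t this] obtain r where r: "0 < r" "r < t"
    "\<psi> t - \<psi> 0 = t * pd j (pd i g) (x + s *\<^sub>R axis i 1 + r *\<^sub>R axis j 1)"
    by auto
  have "norm ((x + s *\<^sub>R axis i 1 + r *\<^sub>R axis j 1) - x) \<le> 2 * t"
    using N[of s r] s r by (simp add: algebra_simps)
  moreover have "g (x + t *\<^sub>R axis i 1 + t *\<^sub>R axis j 1) - g (x + t *\<^sub>R axis i 1) - g (x + t *\<^sub>R axis j 1) + g x
     = \<phi> t - \<phi> 0" by (simp add: \<phi>_def algebra_simps)
  moreover have "\<phi> t - \<phi> 0 = t * (\<psi> t - \<psi> 0)" using s by (simp add: \<psi>_def algebra_simps)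
  ultimately show ?thesis using r(3)
    by (intro exI[of _ "x + s *\<^sub>R axis i 1 + r *\<^sub>R axis j 1"]) (simp add: power2_eq_square)
qed

text \<open>The symmetric second difference equals \<open>t^2\<close> times either mixed derivative
  at points within \<open>2 * t\<close> of \<open>x\<close>. Continuity of both at \<open>x\<close>
  forces equality as \<open>t\<close> shrinks.\<close>

lemma pd_commute:
  assumes "open S" "x \<in> S" "Ck 2 S g"
  shows "pd i (pd j g) x = pd j (pd i g) x"
proof (rule ccontr)
  assume ne: "pd i (pd j g) x \<noteq> pd j (pd i g) x"
  define e where "e = \<bar>pd i (pd j g) x - pd j (pd i g) x\<bar> / 2"
  have e: "e > 0" using ne by (simp add: e_def)
  have c: "isCont (pd i (pd j g)) x" "isCont (pd j (pd i g)) x"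
  proof -
    have "continuous_on S (pd i (pd j g))" "continuous_on S (pd j (pd i g))"
      using assms(3) by (auto simp: numeral_2_eq_2)
    then show "isCont (pd i (pd j g)) x" "isCont (pd j (pd i g)) x"
      using assms by (auto simp: continuous_on_eq_continuous_at)
  qed
  obtain d1 where d1: "d1 > 0" "\<And>y. dist y x < d1 \<Longrightarrow> \<bar>pd i (pd j g) y - pd i (pd j g) x\<bar> < e"
    using c(1) e unfolding continuous_at_eps_delta dist_real_def by blast
  obtain d2 where d2: "d2 > 0" "\<And>y. dist y x < d2 \<Longrightarrow> \<bar>pd j (pd i g) y - pd j (pd i g) x\<bar> < e"
    using c(2) e unfolding continuous_at_eps_delta dist_real_def by blast
  obtain d3 where d3: "d3 > 0" "ball x d3 \<subseteq> S" using assms open_contains_ball by blast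
  define t where "t = min d1 (min d2 d3) / 3"
  have t: "t > 0" "2 * t < d1" "2 * t < d2" "2 * t < d3" using d1 d2 d3 by (auto simp: t_def min_def)
  have S: "y \<in> S" if "norm (y - x) \<le> 2 * t" for y
    using d3(2) that t by (auto simp: dist_norm norm_minus_commute subset_iff)
  obtain a where a: "norm (a - x) \<le> 2 * t" "g (x + t *\<^sub>R axis i 1 + t *\<^sub>R axis j 1) - g (x + t *\<^sub>R axis i 1) - g (x + t *\<^sub>R axis j 1) + g x
      = t\<^sup>2 * pd j (pd i g) a" using second_difference[OF S assms(3) t(1)] by blast
  obtain b where b: "norm (b - x) \<le> 2 * t" "g (x + t *\<^sub>R axis j 1 + t *\<^sub>R axis i 1) - g (x + t *\<^sub>R axis j 1) - g (x + t *\<^sub>R axis i 1) + g x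
      = t\<^sup>2 * pd i (pd j g) b" using second_difference[OF S assms(3) t(1)] by blast
  have "x + t *\<^sub>R axis j 1 + t *\<^sub>R axis i 1 = x + t *\<^sub>R axis i 1 + t *\<^sub>R axis j 1" by simp
  with a(2) b(2) t(1) have "pd j (pd i g) a = pd i (pd j g) b" by (simp add: algebra_simps)
  moreover have "\<bar>pd j (pd i g) a - pd j (pd i g) x\<bar> < e" "\<bar>pd i (pd j g) b - pd i (pd j g) x\<bar> < e"
    using d1 d2 a b t by (auto simp: dist_norm)
  moreover have "\<bar>pd i (pd j g) x - pd j (pd i g) x\<bar> = 2 * e" by (simp add: e_def)
  ultimately show False by (smt (verit))
qed

section \<open>Compactly supported functions and vanishing integrals of derivatives\<close>

lemma pd_zero_outside:
  assumes "\<And>x. norm x > R \<Longrightarrow> F x = 0" "norm x > R"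
  shows "pd i F x = 0"
proof -
  have "pd i F x = pd i (\<lambda>_. 0) x"
    by (rule pd_cong_open[of "- cball 0 R"]) (use assms in auto)
  then show ?thesis by simp
qed

text \<open>The ball and the complement of a smaller closed ball are two open sets covering the
  space. This is how the product of a cutoff with a solution, which is regular only inside the ball,
  becomes regular everywhere.\<close>

lemma Ck_zero_extension:
  assumes "Ck n (ball 0 1) F" "r < 1" "\<And>x. r < norm x \<Longrightarrow> F x = 0"
  shows "Ck n UNIV F"
proof -
  have o: "open (- cball (0::vec3) r)" by auto
  have "Ck n (- cball 0 r) F"
    by (subst Ck_cong[OF o, of F "\<lambda>_. 0"]) (use assms(3) in auto)
  then have "Ck n (ball 0 1 \<union> - cball 0 r) F" using assms(1) o by (intro Ck_Un) auto
  moreover have "ball (0::vec3) 1 \<union> - cball 0 r = UNIV" using assms(2) by auto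
  ultimately show ?thesis by simp
qed

lemma integrable_compact_support:
  fixes F :: "vec3 \<Rightarrow> 'b::{banach, second_countable_topology}"
  assumes "continuous_on UNIV F" "\<And>x. norm x > R \<Longrightarrow> F x = 0"
  shows "integrable lborel F"
proof -
  have "integrable lborel (\<lambda>x. indicator (cball 0 R) x *\<^sub>R F x)"
    by (rule borel_integrable_compact) (auto intro: continuous_on_subset[OF assms(1)])
  moreover have "indicator (cball 0 R) x *\<^sub>R F x = F x" for x
    using assms(2)[of x] by (cases "norm x \<le> R") auto
  ultimately show ?thesis by simp
qed

text \<open>By translation invariance the integral of \<open>F (x + w)\<close> over \<open>w\<close>
  is constant in \<open>x\<close>. Differentiating it under the integral sign at
  \<open>x = 0\<close> produces the integral of the gradient, which is therefore 0.\<close>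

lemma integral_pd_eq_0:
  assumes "Ck 1 UNIV F" "\<And>x. norm x > R \<Longrightarrow> F x = 0"
  shows "(\<integral>x. pd i F x \<partial>lborel) = 0"
proof -
  define G where "G y = (\<chi> i. pd i F y)" for y
  have cF: "continuous_on UNIV F" using Ck_continuous[OF assms(1)] .
  have cG: "continuous_on UNIV G" unfolding G_def using assms(1) by (auto intro!: continuous_intros)
  have G0: "G y = 0" if "norm y > R" for y
    using pd_zero_outside[OF assms(2) that] by (simp add: G_def vec_eq_iff)
  have "bounded (G ` cball 0 R)"
    by (intro compact_imp_bounded compact_continuous_image continuous_on_subset[OF cG]) auto
  then obtain B where B: "B > 0" "\<And>y. y \<in> cball 0 R \<Longrightarrow> norm (G y) \<le> B"
    unfolding bounded_pos by blast
  have Gb: "norm (G y) \<le> B" for y using G0[of y] B by (cases "norm y \<le> R") auto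
  have tr: "integrable lborel (\<lambda>w. f (h + w))" "(\<integral>w. f (h + w) \<partial>lborel) = (\<integral>w. f w \<partial>lborel)"
    if "integrable lborel f" for f :: "vec3 \<Rightarrow> real" and h :: vec3
  proof -
    have "integrable (distr lborel borel ((+) h)) f" "f \<in> borel_measurable borel"
      using that lborel_distr_plus[of h] borel_measurable_integrable[OF that] by auto
    then show "integrable lborel (\<lambda>w. f (h + w))" by (subst (asm) integrable_distr_eq) auto
    have "(\<integral>w. f w \<partial>lborel) = (\<integral>w. f w \<partial>distr lborel borel ((+) h))" by (simp add: lborel_distr_plus)
    also have "\<dots> = (\<integral>w. f (h + w) \<partial>lborel)" by (rule integral_distr) (use \<open>f \<in> borel_measurable borel\<close> in auto)
    finally show "(\<integral>w. f (h + w) \<partial>lborel) = (\<integral>w. f w \<partial>lborel)" by simp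
  qed
  have iF: "integrable lborel F" using integrable_compact_support[OF cF assms(2)] .
  have dF: "F differentiable (at x)" for x using assms(1) by auto
  have der: "((\<lambda>x. F (x + w)) has_derivative (\<lambda>h. G (x + w) \<bullet> h)) (at x)" for x w
  proof -
    have "((\<lambda>x. x + w) has_derivative (\<lambda>h. h)) (at x)" by (auto intro!: derivative_eq_intros)
    from has_derivative_compose[OF this pd_has_derivative[OF dF]] show ?thesis unfolding G_def .
  qed
  have L: "integrable lborel (\<lambda>w. G (0 + w)) \<and>
    ((\<lambda>x. \<integral>w. F (x + w) \<partial>lborel) has_derivative (\<lambda>h. (\<integral>w. G (0 + w) \<partial>lborel) \<bullet> h)) (at 0)"
  proof (rule leibniz_bochner[where S = UNIV and e = 1 and g = "\<lambda>w. indicator (cball 0 (R + 1)) w *\<^sub>R B" and F = "\<lambda>x w. F (x + w)" and F' = "\<lambda>x w. G (x + w)" and x = 0 and M = lborel])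
    \<comment> \<open>Shifts by vectors of length below 1 keep the support inside the ball of radius
      \<open>R + 1\<close>, so this one function dominates all shifted gradients.\<close>
    show "integrable lborel (\<lambda>w::vec3. indicator (cball 0 (R + 1)) w *\<^sub>R B)"
      by (rule borel_integrable_compact) (auto intro!: continuous_intros)
    show "norm (G (y + w)) \<le> indicator (cball 0 (R + 1)) w *\<^sub>R B" if "y \<in> ball 0 1" for y w
    proof (cases "norm (y + w) \<le> R")
      case True
      then have "norm w \<le> R + 1" using norm_triangle_ineq4[of "y + w" y] that by simp
      then show ?thesis using Gb by simp
    next
      case False
      then show ?thesis using G0 B by simp
    qed
    show "(\<lambda>w. G (x + w)) \<in> borel_measurable lborel" for x
      using borel_measurable_continuous_onI[OF cG] by measurable
  qed (use der tr(1)[OF iF] in auto)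
  have "((\<lambda>x::vec3. \<integral>w. F (x + w) \<partial>lborel) has_derivative (\<lambda>h. 0)) (at 0)"
    by (simp add: tr(2)[OF iF])
  from has_derivative_unique[OF this conjunct2[OF L]]
  have "(\<integral>w. G (0 + w) \<partial>lborel) \<bullet> axis i 1 = 0" by (metis)
  then have "(\<integral>w. G w \<partial>lborel) $ i = 0" by (simp add: inner_axis)
  moreover have "(\<integral>w. G w \<partial>lborel) $ i = (\<integral>w. G w $ i \<partial>lborel)"
    using integral_bounded_linear[OF bounded_linear_vec_nth[of i], of lborel G] conjunct1[OF L] by simp
  ultimately show ?thesis by (simp add: G_def)
qed

section \<open>Uniqueness for the Lame system\<close>

lemma Ck1_pd_continuous: "Ck (Suc n) S g \<Longrightarrow> continuous_on S (pd i g)"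
  using Ck_continuous Ck_pd by blast

lemma Ck_2D:
  assumes "Ck 2 S g"
  shows "Ck 1 S g" "Ck 1 S (pd i g)"
proof -
  have "Ck (Suc 1) S g" using assms by (simp add: numeral_2_eq_2)
  then show "Ck 1 S g" "Ck 1 S (pd i g)" using Ck_Suc_D Ck_pd by blast+
qed

text \<open>The derivative of \<open>x_i * F^2\<close> in direction \<open>i\<close> integrates to 0
  and equals \<open>F^2 + 2 x_i F F_i\<close>. Expanding \<open>0 <= (F + 2 x_i F_i)^2\<close> and
  using \<open>|x_i| <= 1\<close> on the support bounds \<open>F^2\<close> by twice this derivative
  plus \<open>4 F_i^2\<close>.\<close>

lemma poincare:
  assumes F: "Ck 1 UNIV F" and F0: "\<And>x. norm x > R \<Longrightarrow> F x = 0" and R: "R \<le> 1"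
  shows "(\<integral>x. (F x)\<^sup>2 \<partial>lborel) \<le> 4 * (\<integral>x. (pd i F x)\<^sup>2 \<partial>lborel)"
proof -
  define G where "G x = x $ i * (F x * F x)" for x
  have dF: "F differentiable (at x)" for x using F by auto
  have G: "Ck 1 UNIV G" unfolding G_def using F by (intro Ck_mult) auto
  have G0: "norm x > R \<Longrightarrow> G x = 0" for x using F0 by (simp add: G_def)
  have pdG: "pd i G x = F x * F x + x $ i * (2 * F x * pd i F x)" for x
    unfolding G_def using dF
    by (subst pd_mult) (auto simp: pd_coord pd_mult intro!: bounded_linear_imp_differentiable bounded_linear_vec_nth)
  have cF: "continuous_on UNIV F" "continuous_on UNIV (pd i F)" "continuous_on UNIV (pd i G)"
    using Ck_continuous[OF F] Ck1_pd_continuous F G by auto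
  have I: "integrable lborel (\<lambda>x. (F x)\<^sup>2)" "integrable lborel (\<lambda>x. (pd i F x)\<^sup>2)" "integrable lborel (pd i G)"
    using F0 pd_zero_outside[of R F] pd_zero_outside[of R G] G0
    by (auto intro!: integrable_compact_support[of _ R] continuous_intros cF)
  have "(F x)\<^sup>2 \<le> 2 * pd i G x + 4 * (pd i F x)\<^sup>2" for x
  proof (cases "norm x > R")
    case False
    then have "\<bar>x $ i\<bar> \<le> 1" using component_le_norm_cart[of x i] R by linarith
    then have "(x $ i)\<^sup>2 * (pd i F x)\<^sup>2 \<le> 1 * (pd i F x)\<^sup>2"
      by (intro mult_right_mono) (auto simp: abs_square_le_1)
    moreover have "0 \<le> (F x + 2 * (x $ i * pd i F x))\<^sup>2" by simp
    ultimately show ?thesis unfolding pdG by (simp add: power2_eq_square algebra_simps)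
  qed (simp add: F0 pd_zero_outside[of R F] pd_zero_outside[of R G] G0)
  then have "(\<integral>x. (F x)\<^sup>2 \<partial>lborel) \<le> (\<integral>x. 2 * pd i G x + 4 * (pd i F x)\<^sup>2 \<partial>lborel)"
    using I by (intro integral_mono) auto
  also have "\<dots> = 4 * (\<integral>x. (pd i F x)\<^sup>2 \<partial>lborel)"
    using I integral_pd_eq_0[OF G G0] by simp
  finally show ?thesis .
qed

text \<open>The difference of the two integrands is the divergence expression
  \<open>(F G_j)_i - (F G_i)_j\<close>, since the second derivatives of \<open>G\<close> commute. It
  allows the squared divergence of a field to be compared with its full gradient.\<close>

lemma integral_pd_swap:
  assumes F: "Ck 2 UNIV F" and F0: "\<And>x. norm x > R \<Longrightarrow> F x = 0" and G: "Ck 2 UNIV G"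
  shows "integrable lborel (\<lambda>x. pd i F x * pd j G x)"
    and "(\<integral>x. pd i F x * pd j G x \<partial>lborel) = (\<integral>x. pd j F x * pd i G x \<partial>lborel)"
proof -
  have F1: "Ck 1 UNIV F" and G1: "Ck 1 UNIV (pd k G)" for k
    using Ck_2D F G by blast+
  have I: "integrable lborel (\<lambda>x. pd i F x * pd j G x)" for i j
    using F1 Ck_continuous[OF G1] pd_zero_outside[of R F] F0
    by (auto intro!: integrable_compact_support[of _ R] continuous_intros)
  then show "integrable lborel (\<lambda>x. pd i F x * pd j G x)" .
  have P: "Ck 1 UNIV (\<lambda>x. F x * pd k G x)" for k by (intro Ck_mult F1 G1) auto
  have pw: "pd i F x * pd j G x - pd j F x * pd i G x
      = pd i (\<lambda>x. F x * pd j G x) x - pd j (\<lambda>x. F x * pd i G x) x" for x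
    using F1 G1 pd_commute[of UNIV x G i j] G by (simp add: pd_mult)
  have Z: "(\<integral>x. pd l (\<lambda>x. F x * pd k G x) x \<partial>lborel) = 0" for l k
    by (rule integral_pd_eq_0[OF P, of R]) (simp add: F0)
  have IP: "integrable lborel (pd l (\<lambda>x. F x * pd k G x))" for l k
    by (rule integrable_compact_support[of _ R])
      (use P pd_zero_outside[of R "\<lambda>x. F x * pd k G x"] F0 in auto)
  have "(\<integral>x. pd i F x * pd j G x - pd j F x * pd i G x \<partial>lborel) = 0"
    unfolding pw using Z IP by simp
  then show "(\<integral>x. pd i F x * pd j G x \<partial>lborel) = (\<integral>x. pd j F x * pd i G x \<partial>lborel)"
    using I by simp
qed

text \<open>The solution is tested against itself times the squared cutoff. Written in terms of
  \<open>p = z d\<close>, the energy equals a quadratic form \<open>Q\<close> in \<open>d\<close>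
  and the derivatives of \<open>z\<close> alone, up to a divergence. The Poincare inequality then
  brings the energy of \<open>p\<close> down to \<open>p\<close> itself.\<close>

lemma caccioppoli:
  fixes d :: "vec3 \<Rightarrow> vec3"
  assumes mu: "mu > 0" "2 * mu + la > 0" and sol: "lame_solution la mu d"
    and z: "Ck 2 UNIV z" and z0: "\<And>x. norm x > R \<Longrightarrow> z x = 0" and R: "R < 1"
  defines "c \<equiv> min mu (2 * mu + la)"
  shows "c * (\<integral>x. (z x)\<^sup>2 * (norm (d x))\<^sup>2 \<partial>lborel)
    \<le> 4 * (mu + \<bar>la + mu\<bar>) * (\<integral>x. (\<Sum>i\<in>UNIV. (pd i z x)\<^sup>2) * (norm (d x))\<^sup>2 \<partial>lborel)"
proof -
  define D where "D k = (\<lambda>x. d x $ k)" for k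
  define p where "p k = (\<lambda>x. z x * D k x)" for k
  have D2: "Ck 2 (ball 0 1) (D k)" for k
    using sol unfolding lame_solution_def D_def C2_on_iff_Ck by blast
  have D1: "Ck 1 (ball 0 1) (D k)" "Ck 1 (ball 0 1) (pd i (D k))" for i k
    using Ck_2D[OF D2] by blast+
  have zB: "Ck 2 (ball 0 1) z" "Ck 1 (ball 0 1) z" "Ck 1 (ball 0 1) (pd i z)" for i
    using Ck_2D[OF Ck_subset[OF z]] Ck_subset[OF z] by blast+
  have dz: "pd i z x = 0" if "norm x > R" for i x using pd_zero_outside[OF z0 that] .
  have ext: "Ck n UNIV F" if "Ck n (ball 0 1) F" "\<And>x. norm x > R \<Longrightarrow> F x = 0" for n F
    using Ck_zero_extension[OF that(1) R] that(2) by blast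
  have p2: "Ck 2 UNIV (p k)" and p0: "norm x > R \<Longrightarrow> p k x = 0" for k x
    unfolding p_def by (intro ext Ck_mult zB D2) (auto simp: z0)
  have p1: "Ck 1 UNIV (p k)" for k using Ck_2D[OF p2] by blast
  have pp: "pd i (p k) x = pd i z x * D k x + z x * pd i (D k) x" if "x \<in> ball 0 1" for i k x
    unfolding p_def using zB(2) D1(1) that by (subst pd_mult) auto
  \<comment> \<open>The flux of the energy identity: the term with \<open>mu\<close> comes from the
    Laplacian, the other one from the gradient of the divergence, both contracted with
    \<open>z^2 d\<close>.\<close>
  define X where "X i k = (\<lambda>x. (z x * z x) * (mu * (D k x * pd i (D k) x) + (la + mu) * (D i x * pd k (D k) x)))" for i k
  have X1: "Ck 1 UNIV (X i k)" and X0: "norm x > R \<Longrightarrow> X i k x = 0" for i k x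
    unfolding X_def by (intro ext Ck_mult Ck_add Ck_const zB D1 open_ball) (auto simp: z0)
  have pX: "pd i (X i k) x = 2 * z x * pd i z x * (mu * (D k x * pd i (D k) x) + (la + mu) * (D i x * pd k (D k) x))
     + (z x)\<^sup>2 * (mu * ((pd i (D k) x)\<^sup>2 + D k x * pd i (pd i (D k)) x)
          + (la + mu) * (pd i (D i) x * pd k (D k) x + D i x * pd i (pd k (D k)) x))"
    if x: "x \<in> ball 0 1" for i k x
  proof -
    have [simp]: "z differentiable (at x)" "D j differentiable (at x)" "pd i (D j) differentiable (at x)" for i j
      using zB(2) D1 x by auto
    show ?thesis unfolding X_def
      by (simp add: pd_mult pd_add pd_cmult power2_eq_square algebra_simps)
  qed
  define N where "N x = (\<Sum>i\<in>UNIV. \<Sum>k\<in>UNIV. (pd i (p k) x)\<^sup>2)" for x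
  define V where "V x = (\<Sum>i\<in>UNIV. pd i (p i) x)" for x
  define Q where "Q x = mu * (\<Sum>i\<in>UNIV. \<Sum>k\<in>UNIV. (pd i z x)\<^sup>2 * (D k x)\<^sup>2) + (la + mu) * (\<Sum>i\<in>UNIV. pd i z x * D i x)\<^sup>2" for x
  have sol0: "(\<Sum>k\<in>UNIV. D k x * (mu * (\<Sum>i\<in>UNIV. pd i (pd i (D k)) x) + (la + mu) * (\<Sum>i\<in>UNIV. pd k (pd i (D i)) x))) = 0"
    if x: "x \<in> ball 0 1" for x
  proof (rule sum.neutral, rule ballI)
    fix k
    have "lame_op la mu d x $ k = 0" using sol x unfolding lame_solution_def by simp
    moreover have "divg d = (\<lambda>x. \<Sum>i\<in>UNIV. pd i (D i) x)" by (auto simp: divg_def D_def)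
    moreover have "pd k (\<lambda>x. \<Sum>i\<in>UNIV. pd i (D i) x) x = (\<Sum>i\<in>UNIV. pd k (pd i (D i)) x)"
      using D1(2) x by (intro pd_sum) auto
    ultimately show "D k x * (mu * (\<Sum>i\<in>UNIV. pd i (pd i (D k)) x) + (la + mu) * (\<Sum>i\<in>UNIV. pd k (pd i (D i)) x)) = 0"
      by (simp add: lame_op_def D_def)
  qed
  \<comment> \<open>The products of a derivative of \<open>z\<close> with a derivative of
    \<open>d\<close> occur identically on both sides, and the second derivatives of \<open>d\<close>
    cancel by \<open>sol0\<close>. What remains of the energy is \<open>Q\<close>, which contains no
    derivative of \<open>d\<close>.\<close>
  have key: "mu * N x + (la + mu) * (V x)\<^sup>2 = Q x + (\<Sum>i\<in>UNIV. \<Sum>k\<in>UNIV. pd i (X i k) x)" for x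
  proof (cases "norm x > R")
    case True
    then show ?thesis using pd_zero_outside[OF X0 True] pd_zero_outside[OF p0 True] dz[OF True]
      by (simp add: N_def V_def Q_def)
  next
    case False
    then have x: "x \<in> ball 0 1" using R by simp
    let ?z = "\<lambda>i. pd i z x" and ?A = "\<lambda>i k. pd i (D k) x"
    have "(\<Sum>i\<in>UNIV. \<Sum>k\<in>UNIV. pd i (X i k) x) = 
       (\<Sum>i\<in>UNIV. \<Sum>k\<in>UNIV. mu * (2 * z x * ?z i * (D k x * ?A i k) + (z x)\<^sup>2 * (?A i k)\<^sup>2)
          + (la + mu) * (2 * z x * ?z i * D i x * ?A k k + (z x)\<^sup>2 * (?A i i * ?A k k)))
       + (z x)\<^sup>2 * (\<Sum>i\<in>UNIV. \<Sum>k\<in>UNIV. mu * (D k x * pd i (pd i (D k)) x) + (la + mu) * (D i x * pd i (pd k (D k)) x))"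
      unfolding pX[OF x] sum_distrib_left sum.distrib[symmetric]
      by (intro sum.cong refl) (simp add: algebra_simps)
    also have "(\<Sum>i\<in>UNIV. \<Sum>k\<in>UNIV. mu * (D k x * pd i (pd i (D k)) x) + (la + mu) * (D i x * pd i (pd k (D k)) x)) = 0"
    proof -
      have "(\<Sum>i\<in>UNIV. \<Sum>k\<in>UNIV. mu * (D k x * pd i (pd i (D k)) x)) = (\<Sum>k\<in>UNIV. \<Sum>i\<in>UNIV. mu * (D k x * pd i (pd i (D k)) x))"
        by (rule sum.swap)
      then show ?thesis using sol0[OF x]
        by (simp add: sum.distrib sum_distrib_left algebra_simps)
    qed
    finally have S: "(\<Sum>i\<in>UNIV. \<Sum>k\<in>UNIV. pd i (X i k) x) = 
       (\<Sum>i\<in>UNIV. \<Sum>k\<in>UNIV. mu * (2 * z x * ?z i * (D k x * ?A i k) + (z x)\<^sup>2 * (?A i k)\<^sup>2)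
          + (la + mu) * (2 * z x * ?z i * D i x * ?A k k + (z x)\<^sup>2 * (?A i i * ?A k k)))" by simp
    have N: "N x = (\<Sum>i\<in>UNIV. \<Sum>k\<in>UNIV. (?z i)\<^sup>2 * (D k x)\<^sup>2 + (2 * z x * ?z i * (D k x * ?A i k) + (z x)\<^sup>2 * (?A i k)\<^sup>2))"
      unfolding N_def pp[OF x] by (intro sum.cong refl) (simp add: power2_eq_square algebra_simps)
    have V: "(V x)\<^sup>2 = (\<Sum>i\<in>UNIV. ?z i * D i x)\<^sup>2 + (2 * z x * (\<Sum>i\<in>UNIV. ?z i * D i x) * (\<Sum>k\<in>UNIV. ?A k k) + (z x)\<^sup>2 * (\<Sum>k\<in>UNIV. ?A k k)\<^sup>2)"
    proof -
      have "V x = (\<Sum>i\<in>UNIV. ?z i * D i x) + z x * (\<Sum>k\<in>UNIV. ?A k k)"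
        unfolding V_def pp[OF x] by (simp add: sum.distrib sum_distrib_left)
      then show ?thesis by (simp add: power2_eq_square algebra_simps)
    qed
    have W: "2 * z x * (\<Sum>i\<in>UNIV. ?z i * D i x) * (\<Sum>k\<in>UNIV. ?A k k) + (z x)\<^sup>2 * (\<Sum>k\<in>UNIV. ?A k k)\<^sup>2
       = (\<Sum>i\<in>UNIV. \<Sum>k\<in>UNIV. 2 * z x * ?z i * D i x * ?A k k + (z x)\<^sup>2 * (?A i i * ?A k k))"
    proof -
      have "(\<Sum>i\<in>UNIV. \<Sum>k\<in>UNIV. 2 * z x * ?z i * D i x * ?A k k) = 2 * z x * ((\<Sum>i\<in>UNIV. ?z i * D i x) * (\<Sum>k\<in>UNIV. ?A k k))"
        by (subst sum_product) (simp add: sum_distrib_left mult.assoc)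
      moreover have "(\<Sum>i\<in>UNIV. \<Sum>k\<in>UNIV. (z x)\<^sup>2 * (?A i i * ?A k k)) = (z x)\<^sup>2 * ((\<Sum>k\<in>UNIV. ?A k k) * (\<Sum>k\<in>UNIV. ?A k k))"
        by (subst sum_product) (simp add: sum_distrib_left mult.assoc)
      ultimately show ?thesis by (simp add: sum.distrib power2_eq_square algebra_simps)
    qed
    show ?thesis unfolding S N V W Q_def
      by (simp add: sum.distrib sum_distrib_left[symmetric] distrib_left)
  qed
  have cp: "continuous_on UNIV (pd i (p k))" for i k using p1 by auto
  have pz: "norm x > R \<Longrightarrow> pd i (p k) x = 0" for i k x using pd_zero_outside[OF p0] .
  have zD: "continuous_on UNIV (\<lambda>x. pd i z x * D k x)" for i k
    by (rule Ck_continuous[of 1], rule ext, rule Ck_mult[OF open_ball zB(3) D1(1)]) (simp add: dz)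
  have IN: "integrable lborel N"
    unfolding N_def by (rule integrable_compact_support[of _ R]) (auto intro!: continuous_intros cp simp: pz)
  have IV: "integrable lborel (\<lambda>x. (V x)\<^sup>2)"
    unfolding V_def by (rule integrable_compact_support[of _ R]) (auto intro!: continuous_intros cp simp: pz)
  define E where "E x = (\<Sum>i\<in>UNIV. (pd i z x)\<^sup>2) * (norm (d x))\<^sup>2" for x
  have E_alt: "E x = (\<Sum>i\<in>UNIV. \<Sum>k\<in>UNIV. (pd i z x * D k x)\<^sup>2)" for x
    unfolding E_def D_def by (simp add: norm_vec_def L2_set_def sum_nonneg sum_product power_mult_distrib)
  have IE: "integrable lborel E" unfolding E_alt
    by (rule integrable_compact_support[of _ R]) (auto intro!: continuous_intros zD simp: dz)
  have IQ: "integrable lborel Q"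
    unfolding Q_def power_mult_distrib[symmetric]
    by (rule integrable_compact_support[of _ R]) (auto intro!: continuous_intros zD simp: dz)
  have IX: "integrable lborel (pd i (X i k))" for i k
    using X1 pd_zero_outside[OF X0] by (intro integrable_compact_support[of _ R]) auto
  have ZX: "(\<integral>x. pd i (X i k) x \<partial>lborel) = 0" for i k using integral_pd_eq_0[OF X1 X0] .
  have energy: "mu * (\<integral>x. N x \<partial>lborel) + (la + mu) * (\<integral>x. (V x)\<^sup>2 \<partial>lborel) = (\<integral>x. Q x \<partial>lborel)"
  proof -
    have "(\<integral>x. mu * N x + (la + mu) * (V x)\<^sup>2 \<partial>lborel) = (\<integral>x. Q x \<partial>lborel) + (\<Sum>i\<in>UNIV. \<Sum>k\<in>UNIV. (\<integral>x. pd i (X i k) x \<partial>lborel))"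
      unfolding key using IQ IX by simp
    then show ?thesis using ZX IN IV by simp
  qed
  have Q_le: "Q x \<le> (mu + \<bar>la + mu\<bar>) * E x" for x
  proof -
    have "(\<Sum>i\<in>UNIV. pd i z x * D i x)\<^sup>2 \<le> E x"
      unfolding E_def D_def norm_vec_def L2_set_def
      using Cauchy_Schwarz_ineq_sum[of "\<lambda>i. pd i z x" "\<lambda>i. d x $ i" UNIV]
      by (simp add: sum_nonneg)
    then have "(la + mu) * (\<Sum>i\<in>UNIV. pd i z x * D i x)\<^sup>2 \<le> \<bar>la + mu\<bar> * E x"
      by (meson abs_ge_self abs_ge_zero mult_mono order_trans zero_le_power2 mult_right_mono mult_left_mono)
    then show ?thesis by (simp add: Q_def E_alt power_mult_distrib algebra_simps)
  qed
  \<comment> \<open>Exchanging derivatives turns the squared divergence into a sum of products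
    \<open>pd k (p i) * pd i (p k)\<close>, and each product is at most half the sum of the two
    squares in \<open>N\<close>.\<close>
  have NV: "(\<integral>x. (V x)\<^sup>2 \<partial>lborel) \<le> (\<integral>x. N x \<partial>lborel)"
  proof -
    have Ipp: "integrable lborel (\<lambda>x. pd i (p k) x * pd j (p l) x)" for i j k l
      using integral_pd_swap(1)[OF p2 p0 p2] .
    have "(\<integral>x. (V x)\<^sup>2 \<partial>lborel) = (\<Sum>i\<in>UNIV. \<Sum>k\<in>UNIV. \<integral>x. pd i (p i) x * pd k (p k) x \<partial>lborel)"
      unfolding V_def power2_eq_square sum_product using Ipp by simp
    also have "\<dots> = (\<Sum>i\<in>UNIV. \<Sum>k\<in>UNIV. \<integral>x. pd k (p i) x * pd i (p k) x \<partial>lborel)"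
      using integral_pd_swap(2)[OF p2 p0 p2] by simp
    also have "\<dots> = (\<integral>x. (\<Sum>i\<in>UNIV. \<Sum>k\<in>UNIV. pd k (p i) x * pd i (p k) x) \<partial>lborel)"
      using Ipp by simp
    also have "\<dots> \<le> (\<integral>x. N x \<partial>lborel)"
    proof (rule integral_mono[OF _ IN])
      fix x
      have "(\<Sum>i\<in>UNIV. \<Sum>k\<in>UNIV. 2 * (pd k (p i) x * pd i (p k) x)) \<le> (\<Sum>i\<in>UNIV. \<Sum>k\<in>UNIV. (pd k (p i) x)\<^sup>2 + (pd i (p k) x)\<^sup>2)"
        using sum_squares_bound by (intro sum_mono) (simp add: mult.assoc)
      also have "\<dots> = 2 * N x"
        unfolding sum.distrib N_def by (subst (1) sum.swap) simp
      finally show "(\<Sum>i\<in>UNIV. \<Sum>k\<in>UNIV. pd k (p i) x * pd i (p k) x) \<le> N x"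
        by (simp add: sum_distrib_left[symmetric])
    qed (use Ipp in simp)
    finally show ?thesis .
  qed
  have N_nonneg: "0 \<le> (\<integral>x. N x \<partial>lborel)" "0 \<le> (\<integral>x. (V x)\<^sup>2 \<partial>lborel)"
    by (intro integral_nonneg_AE AE_I2; simp add: N_def sum_nonneg)+
  \<comment> \<open>If \<open>la + mu < 0\<close>, the divergence term is estimated from below
    through \<open>NV\<close>; the coefficients then add up to
    \<open>mu + (la + mu) = 2 * mu + la\<close>. This explains the minimum in
    \<open>c\<close>.\<close>
  have lower: "c * (\<integral>x. N x \<partial>lborel) \<le> mu * (\<integral>x. N x \<partial>lborel) + (la + mu) * (\<integral>x. (V x)\<^sup>2 \<partial>lborel)"
  proof (cases "la + mu \<ge> 0")
    case True
    have "c * (\<integral>x. N x \<partial>lborel) \<le> mu * (\<integral>x. N x \<partial>lborel)"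
      unfolding c_def using N_nonneg by (intro mult_right_mono) auto
    then show ?thesis using True N_nonneg by (simp add: add_increasing2)
  next
    case False
    have "c * (\<integral>x. N x \<partial>lborel) \<le> (2 * mu + la) * (\<integral>x. N x \<partial>lborel)"
      unfolding c_def using N_nonneg by (intro mult_right_mono) auto
    also have "\<dots> = mu * (\<integral>x. N x \<partial>lborel) + (la + mu) * (\<integral>x. N x \<partial>lborel)" by (simp add: algebra_simps)
    also have "\<dots> \<le> mu * (\<integral>x. N x \<partial>lborel) + (la + mu) * (\<integral>x. (V x)\<^sup>2 \<partial>lborel)"
      using False NV by (simp add: mult_left_mono_neg)
    finally show ?thesis .
  qed
  have "(\<integral>x. (z x)\<^sup>2 * (norm (d x))\<^sup>2 \<partial>lborel) = (\<Sum>k\<in>UNIV. \<integral>x. (p k x)\<^sup>2 \<partial>lborel)"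
  proof -
    have "integrable lborel (\<lambda>x. (p k x)\<^sup>2)" for k
      using p0 Ck_continuous[OF p1] by (intro integrable_compact_support[of _ R]) (auto intro!: continuous_intros)
    moreover have "(z x)\<^sup>2 * (norm (d x))\<^sup>2 = (\<Sum>k\<in>UNIV. (p k x)\<^sup>2)" for x
      by (simp add: p_def D_def norm_vec_def L2_set_def sum_nonneg power_mult_distrib sum_distrib_left)
    ultimately show ?thesis by simp
  qed
  \<comment> \<open>The Poincare inequality uses a single direction of differentiation, and the
    derivatives in direction 1 form one block of the sum \<open>N\<close>.\<close>
  also have "\<dots> \<le> (\<Sum>k\<in>UNIV. 4 * (\<integral>x. (pd 1 (p k) x)\<^sup>2 \<partial>lborel))"
    by (intro sum_mono poincare[OF p1 p0]) (use R in auto)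
  also have "\<dots> = 4 * (\<integral>x. (\<Sum>k\<in>UNIV. (pd 1 (p k) x)\<^sup>2) \<partial>lborel)"
  proof -
    have "integrable lborel (\<lambda>x. (pd 1 (p k) x)\<^sup>2)" for k
      by (intro integrable_compact_support[of _ R]) (auto intro!: continuous_intros cp simp: pz)
    then show ?thesis by (simp add: sum_distrib_left)
  qed
  also have "\<dots> \<le> 4 * (\<integral>x. N x \<partial>lborel)"
  proof (intro mult_left_mono integral_mono IN)
    show "integrable lborel (\<lambda>x. \<Sum>k\<in>UNIV. (pd 1 (p k) x)\<^sup>2)"
      by (intro integrable_compact_support[of _ R]) (auto intro!: continuous_intros cp simp: pz)
    show "(\<Sum>k\<in>UNIV. (pd 1 (p k) x)\<^sup>2) \<le> N x" for x unfolding N_def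
      by (rule member_le_sum[of 1 UNIV "\<lambda>i. \<Sum>k\<in>UNIV. (pd i (p k) x)\<^sup>2"]) (auto intro: sum_nonneg)
  qed auto
  finally have "c * (\<integral>x. (z x)\<^sup>2 * (norm (d x))\<^sup>2 \<partial>lborel) \<le> 4 * (c * (\<integral>x. N x \<partial>lborel))"
    using mu by (simp add: c_def)
  also have "\<dots> \<le> 4 * (\<integral>x. Q x \<partial>lborel)" using lower energy by simp
  also have "\<dots> \<le> 4 * (\<integral>x. (mu + \<bar>la + mu\<bar>) * E x \<partial>lborel)"
    using Q_le IQ IE by (intro mult_left_mono integral_mono) auto
  finally show ?thesis
    by (simp only: E_def[abs_def] integral_mult_right_zero mult.assoc)
qed

section \<open>A twice continuously differentiable cutoff near the sphere\<close>

lemma DERIV_max_power: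
  assumes "0 < n"
  shows "((\<lambda>t::real. max 0 t ^ Suc n) has_real_derivative real (Suc n) * max 0 t ^ n) (at t)"
proof -
  consider "t < 0" | "t > 0" | "t = 0" by linarith
  then show ?thesis
  proof cases
    case 1
    have "((\<lambda>t::real. 0) has_real_derivative 0) (at t)" by simp
    then have "((\<lambda>t::real. max 0 t ^ Suc n) has_real_derivative 0) (at t)"
      by (rule has_field_derivative_transform_within_open[of _ _ _ "{..<0}"]) (use 1 in auto)
    moreover have "real (Suc n) * max 0 t ^ n = 0" using 1 assms by simp
    ultimately show ?thesis by (simp only:)
  next
    case 2
    have "((\<lambda>t::real. t ^ Suc n) has_real_derivative real (Suc n) * t ^ n) (at t)"
      using DERIV_pow[of "Suc n" t] by simp
    then have "((\<lambda>t::real. max 0 t ^ Suc n) has_real_derivative real (Suc n) * t ^ n) (at t)"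
      by (rule has_field_derivative_transform_within_open[of _ _ _ "{0<..}"]) (use 2 in auto)
    then show ?thesis using 2 by simp
  next
    case 3
    have "((\<lambda>h. max 0 h ^ Suc n / h) \<longlongrightarrow> 0) (at (0::real))"
    proof (rule Lim_null_comparison)
      show "\<forall>\<^sub>F h in at 0. norm (max 0 h ^ Suc n / h) \<le> \<bar>h\<bar> ^ n"
        by (rule always_eventually) (auto simp: max_def)
      have "((\<lambda>h::real. \<bar>h\<bar> ^ n) \<longlongrightarrow> \<bar>0\<bar> ^ n) (at 0)" by (intro tendsto_intros)
      moreover have "\<bar>0::real\<bar> ^ n = 0" using assms by simp
      ultimately show "((\<lambda>h::real. \<bar>h\<bar> ^ n) \<longlongrightarrow> 0) (at 0)" by (simp only:)
    qed
    moreover have "real (Suc n) * max 0 t ^ n = 0" using 3 assms by simp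
    moreover have "max 0 (0 + h) ^ Suc n - max 0 (0::real) ^ Suc n = max 0 h ^ Suc n" for h :: real by simp
    ultimately show ?thesis unfolding DERIV_def 3 by (simp only:)
  qed
qed

text \<open>The cubed positive part with its first two derivatives, arranged as the sequence that
  \<open>Ck_comp\<close> expects. The cube is the lowest power of the positive part that is twice
  continuously differentiable at 0.\<close>

definition ramp :: "nat \<Rightarrow> real \<Rightarrow> real" where
  "ramp k t = (if k = 0 then max 0 t ^ 3 else if k = 1 then 3 * max 0 t ^ 2 else 6 * max 0 t)"

lemma ramp_deriv: "k < 2 \<Longrightarrow> (ramp k has_real_derivative ramp (Suc k) t) (at t)"
proof -
  assume "k < 2"
  then consider "k = 0" | "k = 1" by linarith
  then show ?thesis
  proof cases
    case 1
    then show ?thesis using DERIV_max_power[of 2 t] by (simp add: ramp_def[abs_def] numeral_3_eq_3)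
  next
    case 2
    then show ?thesis using DERIV_cmult[OF DERIV_max_power[of 1 t], of 3]
      by (simp add: ramp_def[abs_def] numeral_2_eq_2 algebra_simps)
  qed
qed

lemma Ck_ramp: "open S \<Longrightarrow> Ck 2 S g \<Longrightarrow> Ck 2 S (\<lambda>x. ramp 0 (g x))"
proof (rule Ck_comp[of S 2 ramp g])
  show "continuous_on UNIV (ramp 2)" by (auto simp: ramp_def[abs_def] intro!: continuous_intros)
qed (use ramp_deriv in auto)

lemma norm_power2_sum: "(norm (x::vec3))\<^sup>2 = (\<Sum>i\<in>UNIV. x $ i * x $ i)"
  by (simp add: norm_vec_def L2_set_def sum_nonneg power2_eq_square)

lemma Ck_norm2: "open S \<Longrightarrow> Ck n S (\<lambda>x. (norm x)\<^sup>2)"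
  unfolding norm_power2_sum by (intro Ck_sum Ck_mult Ck_coord) auto

lemma coord_differentiable [simp]: "(\<lambda>x::vec3. x $ i) differentiable (at x)"
  by (intro bounded_linear_imp_differentiable bounded_linear_vec_nth)

lemma pd_norm2: "pd i (\<lambda>x. (norm x)\<^sup>2) x = 2 * x $ i"
proof -
  have "pd i (\<lambda>x. (norm x)\<^sup>2) x = (\<Sum>j\<in>UNIV. pd i (\<lambda>x. x $ j * x $ j) x)"
    unfolding norm_power2_sum by (rule pd_sum) (auto intro!: differentiable_mult)
  also have "\<dots> = (\<Sum>j\<in>UNIV. if i = j then 2 * x $ j else 0)"
    by (intro sum.cong refl) (simp add: pd_mult pd_coord)
  finally show ?thesis by simp
qed

text \<open>Nesting the one-sided cubic, as \<open>1 - ramp 0 (1 - ramp 0 s)\<close>, gives a step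
  that is constant for \<open>s <= 0\<close> and for \<open>s >= 1\<close>. The distance to the
  sphere is measured by \<open>1 - |x|^2\<close>, which is smooth at the origin. In the transition
  zone each of the two derivatives of the cubic is at most 3 and the gradient of \<open>s\<close>
  has length at most \<open>2 / d\<close>, whence \<open>(3 * 3)^2 * 4 = 324\<close>.\<close>

lemma cutoff_exists:
  assumes d: "0 < d"
  obtains z :: "vec3 \<Rightarrow> real" where "Ck 2 UNIV z"
    "\<And>x. 1 - (norm x)\<^sup>2 \<le> d \<Longrightarrow> z x = 0" "\<And>x. 1 - (norm x)\<^sup>2 \<ge> 2 * d \<Longrightarrow> z x = 1"
    "\<And>x. (\<Sum>i\<in>UNIV. (pd i z x)\<^sup>2) \<le> 324 / d\<^sup>2"
    "\<And>x. \<not> (d < 1 - (norm x)\<^sup>2 \<and> 1 - (norm x)\<^sup>2 < 2 * d) \<Longrightarrow> (\<Sum>i\<in>UNIV. (pd i z x)\<^sup>2) = 0"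
proof -
  define q where "q = 1 / d"
  define s where "s x = q * (1 - (norm x)\<^sup>2) - 1" for x :: vec3
  define z where "z x = 1 - ramp 0 (1 - ramp 0 (s x))" for x
  have s2: "Ck 2 UNIV s" unfolding s_def by (intro Ck_diff Ck_mult Ck_norm2 Ck_const) auto
  have sd: "s differentiable (at x)" for x using Ck_differentiable[OF s2] by simp
  have s1: "pd i s x = - 2 * x $ i / d" for i x
  proof -
    have n: "(\<lambda>x::vec3. (norm x)\<^sup>2) differentiable (at x)" using Ck_differentiable[OF Ck_norm2[of UNIV 1]] by simp
    then have "(\<lambda>x::vec3. 1 - (norm x)\<^sup>2) differentiable (at x)" by (intro differentiable_diff) auto
    then have "pd i s x = q * (- 2 * x $ i)"
      unfolding s_def using n by (simp add: pd_diff pd_cmult pd_norm2)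
    then show ?thesis by (simp add: q_def)
  qed
  have z2: "Ck 2 UNIV z" unfolding z_def by (intro Ck_diff Ck_ramp Ck_const s2) auto
  have r1: "(ramp 0 has_real_derivative ramp 1 t) (at t)" for t using ramp_deriv[of 0 t] by simp
  have pz: "pd i z x = ramp 1 (1 - ramp 0 (s x)) * ramp 1 (s x) * (- 2 * x $ i / d)" for i x
  proof -
    have a: "(\<lambda>x. ramp 0 (s x)) differentiable (at x)" by (rule pd_comp(2)[OF r1 sd])
    then have b: "(\<lambda>x. 1 - ramp 0 (s x)) differentiable (at x)" by (intro differentiable_diff) auto
    have c: "(\<lambda>x. ramp 0 (1 - ramp 0 (s x))) differentiable (at x)" by (rule pd_comp(2)[OF r1 b])
    show ?thesis unfolding z_def
      using a b c pd_comp(1)[where m = "ramp 0", OF r1 b, of i] pd_comp(1)[where m = "ramp 0", OF r1 sd, of i]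
      by (simp add: pd_diff s1)
  qed
  have sq: "(\<Sum>i\<in>UNIV. (pd i z x)\<^sup>2) = (ramp 1 (1 - ramp 0 (s x)) * ramp 1 (s x))\<^sup>2 * (4 * (norm x)\<^sup>2 / d\<^sup>2)" for x
    unfolding pz norm_power2_sum
    by (simp add: power_mult_distrib power_divide sum_distrib_left sum_divide_distrib power2_eq_square mult_ac)
  have s0: "s x \<le> 0 \<longleftrightarrow> 1 - (norm x)\<^sup>2 \<le> d" "s x \<ge> 1 \<longleftrightarrow> 1 - (norm x)\<^sup>2 \<ge> 2 * d" for x
    using d by (auto simp: s_def q_def field_simps)
  have ra: "ramp 0 t = 0" "ramp 1 t = 0" if "t \<le> 0" for t using that by (auto simp: ramp_def)
  have rb: "ramp 0 t \<ge> 1" if "t \<ge> 1" for t using that by (auto simp: ramp_def)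
  have rc: "0 \<le> ramp 1 t" "t \<le> 1 \<Longrightarrow> ramp 1 t \<le> 3" "0 \<le> ramp 0 t" for t
    by (auto simp: ramp_def max_def power_le_one_iff)
  show ?thesis
  proof (rule that[OF z2])
    show "z x = 0" if "1 - (norm x)\<^sup>2 \<le> d" for x
      using that ra s0 by (simp add: z_def) (simp add: ramp_def)
    show "z x = 1" if "1 - (norm x)\<^sup>2 \<ge> 2 * d" for x
      using that rb[of "s x"] ra(1)[of "1 - ramp 0 (s x)"] s0 by (simp add: z_def)
    show Z: "(\<Sum>i\<in>UNIV. (pd i z x)\<^sup>2) = 0" if "\<not> (d < 1 - (norm x)\<^sup>2 \<and> 1 - (norm x)\<^sup>2 < 2 * d)" for x
    proof -
      have "s x \<le> 0 \<or> s x \<ge> 1" using that s0 by auto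
      then show ?thesis unfolding sq using ra(2)[of "s x"] ra(2)[of "1 - ramp 0 (s x)"] rb[of "s x"] by auto
    qed
    show "(\<Sum>i\<in>UNIV. (pd i z x)\<^sup>2) \<le> 324 / d\<^sup>2" for x
    proof (cases "d < 1 - (norm x)\<^sup>2 \<and> 1 - (norm x)\<^sup>2 < 2 * d")
      case True
      then have "s x \<le> 1" and n: "(norm x)\<^sup>2 \<le> 1" using s0(2)[of x] d by linarith+
      then have "ramp 1 (1 - ramp 0 (s x)) * ramp 1 (s x) \<le> 3 * 3"
        using rc by (intro mult_mono) auto
      then have "(ramp 1 (1 - ramp 0 (s x)) * ramp 1 (s x))\<^sup>2 \<le> 9\<^sup>2"
        using rc by (intro power_mono) auto
      then have "(ramp 1 (1 - ramp 0 (s x)) * ramp 1 (s x))\<^sup>2 * (4 * (norm x)\<^sup>2 / d\<^sup>2) \<le> 81 * (4 / d\<^sup>2)"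
        using n d by (intro mult_mono divide_right_mono) auto
      then show ?thesis unfolding sq by simp
    qed (use Z in simp)
  qed
qed

lemma shell_measure:
  assumes "0 \<le> r" "r \<le> 1"
  shows "measure lborel (ball (0::vec3) 1 - cball 0 r) \<le> 3 * (1 - r) * measure lborel (ball (0::vec3) 1)"
proof -
  have fm: "ball (0::vec3) s \<in> fmeasurable lborel" for s
    by (rule fmeasurableI) (use emeasure_lborel_ball_finite in auto)
  have "measure lborel (ball (0::vec3) 1 - cball 0 r) \<le> measure lborel (ball (0::vec3) 1 - ball 0 r)"
    by (intro measure_mono_fmeasurable) (auto intro: fmeasurable.Diff fm)
  also have "\<dots> = measure lborel (ball (0::vec3) 1) - measure lborel (ball (0::vec3) r)"
    using assms by (intro measure_Diff) (use emeasure_lborel_ball_finite[of "0::vec3" 1] in auto)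
  also have "\<dots> = (1 - r ^ 3) * measure lborel (ball (0::vec3) 1)"
    using assms content_ball[of r "0::vec3"] content_ball[of 1 "0::vec3"] by (simp add: algebra_simps power3_eq_cube)
  also have "\<dots> \<le> 3 * (1 - r) * measure lborel (ball (0::vec3) 1)"
  proof (rule mult_right_mono)
    have "1 - r ^ 3 = (1 - r) * (1 + r + r * r)" by (simp add: algebra_simps power3_eq_cube)
    also have "\<dots> \<le> (1 - r) * 3" using assms mult_le_one[of r r] by (intro mult_left_mono) auto
    finally show "1 - r ^ 3 \<le> 3 * (1 - r)" by simp
  qed simp
  finally show ?thesis .
qed

text \<open>The exponent 3/4 is not special: any exponent above 1/2 makes the right-hand side of the
  Caccioppoli inequality tend to 0 as the cutoff approaches the indicator function of the ball.\<close>
theorem lame_uniqueness: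
  fixes d :: "vec3 \<Rightarrow> vec3"
  assumes mu: "mu > 0" "2 * mu + la > 0" and sol: "lame_solution la mu d"
    and bd: "\<And>x. norm x < 1 \<Longrightarrow> norm (d x) \<le> C * (1 - norm x) powr (3/4)"
    and x0: "norm x0 < 1"
  shows "d x0 = 0"
proof (rule ccontr)
  assume ne: "d x0 \<noteq> 0"
  define c where "c = min mu (2 * mu + la)"
  define V where "V = measure lborel (ball (0::vec3) 1)"
  have c: "c > 0" using mu by (simp add: c_def)
  have "continuous_on (ball 0 1) d"
  proof -
    have "continuous_on (ball 0 1) (\<lambda>x. d x $ k)" for k
      using sol Ck_continuous unfolding lame_solution_def C2_on_iff_Ck by blast
    then have "continuous_on (ball 0 1) (\<lambda>x. \<chi> k. d x $ k)" by (rule continuous_on_vec_lambda)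
    moreover have "(\<lambda>x. \<chi> k. d x $ k) = d" by auto
    ultimately show ?thesis by (simp only:)
  qed
  then have "isCont d x0" using x0 by (simp add: continuous_on_eq_continuous_at)
  then have "\<exists>e>0. \<forall>y. dist y x0 < e \<longrightarrow> dist (d y) (d x0) < norm (d x0) / 2"
    using ne unfolding continuous_at_eps_delta by (metis half_gt_zero zero_less_norm_iff)
  then obtain e where e: "e > 0" "\<And>y. dist y x0 < e \<Longrightarrow> dist (d y) (d x0) < norm (d x0) / 2" by blast
  define r where "r = min e ((1 - norm x0) / 2)"
  have r: "r > 0" "r \<le> e" "norm x0 + r < 1" using e x0 by (auto simp: r_def min_def field_simps)
  define v where "v = measure lborel (ball x0 r)"
  have v: "v > 0" using r by (simp add: v_def content_ball_pos)
  define R where "R = norm x0 + r"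
  have low: "norm (d y) \<ge> norm (d x0) / 2" if "y \<in> ball x0 r" for y
  proof -
    have "norm (d x0) \<le> norm (d y) + dist (d y) (d x0)"
      using norm_triangle_sub[of "d x0" "d y"] by (simp add: dist_norm norm_minus_commute)
    then show ?thesis using e(2)[of y] that r by (auto simp: dist_commute)
  qed
  \<comment> \<open>The cutoff varies in a layer of width of order \<open>eps^2\<close>. There the
    squared gradient is at most \<open>324 / (eps^2 / 2)^2 = 1296 / eps^4\<close>, the squared
    solution at most \<open>C^2 * eps^3\<close>, and the volume at most
    \<open>3 * eps^2 * V\<close>. The product is of first order in \<open>eps\<close>.\<close>
  have main: "c * ((norm (d x0) / 2)\<^sup>2 * v) \<le> (4 * (mu + \<bar>la + mu\<bar>) * (3888 * C\<^sup>2 * V)) * \<epsilon>"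
    if eps: "0 < \<epsilon>" "\<epsilon>\<^sup>2 \<le> 1 - R\<^sup>2" "\<epsilon> \<le> 1" for \<epsilon>
  proof -
    obtain z where z: "Ck 2 UNIV z"
    "\<And>x. 1 - (norm x)\<^sup>2 \<le> \<epsilon>\<^sup>2 / 2 \<Longrightarrow> z x = 0" "\<And>x. 1 - (norm x)\<^sup>2 \<ge> 2 * (\<epsilon>\<^sup>2 / 2) \<Longrightarrow> z x = 1"
    "\<And>x. (\<Sum>i\<in>UNIV. (pd i z x)\<^sup>2) \<le> 324 / (\<epsilon>\<^sup>2 / 2)\<^sup>2"
    "\<And>x. \<not> (\<epsilon>\<^sup>2 / 2 < 1 - (norm x)\<^sup>2 \<and> 1 - (norm x)\<^sup>2 < 2 * (\<epsilon>\<^sup>2 / 2)) \<Longrightarrow> (\<Sum>i\<in>UNIV. (pd i z x)\<^sup>2) = 0"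
      using cutoff_exists[of "\<epsilon>\<^sup>2 / 2"] eps by auto
    define R' where "R' = sqrt (1 - \<epsilon>\<^sup>2 / 2)"
    have e1: "\<epsilon>\<^sup>2 \<le> 1" using eps by (simp add: power_le_one)
    have R': "R' < 1" "R'\<^sup>2 = 1 - \<epsilon>\<^sup>2 / 2" "R' \<ge> 0" using eps e1 by (auto simp: R'_def)
    have z0: "z x = 0" if "norm x > R'" for x
      using power_strict_mono[OF that R'(3), of 2] R'(2) by (intro z(2)) simp
    note cac = caccioppoli[OF mu sol z(1) z0 R'(1)]
    have "(\<integral>x. (\<Sum>i\<in>UNIV. (pd i z x)\<^sup>2) * (norm (d x))\<^sup>2 \<partial>lborel) \<le> (\<integral>x. indicator (ball (0::vec3) 1 - cball 0 (1 - \<epsilon>\<^sup>2)) x * (1296 / \<epsilon> ^ 4 * (C\<^sup>2 * \<epsilon> ^ 3)) \<partial>lborel)"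
    proof (rule Bochner_Integration.integral_mono')
      have "emeasure lborel (ball (0::vec3) 1 - cball 0 (1 - \<epsilon>\<^sup>2)) < \<infinity>"
        by (rule order.strict_trans1[OF emeasure_mono[of _ "ball 0 1"]]) (use emeasure_lborel_ball_finite[of "0::vec3" 1] in auto)
      then show "integrable lborel (\<lambda>x::vec3. indicator (ball 0 1 - cball 0 (1 - \<epsilon>\<^sup>2)) x * (1296 / \<epsilon> ^ 4 * (C\<^sup>2 * \<epsilon> ^ 3)))"
        by (intro integrable_mult_left integrable_real_indicator) auto
      fix x :: vec3
      show "0 \<le> indicat_real (ball 0 1 - cball 0 (1 - \<epsilon>\<^sup>2)) x * (1296 / \<epsilon> ^ 4 * (C\<^sup>2 * \<epsilon> ^ 3))"
        using eps by simp
      show "(\<Sum>i\<in>UNIV. (pd i z x)\<^sup>2) * (norm (d x))\<^sup>2 \<le> indicat_real (ball 0 1 - cball 0 (1 - \<epsilon>\<^sup>2)) x * (1296 / \<epsilon> ^ 4 * (C\<^sup>2 * \<epsilon> ^ 3))"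
      proof (cases "\<epsilon>\<^sup>2 / 2 < 1 - (norm x)\<^sup>2 \<and> 1 - (norm x)\<^sup>2 < 2 * (\<epsilon>\<^sup>2 / 2)")
        case True
        then have "(norm x)\<^sup>2 < 1" using eps by (smt (verit) zero_less_power half_gt_zero)
        then have n1: "norm x < 1" by (simp add: power_less_one_iff abs_square_less_1)
        have "(norm x)\<^sup>2 \<le> norm x" using n1 by (simp add: power2_eq_square mult_left_le)
        then have n2: "1 - norm x < \<epsilon>\<^sup>2" using True by simp
        have "(norm (d x))\<^sup>2 \<le> (C * (1 - norm x) powr (3/4))\<^sup>2"
          using bd[OF n1] by (intro power_mono) auto
        also have "\<dots> = C\<^sup>2 * (1 - norm x) powr (3/2)"
          using n1 by (simp add: power_mult_distrib powr_power)
        also have "\<dots> \<le> C\<^sup>2 * (\<epsilon>\<^sup>2) powr (3/2)"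
          using n1 n2 by (intro mult_left_mono powr_mono2) auto
        also have "(\<epsilon>\<^sup>2) powr (3/2) = \<epsilon> ^ 3"
          using eps by (simp add: powr_powr flip: powr_numeral)
        finally have "(norm (d x))\<^sup>2 \<le> C\<^sup>2 * \<epsilon> ^ 3" .
        moreover have "(\<Sum>i\<in>UNIV. (pd i z x)\<^sup>2) \<le> 1296 / \<epsilon> ^ 4"
          using z(4)[of x] by (simp add: power_divide flip: power_mult)
        ultimately have "(\<Sum>i\<in>UNIV. (pd i z x)\<^sup>2) * (norm (d x))\<^sup>2 \<le> 1296 / \<epsilon> ^ 4 * (C\<^sup>2 * \<epsilon> ^ 3)"
          using eps by (intro mult_mono) (auto simp: sum_nonneg)
        then show ?thesis using n1 n2 by simp
      qed (use z(5)[of x] eps in simp)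
    qed
    also have "\<dots> = (1296 / \<epsilon> ^ 4 * (C\<^sup>2 * \<epsilon> ^ 3)) * measure lborel (ball (0::vec3) 1 - cball 0 (1 - \<epsilon>\<^sup>2))"
      by simp
    also have "\<dots> \<le> (1296 / \<epsilon> ^ 4 * (C\<^sup>2 * \<epsilon> ^ 3)) * (3 * \<epsilon>\<^sup>2 * V)"
      using shell_measure[of "1 - \<epsilon>\<^sup>2"] e1 eps unfolding V_def by (intro mult_left_mono) auto
    also have "\<dots> = 3888 * C\<^sup>2 * V * \<epsilon>"
      using eps by (simp add: power2_eq_square power3_eq_cube power4_eq_xxxx)
    finally have up: "(\<integral>x. (\<Sum>i\<in>UNIV. (pd i z x)\<^sup>2) * (norm (d x))\<^sup>2 \<partial>lborel) \<le> 3888 * C\<^sup>2 * V * \<epsilon>" .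
    have "(norm (d x0) / 2)\<^sup>2 * v = (\<integral>x. indicator (ball x0 r) x * (norm (d x0) / 2)\<^sup>2 \<partial>lborel)"
      by (simp add: v_def)
    also have "\<dots> \<le> (\<integral>x. (z x)\<^sup>2 * (norm (d x))\<^sup>2 \<partial>lborel)"
    proof (rule Bochner_Integration.integral_mono')
      show "integrable lborel (\<lambda>x. (z x)\<^sup>2 * (norm (d x))\<^sup>2)"
      proof (rule integrable_compact_support[of _ R'])
        have "Ck 2 UNIV (\<lambda>x. z x * d x $ k)" for k
        proof (rule Ck_zero_extension[OF Ck_mult R'(1)])
          show "Ck 2 (ball 0 1) z" by (rule Ck_subset[OF z(1)]) simp
          show "Ck 2 (ball 0 1) (\<lambda>x. d x $ k)"
            using sol unfolding lame_solution_def C2_on_iff_Ck by blast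
        qed (auto simp: z0)
        then have "continuous_on UNIV (\<lambda>x. z x * d x $ k)" for k using Ck_continuous by blast
        then have "continuous_on UNIV (\<lambda>x. \<Sum>k\<in>UNIV. (z x * d x $ k)\<^sup>2)"
          by (intro continuous_on_sum continuous_on_power)
        moreover have "(\<Sum>k\<in>UNIV. (z x * d x $ k)\<^sup>2) = (z x)\<^sup>2 * (norm (d x))\<^sup>2" for x
          unfolding norm_power2_sum by (simp add: sum_distrib_left power2_eq_square mult_ac)
        ultimately show "continuous_on UNIV (\<lambda>x. (z x)\<^sup>2 * (norm (d x))\<^sup>2)" by simp
      qed (simp add: z0)
      fix x
      show "indicat_real (ball x0 r) x * (norm (d x0) / 2)\<^sup>2 \<le> (z x)\<^sup>2 * (norm (d x))\<^sup>2"
      proof (cases "x \<in> ball x0 r")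
        case True
        then have "norm x \<le> R" unfolding R_def using norm_triangle_sub[of x x0]
          by (simp add: dist_norm norm_minus_commute)
        then have "(norm x)\<^sup>2 \<le> R\<^sup>2" by (intro power_mono) auto
        then have "z x = 1" using eps by (intro z(3)) simp
        then show ?thesis using low[OF True] True by (auto intro!: power_mono)
      qed simp
    qed simp
    finally have "c * ((norm (d x0) / 2)\<^sup>2 * v) \<le> c * (\<integral>x. (z x)\<^sup>2 * (norm (d x))\<^sup>2 \<partial>lborel)"
      using c by simp
    also have "\<dots> \<le> 4 * (mu + \<bar>la + mu\<bar>) * (3888 * C\<^sup>2 * V * \<epsilon>)"
      using order_trans[OF cac mult_left_mono[OF up, of "4 * (mu + \<bar>la + mu\<bar>)"]] mu unfolding c_def by simp
    finally show ?thesis by (simp only: mult.assoc)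
  qed
  define A where "A = c * ((norm (d x0) / 2)\<^sup>2 * v)"
  define K where "K = 4 * (mu + \<bar>la + mu\<bar>) * (3888 * C\<^sup>2 * V)"
  have A: "A > 0" using c v ne by (simp add: A_def)
  have "R\<^sup>2 < 1" using r by (simp add: R_def abs_square_less_1)
  \<comment> \<open>Small enough that the ball of radius \<open>R\<close> lies where the cutoff is
    1, and that \<open>main\<close> yields \<open>A <= A / 2\<close>. Since \<open>eps <= 1\<close>,
    the bound on \<open>eps\<close> also bounds its square.\<close>
  define \<epsilon> where "\<epsilon> = min (1 - R\<^sup>2) (A / (2 * (\<bar>K\<bar> + 1)))"
  have \<epsilon>: "0 < \<epsilon>" "\<epsilon> \<le> 1 - R\<^sup>2" "\<epsilon> \<le> 1" "\<epsilon> \<le> A / (2 * (\<bar>K\<bar> + 1))"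
  proof -
    show "0 < \<epsilon>" using A \<open>R\<^sup>2 < 1\<close> by (simp add: \<epsilon>_def)
    show "\<epsilon> \<le> 1 - R\<^sup>2" "\<epsilon> \<le> A / (2 * (\<bar>K\<bar> + 1))" by (simp_all only: \<epsilon>_def min.cobounded1 min.cobounded2)
    then show "\<epsilon> \<le> 1" using zero_le_power2[of R] by linarith
  qed
  have "\<epsilon>\<^sup>2 \<le> \<epsilon>" using \<epsilon> by (simp add: power2_eq_square mult_left_le)
  then have "A \<le> K * \<epsilon>" unfolding A_def K_def using \<epsilon> by (intro main) auto
  also have "\<dots> \<le> (\<bar>K\<bar> + 1) * \<epsilon>" using \<epsilon> by (intro mult_right_mono) auto
  also have "\<dots> \<le> A / 2" using \<epsilon>(4) by (simp add: field_simps)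
  finally show False using A by simp
qed

section \<open>Surface measure\<close>

lemma space_sphere_measure [simp]: "space sphere_measure = sphere 0 1"
  by (simp add: sphere_measure_def space_restrict_space)

lemma sets_sphere_measure [measurable_cong]: "sets sphere_measure = sets (restrict_space borel (sphere 0 1))"
  by (simp add: sphere_measure_def)

lemma measurable_radial_projection [measurable]:
  "(\<lambda>x::vec3. x /\<^sub>R norm x) \<in> measurable (restrict_space lborel (ball 0 1 - {0})) (restrict_space borel (sphere 0 1))"
proof (rule measurable_restrict_space2)
  show "(\<lambda>x::vec3. x /\<^sub>R norm x) \<in> measurable (restrict_space lborel (ball 0 1 - {0})) borel"
    by (rule measurable_restrict_space1) simp
qed (auto simp: space_restrict_space)

lemma nn_integral_sphere_measure:
  assumes "f \<in> borel_measurable (restrict_space borel (sphere 0 1))"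
  shows "(\<integral>\<^sup>+x. f x \<partial>sphere_measure) = 3 * (\<integral>\<^sup>+x. f (x /\<^sub>R norm x) * indicator (ball 0 1 - {0}) x \<partial>lborel)"
proof -
  have "(\<integral>\<^sup>+x. f x \<partial>sphere_measure) = 3 * (\<integral>\<^sup>+x. f (x /\<^sub>R norm x) \<partial>restrict_space lborel (ball 0 1 - {0}))"
    unfolding sphere_measure_def using assms
    by (simp add: nn_integral_density nn_integral_cmult nn_integral_distr)
  then show ?thesis by (simp add: nn_integral_restrict_space)
qed

abbreviation unit_vol :: real where "unit_vol \<equiv> measure lborel (ball (0::vec3) 1)"

lemma emeasure_ball_vec3: "r \<ge> 0 \<Longrightarrow> emeasure lborel (ball (c::vec3) r) = ennreal (unit_vol * r ^ 3)"
proof -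
  assume "r \<ge> 0"
  have "emeasure lborel (ball c r) = ennreal (measure lborel (ball c r))"
    using emeasure_lborel_ball_finite[of c r] by (intro emeasure_eq_ennreal_measure) auto
  then show ?thesis using \<open>r \<ge> 0\<close> content_ball[of r c] content_ball[of 1 "0::vec3"] by (simp add: mult.commute)
qed

lemma emeasure_sphere_measure_UNIV: "emeasure sphere_measure (sphere 0 1) = ennreal (4 * pi)"
proof -
  have "emeasure sphere_measure (sphere 0 1) = (\<integral>\<^sup>+x. 1 \<partial>sphere_measure)" by simp
  also have "\<dots> = 3 * (\<integral>\<^sup>+x. indicator (ball (0::vec3) 1 - {0}) x \<partial>lborel)"
    by (subst nn_integral_sphere_measure) auto
  also have "\<dots> = 3 * emeasure lborel (ball (0::vec3) 1 - {0})" by simp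
  also have "emeasure lborel (ball (0::vec3) 1 - {0}) = emeasure lborel (ball (0::vec3) 1)"
    by (intro emeasure_Diff_null_set) auto
  also have "\<dots> = ennreal (4 / 3 * pi)"
    using emeasure_ball_vec3[of 1 0] content_ball[of 1 "0::vec3"] by (simp add: unit_ball_vol_3)
  also have "3 * \<dots> = ennreal (3 * (4 / 3 * pi))" by (subst ennreal_mult') auto
  also have "3 * (4 / 3 * pi) = 4 * pi" by simp
  finally show ?thesis .
qed

text \<open>The surface measure as a Borel measure on all of space, so that it can be compared with
  measures obtained as weak limits.\<close>
definition sphere_borel :: "vec3 measure" where
  "sphere_borel = distr sphere_measure borel (\<lambda>x. x)"

lemma id_sphere_measurable [measurable]: "(\<lambda>x. x) \<in> measurable sphere_measure borel"
  by (simp add: measurable_cong_sets[OF sets_sphere_measure refl] measurable_restrict_space1)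

lemma sets_sphere_borel [simp, measurable_cong]: "sets sphere_borel = sets borel"
  and space_sphere_borel [simp]: "space sphere_borel = UNIV"
  by (simp_all add: sphere_borel_def)

lemma AE_sphere_borelD: "(AE x in sphere_borel. P x) \<Longrightarrow> (AE x in sphere_measure. P x)"
  unfolding sphere_borel_def by (rule AE_distrD[OF id_sphere_measurable])

lemma borel_measurable_sphere_measure_iff:
  fixes f :: "vec3 \<Rightarrow> 'b::real_normed_vector"
  shows "f \<in> borel_measurable sphere_measure \<longleftrightarrow> (\<lambda>x. indicator (sphere 0 1) x *\<^sub>R f x) \<in> borel_measurable borel"
  using borel_measurable_restrict_space_iff[of "sphere (0::vec3) 1" borel f]
  by (simp add: measurable_cong_sets[OF sets_sphere_measure refl])

lemma borel_measurable_sphere_borelI: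
  "f \<in> borel_measurable borel \<Longrightarrow> f \<in> borel_measurable sphere_measure"
  by (simp add: measurable_cong_sets[OF sets_sphere_measure refl] measurable_restrict_space1)

lemma nn_integral_sphere_borel:
  "f \<in> borel_measurable borel \<Longrightarrow> (\<integral>\<^sup>+x. f x \<partial>sphere_borel) = (\<integral>\<^sup>+x. f x \<partial>sphere_measure)"
  unfolding sphere_borel_def by (subst nn_integral_distr) auto

lemma integral_sphere_borel:
  fixes f :: "vec3 \<Rightarrow> 'b::{banach, second_countable_topology}"
  shows "f \<in> borel_measurable borel \<Longrightarrow> (\<integral>x. f x \<partial>sphere_borel) = (\<integral>x. f x \<partial>sphere_measure)"
  unfolding sphere_borel_def by (subst integral_distr) auto

lemma integrable_sphere_borel:
  fixes f :: "vec3 \<Rightarrow> 'b::{banach, second_countable_topology}"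
  shows "f \<in> borel_measurable borel \<Longrightarrow> integrable sphere_borel f \<longleftrightarrow> integrable sphere_measure f"
  unfolding sphere_borel_def by (subst integrable_distr_eq) auto

lemma emeasure_sphere_borel_complement: "emeasure sphere_borel (- sphere 0 1) = 0"
proof -
  have "emeasure sphere_borel (- sphere 0 1) = emeasure sphere_measure ({})"
    unfolding sphere_borel_def by (subst emeasure_distr) (auto intro!: arg_cong[where f = "emeasure sphere_measure"])
  then show ?thesis by simp
qed

lemma emeasure_sphere_borel_UNIV: "emeasure sphere_borel UNIV = ennreal (4 * pi)"
  unfolding sphere_borel_def using emeasure_sphere_measure_UNIV by (subst emeasure_distr) (auto simp: Int_absorb1)

lemma finite_sphere_borel: "finite_measure sphere_borel"
  by (rule finite_measureI) (simp add: emeasure_sphere_borel_UNIV)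

lemma finite_sphere_measure: "finite_measure sphere_measure"
  by (rule finite_measureI) (simp only: space_sphere_measure emeasure_sphere_measure_UNIV, simp)

lemma emeasure_sphere_borel:
  assumes A: "A \<in> sets borel"
  shows "emeasure sphere_borel A = 3 * emeasure lborel {x \<in> ball 0 1 - {0}. x /\<^sub>R norm x \<in> A}"
proof -
  have m: "{x \<in> ball (0::vec3) 1 - {0}. x /\<^sub>R norm x \<in> A} \<in> sets borel"
    using A by measurable
  have "emeasure sphere_borel A = (\<integral>\<^sup>+x. indicator A x \<partial>sphere_borel)" using A by simp
  also have "\<dots> = (\<integral>\<^sup>+x. indicator A x \<partial>sphere_measure)" using A by (subst nn_integral_sphere_borel) auto
  also have "\<dots> = 3 * (\<integral>\<^sup>+x. indicator A (x /\<^sub>R norm x) * indicator (ball 0 1 - {0}) x \<partial>lborel)"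
    by (subst nn_integral_sphere_measure) (use A in \<open>auto intro!: measurable_restrict_space1\<close>)
  also have "\<dots> = 3 * (\<integral>\<^sup>+x. indicator {x \<in> ball (0::vec3) 1 - {0}. x /\<^sub>R norm x \<in> A} x \<partial>lborel)"
    by (intro arg_cong[where f = "\<lambda>x. 3 * x"] nn_integral_cong) (auto simp: indicator_def)
  also have "\<dots> = 3 * emeasure lborel {x \<in> ball (0::vec3) 1 - {0}. x /\<^sub>R norm x \<in> A}"
    using m by simp
  finally show ?thesis .
qed

text \<open>The cone over the cap is covered by \<open>n <= 2 / r\<close> balls of radius
  \<open>2 * r\<close> with centres spaced along the segment from 0 to \<open>xi\<close>. Each has
  volume \<open>8 r^3\<close> times that of the unit ball, and the factor 3 of the cone construction
  gives \<open>3 * 2 * 8 = 48\<close>. For \<open>r > 1\<close> the total mass is already below the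
  bound.\<close>

lemma sphere_borel_ball_le:
  assumes \<xi>: "norm \<xi> = 1" and r: "r > 0"
  shows "emeasure sphere_borel (ball \<xi> r) \<le> ennreal (48 * unit_vol * r\<^sup>2)"
proof (cases "r \<le> 1")
  case False
  have "emeasure sphere_borel (ball \<xi> r) \<le> emeasure sphere_borel UNIV" by (rule emeasure_mono) auto
  also have "\<dots> = ennreal (3 * unit_vol)"
    unfolding emeasure_sphere_borel_UNIV using content_ball[of 1 "0::vec3"]
    by (intro arg_cong[where f = ennreal]) (simp add: unit_ball_vol_3)
  also have "\<dots> \<le> ennreal (48 * unit_vol * r\<^sup>2)"
  proof (rule ennreal_leI)
    have "1 \<le> r\<^sup>2" using False by (simp add: one_le_power)
    then have "3 * unit_vol * 1 \<le> (48 * unit_vol) * r\<^sup>2" by (intro mult_mono) auto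
    then show "3 * unit_vol \<le> 48 * unit_vol * r\<^sup>2" by simp
  qed
  finally show ?thesis .
next
  case True
  define n where "n = nat \<lceil>1 / r\<rceil>"
  have n1: "real n \<ge> 1 / r" "real n \<le> 1 / r + 1" using r by (auto simp: n_def)
  have "1 / r \<ge> 1" using True r by simp
  then have n0: "real n > 0" using n1 by linarith
  have "1 \<le> r * real n" using n1(1) r by (simp add: divide_le_eq mult.commute)
  then have n: "real n \<le> 2 / r" "1 / real n \<le> r" "real n > 0"
    using n0 n1(2) \<open>1 / r \<ge> 1\<close> by (auto simp: divide_le_eq)
  let ?A = "{x \<in> ball 0 1 - {0}. x /\<^sub>R norm x \<in> ball \<xi> r}"
  have sub: "?A \<subseteq> (\<Union>j\<in>{..<n}. ball ((real j / real n) *\<^sub>R \<xi>) (2 * r))"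
  proof
    fix x assume x: "x \<in> ?A"
    define t where "t = norm x"
    have t: "0 < t" "t < 1" using x by (auto simp: t_def)
    define j where "j = nat \<lfloor>t * real n\<rfloor>"
    have jn: "real j \<le> t * real n" "t * real n < real j + 1" using t by (auto simp: j_def)
    have "t * real n < real n" using t n by simp
    then have j: "j < n" using jn by simp
    have "t - real j / real n = (t * real n - real j) / real n" using n0 by (simp add: field_simps)
    then have "\<bar>t - real j / real n\<bar> \<le> 1 / real n" using jn by (simp add: divide_right_mono)
    then have a: "norm ((t - real j / real n) *\<^sub>R \<xi>) \<le> r" using \<xi> n by simp
    have "norm (t *\<^sub>R (\<xi> - x /\<^sub>R norm x)) = t * norm (\<xi> - x /\<^sub>R norm x)" using t by simp
    also have "\<dots> < 1 * r" using x t by (intro mult_strict_mono) (auto simp: dist_norm)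
    finally have b: "norm (t *\<^sub>R \<xi> - x) < r" using t by (simp add: t_def algebra_simps)
    have eq: "(real j / real n) *\<^sub>R \<xi> - x = (t *\<^sub>R \<xi> - x) - (t - real j / real n) *\<^sub>R \<xi>" by (simp add: algebra_simps)
    have "norm ((real j / real n) *\<^sub>R \<xi> - x) < 2 * r"
      unfolding eq using a b norm_triangle_ineq4[of "t *\<^sub>R \<xi> - x" "(t - real j / real n) *\<^sub>R \<xi>"] by linarith
    then show "x \<in> (\<Union>j\<in>{..<n}. ball ((real j / real n) *\<^sub>R \<xi>) (2 * r))"
      using j by (auto simp: dist_norm)
  qed
  have "emeasure sphere_borel (ball \<xi> r) = 3 * emeasure lborel ?A"
    by (rule emeasure_sphere_borel) simp
  also have "\<dots> \<le> 3 * emeasure lborel (\<Union>j\<in>{..<n}. ball ((real j / real n) *\<^sub>R \<xi>) (2 * r))"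
    using sub by (intro mult_left_mono emeasure_mono) auto
  also have "\<dots> \<le> 3 * (\<Sum>j\<in>{..<n}. emeasure lborel (ball ((real j / real n) *\<^sub>R \<xi>) (2 * r)))"
    by (intro mult_left_mono emeasure_subadditive_finite) auto
  also have "(\<Sum>j\<in>{..<n}. emeasure lborel (ball ((real j / real n) *\<^sub>R \<xi>) (2 * r))) = ennreal (real n * (unit_vol * (2 * r) ^ 3))"
  proof -
    have "(\<Sum>j\<in>{..<n}. emeasure lborel (ball ((real j / real n) *\<^sub>R \<xi>) (2 * r))) = (\<Sum>j\<in>{..<n}. ennreal (unit_vol * (2 * r) ^ 3))"
      using r by (intro sum.cong refl emeasure_ball_vec3) simp
    also have "\<dots> = ennreal (\<Sum>j\<in>{..<n}. unit_vol * (2 * r) ^ 3)"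
      using r by (intro sum_ennreal) simp
    finally show ?thesis by simp
  qed
  also have "3 * ennreal (real n * (unit_vol * (2 * r) ^ 3)) = ennreal (3 * (real n * (unit_vol * (2 * r) ^ 3)))"
    by (subst (2) ennreal_mult') auto
  also have "\<dots> \<le> ennreal (48 * unit_vol * r\<^sup>2)"
  proof (rule ennreal_leI)
    have "real n * (unit_vol * (2 * r) ^ 3) \<le> (2 / r) * (unit_vol * (2 * r) ^ 3)"
      using n r by (intro mult_right_mono) auto
    also have "\<dots> = 16 * unit_vol * r\<^sup>2" using r by (simp add: power3_eq_cube power2_eq_square)
    finally show "3 * (real n * (unit_vol * (2 * r) ^ 3)) \<le> 48 * unit_vol * r\<^sup>2" by simp
  qed
  finally show ?thesis .
qed

section \<open>Rotation invariance of the surface measure\<close>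

lemma distr_lborel_orthogonal:
  fixes T :: "vec3 \<Rightarrow> vec3"
  assumes T: "orthogonal_transformation T"
  shows "distr lborel borel T = lborel"
proof (rule sym, rule lborel_eqI)
  fix l u :: vec3 assume lu: "\<And>b. b \<in> Basis \<Longrightarrow> l \<bullet> b \<le> u \<bullet> b"
  have m: "T \<in> borel_measurable borel"
    using orthogonal_transformation_linear[OF T] by (intro borel_measurable_continuous_onI linear_continuous_on) (simp add: linear_conv_bounded_linear)
  have bij: "bij T" using T orthogonal_transformation_bij by blast
  have invT: "orthogonal_transformation (inv T)" using T orthogonal_transformation_inv by blast
  have vi: "T -` box l u = inv T ` box l u" using bij by (simp add: bij_vimage_eq_inv_image)
  have b: "T -` box l u \<in> sets borel" using measurable_sets[OF m, of "box l u"] by simp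
  have lm: "box l u \<in> lmeasurable" by simp
  have "emeasure lborel (T -` box l u) = emeasure lebesgue (inv T ` box l u)" using b unfolding vi by simp
  also have "\<dots> = ennreal (measure lebesgue (inv T ` box l u))"
    using measurable_orthogonal_image[OF invT lm] by (intro emeasure_eq_measure2) auto
  also have "\<dots> = ennreal (measure lebesgue (box l u))" using measure_orthogonal_image[OF invT lm] by simp
  also have "\<dots> = ennreal (\<Prod>b\<in>Basis. (u - l) \<bullet> b)" using lu by simp
  finally show "emeasure (distr lborel borel T) (box l u) = ennreal (\<Prod>b\<in>Basis. (u - l) \<bullet> b)"
    using m by (subst emeasure_distr) auto
qed simp

text \<open>An orthogonal map commutes with the radial projection, so the cone over a preimage is
  the preimage of the cone, and invariance descends from Lebesgue measure.\<close>

lemma sphere_measure_orthogonal_invariant: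
  fixes T :: "vec3 \<Rightarrow> vec3" and f :: "vec3 \<Rightarrow> real"
  assumes T: "orthogonal_transformation T" and f: "f \<in> borel_measurable borel"
  shows "(\<integral>x. f (T x) \<partial>sphere_measure) = (\<integral>x. f x \<partial>sphere_measure)"
proof -
  have m[measurable]: "T \<in> borel_measurable borel"
    using orthogonal_transformation_linear[OF T] by (intro borel_measurable_continuous_onI linear_continuous_on) (simp add: linear_conv_bounded_linear)
  have [simp]: "norm (T x) = norm x" for x using T by (simp add: orthogonal_transformation_norm)
  have lin: "T (c *\<^sub>R x) = c *\<^sub>R T x" for c x using orthogonal_transformation_linear[OF T] by (simp add: linear_scale)
  have T0: "T x = 0 \<longleftrightarrow> x = 0" for x using \<open>\<And>x. norm (T x) = norm x\<close>[of x] by (metis norm_eq_zero)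
  have "distr sphere_borel borel T = sphere_borel"
  proof (rule measure_eqI)
    fix A assume "A \<in> sets (distr sphere_borel borel T)"
    then have A[measurable]: "A \<in> sets borel" by simp
    have TA: "T -` A \<in> sets borel" using measurable_sets[OF m A] by simp
    have "emeasure (distr sphere_borel borel T) A = 3 * emeasure lborel {x \<in> ball 0 1 - {0}. x /\<^sub>R norm x \<in> T -` A}"
      using A TA by (subst emeasure_distr) (auto simp: emeasure_sphere_borel measurable_cong_sets[OF sets_sphere_borel refl])
    also have "{x \<in> ball 0 1 - {0}. x /\<^sub>R norm x \<in> T -` A} = T -` {x \<in> ball 0 1 - {0}. x /\<^sub>R norm x \<in> A}"
      by (auto simp: lin T0)
    also have "emeasure lborel \<dots> = emeasure (distr lborel borel T) {x \<in> ball 0 1 - {0}. x /\<^sub>R norm x \<in> A}"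
      by (subst emeasure_distr) auto
    also have "3 * \<dots> = emeasure sphere_borel A" using distr_lborel_orthogonal[OF T] emeasure_sphere_borel[OF A] by simp
    finally show "emeasure (distr sphere_borel borel T) A = emeasure sphere_borel A" .
  qed simp
  then have "(\<integral>x. f x \<partial>sphere_borel) = (\<integral>x. f x \<partial>distr sphere_borel borel T)" by simp
  also have "\<dots> = (\<integral>x. f (T x) \<partial>sphere_borel)" using f by (intro integral_distr) (auto simp: measurable_cong_sets[OF sets_sphere_borel refl])
  finally show ?thesis using f by (simp add: integral_sphere_borel)
qed

section \<open>The Poisson kernel and its derivatives\<close>

text \<open>Kernels polynomial in the coordinates of both arguments and in \<open>1 / norm (y - e)\<close>: a class
  closed under differentiation in \<open>y\<close> that contains all derivatives of the Poisson kernel.\<close>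
inductive rk :: "(vec3 \<Rightarrow> vec3 \<Rightarrow> real) \<Rightarrow> bool" where
  rk_const: "rk (\<lambda>y e. c)"
| rk_fst: "rk (\<lambda>y e. y $ i)"
| rk_snd: "rk (\<lambda>y e. e $ i)"
| rk_inv: "rk (\<lambda>y e. 1 / norm (y - e))"
| rk_add: "rk k \<Longrightarrow> rk l \<Longrightarrow> rk (\<lambda>y e. k y e + l y e)"
| rk_mult: "rk k \<Longrightarrow> rk l \<Longrightarrow> rk (\<lambda>y e. k y e * l y e)"

lemma rk_cmult: "rk k \<Longrightarrow> rk (\<lambda>y e. c * k y e)"
  by (intro rk_mult rk_const)

lemma rk_diff: "rk k \<Longrightarrow> rk l \<Longrightarrow> rk (\<lambda>y e. k y e - l y e)"
  using rk_add[of k "\<lambda>y e. -1 * l y e"] rk_cmult[of l "-1"] by simp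

lemma rk_sum: "finite A \<Longrightarrow> (\<And>a. a \<in> A \<Longrightarrow> rk (k a)) \<Longrightarrow> rk (\<lambda>y e. \<Sum>a\<in>A. k a y e)"
  by (induction A rule: finite_induct) (auto intro: rk_add rk_const)

lemma rk_power: "rk k \<Longrightarrow> rk (\<lambda>y e. k y e ^ n)"
  by (induction n) (auto intro: rk_mult rk_const)

lemma pd_inverse_distance:
  fixes y e :: vec3
  assumes "y \<noteq> e"
  shows "(\<lambda>y. 1 / norm (y - e)) differentiable (at y)"
    and "pd i (\<lambda>y. 1 / norm (y - e)) y = - (y $ i - e $ i) * (1 / norm (y - e)) ^ 3"
proof -
  have ne: "y - e \<noteq> 0" using assms by simp
  have "((\<lambda>y. y - e) has_derivative (\<lambda>h. h)) (at y)" by (auto intro!: derivative_eq_intros)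
  from has_derivative_compose[OF this GDERIV_norm[OF ne, unfolded gderiv_def]]
  have D: "((\<lambda>y. norm (y - e)) has_derivative (\<lambda>h. sgn (y - e) \<bullet> h)) (at y)" by (simp add: inner_commute)
  have d: "(\<lambda>y. norm (y - e)) differentiable (at y)" using D by (auto simp: differentiable_def)
  have m: "((\<lambda>t::real. 1 / t) has_real_derivative - (1 / (norm (y - e))\<^sup>2)) (at (norm (y - e)))"
    using ne by (auto intro!: derivative_eq_intros simp: power2_eq_square)
  show "(\<lambda>y. 1 / norm (y - e)) differentiable (at y)" by (rule pd_comp(2)[OF m d])
  have "pd i (\<lambda>y. 1 / norm (y - e)) y = - (1 / (norm (y - e))\<^sup>2) * sgn (y - e) $ i"
    unfolding pd_comp(1)[OF m d] pd_eqI[OF D] ..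
  also have "\<dots> = - (y $ i - e $ i) * (1 / norm (y - e)) ^ 3"
    by (simp add: sgn_div_norm power2_eq_square power3_eq_cube divide_simps)
  finally show "pd i (\<lambda>y. 1 / norm (y - e)) y = - (y $ i - e $ i) * (1 / norm (y - e)) ^ 3" .
qed

lemma rk_deriv:
  assumes "rk k"
  shows "\<exists>k'. (\<forall>i. rk (k' i)) \<and> (\<forall>y e. y \<noteq> e \<longrightarrow> (\<lambda>y. k y e) differentiable (at y) \<and> (\<forall>i. pd i (\<lambda>y. k y e) y = k' i y e))"
  using assms
proof induction
  case (rk_const c)
  show ?case by (rule exI[of _ "\<lambda>i y e. 0"]) (auto intro: rk.rk_const)
next
  case (rk_fst j)
  show ?case by (rule exI[of _ "\<lambda>i y e. if i = j then 1 else 0"])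
    (auto intro: rk.rk_const bounded_linear_imp_differentiable bounded_linear_vec_nth simp: pd_coord)
next
  case (rk_snd j)
  show ?case by (rule exI[of _ "\<lambda>i y e. 0"]) (auto intro: rk.rk_const)
next
  case rk_inv
  show ?case
  proof (rule exI[of _ "\<lambda>i y e. - 1 * (y $ i - e $ i) * (1 / norm (y - e)) ^ 3"], intro conjI allI impI)
    show "rk (\<lambda>y e. - 1 * (y $ i - e $ i) * (1 / norm (y - e)) ^ 3)" for i
      by (intro rk_mult rk_power rk.rk_const rk_diff rk_fst rk_snd rk.rk_inv)
  qed (use pd_inverse_distance in auto)
next
  case (rk_add k l)
  then obtain k' l' where
    "\<forall>i. rk (k' i)" "\<forall>y e. y \<noteq> e \<longrightarrow> (\<lambda>y. k y e) differentiable (at y) \<and> (\<forall>i. pd i (\<lambda>y. k y e) y = k' i y e)"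
    "\<forall>i. rk (l' i)" "\<forall>y e. y \<noteq> e \<longrightarrow> (\<lambda>y. l y e) differentiable (at y) \<and> (\<forall>i. pd i (\<lambda>y. l y e) y = l' i y e)"
    by blast
  then show ?case
    by (intro exI[of _ "\<lambda>i y e. k' i y e + l' i y e"]) (auto intro: rk.rk_add simp: pd_add)
next
  case (rk_mult k l)
  then obtain k' l' where
    "\<forall>i. rk (k' i)" "\<forall>y e. y \<noteq> e \<longrightarrow> (\<lambda>y. k y e) differentiable (at y) \<and> (\<forall>i. pd i (\<lambda>y. k y e) y = k' i y e)"
    "\<forall>i. rk (l' i)" "\<forall>y e. y \<noteq> e \<longrightarrow> (\<lambda>y. l y e) differentiable (at y) \<and> (\<forall>i. pd i (\<lambda>y. l y e) y = l' i y e)"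
    by blast
  note kl = this
  show ?case
  proof (rule exI[of _ "\<lambda>i y e. k' i y e * l y e + k y e * l' i y e"], intro conjI allI impI)
    show "rk (\<lambda>y e. k' i y e * l y e + k y e * l' i y e)" for i
      by (rule rk.rk_add; rule rk.rk_mult) (use kl rk_mult.hyps in auto)
  qed (use kl in \<open>auto simp: pd_mult\<close>)
qed

lemma rk_measurable_pair: "rk k \<Longrightarrow> (\<lambda>p. k (fst p) (snd p)) \<in> borel_measurable (borel \<Otimes>\<^sub>M borel)"
proof (induction rule: rk.induct)
  case (rk_fst i)
  have "(\<lambda>x::vec3. x $ i) \<in> borel_measurable borel"
    by (intro borel_measurable_continuous_onI continuous_intros)
  from measurable_compose[OF measurable_fst this] show ?case .
next
  case (rk_snd i)
  have "(\<lambda>x::vec3. x $ i) \<in> borel_measurable borel"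
    by (intro borel_measurable_continuous_onI continuous_intros)
  from measurable_compose[OF measurable_snd this] show ?case .
next
  case rk_inv
  have "(\<lambda>p::vec3 \<times> vec3. norm (fst p - snd p)) \<in> borel_measurable (borel \<Otimes>\<^sub>M borel)" by measurable
  then show ?case by (intro borel_measurable_divide borel_measurable_const)
qed (simp_all add: borel_measurable_add borel_measurable_times)

lemma rk_continuous: "rk k \<Longrightarrow> continuous_on {p. fst p \<noteq> snd p} (\<lambda>p. k (fst p) (snd p))"
  by (induction rule: rk.induct) (auto intro!: continuous_intros)

lemma rk_bounded:
  assumes k: "rk k" and r: "r < 1"
  shows "\<exists>B\<ge>0. \<forall>y e. norm y \<le> r \<longrightarrow> norm e = 1 \<longrightarrow> \<bar>k y e\<bar> \<le> B"
proof -
  let ?K = "cball (0::vec3) r \<times> sphere (0::vec3) 1"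
  have "bounded ((\<lambda>p. k (fst p) (snd p)) ` ?K)"
    by (intro compact_imp_bounded compact_continuous_image continuous_on_subset[OF rk_continuous[OF k]] compact_Times)
      (use r in auto)
  then obtain B where "B > 0" "\<And>p. p \<in> ?K \<Longrightarrow> norm (k (fst p) (snd p)) \<le> B" unfolding bounded_pos by blast
  then show ?thesis by (intro exI[of _ B]) force
qed

lemma rk_measurable_snd: "rk k \<Longrightarrow> (\<lambda>e. k y e) \<in> borel_measurable borel"
  using measurable_compose[OF measurable_Pair1'[of y borel borel] rk_measurable_pair] by simp

text \<open>\<open>4 * pi\<close> times the Poisson kernel; \<open>Q1 j\<close> and \<open>Q2 i j\<close> are its first and second derivatives in \<open>y\<close>.\<close>
definition Q0 :: "vec3 \<Rightarrow> vec3 \<Rightarrow> real" where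
  "Q0 y e = (1 - (norm y)\<^sup>2) * (1 / norm (y - e)) ^ 3"

definition Q1 :: "3 \<Rightarrow> vec3 \<Rightarrow> vec3 \<Rightarrow> real" where
  "Q1 j y e = - 2 * y $ j * (1 / norm (y - e)) ^ 3 - 3 * (1 - (norm y)\<^sup>2) * (y $ j - e $ j) * (1 / norm (y - e)) ^ 5"

definition Q2 :: "3 \<Rightarrow> 3 \<Rightarrow> vec3 \<Rightarrow> vec3 \<Rightarrow> real" where
  "Q2 i j y e = - 2 * (if i = j then 1 else 0) * (1 / norm (y - e)) ^ 3
     + 6 * y $ j * (y $ i - e $ i) * (1 / norm (y - e)) ^ 5
     + 6 * y $ i * (y $ j - e $ j) * (1 / norm (y - e)) ^ 5
     - 3 * (1 - (norm y)\<^sup>2) * (if i = j then 1 else 0) * (1 / norm (y - e)) ^ 5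
     + 15 * (1 - (norm y)\<^sup>2) * (y $ j - e $ j) * (y $ i - e $ i) * (1 / norm (y - e)) ^ 7"

lemma rk_norm_power2: "rk (\<lambda>y e. (norm y)\<^sup>2)"
  unfolding norm_power2_sum by (intro rk_sum rk_mult rk_fst) auto

lemma rk_Q0: "rk Q0" and rk_Q1: "rk (Q1 j)" and rk_Q2: "rk (Q2 i j)"
  unfolding Q0_def[abs_def] Q1_def[abs_def] Q2_def[abs_def]
  by (intro rk_norm_power2 rk_mult rk_power rk_const rk_diff rk_add rk_fst rk_snd rk_inv)+

lemma pd_inverse_distance_power:
  fixes y e :: vec3
  assumes "y \<noteq> e"
  shows "(\<lambda>y. (1 / norm (y - e)) ^ n) differentiable (at y)"
    and "pd i (\<lambda>y. (1 / norm (y - e)) ^ n) y = - real n * (y $ i - e $ i) * (1 / norm (y - e)) ^ (n + 2)"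
proof -
  have m: "((\<lambda>t::real. t ^ n) has_real_derivative real n * t ^ (n - 1)) (at t)" for t
    using DERIV_pow[of n t] by simp
  note c = pd_comp[where m = "\<lambda>t. t ^ n", OF m pd_inverse_distance(1)[OF assms]]
  show "(\<lambda>y. (1 / norm (y - e)) ^ n) differentiable (at y)" using c(2) .
  show "pd i (\<lambda>y. (1 / norm (y - e)) ^ n) y = - real n * (y $ i - e $ i) * (1 / norm (y - e)) ^ (n + 2)"
  proof -
    have "real n * N ^ (n - 1) * (- d * N ^ 3) = - real n * d * N ^ (n + 2)" for N d :: real
      by (cases n) (simp_all add: power3_eq_cube algebra_simps)
    then show ?thesis unfolding c(1) pd_inverse_distance(2)[OF assms] .
  qed
qed

lemma pd_one_minus_norm2:
  "(\<lambda>x::vec3. 1 - (norm x)\<^sup>2) differentiable (at x)" "pd i (\<lambda>x. 1 - (norm x)\<^sup>2) x = - 2 * x $ i"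
proof -
  have d: "(\<lambda>x::vec3. (norm x)\<^sup>2) differentiable (at x)"
    unfolding norm_power2_sum by (intro differentiable_sum ballI differentiable_mult coord_differentiable) auto
  then show "(\<lambda>x::vec3. 1 - (norm x)\<^sup>2) differentiable (at x)" by (intro differentiable_diff) auto
  show "pd i (\<lambda>x. 1 - (norm x)\<^sup>2) x = - 2 * x $ i" using d by (simp add: pd_diff pd_norm2)
qed

lemma pd_Q0:
  assumes "y \<noteq> e"
  shows "(\<lambda>y. Q0 y e) differentiable (at y)" "pd j (\<lambda>y. Q0 y e) y = Q1 j y e"
proof -
  show "(\<lambda>y. Q0 y e) differentiable (at y)" unfolding Q0_def
    by (intro differentiable_mult pd_one_minus_norm2 pd_inverse_distance_power[OF assms])
  have "pd j (\<lambda>y. Q0 y e) y = - 2 * y $ j * (1 / norm (y - e)) ^ 3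
      + (1 - (norm y)\<^sup>2) * (- real 3 * (y $ j - e $ j) * (1 / norm (y - e)) ^ (3 + 2))"
    unfolding Q0_def pd_mult[OF pd_one_minus_norm2(1) pd_inverse_distance_power(1)[OF assms]]
      pd_one_minus_norm2(2) pd_inverse_distance_power(2)[OF assms] ..
  then show "pd j (\<lambda>y. Q0 y e) y = Q1 j y e" by (simp add: Q1_def algebra_simps)
qed

lemma pd_Q1:
  assumes "y \<noteq> e"
  shows "(\<lambda>y. Q1 j y e) differentiable (at y)" "pd i (\<lambda>y. Q1 j y e) y = Q2 i j y e"
proof -
  note [simp] = pd_one_minus_norm2 pd_inverse_distance_power[OF assms]
  have [simp]: "(\<lambda>y. y $ j - e $ j) differentiable (at y)" "pd i (\<lambda>y. y $ j - e $ j) y = (if i = j then 1 else 0)"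
    by (auto simp: pd_diff pd_coord intro!: differentiable_diff)
  define A where "A y = - 2 * (y $ j * (1 / norm (y - e)) ^ 3)" for y
  define B where "B y = (-3) * ((1 - (norm y)\<^sup>2) * ((y $ j - e $ j) * (1 / norm (y - e)) ^ 5))" for y
  have Q: "(\<lambda>y. Q1 j y e) = (\<lambda>y. A y + B y)" by (auto simp: Q1_def A_def B_def)
  have dA: "A differentiable (at y)" unfolding A_def by (intro differentiable_mult) auto
  have dB: "B differentiable (at y)" unfolding B_def by (intro differentiable_mult) auto
  have m: "(\<lambda>y. y $ j * (1 / norm (y - e)) ^ 3) differentiable (at y)"
    "(\<lambda>y. (y $ j - e $ j) * (1 / norm (y - e)) ^ 5) differentiable (at y)"
    "(\<lambda>y. (1 - (norm y)\<^sup>2) * ((y $ j - e $ j) * (1 / norm (y - e)) ^ 5)) differentiable (at y)"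
    by (intro differentiable_mult; simp)+
  show "(\<lambda>y. Q1 j y e) differentiable (at y)" unfolding Q using dA dB by (rule differentiable_add)
  have a: "pd i A y = - 2 * ((if i = j then 1 else 0) * (1 / norm (y - e)) ^ 3 + y $ j * (- 3 * (y $ i - e $ i) * (1 / norm (y - e)) ^ 5))"
    unfolding A_def pd_cmult[OF m(1)] by (subst pd_mult) (simp_all del: One_nat_def add: pd_coord)
  have b: "pd i B y = -3 * (- 2 * y $ i * ((y $ j - e $ j) * (1 / norm (y - e)) ^ 5)
      + (1 - (norm y)\<^sup>2) * ((if i = j then 1 else 0) * (1 / norm (y - e)) ^ 5 + (y $ j - e $ j) * (- 5 * (y $ i - e $ i) * (1 / norm (y - e)) ^ 7)))"
    unfolding B_def pd_cmult[OF m(3)] 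
    by (subst pd_mult, simp, rule m(2), subst pd_mult) simp_all
  show "pd i (\<lambda>y. Q1 j y e) y = Q2 i j y e"
    unfolding Q pd_add[OF dA dB] a b Q2_def by (simp add: algebra_simps)
qed

lemma Q0_harmonic:
  assumes "norm e = 1" "y \<noteq> e"
  shows "(\<Sum>i\<in>UNIV. Q2 i i y e) = 0"
proof -
  define N where "N = 1 / norm (y - e)"
  have N: "N\<^sup>2 * (norm (y - e))\<^sup>2 = 1" using assms by (simp add: N_def power_mult_distrib[symmetric])
  define a where "a = (norm y)\<^sup>2"
  define b where "b = y \<bullet> e"
  have e: "e \<bullet> e = 1" using assms by (simp add: norm_eq_1)
  have n: "(norm (y - e))\<^sup>2 = a - 2 * b + 1"
    unfolding power2_norm_eq_inner a_def b_def by (simp add: inner_diff inner_commute e)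
  have s1: "(\<Sum>i\<in>UNIV. y $ i * (y $ i - e $ i)) = a - b"
    unfolding a_def b_def power2_norm_eq_inner by (simp add: inner_vec_def right_diff_distrib sum_subtractf)
  have s2: "(\<Sum>i\<in>UNIV. (y $ i - e $ i) * (y $ i - e $ i)) = a - 2 * b + 1"
    unfolding n[symmetric] norm_power2_sum by simp
  have Q: "Q2 i i y e = - 2 * N ^ 3 + 12 * N ^ 5 * (y $ i * (y $ i - e $ i)) - 3 * (1 - a) * N ^ 5
      + 15 * (1 - a) * N ^ 7 * ((y $ i - e $ i) * (y $ i - e $ i))" for i
    unfolding Q2_def N_def[symmetric] a_def[symmetric] by (simp add: algebra_simps)
  have "(\<Sum>i\<in>UNIV. Q2 i i y e) = - 6 * N ^ 3 + 12 * N ^ 5 * (a - b) - 9 * (1 - a) * N ^ 5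
      + 15 * (1 - a) * N ^ 7 * (a - 2 * b + 1)"
    unfolding Q sum.distrib sum_subtractf sum_distrib_left[symmetric] s1 s2 by simp
  also have "\<dots> = - 6 * N ^ 3 + 12 * N ^ 5 * (a - b) - 9 * (1 - a) * N ^ 5
      + 15 * (1 - a) * (N ^ 7 * (a - 2 * b + 1))" by simp
  also have "N ^ 7 * (a - 2 * b + 1) = N ^ 5 * (N\<^sup>2 * (a - 2 * b + 1))"
    by (simp add: eval_nat_numeral)
  also have "N\<^sup>2 * (a - 2 * b + 1) = 1" using N unfolding n .
  \<comment> \<open>Multiplying by \<open>N^2 * |y - e|^2 = 1\<close> brings the last term to the
    power \<open>N^5\<close> of the others; after that the coefficients cancel as polynomials in
    \<open>a\<close> and \<open>b\<close>.\<close>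
  also have "N ^ 3 = N ^ 3 * (N\<^sup>2 * (a - 2 * b + 1))" using N unfolding n by simp
  also have "\<dots> = N ^ 5 * (a - 2 * b + 1)" by (simp add: eval_nat_numeral)
  finally show ?thesis by (simp add: algebra_simps)
qed

text \<open>Each factor \<open>1 - |y|^2\<close> is at most \<open>2 * r\<close> and each component
  of \<open>y - e\<close> at most \<open>r\<close>, where \<open>r = |y - e|\<close>; these
  compensate the excess powers of \<open>1 / r\<close>. The cubic term is raised to the fourth power
  by \<open>r <= 2\<close>. The five terms contribute
  \<open>4 + 6 + 6 + 6 + 30 = 52\<close>.\<close>

lemma Q2_bound:
  assumes y: "norm y < 1" and e: "norm e = 1"
  shows "\<bar>Q2 i j y e\<bar> \<le> 52 / norm (y - e) ^ 4"
proof -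
  define r where "r = norm (y - e)"
  define N where "N = 1 / r"
  have r0: "r > 0" using assms by (auto simp: r_def)
  have rN: "r * N = 1" using r0 by (simp add: N_def)
  have r2: "r \<le> 2" using norm_triangle_ineq4[of y e] assms by (simp add: r_def)
  have N0: "N > 0" using r0 by (simp add: N_def)
  have N2: "1 \<le> 2 * N" using r0 r2 by (simp add: N_def field_simps)
  have s: "0 \<le> 1 - (norm y)\<^sup>2" "1 - (norm y)\<^sup>2 \<le> 2 * r"
  proof -
    show "0 \<le> 1 - (norm y)\<^sup>2" using y by (simp add: power_le_one)
    have "1 - norm y \<le> r" using norm_triangle_ineq2[of e y] e by (simp add: r_def norm_minus_commute)
    moreover have "1 - (norm y)\<^sup>2 = (1 - norm y) * (1 + norm y)" by (simp add: power2_eq_square algebra_simps)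
    ultimately show "1 - (norm y)\<^sup>2 \<le> 2 * r"
      using mult_mono[of "1 - norm y" r "1 + norm y" 2] y r0 by simp
  qed
  have c: "\<bar>y $ k\<bar> \<le> 1" "\<bar>y $ k - e $ k\<bar> \<le> r" for k
    using component_le_norm_cart[of y k] y component_le_norm_cart[of "y - e" k] by (auto simp: r_def)
  define d where "d = (if i = j then 1 else 0 :: real)"
  have d: "0 \<le> d" "d \<le> 1" by (auto simp: d_def)
  have N34: "N ^ 3 \<le> 2 * N ^ 4" using mult_right_mono[OF N2, of "N ^ 3"] N0 by (simp add: eval_nat_numeral)
  have N5: "r * N ^ 5 = N ^ 4" using rN by (simp add: eval_nat_numeral)
  have N7: "r * r * r * N ^ 7 = N ^ 4"
  proof -
    have "r * r * r * N ^ 7 = (r * N) ^ 3 * N ^ 4" by (simp add: eval_nat_numeral)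
    then show ?thesis using rN by simp
  qed
  have t1: "\<bar>- 2 * d * N ^ 3\<bar> \<le> 4 * N ^ 4"
  proof -
    have "\<bar>- 2 * d * N ^ 3\<bar> = 2 * (d * N ^ 3)" using d N0 by (simp add: abs_mult)
    also have "\<dots> \<le> 2 * (1 * N ^ 3)" using d N0 by (intro mult_left_mono mult_right_mono) auto
    finally show ?thesis using N34 by simp
  qed
  have t2: "\<bar>6 * y $ k * (y $ l - e $ l) * N ^ 5\<bar> \<le> 6 * N ^ 4" for k l
  proof -
    have "\<bar>6 * y $ k * (y $ l - e $ l) * N ^ 5\<bar> = 6 * (\<bar>y $ k\<bar> * \<bar>y $ l - e $ l\<bar> * N ^ 5)" using N0 by (simp add: abs_mult)
    also have "\<dots> \<le> 6 * (1 * r * N ^ 5)" using c r0 N0 by (intro mult_left_mono mult_right_mono mult_mono) auto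
    finally show ?thesis using N5 by simp
  qed
  have t4: "\<bar>3 * (1 - (norm y)\<^sup>2) * d * N ^ 5\<bar> \<le> 6 * N ^ 4"
  proof -
    have "\<bar>3 * (1 - (norm y)\<^sup>2) * d * N ^ 5\<bar> = 3 * ((1 - (norm y)\<^sup>2) * d * N ^ 5)" using N0 s d by (simp add: abs_mult)
    also have "\<dots> \<le> 3 * ((2 * r) * 1 * N ^ 5)" using s d r0 N0 by (intro mult_left_mono mult_right_mono mult_mono) auto
    finally show ?thesis using N5 by simp
  qed
  have t5: "\<bar>15 * (1 - (norm y)\<^sup>2) * (y $ j - e $ j) * (y $ i - e $ i) * N ^ 7\<bar> \<le> 30 * N ^ 4"
  proof -
    have "\<bar>15 * (1 - (norm y)\<^sup>2) * (y $ j - e $ j) * (y $ i - e $ i) * N ^ 7\<bar> = 15 * ((1 - (norm y)\<^sup>2) * \<bar>y $ j - e $ j\<bar> * \<bar>y $ i - e $ i\<bar> * N ^ 7)"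
      using N0 s by (simp add: abs_mult)
    also have "\<dots> \<le> 15 * ((2 * r) * r * r * N ^ 7)" using s c r0 N0 by (intro mult_left_mono mult_right_mono mult_mono) auto
    also have "\<dots> = 30 * (r * r * r * N ^ 7)" by simp
    finally show ?thesis using N7 by simp
  qed
  have "\<bar>Q2 i j y e\<bar> \<le> 52 * N ^ 4"
    unfolding Q2_def r_def[symmetric] N_def[symmetric] d_def[symmetric]
    using t1 t2[of j i] t2[of i j] t4 t5 by (smt (verit))
  then show ?thesis by (simp add: N_def r_def power_divide)
qed

section \<open>Integrals of kernels and radial averages\<close>

text \<open>A fixed selection of the derivative kernels from \<open>rk_deriv\<close>. They lie in
  the class again, so differentiation under the integral can be iterated to any order.\<close>

definition rk_grad :: "(vec3 \<Rightarrow> vec3 \<Rightarrow> real) \<Rightarrow> 3 \<Rightarrow> vec3 \<Rightarrow> vec3 \<Rightarrow> real" where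
  "rk_grad k = (SOME k'. (\<forall>i. rk (k' i)) \<and> (\<forall>y e. y \<noteq> e \<longrightarrow> (\<lambda>y. k y e) differentiable (at y) \<and> (\<forall>i. pd i (\<lambda>y. k y e) y = k' i y e)))"

lemma rk_grad:
  assumes "rk k"
  shows "rk (rk_grad k i)"
    and "y \<noteq> e \<Longrightarrow> (\<lambda>y. k y e) differentiable (at y)"
    and "y \<noteq> e \<Longrightarrow> pd i (\<lambda>y. k y e) y = rk_grad k i y e"
proof -
  note * = someI_ex[OF rk_deriv[OF assms], folded rk_grad_def]
  show "rk (rk_grad k i)" using * by blast
  show "y \<noteq> e \<Longrightarrow> (\<lambda>y. k y e) differentiable (at y)" using * by blast
  show "y \<noteq> e \<Longrightarrow> pd i (\<lambda>y. k y e) y = rk_grad k i y e" using * by blast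
qed

lemma rk_Ck:
  assumes "rk k" "norm e = 1"
  shows "Ck n (ball 0 1) (\<lambda>y. k y e)"
  using assms(1)
proof (induction n arbitrary: k)
  case 0
  have "continuous_on (ball 0 1) (\<lambda>y. (\<lambda>p. k (fst p) (snd p)) (y, e))"
    by (rule continuous_on_compose2[OF rk_continuous[OF 0]]) (use assms(2) in \<open>auto intro!: continuous_intros\<close>)
  then show ?case by simp
next
  case (Suc n)
  have "Ck n (ball 0 1) (pd i (\<lambda>y. k y e))" for i
  proof (subst Ck_cong[OF open_ball])
    show "y \<in> ball 0 1 \<Longrightarrow> pd i (\<lambda>y. k y e) y = rk_grad k i y e" for y
      by (rule rk_grad(3)[OF Suc.prems]) (use assms(2) in auto)
    show "Ck n (ball 0 1) (\<lambda>y. rk_grad k i y e)" by (rule Suc.IH[OF rk_grad(1)[OF Suc.prems]])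
  qed
  moreover have "(\<lambda>y. k y e) differentiable (at y)" if "y \<in> ball 0 1" for y
    by (rule rk_grad(2)[OF Suc.prems]) (use assms(2) that in auto)
  ultimately show ?case by simp
qed

lemma rk_integrable:
  assumes k: "rk k" and f: "integrable sphere_measure f" and x: "norm x < 1"
  shows "integrable sphere_measure (\<lambda>\<eta>. k x \<eta> * f \<eta> :: real)"
proof -
  obtain B where B: "B \<ge> 0" "\<And>y e. norm y \<le> norm x \<Longrightarrow> norm e = 1 \<Longrightarrow> \<bar>k y e\<bar> \<le> B"
    using rk_bounded[OF k x] by blast
  show ?thesis
  proof (rule Bochner_Integration.integrable_bound)
    show "integrable sphere_measure (\<lambda>\<eta>. B * f \<eta>)" using f by simp
    show "(\<lambda>\<eta>. k x \<eta> * f \<eta>) \<in> borel_measurable sphere_measure"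
      by (intro borel_measurable_times borel_measurable_sphere_borelI rk_measurable_snd[OF k] borel_measurable_integrable[OF f])
    show "AE \<eta> in sphere_measure. norm (k x \<eta> * f \<eta>) \<le> norm (B * f \<eta>)"
      using B by (intro AE_I2) (auto simp: abs_mult intro!: mult_right_mono)
  qed
qed

lemma rk_integral_deriv:
  assumes k: "rk k" and f: "integrable sphere_measure f" and x: "norm x < 1"
  shows "(\<lambda>x. \<integral>\<eta>. k x \<eta> * f \<eta> \<partial>sphere_measure) differentiable (at x)"
    and "pd i (\<lambda>x. \<integral>\<eta>. k x \<eta> * f \<eta> \<partial>sphere_measure) x = (\<integral>\<eta>. rk_grad k i x \<eta> * f \<eta> \<partial>sphere_measure)"
proof -
  \<comment> \<open>The midpoint between \<open>norm x\<close> and 1 leaves a ball around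
    \<open>x\<close> on which the differentiated kernel is bounded by compactness, uniformly over
    all poles on the sphere.\<close>
  define r where "r = (1 + norm x) / 2"
  have r: "r < 1" "norm x < r" using x by (auto simp: r_def)
  have "\<forall>i. \<exists>B\<ge>0. \<forall>y e. norm y \<le> r \<longrightarrow> norm e = 1 \<longrightarrow> \<bar>rk_grad k i y e\<bar> \<le> B"
    using rk_bounded[OF rk_grad(1)[OF k] r(1)] by blast
  then obtain B where B: "\<And>i. B i \<ge> 0" "\<And>i y e. norm y \<le> r \<Longrightarrow> norm e = 1 \<Longrightarrow> \<bar>rk_grad k i y e\<bar> \<le> B i"
    by metis
  define F' where "F' y \<eta> = (\<chi> i. rk_grad k i y \<eta> * f \<eta>)" for y \<eta>
  have L: "integrable sphere_measure (F' x) \<and>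
    ((\<lambda>x. \<integral>\<eta>. k x \<eta> * f \<eta> \<partial>sphere_measure) has_derivative (\<lambda>h. (\<integral>\<eta>. F' x \<eta> \<partial>sphere_measure) \<bullet> h)) (at x)"
  proof (rule leibniz_bochner[where S = "ball 0 1" and e = "r - norm x" and g = "\<lambda>\<eta>. (\<Sum>i\<in>UNIV. B i) * \<bar>f \<eta>\<bar>"])
    show "((\<lambda>x. k x w * f w) has_derivative (\<lambda>h. F' y w \<bullet> h)) (at y)"
      if "y \<in> ball 0 1" "w \<in> space sphere_measure" for y w
    proof -
      have ne: "y \<noteq> w" using that by auto
      have d: "(\<lambda>x. k x w) differentiable (at y)" by (rule rk_grad(2)[OF k ne])
      then have "(\<lambda>x. k x w * f w) differentiable (at y)" by (rule differentiable_mult) simp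
      moreover have "pd i (\<lambda>x. k x w * f w) y = rk_grad k i y w * f w" for i
        using pd_mult[OF d, of "\<lambda>_. f w" i] rk_grad(3)[OF k ne, of i] by simp
      ultimately show ?thesis unfolding pd_has_derivative_iff F'_def by simp
    qed
    show "integrable sphere_measure (\<lambda>w. k y w * f w)" if "y \<in> ball 0 1" for y
      using rk_integrable[OF k f] that by simp
    show "F' y \<in> borel_measurable sphere_measure" for y
    proof -
      have "(\<lambda>w. F' y w $ i) \<in> borel_measurable sphere_measure" for i
        unfolding F'_def using borel_measurable_sphere_borelI[OF rk_measurable_snd[OF rk_grad(1)[OF k]]] borel_measurable_integrable[OF f]
        by (simp add: borel_measurable_times)
      then show ?thesis
        by (subst borel_measurable_euclidean_space) (auto simp: Basis_vec_def inner_axis)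
    qed
    show "integrable sphere_measure (\<lambda>\<eta>. (\<Sum>i\<in>UNIV. B i) * \<bar>f \<eta>\<bar>)" using f by simp
    show "norm (F' y w) \<le> (\<Sum>i\<in>UNIV. B i) * \<bar>f w\<bar>" if "y \<in> ball x (r - norm x)" "w \<in> space sphere_measure" for y w
    proof -
      have "norm y \<le> r" using that norm_triangle_sub[of y x] by (simp add: dist_norm norm_minus_commute)
      have "norm (F' y w) \<le> (\<Sum>i\<in>UNIV. \<bar>rk_grad k i y w * f w\<bar>)"
        using norm_le_l1_cart[of "F' y w"] by (simp add: F'_def)
      also have "\<dots> \<le> (\<Sum>i\<in>UNIV. B i * \<bar>f w\<bar>)"
        using B(2)[OF \<open>norm y \<le> r\<close>] that by (intro sum_mono) (auto simp: abs_mult intro!: mult_right_mono)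
      finally show ?thesis by (simp add: sum_distrib_right)
    qed
    show "ball x (r - norm x) \<subseteq> ball 0 1"
    proof
      fix y assume "y \<in> ball x (r - norm x)"
      then show "y \<in> ball 0 1" using r norm_triangle_sub[of y x] by (simp add: dist_norm norm_minus_commute)
    qed
  qed (use r x in auto)
  show "(\<lambda>x. \<integral>\<eta>. k x \<eta> * f \<eta> \<partial>sphere_measure) differentiable (at x)"
    using L by (auto simp: differentiable_def)
  have "(\<integral>\<eta>. F' x \<eta> \<partial>sphere_measure) $ i = (\<integral>\<eta>. F' x \<eta> $ i \<partial>sphere_measure)"
    using integral_bounded_linear[OF bounded_linear_vec_nth[of i], of sphere_measure "F' x"] L by simp
  then show "pd i (\<lambda>x. \<integral>\<eta>. k x \<eta> * f \<eta> \<partial>sphere_measure) x = (\<integral>\<eta>. rk_grad k i x \<eta> * f \<eta> \<partial>sphere_measure)"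
    using pd_eqI[OF conjunct2[OF L]] by (simp add: F'_def)
qed

lemma rk_integral_Ck:
  assumes k: "rk k" and f: "integrable sphere_measure f"
  shows "Ck n (ball 0 1) (\<lambda>x. \<integral>\<eta>. k x \<eta> * f \<eta> \<partial>sphere_measure)"
  using k
proof (induction n arbitrary: k)
  case 0
  show ?case using rk_integral_deriv(1)[OF 0 f]
    by (auto intro!: continuous_at_imp_continuous_on differentiable_imp_continuous_within)
next
  case (Suc n)
  have "Ck n (ball 0 1) (pd i (\<lambda>x. \<integral>\<eta>. k x \<eta> * f \<eta> \<partial>sphere_measure))" for i
    by (subst Ck_cong[OF open_ball, of _ _ _ "\<lambda>x. \<integral>\<eta>. rk_grad k i x \<eta> * f \<eta> \<partial>sphere_measure"])
      (use rk_integral_deriv(2)[OF Suc.prems f] Suc.IH[OF rk_grad(1)[OF Suc.prems]] in auto)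
  then show ?case using rk_integral_deriv(1)[OF Suc.prems f] by auto
qed

text \<open>The integral of \<open>t^a g(t x)\<close> over \<open>t\<close> from 0 to 1. A
  homogeneous function of degree \<open>m\<close> is multiplied by \<open>1 / (a + m + 1)\<close>,
  and every derivative in \<open>x\<close> releases one factor \<open>t\<close>, that is, raises the
  exponent by 1.\<close>

definition radial_avg :: "real \<Rightarrow> (vec3 \<Rightarrow> real) \<Rightarrow> vec3 \<Rightarrow> real" where
  "radial_avg a g x = (\<integral>t. indicator {0<..<1} t * (t powr a * g (t *\<^sub>R x)) \<partial>lborel)"

lemma integrable_powr_01:
  assumes "a > -1"
  shows "integrable lborel (\<lambda>t::real. indicator {0<..<1} t * t powr a)"
proof -
  have "((\<lambda>t. t powr a) has_integral (1 powr (a + 1) / (a + 1))) {0..1::real}"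
    using has_integral_powr_from_0[of a 1] assms by simp
  then have "((\<lambda>t. if t \<in> {0..1} then t powr a else 0) has_integral (1 powr (a + 1) / (a + 1))) (UNIV::real set)"
    by (simp only: has_integral_restrict_UNIV)
  then have "(\<integral>\<^sup>+t. ennreal (if t \<in> {0..1::real} then t powr a else 0) \<partial>lborel) = ennreal (1 powr (a + 1) / (a + 1))"
    by (intro nn_integral_has_integral_lborel) auto
  then have "integrable lborel (\<lambda>t::real. if t \<in> {0..1::real} then t powr a else 0)"
    by (intro integrableI_nonneg) auto
  then show ?thesis by (rule Bochner_Integration.integrable_bound) (auto simp: indicator_def)
qed

lemma scale_in_ball: "norm x < 1 \<Longrightarrow> 0 < t \<Longrightarrow> t < 1 \<Longrightarrow> norm (t *\<^sub>R (x::vec3)) < 1"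
  using mult_left_le_one_le[of "norm x" t] by simp

lemma measurable_radial:
  fixes g :: "vec3 \<Rightarrow> real"
  assumes "continuous_on (ball 0 1) g" "norm x < 1"
  shows "(\<lambda>t. indicator {0<..<1} t * (t powr a * g (t *\<^sub>R x))) \<in> borel_measurable borel"
proof -
  have "continuous_on {0<..<1} (\<lambda>t. t powr a * g (t *\<^sub>R x))"
    by (intro continuous_intros continuous_on_compose2[OF assms(1)])
      (use scale_in_ball[OF assms(2)] in auto)
  from borel_measurable_continuous_on_indicator[OF _ this] show ?thesis by simp
qed

lemma bounded_on_cball:
  fixes g :: "vec3 \<Rightarrow> real"
  assumes "continuous_on (ball 0 1) g" "r < 1"
  shows "\<exists>B\<ge>0. \<forall>y. norm y \<le> r \<longrightarrow> \<bar>g y\<bar> \<le> B"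
proof -
  have "bounded (g ` cball 0 r)"
    by (intro compact_imp_bounded compact_continuous_image continuous_on_subset[OF assms(1)]) (use assms in auto)
  then obtain B where "B > 0" "\<And>y. y \<in> cball 0 r \<Longrightarrow> norm (g y) \<le> B" unfolding bounded_pos by blast
  then show ?thesis by (intro exI[of _ B]) auto
qed

lemma integrable_radial_avg:
  fixes g :: "vec3 \<Rightarrow> real"
  assumes "continuous_on (ball 0 1) g" "norm x < 1" "a > -1"
  shows "integrable lborel (\<lambda>t. indicator {0<..<1} t * (t powr a * g (t *\<^sub>R x)))"
proof -
  obtain B where B: "B \<ge> 0" "\<And>y. norm y \<le> norm x \<Longrightarrow> \<bar>g y\<bar> \<le> B"
    using bounded_on_cball[OF assms(1,2)] by blast
  show ?thesis
  proof (rule Bochner_Integration.integrable_bound)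
    show "integrable lborel (\<lambda>t. (indicator {0<..<1} t * t powr a) * B)"
      using integrable_powr_01[OF assms(3)] by simp
    show "AE t in lborel. norm (indicator {0<..<1} t * (t powr a * g (t *\<^sub>R x))) \<le> norm (indicator {0<..<1} t * t powr a * B)"
    proof (rule AE_I2)
      fix t :: real
      show "norm (indicator {0<..<1} t * (t powr a * g (t *\<^sub>R x))) \<le> norm (indicator {0<..<1} t * t powr a * B)"
      proof (cases "t \<in> {0<..<1}")
        case True
        then have "norm (t *\<^sub>R x) \<le> norm x" by (simp add: mult_left_le_one_le)
        from B(2)[OF this] show ?thesis using True B(1) by (simp add: abs_mult mult_left_mono)
      qed simp
    qed
  qed (use measurable_radial[OF assms(1,2)] in simp)
qed

text \<open>For exponents between -2 and -1 the weight alone is not integrable at 0, so the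
  integrability of the undifferentiated integrand is a separate hypothesis. After one derivative the
  exponent exceeds -1 and bounds on compact sets suffice. The range covers the exponent
  \<open>-1 - alpha\<close> of the potential.\<close>

lemma radial_avg_deriv:
  assumes a: "a > -2" and g: "Ck 1 (ball 0 1) g"
    and int: "\<And>x. norm x < 1 \<Longrightarrow> integrable lborel (\<lambda>t. indicator {0<..<1} t * (t powr a * g (t *\<^sub>R x)))"
    and x: "norm x < 1"
  shows "radial_avg a g differentiable (at x)" "pd i (radial_avg a g) x = radial_avg (a + 1) (pd i g) x"
proof -
  define r where "r = (1 + norm x) / 2"
  have r: "r < 1" "norm x < r" using x by (auto simp: r_def)
  have gc: "continuous_on (ball 0 1) (pd i g)" for i using g by auto
  have "\<forall>i. \<exists>B\<ge>0. \<forall>y. norm y \<le> r \<longrightarrow> \<bar>pd i g y\<bar> \<le> B"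
    using bounded_on_cball[OF gc r(1)] by blast
  then obtain B where B: "\<And>i. B i \<ge> 0" "\<And>i y. norm y \<le> r \<Longrightarrow> \<bar>pd i g y\<bar> \<le> B i"
    by metis
  define F' where "F' y t = (\<chi> i. indicator {0<..<1} t * (t powr (a + 1) * pd i g (t *\<^sub>R y)))" for y :: vec3 and t :: real
  have L: "integrable lborel (F' x) \<and>
    ((\<lambda>x. \<integral>t. indicator {0<..<1} t * (t powr a * g (t *\<^sub>R x)) \<partial>lborel) has_derivative (\<lambda>h. (\<integral>t. F' x t \<partial>lborel) \<bullet> h)) (at x)"
  proof (rule leibniz_bochner[where S = "ball 0 1" and e = "r - norm x" and g = "\<lambda>t. (\<Sum>i\<in>UNIV. B i) * (indicator {0<..<1} t * t powr (a + 1))"])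
    show "((\<lambda>x. indicator {0<..<1} t * (t powr a * g (t *\<^sub>R x))) has_derivative (\<lambda>h. F' y t \<bullet> h)) (at y)"
      if y: "y \<in> ball 0 1" for y t
    proof (cases "t \<in> {0<..<1}")
      case True
      have "g differentiable (at (t *\<^sub>R y))" using g scale_in_ball[of y t] y True by simp
      note s = pd_scale[OF this]
      have "(\<lambda>x. t powr a * g (t *\<^sub>R x)) differentiable (at y)" using s(2) by (intro differentiable_mult) auto
      moreover have "pd i (\<lambda>x. t powr a * g (t *\<^sub>R x)) y = t powr (a + 1) * pd i g (t *\<^sub>R y)" for i
        unfolding pd_cmult[OF s(2)] s(1) using True by (simp add: powr_add)
      ultimately show ?thesis using True unfolding pd_has_derivative_iff F'_def by simp
    qed (simp add: F'_def zero_vec_def[symmetric])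
    show "integrable lborel (\<lambda>t. indicator {0<..<1} t * (t powr a * g (t *\<^sub>R y)))" if "y \<in> ball 0 1" for y
      using int that by simp
    show "F' y \<in> borel_measurable lborel" if "y \<in> ball 0 1" for y
    proof -
      have "(\<lambda>t. F' y t $ i) \<in> borel_measurable lborel" for i
        unfolding F'_def using measurable_radial[OF gc, of y] that by simp
      then show ?thesis
        by (subst borel_measurable_euclidean_space) (auto simp: Basis_vec_def inner_axis)
    qed
    show "integrable lborel (\<lambda>t. (\<Sum>i\<in>UNIV. B i) * (indicator {0<..<1} t * t powr (a + 1)))"
      using integrable_powr_01[of "a + 1"] a by simp
    show "norm (F' y t) \<le> (\<Sum>i\<in>UNIV. B i) * (indicator {0<..<1} t * t powr (a + 1))" if "y \<in> ball x (r - norm x)" for y t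
    proof -
      have "norm y \<le> r" using that norm_triangle_sub[of y x] by (simp add: dist_norm norm_minus_commute)
      have "norm (F' y t) \<le> (\<Sum>i\<in>UNIV. \<bar>indicator {0<..<1} t * (t powr (a + 1) * pd i g (t *\<^sub>R y))\<bar>)"
        using norm_le_l1_cart[of "F' y t"] by (simp add: F'_def)
      also have "\<dots> \<le> (\<Sum>i\<in>UNIV. B i * (indicator {0<..<1} t * t powr (a + 1)))"
      proof (rule sum_mono)
        fix i
        show "\<bar>indicator {0<..<1} t * (t powr (a + 1) * pd i g (t *\<^sub>R y))\<bar> \<le> B i * (indicator {0<..<1} t * t powr (a + 1))"
        proof (cases "t \<in> {0<..<1}")
          case True
          then have "norm (t *\<^sub>R y) \<le> norm y" by (simp add: mult_left_le_one_le)
          then have "\<bar>pd i g (t *\<^sub>R y)\<bar> \<le> B i" using \<open>norm y \<le> r\<close> by (intro B) simp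
          then show ?thesis using True by (simp add: abs_mult mult.commute mult_left_mono)
        qed simp
      qed
      finally show ?thesis by (simp add: sum_distrib_right)
    qed
    show "ball x (r - norm x) \<subseteq> ball 0 1"
    proof
      fix y assume "y \<in> ball x (r - norm x)"
      then show "y \<in> ball 0 1" using r norm_triangle_sub[of y x] by (simp add: dist_norm norm_minus_commute)
    qed
  qed (use r x in auto)
  show "radial_avg a g differentiable (at x)"
    using L by (auto simp: differentiable_def radial_avg_def[abs_def])
  have "(\<integral>t. F' x t \<partial>lborel) $ i = (\<integral>t. F' x t $ i \<partial>lborel)"
    using integral_bounded_linear[OF bounded_linear_vec_nth[of i], of lborel "F' x"] L by simp
  then show "pd i (radial_avg a g) x = radial_avg (a + 1) (pd i g) x"
    using pd_eqI[OF conjunct2[OF L]] by (simp add: F'_def radial_avg_def[abs_def])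
qed

lemma radial_avg_deriv':
  assumes "a > -1" "Ck 1 (ball 0 1) g" "norm x < 1"
  shows "radial_avg a g differentiable (at x)" "pd i (radial_avg a g) x = radial_avg (a + 1) (pd i g) x"
  using radial_avg_deriv[OF _ assms(2) integrable_radial_avg[OF Ck_continuous[OF assms(2)] _ assms(1)] assms(3)] assms(1) by auto

lemma Ck_radial_avg: "a > -1 \<Longrightarrow> Ck (Suc n) (ball 0 1) g \<Longrightarrow> Ck n (ball 0 1) (radial_avg a g)"
proof (induction n arbitrary: a g)
  case 0
  then show ?case using radial_avg_deriv'(1)[of a g]
    by (auto intro!: continuous_at_imp_continuous_on differentiable_imp_continuous_within)
next
  case (Suc n)
  have g1: "Ck 1 (ball 0 1) g" using Ck_mono[OF Suc.prems(2), of 1] by simp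
  have "Ck n (ball 0 1) (pd i (radial_avg a g))" for i
    by (subst Ck_cong[OF open_ball, of _ _ _ "radial_avg (a + 1) (pd i g)"])
      (use radial_avg_deriv'(2)[OF Suc.prems(1) g1] Suc.IH[of "a + 1" "pd i g"] Suc.prems in auto)
  then show ?case using radial_avg_deriv'(1)[OF Suc.prems(1) g1] by auto
qed

lemma radial_avg_cong:
  assumes "\<And>y. norm y < 1 \<Longrightarrow> g y = h y" "norm x < 1"
  shows "radial_avg a g x = radial_avg a h x"
  unfolding radial_avg_def
  by (intro Bochner_Integration.integral_cong refl) (auto simp: indicator_def assms(1)[OF scale_in_ball[OF assms(2)]])

lemma radial_deriv:
  assumes "g differentiable (at (t *\<^sub>R x))"
  shows "((\<lambda>t. g (t *\<^sub>R x)) has_real_derivative (\<Sum>k\<in>UNIV. x $ k * pd k g (t *\<^sub>R x))) (at t)"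
proof -
  have "((\<lambda>t. t *\<^sub>R x) has_derivative (\<lambda>h. h *\<^sub>R x)) (at t)" by (auto intro!: derivative_eq_intros)
  from has_derivative_compose[OF this pd_has_derivative[OF assms]]
  have "((\<lambda>t. g (t *\<^sub>R x)) has_derivative (\<lambda>h. (\<chi> i. pd i g (t *\<^sub>R x)) \<bullet> (h *\<^sub>R x))) (at t)" .
  moreover have "(\<lambda>h. (\<chi> i. pd i g (t *\<^sub>R x)) \<bullet> (h *\<^sub>R x)) = (*) (\<Sum>k\<in>UNIV. x $ k * pd k g (t *\<^sub>R x))"
    by (auto simp: fun_eq_iff inner_vec_def sum_distrib_left mult_ac)
  ultimately show ?thesis by (simp add: has_field_derivative_def)
qed

text \<open>The fundamental theorem of calculus for \<open>t^(a + 1) * g(t x)\<close> on the unit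
  interval, whose value at \<open>t = 0\<close> vanishes because the exponent is positive.\<close>

lemma radial_avg_euler:
  assumes g: "Ck 1 (ball 0 1) g" and x: "norm x < 1" and a: "a > 0"
  shows "(\<Sum>k\<in>UNIV. x $ k * radial_avg (a + 1) (pd k g) x) + (a + 1) * radial_avg a g x = g x"
proof -
  define G where "G t = t powr (a + 1) * g (t *\<^sub>R x)" for t :: real
  define G' where "G' t = (a + 1) * (t powr a * g (t *\<^sub>R x)) + (\<Sum>k\<in>UNIV. x $ k * (t powr (a + 1) * pd k g (t *\<^sub>R x)))" for t :: real
  have gc: "continuous_on (ball 0 1) (pd i g)" for i using g by auto
  have "(G' has_integral G 1 - G 0) {0..1}"
  proof (rule fundamental_theorem_of_calculus_interior)
    show "continuous_on {0..1} G" unfolding G_def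
    proof (intro continuous_on_mult continuous_on_powr' continuous_on_compose2[OF Ck_continuous[OF g]] continuous_intros)
      show "(\<lambda>t. t *\<^sub>R x) ` {0..1} \<subseteq> ball 0 1"
      proof
        fix y assume "y \<in> (\<lambda>t. t *\<^sub>R x) ` {0..1}"
        then obtain t where t: "t \<in> {0..1}" "y = t *\<^sub>R x" by blast
        then have "norm y \<le> norm x" by (simp add: mult_left_le_one_le)
        then show "y \<in> ball 0 1" using x by simp
      qed
    qed (use a in auto)
    fix t :: real assume t: "t \<in> {0<..<1}"
    have gd: "g differentiable (at (t *\<^sub>R x))" using g scale_in_ball[OF x, of t] t by simp
    note d = radial_deriv[OF gd]
    have "((\<lambda>t. t powr (a + 1)) has_real_derivative (a + 1) * t powr a) (at t)"
      using t by (auto intro!: derivative_eq_intros simp: powr_diff)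
    from DERIV_mult[OF this d] have "(G has_real_derivative G' t) (at t)"
      unfolding G_def G'_def by (simp add: sum_distrib_left mult_ac add_ac)
    then show "(G has_vector_derivative G' t) (at t)"
      by (simp add: has_real_derivative_iff_has_vector_derivative)
  qed simp
  moreover have "G 1 - G 0 = g x" by (simp add: G_def)
  ultimately have I1: "(G' has_integral g x) {0..1}" by simp
  define H where "H t = (a + 1) * (indicator {0<..<1} t * (t powr a * g (t *\<^sub>R x)))
     + (\<Sum>k\<in>UNIV. x $ k * (indicator {0<..<1} t * (t powr (a + 1) * pd k g (t *\<^sub>R x))))" for t :: real
  have i1: "integrable lborel (\<lambda>t. indicator {0<..<1} t * (t powr a * g (t *\<^sub>R x)))"
    using a by (intro integrable_radial_avg Ck_continuous[OF g] x) auto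
  have i2: "integrable lborel (\<lambda>t. indicator {0<..<1} t * (t powr (a + 1) * pd k g (t *\<^sub>R x)))" for k
    using a by (intro integrable_radial_avg gc x) auto
  have iH: "integrable lborel H" unfolding H_def using i1 i2 by simp
  have "(H has_integral (\<integral>t. H t \<partial>lborel)) UNIV" by (rule has_integral_integral_lborel[OF iH])
  moreover have "H = (\<lambda>t. if t \<in> {0<..<1} then G' t else 0)"
    by (auto simp: H_def G'_def indicator_def fun_eq_iff)
  ultimately have "(G' has_integral (\<integral>t. H t \<partial>lborel)) {0<..<1}"
    by (simp only: has_integral_restrict_UNIV)
  moreover have "(G' has_integral (\<integral>t. H t \<partial>lborel)) {0<..<1} \<longleftrightarrow> (G' has_integral (\<integral>t. H t \<partial>lborel)) {0..1}"
    by (simp add: has_integral_Icc_iff_Ioo)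
  ultimately have "(\<integral>t. H t \<partial>lborel) = g x" using I1 has_integral_unique by blast
  then show ?thesis unfolding H_def radial_avg_def using i1 i2 by (simp add: add.commute)
qed

lemma radial_avg_add:
  assumes "continuous_on (ball 0 1) g" "continuous_on (ball 0 1) h" "norm x < 1" "a > -1"
  shows "radial_avg a (\<lambda>y. g y + h y) x = radial_avg a g x + radial_avg a h x"
  unfolding radial_avg_def using integrable_radial_avg[OF assms(1,3,4)] integrable_radial_avg[OF assms(2,3,4)]
  by (simp add: distrib_left)

lemma radial_avg_zero [simp]: "radial_avg a (\<lambda>y. 0) x = 0"
  by (simp add: radial_avg_def)

lemma radial_avg_sum:
  assumes "finite A" "\<And>k. k \<in> A \<Longrightarrow> continuous_on (ball 0 1) (g k)" "norm x < 1" "a > -1"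
  shows "radial_avg a (\<lambda>y. \<Sum>k\<in>A. g k y) x = (\<Sum>k\<in>A. radial_avg a (g k) x)"
  using assms(1,2)
proof (induction A rule: finite_induct)
  case (insert k A)
  then show ?case using radial_avg_add[of "g k" "\<lambda>y. \<Sum>k\<in>A. g k y" x a] assms(3,4)
    by (simp add: continuous_on_sum)
qed simp

section \<open>Lame solutions from harmonic functions\<close>

lemma pd_laplacian_commute:
  assumes S: "open S" and g: "Ck 3 S g" and x: "x \<in> S"
  shows "(\<Sum>k\<in>UNIV. pd k (pd k (pd j g)) x) = pd j (\<lambda>x. \<Sum>k\<in>UNIV. pd k (pd k g) x) x"
proof -
  have g2: "Ck 2 S g" "Ck 2 S (pd k g)" "Ck 1 S (pd l (pd k g))" for k l
  proof -
    have "Ck (Suc 2) S g" using g by (simp add: eval_nat_numeral)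
    then show "Ck 2 S g" "Ck 2 S (pd k g)" using Ck_Suc_D Ck_pd by blast+
    then show "Ck 1 S (pd l (pd k g))" using Ck_2D by blast
  qed
  have "pd k (pd k (pd j g)) x = pd j (pd k (pd k g)) x" for k
  proof -
    have "pd k (pd k (pd j g)) x = pd k (pd j (pd k g)) x"
      by (rule pd_cong_open[OF S x]) (rule pd_commute[OF S _ g2(1)])
    also have "\<dots> = pd j (pd k (pd k g)) x" by (rule pd_commute[OF S x g2(2)])
    finally show ?thesis .
  qed
  then have "(\<Sum>k\<in>UNIV. pd k (pd k (pd j g)) x) = (\<Sum>k\<in>UNIV. pd j (pd k (pd k g)) x)" by simp
  also have "\<dots> = pd j (\<lambda>x. \<Sum>k\<in>UNIV. pd k (pd k g) x) x"
    using g2(3) x by (intro pd_sum[symmetric]) (auto intro: Ck_differentiable)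
  finally show ?thesis .
qed

lemma pd_ball_cong:
  "norm x < 1 \<Longrightarrow> (\<And>y. norm y < 1 \<Longrightarrow> f y = g y) \<Longrightarrow> pd i f x = pd i g x"
  by (rule pd_cong_open[of "ball 0 1"]) auto

text \<open>By the Euler identity for radial averages, \<open>alpha_e\<close> is exactly the exponent for which the
  gradient terms produced by the factor \<open>1 - (norm x)\<^sup>2\<close> cancel.\<close>
lemma lame_from_harmonic:
  fixes H :: "3 \<Rightarrow> vec3 \<Rightarrow> real"
  assumes mu: "mu > 0" "2 * mu + la > 0"
    and HC: "\<And>i n. Ck n (ball 0 1) (H i)"
    and Hh: "\<And>i x. norm x < 1 \<Longrightarrow> (\<Sum>k\<in>UNIV. pd k (pd k (H i)) x) = 0"
  defines "D \<equiv> (\<lambda>x. \<Sum>j\<in>UNIV. pd j (H j) x)"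
  shows "lame_solution la mu (\<lambda>x. \<chi> i. H i x + beta_e la mu * (1 - (norm x)\<^sup>2) * radial_avg (1 - alpha_e la mu) (pd i D) x)"
proof -
  define al where "al = alpha_e la mu"
  define be where "be = beta_e la mu"
  have pos: "la + 3 * mu > 0" using mu by linarith
  have al: "0 < al" "al < 1" using mu pos by (auto simp: al_def alpha_e_def)
  define P where "P = la + 3 * mu"
  \<comment> \<open>With \<open>q = mu / (la + 3 mu)\<close> all constants become affine:
    \<open>be = 1/2 - q\<close>, \<open>al = 1 - q\<close>, and \<open>mu\<close>,
    \<open>la + mu\<close> are \<open>P\<close> times \<open>q\<close> and \<open>1 - 2 q\<close>.
    The final cancellations are then polynomial identities.\<close>
  define q where "q = mu / P"
  have mu_q: "mu = q * P" using pos by (simp add: q_def P_def)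
  have la_q: "la + mu = P - 2 * (q * P)" using mu_q by (simp add: P_def)
  have be_q: "be = 1 / 2 - q"
    using pos by (simp add: be_def beta_e_def q_def P_def divide_simps)
  have al_q: "al = 1 - q"
    using pos by (simp add: al_def alpha_e_def q_def P_def divide_simps)
  have HCpd: "Ck n (ball 0 1) (pd j (H i))" for n i j using HC[of "Suc n" i] by simp
  have DC: "Ck n (ball 0 1) D" for n unfolding D_def by (intro Ck_sum HCpd) auto
  define w where "w i = pd i D" for i
  have wC: "Ck n (ball 0 1) (w i)" for n i using DC[of "Suc n"] by (simp add: w_def)
  have wC': "Ck n (ball 0 1) (pd k (w i))" "Ck n (ball 0 1) (pd l (pd k (w i)))" for n i k l
    using wC[of "Suc n" i] wC[of "Suc (Suc n)" i] by simp_all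
  define W where "W i = radial_avg (1 - al) (w i)" for i
  have WC: "Ck n (ball 0 1) (W i)" for n i unfolding W_def using al by (intro Ck_radial_avg wC) auto
  have WC': "Ck n (ball 0 1) (pd k (W i))" for n i k using WC[of "Suc n" i] by simp
  have diffs [simp]: "H i differentiable (at x)" "pd k (H i) differentiable (at x)" "W i differentiable (at x)"
     "pd k (W i) differentiable (at x)" "D differentiable (at x)"
    if "norm x < 1" for i k x
    using that Ck_differentiable[OF HC[of 1 i]] Ck_differentiable[OF HCpd[of 1 k i]] Ck_differentiable[OF WC[of 1 i]]
      Ck_differentiable[OF WC'[of 1 k i]] Ck_differentiable[OF DC[of 1]] by auto
  have Wpd: "pd k (W i) x = radial_avg (2 - al) (pd k (w i)) x" if "norm x < 1" for i k x
    unfolding W_def using radial_avg_deriv'(2)[OF _ wC[of 1 i] that, of "1 - al" k] al by (simp add: add.commute)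
  have Wpd2: "pd l (pd k (W i)) x = radial_avg (3 - al) (pd l (pd k (w i))) x" if x: "norm x < 1" for i k l x
  proof -
    have "pd l (pd k (W i)) x = pd l (radial_avg (2 - al) (pd k (w i))) x"
      using Wpd by (intro pd_ball_cong x) auto
    also have "\<dots> = radial_avg (3 - al) (pd l (pd k (w i))) x"
      using radial_avg_deriv'(2)[OF _ wC'(1)[of 1 k i] x, of "2 - al" l] al by (simp add: add.commute)
    finally show ?thesis .
  qed
  have Dharm: "(\<Sum>k\<in>UNIV. pd k (pd k D) x) = 0" if x: "norm x < 1" for x
  proof -
    have "pd k (pd k D) x = (\<Sum>j\<in>UNIV. pd k (pd k (pd j (H j))) x)" for k
    proof -
      have "pd k (pd k D) x = pd k (\<lambda>x. \<Sum>j\<in>UNIV. pd k (pd j (H j)) x) x"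
        unfolding D_def by (intro pd_ball_cong x pd_sum) auto
      also have "\<dots> = (\<Sum>j\<in>UNIV. pd k (pd k (pd j (H j))) x)"
      proof (intro pd_sum)
        fix j
        show "pd k (pd j (H j)) differentiable (at x)"
          using Ck_differentiable[of 1 "ball 0 1" "pd k (pd j (H j))" x] HCpd[of 2 j j] x Ck_2D by simp
      qed simp
      finally show ?thesis .
    qed
    then have "(\<Sum>k\<in>UNIV. pd k (pd k D) x) = (\<Sum>k\<in>UNIV. \<Sum>j\<in>UNIV. pd k (pd k (pd j (H j))) x)" by simp
    also have "\<dots> = (\<Sum>j\<in>UNIV. \<Sum>k\<in>UNIV. pd k (pd k (pd j (H j))) x)" by (rule sum.swap)
    also have "\<dots> = (\<Sum>j\<in>UNIV. pd j (\<lambda>x. \<Sum>k\<in>UNIV. pd k (pd k (H j)) x) x)"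
      using x by (intro sum.cong refl pd_laplacian_commute[OF open_ball HC]) auto
    also have "\<dots> = (\<Sum>j\<in>UNIV. pd j (\<lambda>x. 0) x)"
      by (intro sum.cong refl pd_ball_cong x Hh)
    finally show ?thesis by simp
  qed
  \<comment> \<open>\<open>W\<close> is a radial average of the gradient of the harmonic function
    \<open>D\<close>. Averaging commutes with differentiation up to a shift of the exponent, so
    \<open>W\<close> inherits from that gradient that it is divergence free, harmonic
    (\<open>lapW\<close>) and curl free (\<open>Wsym\<close>).\<close>
  have divW: "(\<Sum>k\<in>UNIV. pd k (W k) x) = 0" if x: "norm x < 1" for x
  proof -
    have "(\<Sum>k\<in>UNIV. pd k (W k) x) = radial_avg (2 - al) (\<lambda>x. \<Sum>k\<in>UNIV. pd k (w k) x) x"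
      using Wpd[OF x] radial_avg_sum[of UNIV "\<lambda>k. pd k (w k)" x "2 - al"] Ck_continuous[OF wC'(1)] x al by simp
    also have "\<dots> = radial_avg (2 - al) (\<lambda>x. 0) x"
      using Dharm x by (intro radial_avg_cong) (auto simp: w_def)
    finally show ?thesis by simp
  qed
  have lapW: "(\<Sum>k\<in>UNIV. pd k (pd k (W i)) x) = 0" if x: "norm x < 1" for x i
  proof -
    have "(\<Sum>k\<in>UNIV. pd k (pd k (W i)) x) = radial_avg (3 - al) (\<lambda>x. \<Sum>k\<in>UNIV. pd k (pd k (w i)) x) x"
      using Wpd2[OF x] radial_avg_sum[of UNIV "\<lambda>k. pd k (pd k (w i))" x "3 - al"] Ck_continuous[OF wC'(2)] x al by simp
    also have "\<dots> = radial_avg (3 - al) (\<lambda>x. 0) x"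
    proof (intro radial_avg_cong x)
      fix y :: vec3 assume y: "norm y < 1"
      have "(\<Sum>k\<in>UNIV. pd k (pd k (w i)) y) = pd i (\<lambda>x. \<Sum>k\<in>UNIV. pd k (pd k D) x) y"
        unfolding w_def using y by (intro pd_laplacian_commute[OF open_ball DC]) auto
      also have "\<dots> = pd i (\<lambda>x. 0) y" by (intro pd_ball_cong y Dharm)
      finally show "(\<Sum>k\<in>UNIV. pd k (pd k (w i)) y) = 0" by simp
    qed
    finally show ?thesis by simp
  qed
  have Wsym: "pd k (W i) x = pd i (W k) x" if x: "norm x < 1" for i k x
    unfolding Wpd[OF x] w_def using DC[of 2] by (intro radial_avg_cong x pd_commute[of "ball 0 1"]) auto
  have Weuler: "(\<Sum>k\<in>UNIV. x $ k * pd k (W i) x) + (2 - al) * W i x = w i x" if x: "norm x < 1" for i x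
    using radial_avg_euler[OF wC[of 1 i] x, of "1 - al"] al Wpd[OF x] by (simp add: W_def add.commute)
  define v where "v i x = H i x + be * ((1 - (norm x)\<^sup>2) * W i x)" for i x
  have n2: "(\<lambda>x::vec3. 1 - (norm x)\<^sup>2) differentiable (at x)" for x by (rule pd_one_minus_norm2)
  have vC: "Ck 2 (ball 0 1) (v i)" for i
    unfolding v_def by (intro Ck_add Ck_cmult Ck_mult Ck_diff Ck_norm2 Ck_const HC WC) auto
  have nW: "(\<lambda>x. (1 - (norm x)\<^sup>2) * W i x) differentiable (at x)" if "norm x < 1" for i x
    using that by (intro differentiable_mult n2 diffs)
  have pdv: "pd k (v i) x = pd k (H i) x + be * (- 2 * (x $ k * W i x) + (1 - (norm x)\<^sup>2) * pd k (W i) x)"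
    if x: "norm x < 1" for i k x
  proof -
    have "pd k (v i) x = pd k (H i) x + be * pd k (\<lambda>x. (1 - (norm x)\<^sup>2) * W i x) x"
      unfolding v_def using x nW[OF x] by (subst pd_add) (auto simp: pd_cmult intro: differentiable_mult)
    also have "pd k (\<lambda>x. (1 - (norm x)\<^sup>2) * W i x) x = - 2 * (x $ k * W i x) + (1 - (norm x)\<^sup>2) * pd k (W i) x"
      using x by (subst pd_mult[OF n2]) (auto simp: pd_one_minus_norm2)
    finally show ?thesis .
  qed
  have pd2v: "pd k (pd k (v i)) x = pd k (pd k (H i)) x + be * (- 2 * W i x - 4 * (x $ k * pd k (W i) x) + (1 - (norm x)\<^sup>2) * pd k (pd k (W i)) x)"
    if x: "norm x < 1" for i k x
  proof -
    have a: "(\<lambda>x. x $ k * W i x) differentiable (at x)" "(\<lambda>x. (1 - (norm x)\<^sup>2) * pd k (W i) x) differentiable (at x)"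
      using x by (auto intro!: differentiable_mult n2)
    have b: "(\<lambda>x. - 2 * (x $ k * W i x)) differentiable (at x)"
      "(\<lambda>x. - 2 * (x $ k * W i x) + (1 - (norm x)\<^sup>2) * pd k (W i) x) differentiable (at x)"
      using a by (auto intro!: differentiable_add differentiable_mult)
    have "pd k (pd k (v i)) x = pd k (\<lambda>x. pd k (H i) x + be * (- 2 * (x $ k * W i x) + (1 - (norm x)\<^sup>2) * pd k (W i) x)) x"
      by (intro pd_ball_cong x pdv)
    also have "\<dots> = pd k (pd k (H i)) x + be * (- 2 * pd k (\<lambda>x. x $ k * W i x) x + pd k (\<lambda>x. (1 - (norm x)\<^sup>2) * pd k (W i) x) x)"
    proof -
      have c: "(\<lambda>x. be * (- 2 * (x $ k * W i x) + (1 - (norm x)\<^sup>2) * pd k (W i) x)) differentiable (at x)"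
        using b(2) by (intro differentiable_mult) auto
      show ?thesis
        unfolding pd_add[OF diffs(2)[OF x] c] pd_cmult[OF b(2)] pd_add[OF b(1) a(2)] pd_cmult[OF a(1)] ..
    qed
    also have "pd k (\<lambda>x. x $ k * W i x) x = W i x + x $ k * pd k (W i) x"
      using x by (subst pd_mult) (auto simp: pd_coord)
    also have "pd k (\<lambda>x. (1 - (norm x)\<^sup>2) * pd k (W i) x) x = - 2 * (x $ k * pd k (W i) x) + (1 - (norm x)\<^sup>2) * pd k (pd k (W i)) x"
      using x by (subst pd_mult[OF n2]) (auto simp: pd_one_minus_norm2)
    finally show ?thesis by (simp add: algebra_simps)
  qed
  \<comment> \<open>Since \<open>H\<close> and \<open>W\<close> are harmonic, only two contributions
    remain: \<open>-6 W\<close> from the Laplacian of \<open>1 - |x|^2\<close> in three variables,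
    and \<open>-4\<close> times the radial derivative of \<open>W\<close> from the mixed
    terms.\<close>
  have lapv: "(\<Sum>k\<in>UNIV. pd k (pd k (v i)) x) = be * (- 6 * W i x - 4 * (\<Sum>k\<in>UNIV. x $ k * pd k (W i) x))"
    if x: "norm x < 1" for i x
    unfolding pd2v[OF x] sum.distrib sum_subtractf sum_distrib_left[symmetric] Hh[OF x] lapW[OF x] by simp
  have divv: "(\<Sum>i\<in>UNIV. pd i (v i) x) = D x + (- 2 * be) * (\<Sum>i\<in>UNIV. x $ i * W i x)" if x: "norm x < 1" for x
    unfolding pdv[OF x] sum.distrib sum_distrib_left[symmetric] divW[OF x] D_def by simp
  have pddiv: "pd k (\<lambda>x. \<Sum>i\<in>UNIV. pd i (v i) x) x = w k x - 2 * be * (W k x + (\<Sum>i\<in>UNIV. x $ i * pd i (W k) x))"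
    if x: "norm x < 1" for k x
  proof -
    have a: "(\<lambda>x. x $ i * W i x) differentiable (at x)" for i using x by (auto intro!: differentiable_mult)
    then have b: "(\<lambda>x. \<Sum>i\<in>UNIV. x $ i * W i x) differentiable (at x)" by (intro differentiable_sum) auto
    have "pd k (\<lambda>x. \<Sum>i\<in>UNIV. pd i (v i) x) x = pd k (\<lambda>x. D x + (- 2 * be) * (\<Sum>i\<in>UNIV. x $ i * W i x)) x"
      by (intro pd_ball_cong x divv)
    also have "\<dots> = w k x + (- 2 * be) * pd k (\<lambda>x. \<Sum>i\<in>UNIV. x $ i * W i x) x"
      unfolding w_def pd_cmult[OF b, symmetric] using x b by (intro pd_add) (auto intro: differentiable_mult)
    also have "pd k (\<lambda>x. \<Sum>i\<in>UNIV. x $ i * W i x) x = (\<Sum>i\<in>UNIV. pd k (\<lambda>x. x $ i * W i x) x)"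
      using a by (intro pd_sum) auto
    also have "\<dots> = (\<Sum>i\<in>UNIV. (if k = i then W i x else 0) + x $ i * pd i (W k) x)"
      using x Wsym[OF x] by (intro sum.cong refl, subst pd_mult) (auto simp: pd_coord)
    also have "\<dots> = W k x + (\<Sum>i\<in>UNIV. x $ i * pd i (W k) x)" by (simp add: sum.distrib)
    finally show ?thesis by simp
  qed
  have "lame_op la mu (\<lambda>x. \<chi> i. v i x) x = 0" if x: "norm x < 1" for x
  proof -
    have "mu * (\<Sum>k\<in>UNIV. pd k (pd k (v i)) x) + (la + mu) * pd i (\<lambda>x. \<Sum>i\<in>UNIV. pd i (v i) x) x = 0" for i
    proof -
      define E where "E = (\<Sum>k\<in>UNIV. x $ k * pd k (W i) x)"
      have wE: "w i x = E + (2 - al) * W i x" using Weuler[OF x, of i] by (simp add: E_def)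
      \<comment> \<open>By the Euler identity everything is a combination of \<open>W i x\<close>
        and its radial derivative \<open>E\<close>. The vanishing of the coefficient of
        \<open>E\<close> is the condition that determines \<open>beta\<close>; that of the
        coefficient of \<open>W i x\<close> then determines \<open>alpha\<close>.\<close>
      have "mu * (be * (- 6 * W i x - 4 * E)) + (la + mu) * (E + (2 - al) * W i x - 2 * be * (W i x + E)) =
         (- 6 * mu * be + (la + mu) * (2 - al - 2 * be)) * W i x + (- 4 * mu * be + (la + mu) * (1 - 2 * be)) * E"
        by (simp add: algebra_simps)
      also have "- 6 * mu * be + (la + mu) * (2 - al - 2 * be) = 0"
        unfolding la_q unfolding be_q al_q mu_q by (simp add: algebra_simps)
      also have "- 4 * mu * be + (la + mu) * (1 - 2 * be) = 0"
        unfolding la_q unfolding be_q mu_q by (simp add: algebra_simps)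
      finally show ?thesis unfolding lapv[OF x] pddiv[OF x] E_def[symmetric] wE by simp
    qed
    then show ?thesis by (simp add: lame_op_def divg_def[abs_def] vec_eq_iff)
  qed
  then have "lame_solution la mu (\<lambda>x. \<chi> i. v i x)"
    using vC unfolding lame_solution_def C2_on_iff_Ck by simp
  then show ?thesis by (simp only: v_def be_def al_def w_def W_def mult.assoc)
qed

section \<open>Bounds for the elastic Poisson kernel\<close>

text \<open>Taylor's formula to second order along a ray, through two applications of the mean value
  theorem. The factor \<open>t^2\<close> offsets the weight of exponent \<open>-1 - alpha\<close>,
  leaving the integrable power \<open>1 - alpha\<close>.\<close>

lemma second_order_bound:
  assumes g: "Ck 2 (ball 0 1) g" and g0: "g 0 = 0" "\<And>j. pd j g 0 = 0" and x: "norm x < 1"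
  shows "\<exists>C\<ge>0. \<forall>t. 0 < t \<and> t < 1 \<longrightarrow> \<bar>g (t *\<^sub>R x)\<bar> \<le> C * t\<^sup>2"
proof -
  have "\<forall>k l. \<exists>B\<ge>0. \<forall>y. norm y \<le> norm x \<longrightarrow> \<bar>pd l (pd k g) y\<bar> \<le> B"
    using bounded_on_cball[OF _ x] g by (auto simp: numeral_2_eq_2)
  then obtain B where B: "\<And>k l. B k l \<ge> 0" "\<And>k l y. norm y \<le> norm x \<Longrightarrow> \<bar>pd l (pd k g) y\<bar> \<le> B k l"
    by metis
  define C where "C = (\<Sum>k\<in>UNIV. \<Sum>l\<in>UNIV. B k l)"
  have C: "C \<ge> 0" unfolding C_def by (intro sum_nonneg B)
  have s_le: "norm (s *\<^sub>R x) \<le> norm x" if "0 \<le> s" "s < 1" for s using that by (simp add: mult_left_le_one_le)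
  have gd: "g differentiable (at (s *\<^sub>R x))" "pd k g differentiable (at (s *\<^sub>R x))" if "0 \<le> s" "s < 1" for s k
    using g s_le[OF that] x by (auto simp: numeral_2_eq_2)
  have x1: "\<bar>x $ k\<bar> \<le> 1" for k using component_le_norm_cart[of x k] x by linarith
  define P where "P s = (\<Sum>k\<in>UNIV. x $ k * pd k g (s *\<^sub>R x))" for s
  have "\<bar>g (t *\<^sub>R x)\<bar> \<le> C * t\<^sup>2" if t: "0 < t" "t < 1" for t
  proof -
    have "((\<lambda>t. g (t *\<^sub>R x)) has_real_derivative P s) (at s)" if "0 \<le> s" "s \<le> t" for s
      unfolding P_def by (rule radial_deriv) (use gd that t in auto)
    from MVT2[OF t(1) this] obtain s where s: "0 < s" "s < t" "g (t *\<^sub>R x) = t * P s"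
      using g0 by auto
    have "(P has_real_derivative (\<Sum>k\<in>UNIV. x $ k * (\<Sum>l\<in>UNIV. x $ l * pd l (pd k g) (r *\<^sub>R x)))) (at r)" if "0 \<le> r" "r \<le> s" for r
      unfolding P_def by (intro DERIV_sum DERIV_cmult radial_deriv) (use gd that s t in auto)
    from MVT2[OF s(1) this] obtain r where r: "0 < r" "r < s"
      "P s - P 0 = s * (\<Sum>k\<in>UNIV. x $ k * (\<Sum>l\<in>UNIV. x $ l * pd l (pd k g) (r *\<^sub>R x)))"
      by auto
    have P0: "P 0 = 0" by (simp add: P_def g0)
    have "\<bar>\<Sum>k\<in>UNIV. x $ k * (\<Sum>l\<in>UNIV. x $ l * pd l (pd k g) (r *\<^sub>R x))\<bar> \<le> C"
      unfolding C_def sum_distrib_left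
    proof (intro order_trans[OF sum_abs] sum_mono)
      fix k l
      have "\<bar>x $ k * (x $ l * pd l (pd k g) (r *\<^sub>R x))\<bar> = \<bar>x $ k\<bar> * (\<bar>x $ l\<bar> * \<bar>pd l (pd k g) (r *\<^sub>R x)\<bar>)"
        by (simp add: abs_mult)
      also have "\<dots> \<le> 1 * (1 * B k l)"
        using x1 B(2)[OF s_le[of r]] r s t by (intro mult_mono) auto
      finally show "\<bar>x $ k * (x $ l * pd l (pd k g) (r *\<^sub>R x))\<bar> \<le> B k l" by simp
    qed
    then have "\<bar>P s\<bar> \<le> s * C" using r(3) P0 s by (simp add: abs_mult mult_left_mono)
    also have "\<dots> \<le> t * C" using s C by (intro mult_right_mono) auto
    finally have "t * \<bar>P s\<bar> \<le> t * (t * C)" using t by (intro mult_left_mono) auto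
    then show ?thesis using s t by (simp add: abs_mult power2_eq_square mult_ac)
  qed
  then show ?thesis using C by blast
qed

text \<open>\<open>4 * pi\<close> times the Poisson kernel minus its first-order Taylor polynomial
  at the origin; dilated by \<open>t\<close>, it is the numerator of the integrand of
  \<open>Phi_e\<close>.\<close>

definition Phi_core :: "vec3 \<Rightarrow> vec3 \<Rightarrow> real" where
  "Phi_core e y = Q0 y e - 1 - 3 * (y \<bullet> e)"

lemma rk_inner: "rk (\<lambda>y e. y \<bullet> e)"
  unfolding inner_vec_def inner_real_def by (intro rk_sum rk_mult rk_fst rk_snd) auto

lemma Ck_Phi_core: "norm e = 1 \<Longrightarrow> Ck n (ball 0 1) (Phi_core e)"
  unfolding Phi_core_def[abs_def]
  by (rule rk_Ck[where k = "\<lambda>y e. Q0 y e - 1 - 3 * (y \<bullet> e)"]) (intro rk_diff rk_cmult rk_inner rk_Q0 rk_const)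

lemma pd_inner: "(\<lambda>y::vec3. y \<bullet> e) differentiable (at y)" "pd j (\<lambda>y. y \<bullet> e) y = e $ j"
proof -
  have "((\<lambda>y. y \<bullet> e) has_derivative (\<lambda>h. e \<bullet> h)) (at y)"
    by (auto intro!: derivative_eq_intros simp: inner_commute)
  then show "(\<lambda>y::vec3. y \<bullet> e) differentiable (at y)" "pd j (\<lambda>y. y \<bullet> e) y = e $ j"
    using pd_eqI by (auto simp: differentiable_def)
qed

lemma pd_Phi_core:
  assumes "norm y < 1" "norm e = 1"
  shows "pd j (Phi_core e) y = Q1 j y e - 3 * e $ j" "pd i (pd j (Phi_core e)) y = Q2 i j y e"
proof -
  have ne: "y \<noteq> e" if "norm y < 1" for y using that assms(2) by auto
  have a: "pd j (Phi_core e) y = Q1 j y e - 3 * e $ j" if y: "norm y < 1" for y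
  proof -
    have d: "(\<lambda>y. Q0 y e - 1) differentiable (at y)" "(\<lambda>y. 3 * (y \<bullet> e)) differentiable (at y)"
      using pd_Q0(1)[OF ne[OF y]] pd_inner(1)[of e y] by (auto intro!: differentiable_diff differentiable_mult)
    have "pd j (\<lambda>y. 3 * (y \<bullet> e)) y = 3 * e $ j" by (subst pd_cmult) (auto simp: pd_inner)
    then show ?thesis unfolding Phi_core_def[abs_def] pd_diff[OF d]
      using pd_Q0[OF ne[OF y]] by (simp add: pd_diff)
  qed
  then show "pd j (Phi_core e) y = Q1 j y e - 3 * e $ j" using assms by blast
  have "pd i (pd j (Phi_core e)) y = pd i (\<lambda>y. Q1 j y e - 3 * e $ j) y"
    by (rule pd_ball_cong[OF assms(1)]) (rule a)
  also have "\<dots> = Q2 i j y e" using pd_Q1[OF ne[OF assms(1)]] by (simp add: pd_diff)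
  finally show "pd i (pd j (Phi_core e)) y = Q2 i j y e" .
qed

lemma Phi_core_0: "norm e = 1 \<Longrightarrow> Phi_core e 0 = 0" "norm e = 1 \<Longrightarrow> pd j (Phi_core e) 0 = 0"
  by (simp add: Phi_core_def Q0_def) (simp add: pd_Phi_core Q1_def)

lemma integrable_Phi_core:
  assumes e: "norm e = 1" and x: "norm x < 1" and al: "0 < al" "al < 1"
  shows "integrable lborel (\<lambda>t. indicator {0<..<1} t * (t powr (- 1 - al) * Phi_core e (t *\<^sub>R x)))"
proof -
  obtain C where C: "C \<ge> 0" "\<And>t. 0 < t \<Longrightarrow> t < 1 \<Longrightarrow> \<bar>Phi_core e (t *\<^sub>R x)\<bar> \<le> C * t\<^sup>2"
    using second_order_bound[OF Ck_Phi_core[OF e] Phi_core_0[OF e] x] by blast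
  show ?thesis
  proof (rule Bochner_Integration.integrable_bound)
    show "integrable lborel (\<lambda>t. (indicator {0<..<1} t * t powr (1 - al)) * C)"
      using integrable_powr_01[of "1 - al"] al by simp
    show "AE t in lborel. norm (indicator {0<..<1} t * (t powr (- 1 - al) * Phi_core e (t *\<^sub>R x))) \<le> norm (indicator {0<..<1} t * t powr (1 - al) * C)"
    proof (rule AE_I2)
      fix t :: real
      show "norm (indicator {0<..<1} t * (t powr (- 1 - al) * Phi_core e (t *\<^sub>R x))) \<le> norm (indicator {0<..<1} t * t powr (1 - al) * C)"
      proof (cases "t \<in> {0<..<1}")
        case True
        have "t powr (- 1 - al) * \<bar>Phi_core e (t *\<^sub>R x)\<bar> \<le> t powr (- 1 - al) * (C * t\<^sup>2)"
          using C True by (intro mult_left_mono) auto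
        also have "t powr (- 1 - al) * (C * t\<^sup>2) = C * (t powr (- 1 - al) * t powr 2)"
          using True by (simp add: powr_numeral)
        also have "t powr (- 1 - al) * t powr 2 = t powr (1 - al)"
          unfolding powr_add[symmetric] by (simp add: algebra_simps)
        finally show ?thesis using True C by (simp add: abs_mult mult.commute)
      qed simp
    qed
  qed (use measurable_radial[OF Ck_continuous[OF Ck_Phi_core[OF e, of 0]] x] in simp)
qed

text \<open>The intervals of the two integrals differ by their end points only. For
  \<open>0 < t < 1\<close> the base of the power \<open>3/2\<close> is the square of the positive
  distance \<open>norm (t x - e)\<close>, so the power is the cube of that distance.\<close>

lemma Phi_e_eq_radial_avg:
  assumes e: "norm e = 1" and x: "norm x < 1" and al: "0 < al" "al < 1"
  shows "Phi_e al x e = 1 / (4 * pi) * radial_avg (- 1 - al) (Phi_core e) x"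
proof -
  define F where "F t = t powr (- 1 - al) * Phi_core e (t *\<^sub>R x)" for t
  have "((\<lambda>t. indicator {0<..<1} t * F t) has_integral radial_avg (- 1 - al) (Phi_core e) x) UNIV"
    using has_integral_integral_lborel[OF integrable_Phi_core[OF assms]] unfolding radial_avg_def F_def .
  moreover have "(\<lambda>t. indicator {0<..<1} t * F t) = (\<lambda>t. if t \<in> {0<..<1} then F t else 0)"
    by (auto simp: indicator_def)
  ultimately have "(F has_integral radial_avg (- 1 - al) (Phi_core e) x) {0<..<1}"
    by (simp only: has_integral_restrict_UNIV)
  moreover have "F t = ((1 - t\<^sup>2 * (norm x)\<^sup>2) / (1 - 2 * t * (x \<bullet> e) + t\<^sup>2 * (norm x)\<^sup>2) powr (3/2)
        - 1 - 3 * t * (x \<bullet> e)) / t powr (1 + al)" if t: "t \<in> {0<..<1}" for t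
  proof -
    have n: "(norm (t *\<^sub>R x - e))\<^sup>2 = 1 - 2 * t * (x \<bullet> e) + t\<^sup>2 * (norm x)\<^sup>2"
      using e unfolding power2_norm_eq_inner norm_eq_1
      by (simp add: inner_diff inner_commute power2_eq_square algebra_simps)
    have "t *\<^sub>R x \<noteq> e" using scale_in_ball[OF x, of t] t e by auto
    then have np: "norm (t *\<^sub>R x - e) > 0" by simp
    have "((norm (t *\<^sub>R x - e))\<^sup>2) powr (3/2) = norm (t *\<^sub>R x - e) powr 3"
      using np by (simp add: powr_powr flip: powr_numeral)
    also have "\<dots> = norm (t *\<^sub>R x - e) ^ 3" using np by (simp add: powr_numeral)
    finally have p: "(1 - 2 * t * (x \<bullet> e) + t\<^sup>2 * (norm x)\<^sup>2) powr (3/2) = norm (t *\<^sub>R x - e) ^ 3"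
      unfolding n .
    have "t powr (- 1 - al) = 1 / t powr (1 + al)"
      using powr_minus_divide[of t "1 + al"] by simp
    then show ?thesis unfolding F_def Phi_core_def Q0_def p
      by (simp add: power_mult_distrib power_divide)
  qed
  ultimately have "((\<lambda>t. ((1 - t\<^sup>2 * (norm x)\<^sup>2) / (1 - 2 * t * (x \<bullet> e) + t\<^sup>2 * (norm x)\<^sup>2) powr (3/2)
        - 1 - 3 * t * (x \<bullet> e)) / t powr (1 + al)) has_integral radial_avg (- 1 - al) (Phi_core e) x) {0..1}"
    unfolding has_integral_Icc_iff_Ioo by (subst has_integral_cong[symmetric]) auto
  then show ?thesis unfolding Phi_e_def by (simp add: integral_unique)
qed

text \<open>The exponent of the average runs through \<open>-1 - al\<close>, \<open>-al\<close>,
  \<open>1 - al\<close>. Subtracting the Taylor polynomial makes the first of these integrals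
  converge; being affine, the polynomial disappears under two derivatives.\<close>

lemma pd2_Phi_e:
  assumes e: "norm e = 1" and x: "norm x < 1" and al: "0 < al" "al < 1"
  shows "pd i (pd j (\<lambda>y. Phi_e al y e)) x = 1 / (4 * pi) * radial_avg (1 - al) (\<lambda>y. Q2 i j y e) x"
proof -
  let ?g = "Phi_core e"
  have C1: "Ck 1 (ball 0 1) ?g" "Ck 1 (ball 0 1) (pd j ?g)"
    using Ck_2D[OF Ck_Phi_core[OF e]] by blast+
  have t1: "radial_avg (-1 - al) ?g differentiable (at y)" "pd j (radial_avg (-1 - al) ?g) y = radial_avg (- al) (pd j ?g) y" if "norm y < 1" for y
    using radial_avg_deriv[OF _ C1(1) integrable_Phi_core[OF e _ al] that] al by auto
  have t2: "radial_avg (- al) (pd j ?g) differentiable (at x)" "pd i (radial_avg (- al) (pd j ?g)) x = radial_avg (1 - al) (pd i (pd j ?g)) x"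
    using radial_avg_deriv'[OF _ C1(2) x, of "- al"] al by auto
  have "pd j (\<lambda>y. Phi_e al y e) y = 1 / (4 * pi) * radial_avg (- al) (pd j ?g) y" if y: "norm y < 1" for y
  proof -
    have "pd j (\<lambda>y. Phi_e al y e) y = pd j (\<lambda>y. 1 / (4 * pi) * radial_avg (- 1 - al) ?g y) y"
      by (rule pd_ball_cong[OF y]) (rule Phi_e_eq_radial_avg[OF e _ al])
    then show ?thesis using t1[OF y] by (simp add: pd_cmult del: times_divide_eq_left)
  qed
  then have "pd i (pd j (\<lambda>y. Phi_e al y e)) x = pd i (\<lambda>y. 1 / (4 * pi) * radial_avg (- al) (pd j ?g) y) x"
    by (intro pd_ball_cong x)
  also have "\<dots> = 1 / (4 * pi) * radial_avg (1 - al) (pd i (pd j ?g)) x"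
    using t2 by (simp add: pd_cmult del: times_divide_eq_left)
  also have "radial_avg (1 - al) (pd i (pd j ?g)) x = radial_avg (1 - al) (\<lambda>y. Q2 i j y e) x"
    by (intro radial_avg_cong x pd_Phi_core e)
  finally show ?thesis .
qed

lemma alpha_e_bounds: "mu > 0 \<Longrightarrow> 2 * mu + la > 0 \<Longrightarrow> 0 < alpha_e la mu \<and> alpha_e la mu < 1"
  by (simp add: alpha_e_def)

lemma elastic_kernel_eq:
  assumes mu: "mu > 0" "2 * mu + la > 0" and e: "norm e = 1" and x: "norm x < 1"
  shows "elastic_kernel la mu x e $ i $ j = (if i = j then Q0 x e / (4 * pi) else 0)
    + beta_e la mu * (1 - (norm x)\<^sup>2) * (radial_avg (1 - alpha_e la mu) (\<lambda>y. Q2 i j y e) x / (4 * pi))"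
  unfolding elastic_kernel_def using pd2_Phi_e[OF e x, of "alpha_e la mu" i j] alpha_e_bounds[OF mu]
  by (simp add: poisson_kernel_def Q0_def power_divide)

text \<open>The distance from \<open>t x\<close> to the sphere is at least \<open>1 - t\<close>,
  hence \<open>1 - t <= norm (t x - e)\<close>. Since \<open>x\<close> and \<open>t x\<close> are at
  most \<open>1 - t\<close> apart, \<open>norm (x - e)\<close> is at most twice
  \<open>norm (t x - e)\<close>.\<close>

lemma radial_distance_bound:
  fixes x e :: vec3
  assumes "norm e = 1" "norm x < 1" "0 < t" "t < 1"
  shows "norm (x - e) + (1 - t) \<le> 3 * norm (t *\<^sub>R x - e)"
proof -
  have "norm e \<le> norm (t *\<^sub>R x) + norm (t *\<^sub>R x - e)"
    using norm_triangle_sub[of e "t *\<^sub>R x"] by (simp add: norm_minus_commute)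
  then have a: "1 - t * norm x \<le> norm (t *\<^sub>R x - e)" using assms by simp
  have "t * norm x \<le> t * 1" using assms by (intro mult_left_mono) auto
  then have b: "1 - t \<le> norm (t *\<^sub>R x - e)" using a by linarith
  have "norm (x - e) \<le> norm (t *\<^sub>R x - e) + norm ((1 - t) *\<^sub>R x)"
    using norm_triangle_ineq[of "t *\<^sub>R x - e" "(1 - t) *\<^sub>R x"] by (simp add: algebra_simps)
  moreover have "norm ((1 - t) *\<^sub>R x) \<le> 1 - t" using assms by simp
  ultimately show ?thesis using b by linarith
qed

text \<open>With \<open>D = norm (x - e)\<close> the integrand is at most
  \<open>52 * 3^4 / (D + 1 - t)^4\<close>, by \<open>Q2_bound\<close> and
  \<open>radial_distance_bound\<close>. Integration in \<open>t\<close> lowers the power by one and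
  divides by 3: \<open>4212 / 3 = 1404\<close>.\<close>

lemma radial_avg_Q2_bound:
  assumes e: "norm e = 1" and x: "norm x < 1" and al: "al < 1"
  shows "\<bar>radial_avg (1 - al) (\<lambda>y. Q2 i j y e) x\<bar> \<le> 1404 / norm (x - e) ^ 3"
proof -
  define D where "D = norm (x - e)"
  have D: "D > 0" using e x by (auto simp: D_def)
  have hb: "has_bochner_integral lborel (\<lambda>t. 4212 / (D + 1 - t) ^ 4 * indicator {0..1} t) (1404 / (D + 1 - 1) ^ 3 - 1404 / (D + 1 - 0) ^ 3)"
  proof (rule has_bochner_integral_FTC_Icc_real)
    show "((\<lambda>t. 1404 / (D + 1 - t) ^ 3) has_real_derivative 4212 / (D + 1 - t) ^ 4) (at t)" if "0 \<le> t" "t \<le> 1" for t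
    proof -
      have "((\<lambda>t. 1404 / (D + 1 - t) ^ 3) has_real_derivative
          (1404 * (3 * (D + 1 - t)\<^sup>2) / ((D + 1 - t) ^ 3 * (D + 1 - t) ^ 3))) (at t)"
        using D that by (auto intro!: derivative_eq_intros)
      moreover have "1404 * (3 * s\<^sup>2) / (s ^ 3 * s ^ 3) = 4212 / s ^ 4" if "s > 0" for s :: real
        using that by (simp add: field_simps eval_nat_numeral)
      ultimately show ?thesis using D that by simp
    qed
    show "isCont (\<lambda>t. 4212 / (D + 1 - t) ^ 4) t" if "0 \<le> t" "t \<le> 1" for t
      using D that by (auto intro!: continuous_intros)
  qed auto
  have "\<bar>radial_avg (1 - al) (\<lambda>y. Q2 i j y e) x\<bar> \<le> (\<integral>t. \<bar>indicator {0<..<1} t * (t powr (1 - al) * Q2 i j (t *\<^sub>R x) e)\<bar> \<partial>lborel)"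
    unfolding radial_avg_def by (rule integral_abs_bound)
  also have "\<dots> \<le> (\<integral>t. 4212 / (D + 1 - t) ^ 4 * indicator {0..1} t \<partial>lborel)"
  proof (rule Bochner_Integration.integral_mono')
    show "integrable lborel (\<lambda>t. 4212 / (D + 1 - t) ^ 4 * indicator {0..1} t)"
      using hb by (simp add: has_bochner_integral_iff)
    fix t :: real
    show "\<bar>indicator {0<..<1} t * (t powr (1 - al) * Q2 i j (t *\<^sub>R x) e)\<bar> \<le> 4212 / (D + 1 - t) ^ 4 * indicator {0..1} t"
    proof (cases "t \<in> {0<..<1}")
      case True
      then have t: "0 < t" "t < 1" by auto
      have p: "t powr (1 - al) \<le> 1" using t al powr_le_one_le[of t "1 - al"] by (simp add: powr_le1)
      have r: "D + (1 - t) \<le> 3 * norm (t *\<^sub>R x - e)" unfolding D_def by (rule radial_distance_bound[OF e x t])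
      have "((D + 1 - t) / 3) ^ 4 \<le> norm (t *\<^sub>R x - e) ^ 4"
        using r D t by (intro power_mono) auto
      then have q: "52 / norm (t *\<^sub>R x - e) ^ 4 \<le> 52 / ((D + 1 - t) / 3) ^ 4"
        using D t by (intro divide_left_mono mult_pos_pos zero_less_power) (auto simp: scale_in_ball[OF x t, THEN less_imp_neq] intro: order_less_le_trans)
      have "\<bar>t powr (1 - al) * Q2 i j (t *\<^sub>R x) e\<bar> = t powr (1 - al) * \<bar>Q2 i j (t *\<^sub>R x) e\<bar>"
        by (simp add: abs_mult)
      also have "\<dots> \<le> 1 * (52 / norm (t *\<^sub>R x - e) ^ 4)"
        using p Q2_bound[OF scale_in_ball[OF x t] e] by (intro mult_mono) auto
      also have "\<dots> \<le> 4212 / (D + 1 - t) ^ 4" using q by (simp add: power_divide)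
      finally show ?thesis using t by simp
    qed (use D in \<open>auto simp: indicator_def\<close>)
  qed (use D in \<open>auto simp: indicator_def\<close>)
  also have "\<dots> = 1404 / D ^ 3 - 1404 / (D + 1) ^ 3"
    using hb by (simp add: has_bochner_integral_iff)
  also have "\<dots> \<le> 1404 / D ^ 3" using D by simp
  finally show ?thesis by (simp add: D_def)
qed

text \<open>The summand 1 bounds the Poisson part and 1404 comes from
  \<open>radial_avg_Q2_bound\<close>; the factor 9 passes from single entries to the action on
  vectors, three rows of three entries.\<close>

definition ker_const :: "real \<Rightarrow> real \<Rightarrow> real" where
  "ker_const la mu = 9 * (1 + 1404 * \<bar>beta_e la mu\<bar>)"

lemma elastic_kernel_entry_bound:
  assumes mu: "mu > 0" "2 * mu + la > 0" and e: "norm e = 1" and x: "norm x < 1"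
  shows "\<bar>elastic_kernel la mu x e $ i $ j\<bar> \<le> (1 + 1404 * \<bar>beta_e la mu\<bar>) * ((1 - norm x) / norm (x - e) ^ 3)"
proof -
  define D where "D = norm (x - e)"
  define b where "b = \<bar>beta_e la mu\<bar>"
  have D: "D > 0" using e x by (auto simp: D_def)
  have s: "0 \<le> 1 - (norm x)\<^sup>2" "1 - (norm x)\<^sup>2 \<le> 2 * (1 - norm x)"
  proof -
    show "0 \<le> 1 - (norm x)\<^sup>2" using x by (simp add: power_le_one)
    have "0 \<le> (1 - norm x)\<^sup>2" by simp
    then show "1 - (norm x)\<^sup>2 \<le> 2 * (1 - norm x)" by (simp add: power2_eq_square algebra_simps)
  qed
  \<comment> \<open>The normalization by \<open>4 * pi\<close> absorbs the factor 2 in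
    \<open>1 - |x|^2 <= 2 * (1 - |x|)\<close>.\<close>
  have pi4: "4 * pi \<ge> 2" using pi_ge_two by linarith
  have sp: "(1 - (norm x)\<^sup>2) / (4 * pi) \<le> 1 - norm x"
  proof -
    have "(1 - (norm x)\<^sup>2) / (4 * pi) \<le> (2 * (1 - norm x)) / 2"
      using s pi4 x by (intro frac_le) auto
    also have "\<dots> = 1 - norm x" by simp
    finally show ?thesis .
  qed
  have a: "\<bar>if i = j then Q0 x e / (4 * pi) else 0\<bar> \<le> (1 - norm x) / D ^ 3"
  proof -
    have "Q0 x e / (4 * pi) = ((1 - (norm x)\<^sup>2) / (4 * pi)) / D ^ 3" by (simp add: Q0_def D_def power_divide)
    moreover have "\<dots> \<le> (1 - norm x) / D ^ 3" using sp D by (intro divide_right_mono) auto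
    moreover have "0 \<le> ((1 - (norm x)\<^sup>2) / (4 * pi)) / D ^ 3" using s D by simp
    ultimately show ?thesis using x D by auto
  qed
  have t: "\<bar>radial_avg (1 - alpha_e la mu) (\<lambda>y. Q2 i j y e) x\<bar> \<le> 1404 / D ^ 3"
    unfolding D_def using radial_avg_Q2_bound[OF e x] alpha_e_bounds[OF mu] by blast
  have "\<bar>beta_e la mu * (1 - (norm x)\<^sup>2) * (radial_avg (1 - alpha_e la mu) (\<lambda>y. Q2 i j y e) x / (4 * pi))\<bar>
      = b * (((1 - (norm x)\<^sup>2) / (4 * pi)) * \<bar>radial_avg (1 - alpha_e la mu) (\<lambda>y. Q2 i j y e) x\<bar>)"
    using s by (simp add: abs_mult b_def)
  also have "\<dots> \<le> b * ((1 - norm x) * (1404 / D ^ 3))"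
    using sp t s x by (intro mult_left_mono mult_mono) (auto simp: b_def)
  finally have "\<bar>elastic_kernel la mu x e $ i $ j\<bar> \<le> (1 - norm x) / D ^ 3 + b * ((1 - norm x) * (1404 / D ^ 3))"
    unfolding elastic_kernel_eq[OF mu e x] using a by linarith
  then show ?thesis unfolding D_def[symmetric] b_def[symmetric] by (simp add: algebra_simps)
qed

lemma elastic_kernel_bound:
  assumes mu: "mu > 0" "2 * mu + la > 0" and e: "norm e = 1" and x: "norm x < 1"
  shows "norm (elastic_kernel la mu x e *v v) \<le> ker_const la mu * ((1 - norm x) / norm (x - e) ^ 3) * norm v"
proof -
  define c where "c = (1 + 1404 * \<bar>beta_e la mu\<bar>) * ((1 - norm x) / norm (x - e) ^ 3)"
  have c: "0 \<le> c" using x by (auto simp: c_def)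
  have "norm (elastic_kernel la mu x e *v v) \<le> (\<Sum>i\<in>UNIV. \<bar>(elastic_kernel la mu x e *v v) $ i\<bar>)"
    by (rule norm_le_l1_cart)
  also have "\<dots> \<le> (\<Sum>i\<in>(UNIV::3 set). 3 * c * norm v)"
  proof (rule sum_mono)
    fix i :: 3
    have "\<bar>(elastic_kernel la mu x e *v v) $ i\<bar> \<le> (\<Sum>j\<in>UNIV. \<bar>elastic_kernel la mu x e $ i $ j * v $ j\<bar>)"
      unfolding matrix_vector_mult_def by (simp add: sum_abs)
    also have "\<dots> \<le> (\<Sum>j\<in>(UNIV::3 set). c * norm v)"
      unfolding abs_mult c_def using elastic_kernel_entry_bound[OF assms] component_le_norm_cart c[unfolded c_def]
      by (intro sum_mono mult_mono) auto
    finally show "\<bar>(elastic_kernel la mu x e *v v) $ i\<bar> \<le> 3 * c * norm v" by simp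
  qed
  also have "\<dots> = ker_const la mu * ((1 - norm x) / norm (x - e) ^ 3) * norm v"
    by (simp add: c_def ker_const_def)
  finally show ?thesis .
qed

section \<open>Elastic Poisson integrals\<close>

lemma sigma_finite_sphere_measure: "sigma_finite_measure sphere_measure"
  using finite_sphere_measure by (simp add: finite_measure_def)

lemma measurable_kernel_pair:
  assumes "rk k"
  shows "(\<lambda>p. k (fst p *\<^sub>R x) (snd p)) \<in> borel_measurable (borel \<Otimes>\<^sub>M borel)"
proof -
  have "(\<lambda>p::real \<times> vec3. (fst p *\<^sub>R x, snd p)) \<in> measurable (borel \<Otimes>\<^sub>M borel) (borel \<Otimes>\<^sub>M borel)"
    by measurable
  from measurable_compose[OF this rk_measurable_pair[OF assms]] show ?thesis by simp
qed

lemma measurable_radial_avg_kernel: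
  assumes "rk k"
  shows "(\<lambda>e. radial_avg a (\<lambda>y. k y e) x) \<in> borel_measurable borel"
proof -
  have "(\<lambda>q::vec3 \<times> real. (snd q, fst q)) \<in> measurable (borel \<Otimes>\<^sub>M borel) (borel \<Otimes>\<^sub>M borel)" by measurable
  from measurable_compose[OF this measurable_kernel_pair[OF assms, of x]]
  have [measurable]: "(\<lambda>q::vec3 \<times> real. k (snd q *\<^sub>R x) (fst q)) \<in> borel_measurable (borel \<Otimes>\<^sub>M borel)" by simp
  have "(\<lambda>q::vec3 \<times> real. indicator {0<..<1} (snd q) * (snd q powr a * k (snd q *\<^sub>R x) (fst q))) \<in> borel_measurable (borel \<Otimes>\<^sub>M borel)"
    by measurable
  then have "(\<lambda>(e, t). indicator {0<..<1} t * (t powr a * k (t *\<^sub>R x) e)) \<in> borel_measurable (borel \<Otimes>\<^sub>M lborel)"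
    by (simp add: case_prod_beta' measurable_cong_sets[OF sets_pair_measure_cong[OF refl sets_lborel] refl])
  then show ?thesis unfolding radial_avg_def
    by (rule sigma_finite_measure.borel_measurable_lebesgue_integral[OF sigma_finite_lborel])
qed

text \<open>For fixed \<open>x\<close> the points \<open>t x\<close> stay away from the sphere, so
  the kernel is bounded uniformly in the pole and dominated convergence applies. The purpose is to
  admit the elastic kernel as a test function for weak limits.\<close>

lemma radial_avg_kernel_continuous:
  assumes k: "rk k" and x: "norm x < 1" and a: "a > -1"
  shows "continuous_on (sphere 0 1) (\<lambda>e. radial_avg a (\<lambda>y. k y e) x)"
proof (rule continuous_on_sequentiallyI)
  fix u :: "nat \<Rightarrow> vec3" and e assume u: "\<forall>n. u n \<in> sphere 0 1" "e \<in> sphere 0 1" "u \<longlonglongrightarrow> e"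
  obtain B where B: "B \<ge> 0" "\<And>y e. norm y \<le> norm x \<Longrightarrow> norm e = 1 \<Longrightarrow> \<bar>k y e\<bar> \<le> B"
    using rk_bounded[OF k x] by blast
  have kc: "continuous_on (ball 0 1) (\<lambda>y. k y e)" if "norm e = 1" for e
    using rk_Ck[OF k that, of 0] by simp
  show "(\<lambda>n. radial_avg a (\<lambda>y. k y (u n)) x) \<longlonglongrightarrow> radial_avg a (\<lambda>y. k y e) x"
    unfolding radial_avg_def
  proof (rule integral_dominated_convergence[where w = "\<lambda>t. (indicator {0<..<1} t * t powr a) * B"])
    show "integrable lborel (\<lambda>t. (indicator {0<..<1} t * t powr a) * B)"
      using integrable_powr_01[OF a] by simp
    show "(\<lambda>t. indicator {0<..<1} t * (t powr a * k (t *\<^sub>R x) e)) \<in> borel_measurable lborel"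
      using measurable_radial[OF kc x] u by simp
    show "(\<lambda>t. indicator {0<..<1} t * (t powr a * k (t *\<^sub>R x) (u n))) \<in> borel_measurable lborel" for n
      using measurable_radial[OF kc x] u by simp
    show "AE t in lborel. (\<lambda>n. indicator {0<..<1} t * (t powr a * k (t *\<^sub>R x) (u n))) \<longlonglongrightarrow> indicator {0<..<1} t * (t powr a * k (t *\<^sub>R x) e)"
    proof (rule AE_I2)
      fix t :: real
      show "(\<lambda>n. indicator {0<..<1} t * (t powr a * k (t *\<^sub>R x) (u n))) \<longlonglongrightarrow> indicator {0<..<1} t * (t powr a * k (t *\<^sub>R x) e)"
      proof (cases "t \<in> {0<..<1}")
        case True
        then have t: "norm (t *\<^sub>R x) < 1" by (intro scale_in_ball x) auto
        have "continuous_on (sphere 0 1) (\<lambda>e. (\<lambda>p. k (fst p) (snd p)) (t *\<^sub>R x, e))"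
          by (rule continuous_on_compose2[OF rk_continuous[OF k]]) (use t in \<open>auto intro!: continuous_intros\<close>)
        then have "continuous_on (sphere 0 1) (\<lambda>e. k (t *\<^sub>R x) e)" by simp
        then have "(\<lambda>n. k (t *\<^sub>R x) (u n)) \<longlonglongrightarrow> k (t *\<^sub>R x) e"
          by (rule continuous_on_tendsto_compose) (use u in auto)
        then show ?thesis by (intro tendsto_intros)
      qed simp
    qed
    show "AE t in lborel. norm (indicator {0<..<1} t * (t powr a * k (t *\<^sub>R x) (u n))) \<le> (indicator {0<..<1} t * t powr a) * B" for n
    proof (rule AE_I2)
      fix t :: real
      show "norm (indicator {0<..<1} t * (t powr a * k (t *\<^sub>R x) (u n))) \<le> (indicator {0<..<1} t * t powr a) * B"
      proof (cases "t \<in> {0<..<1}")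
        case True
        then have "norm (t *\<^sub>R x) \<le> norm x" by (simp add: mult_left_le_one_le)
        then have "\<bar>k (t *\<^sub>R x) (u n)\<bar> \<le> B" using u by (intro B) auto
        then show ?thesis using True by (simp add: abs_mult mult_left_mono)
      qed simp
    qed
  qed
qed

text \<open>For \<open>norm x < 1\<close> the kernel is bounded along the whole ray, uniformly in
  the pole. The integrand is therefore dominated by a product of \<open>t powr a\<close> and the
  absolute value of \<open>f\<close>.\<close>

lemma radial_avg_kernel_fubini:
  assumes k: "rk k" and f: "integrable sphere_measure f" and x: "norm x < 1" and a: "a > -1"
  shows "integrable sphere_measure (\<lambda>\<eta>. radial_avg a (\<lambda>y. k y \<eta>) x * f \<eta> :: real)"
    and "(\<integral>\<eta>. radial_avg a (\<lambda>y. k y \<eta>) x * f \<eta> \<partial>sphere_measure) = radial_avg a (\<lambda>y. \<integral>\<eta>. k y \<eta> * f \<eta> \<partial>sphere_measure) x"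
proof -
  interpret S: sigma_finite_measure sphere_measure by (rule sigma_finite_sphere_measure)
  interpret pair_sigma_finite lborel sphere_measure ..
  obtain B where B: "B \<ge> 0" "\<And>y e. norm y \<le> norm x \<Longrightarrow> norm e = 1 \<Longrightarrow> \<bar>k y e\<bar> \<le> B"
    using rk_bounded[OF k x] by blast
  define F where "F t \<eta> = indicator {0<..<1} t * (t powr a * k (t *\<^sub>R x) \<eta>) * f \<eta>" for t :: real and \<eta>
  have F_le: "\<bar>F t \<eta>\<bar> \<le> ((indicator {0<..<1} t * t powr a) * B) * \<bar>f \<eta>\<bar>" if "\<eta> \<in> space sphere_measure" for t \<eta>
  proof (cases "t \<in> {0<..<1}")
    case True
    then have "norm (t *\<^sub>R x) \<le> norm x" by (simp add: mult_left_le_one_le)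
    then have "\<bar>k (t *\<^sub>R x) \<eta>\<bar> \<le> B" using that by (intro B) auto
    then show ?thesis using True by (simp add: F_def abs_mult mult_left_mono mult_right_mono)
  qed (simp add: F_def)
  have mk: "(\<lambda>p. k (fst p *\<^sub>R x) (snd p)) \<in> borel_measurable (lborel \<Otimes>\<^sub>M sphere_measure)"
  proof -
    have "(\<lambda>p. (fst p, snd p)) \<in> measurable (lborel \<Otimes>\<^sub>M sphere_measure) (borel \<Otimes>\<^sub>M borel)"
    proof (rule measurable_Pair)
      show "fst \<in> borel_measurable (lborel \<Otimes>\<^sub>M sphere_measure)" by measurable
      show "snd \<in> borel_measurable (lborel \<Otimes>\<^sub>M sphere_measure)"
        using measurable_compose[OF measurable_snd id_sphere_measurable] by simp
    qed
    from measurable_compose[OF this measurable_kernel_pair[OF k, of x]] show ?thesis by simp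
  qed
  have [measurable]: "f \<in> borel_measurable sphere_measure" using f by simp
  have mF: "(\<lambda>p. F (fst p) (snd p)) \<in> borel_measurable (lborel \<Otimes>\<^sub>M sphere_measure)"
    unfolding F_def using mk by measurable
  have IF: "integrable (lborel \<Otimes>\<^sub>M sphere_measure) (\<lambda>p. F (fst p) (snd p))"
  proof (rule Fubini_integrable[OF mF])
    have i2: "integrable sphere_measure (\<lambda>\<eta>. F t \<eta>)" for t
    proof (cases "t \<in> {0<..<1}")
      case True
      then have "norm (t *\<^sub>R x) < 1" by (intro scale_in_ball x) auto
      from rk_integrable[OF k f this] show ?thesis by (simp add: F_def mult.assoc)
    qed (simp add: F_def)
    then show "AE t in lborel. integrable sphere_measure (\<lambda>\<eta>. F (fst (t, \<eta>)) (snd (t, \<eta>)))" by simp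
    show "integrable lborel (\<lambda>t. \<integral>\<eta>. norm (F (fst (t, \<eta>)) (snd (t, \<eta>))) \<partial>sphere_measure)"
    proof (rule Bochner_Integration.integrable_bound)
      show "integrable lborel (\<lambda>t. (indicator {0<..<1} t * t powr a) * (B * (\<integral>\<eta>. \<bar>f \<eta>\<bar> \<partial>sphere_measure)))"
        using integrable_powr_01[OF a] by simp
      have "(\<lambda>(t, \<eta>). norm (F t \<eta>)) \<in> borel_measurable (lborel \<Otimes>\<^sub>M sphere_measure)"
        using mF by (simp add: case_prod_beta')
      from S.borel_measurable_lebesgue_integral[OF this]
      show "(\<lambda>t. \<integral>\<eta>. norm (F (fst (t, \<eta>)) (snd (t, \<eta>))) \<partial>sphere_measure) \<in> borel_measurable lborel" by simp
      show "AE t in lborel. norm (\<integral>\<eta>. norm (F (fst (t, \<eta>)) (snd (t, \<eta>))) \<partial>sphere_measure)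
          \<le> norm ((indicator {0<..<1} t * t powr a) * (B * (\<integral>\<eta>. \<bar>f \<eta>\<bar> \<partial>sphere_measure)))"
      proof (rule AE_I2)
        fix t :: real
        have "(\<integral>\<eta>. \<bar>F t \<eta>\<bar> \<partial>sphere_measure) \<le> (\<integral>\<eta>. ((indicator {0<..<1} t * t powr a) * B) * \<bar>f \<eta>\<bar> \<partial>sphere_measure)"
          using i2[of t] f F_le by (intro integral_mono) auto
        then show "norm (\<integral>\<eta>. norm (F (fst (t, \<eta>)) (snd (t, \<eta>))) \<partial>sphere_measure)
          \<le> norm ((indicator {0<..<1} t * t powr a) * (B * (\<integral>\<eta>. \<bar>f \<eta>\<bar> \<partial>sphere_measure)))"
          using B(1) by (simp add: abs_mult mult.assoc)
      qed
    qed
  qed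
  have IF': "integrable (lborel \<Otimes>\<^sub>M sphere_measure) (case_prod F)" using IF by (simp add: case_prod_beta')
  have e: "radial_avg a (\<lambda>y. k y \<eta>) x * f \<eta> = (\<integral>t. F t \<eta> \<partial>lborel)" for \<eta>
    unfolding radial_avg_def F_def by simp
  show "integrable sphere_measure (\<lambda>\<eta>. radial_avg a (\<lambda>y. k y \<eta>) x * f \<eta>)"
    unfolding e by (rule integrable_snd[OF IF'])
  have "(\<integral>\<eta>. radial_avg a (\<lambda>y. k y \<eta>) x * f \<eta> \<partial>sphere_measure) = (\<integral>t. (\<integral>\<eta>. F t \<eta> \<partial>sphere_measure) \<partial>lborel)"
    unfolding e by (rule Fubini_integral[OF IF'])
  also have "\<dots> = radial_avg a (\<lambda>y. \<integral>\<eta>. k y \<eta> * f \<eta> \<partial>sphere_measure) x"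
    unfolding radial_avg_def F_def by (simp add: mult.assoc)
  finally show "(\<integral>\<eta>. radial_avg a (\<lambda>y. k y \<eta>) x * f \<eta> \<partial>sphere_measure) = radial_avg a (\<lambda>y. \<integral>\<eta>. k y \<eta> * f \<eta> \<partial>sphere_measure) x" .
qed

text \<open>The entries of the elastic kernel by a formula that is Borel in \<open>e\<close> on the whole space.\<close>
definition elastic_entry :: "real \<Rightarrow> real \<Rightarrow> vec3 \<Rightarrow> 3 \<Rightarrow> 3 \<Rightarrow> vec3 \<Rightarrow> real" where
  "elastic_entry la mu x i j e = (if i = j then Q0 x e / (4 * pi) else 0)
    + beta_e la mu * (1 - (norm x)\<^sup>2) * (radial_avg (1 - alpha_e la mu) (\<lambda>y. Q2 i j y e) x / (4 * pi))"

lemma elastic_entry_measurable [measurable]: "elastic_entry la mu x i j \<in> borel_measurable borel"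
proof -
  have [measurable]: "(\<lambda>e. radial_avg a (\<lambda>y. Q2 i j y e) x) \<in> borel_measurable borel" "Q0 x \<in> borel_measurable borel" for a
    using measurable_radial_avg_kernel[OF rk_Q2] rk_measurable_snd[OF rk_Q0] by auto
  show ?thesis unfolding elastic_entry_def[abs_def] by measurable
qed

lemma elastic_entry_continuous:
  assumes mu: "mu > 0" "2 * mu + la > 0" and x: "norm x < 1"
  shows "continuous_on (sphere 0 1) (elastic_entry la mu x i j)"
proof -
  have "continuous_on (sphere 0 1) (\<lambda>e. (\<lambda>p. Q0 (fst p) (snd p)) (x, e))"
    by (rule continuous_on_compose2[OF rk_continuous[OF rk_Q0]]) (use x in \<open>auto intro!: continuous_intros\<close>)
  then have "continuous_on (sphere 0 1) (\<lambda>e. if i = j then Q0 x e / (4 * pi) else 0)"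
    by (cases "i = j") (auto intro!: continuous_intros)
  moreover have "continuous_on (sphere 0 1) (\<lambda>e. radial_avg (1 - alpha_e la mu) (\<lambda>y. Q2 i j y e) x)"
    by (rule radial_avg_kernel_continuous[OF rk_Q2 x]) (use alpha_e_bounds[OF mu] in auto)
  ultimately show ?thesis unfolding elastic_entry_def[abs_def] by (intro continuous_intros) auto
qed

lemma elastic_entry_integrable:
  assumes mu: "mu > 0" "2 * mu + la > 0" and x: "norm x < 1" and f: "integrable sphere_measure f"
  shows "integrable sphere_measure (\<lambda>\<eta>. elastic_entry la mu x i j \<eta> * f \<eta>)"
proof -
  have "integrable sphere_measure (\<lambda>\<eta>. (if i = j then 1 / (4 * pi) else 0) * (Q0 x \<eta> * f \<eta>)
      + beta_e la mu * (1 - (norm x)\<^sup>2) / (4 * pi) * (radial_avg (1 - alpha_e la mu) (\<lambda>y. Q2 i j y \<eta>) x * f \<eta>))"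
    by (intro Bochner_Integration.integrable_add integrable_mult_right rk_integrable[OF rk_Q0 f x]
        radial_avg_kernel_fubini(1)[OF rk_Q2 f x]) (use alpha_e_bounds[OF mu] in auto)
  then show ?thesis by (rule Bochner_Integration.integrable_cong[THEN iffD1, rotated -1])
      (auto simp: elastic_entry_def algebra_simps)
qed

lemma integrable_nth: "integrable M f \<Longrightarrow> integrable M (\<lambda>x. (f x :: vec3) $ j)"
  using integrable_bounded_linear[OF bounded_linear_vec_nth] .

lemma integral_nth: "integrable M f \<Longrightarrow> (\<integral>x. f x \<partial>M) $ j = (\<integral>x. (f x :: vec3) $ j \<partial>M)"
  using integral_bounded_linear[OF bounded_linear_vec_nth[of j], of M f] by simp

lemma integrable_vec3I:
  fixes f :: "_ \<Rightarrow> vec3"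
  assumes "\<And>j. integrable M (\<lambda>x. f x $ j)"
  shows "integrable M f"
proof -
  have "integrable M (\<lambda>x. \<Sum>j\<in>UNIV. (f x $ j) *\<^sub>R axis j (1::real))"
    using assms by (intro Bochner_Integration.integrable_sum integrable_scaleR_left) auto
  moreover have "(\<Sum>j\<in>UNIV. (f x $ j) *\<^sub>R axis j (1::real)) = f x" for x
    using basis_expansion[of "f x"] by (simp only: scalar_mult_eq_scaleR)
  ultimately show ?thesis by simp
qed

lemma elastic_kernel_entry_eq:
  assumes "mu > 0" "2 * mu + la > 0" "norm e = 1" "norm x < 1"
  shows "(elastic_kernel la mu x e *v v) $ i = (\<Sum>j\<in>UNIV. elastic_entry la mu x i j e * v $ j)"
  unfolding matrix_vector_mult_def elastic_entry_def using elastic_kernel_eq[OF assms] by simp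

lemma elastic_poisson_integrable:
  assumes mu: "mu > 0" "2 * mu + la > 0" and x: "norm x < 1" and f: "integrable sphere_measure f"
  shows "integrable sphere_measure (\<lambda>\<eta>. elastic_kernel la mu x \<eta> *v f \<eta>)"
proof (rule integrable_vec3I)
  fix i
  have "integrable sphere_measure (\<lambda>\<eta>. \<Sum>j\<in>UNIV. elastic_entry la mu x i j \<eta> * f \<eta> $ j)"
    by (intro Bochner_Integration.integrable_sum elastic_entry_integrable[OF mu x] integrable_nth f)
  then show "integrable sphere_measure (\<lambda>\<eta>. (elastic_kernel la mu x \<eta> *v f \<eta>) $ i)"
    by (rule Bochner_Integration.integrable_cong[THEN iffD1, rotated -1]) (auto simp: elastic_kernel_entry_eq[OF mu _ x])
qed

lemma elastic_poisson_nth: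
  assumes mu: "mu > 0" "2 * mu + la > 0" and x: "norm x < 1" and f: "integrable sphere_measure f"
  shows "elastic_poisson la mu f x $ i = (\<Sum>j\<in>UNIV. \<integral>\<eta>. elastic_entry la mu x i j \<eta> * f \<eta> $ j \<partial>sphere_measure)"
proof -
  have "elastic_poisson la mu f x $ i = (\<integral>\<eta>. (elastic_kernel la mu x \<eta> *v f \<eta>) $ i \<partial>sphere_measure)"
    unfolding elastic_poisson_def by (rule integral_nth[OF elastic_poisson_integrable[OF assms]])
  also have "\<dots> = (\<integral>\<eta>. (\<Sum>j\<in>UNIV. elastic_entry la mu x i j \<eta> * f \<eta> $ j) \<partial>sphere_measure)"
    by (intro Bochner_Integration.integral_cong refl) (auto simp: elastic_kernel_entry_eq[OF mu _ x])
  also have "\<dots> = (\<Sum>j\<in>UNIV. \<integral>\<eta>. elastic_entry la mu x i j \<eta> * f \<eta> $ j \<partial>sphere_measure)"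
    by (intro Bochner_Integration.integral_sum elastic_entry_integrable[OF mu x] integrable_nth f)
  finally show ?thesis .
qed

definition poisson_ext :: "(vec3 \<Rightarrow> vec3) \<Rightarrow> 3 \<Rightarrow> vec3 \<Rightarrow> real" where
  "poisson_ext f j x = 1 / (4 * pi) * (\<integral>\<eta>. Q0 x \<eta> * f \<eta> $ j \<partial>sphere_measure)"

lemma pd_kernel_integral:
  assumes f: "integrable sphere_measure f" and x: "norm x < 1"
  shows "pd i (\<lambda>x. \<integral>\<eta>. Q0 x \<eta> * f \<eta> \<partial>sphere_measure) x = (\<integral>\<eta>. Q1 i x \<eta> * f \<eta> \<partial>sphere_measure)"
    "pd k (\<lambda>x. \<integral>\<eta>. Q1 i x \<eta> * f \<eta> \<partial>sphere_measure) x = (\<integral>\<eta>. Q2 k i x \<eta> * f \<eta> \<partial>sphere_measure)"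
proof -
  have ne: "\<eta> \<in> space sphere_measure \<Longrightarrow> x \<noteq> \<eta>" for \<eta> using x by auto
  show "pd i (\<lambda>x. \<integral>\<eta>. Q0 x \<eta> * f \<eta> \<partial>sphere_measure) x = (\<integral>\<eta>. Q1 i x \<eta> * f \<eta> \<partial>sphere_measure)"
    unfolding rk_integral_deriv(2)[OF rk_Q0 f x]
    using rk_grad(3)[OF rk_Q0 ne] pd_Q0(2)[OF ne] by (intro Bochner_Integration.integral_cong) auto
  show "pd k (\<lambda>x. \<integral>\<eta>. Q1 i x \<eta> * f \<eta> \<partial>sphere_measure) x = (\<integral>\<eta>. Q2 k i x \<eta> * f \<eta> \<partial>sphere_measure)"
    unfolding rk_integral_deriv(2)[OF rk_Q1 f x]
    using rk_grad(3)[OF rk_Q1 ne] pd_Q1(2)[OF ne] by (intro Bochner_Integration.integral_cong) auto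
qed

lemma poisson_ext_props:
  assumes f: "integrable sphere_measure f"
  shows "Ck n (ball 0 1) (poisson_ext f j)"
    and "norm x < 1 \<Longrightarrow> pd i (poisson_ext f j) x = 1 / (4 * pi) * (\<integral>\<eta>. Q1 i x \<eta> * f \<eta> $ j \<partial>sphere_measure)"
    and "norm x < 1 \<Longrightarrow> pd k (pd i (poisson_ext f j)) x = 1 / (4 * pi) * (\<integral>\<eta>. Q2 k i x \<eta> * f \<eta> $ j \<partial>sphere_measure)"
    and "norm x < 1 \<Longrightarrow> (\<Sum>k\<in>UNIV. pd k (pd k (poisson_ext f j)) x) = 0"
proof -
  note fj = integrable_nth[OF f, of j]
  show "Ck n (ball 0 1) (poisson_ext f j)"
    unfolding poisson_ext_def[abs_def] by (intro Ck_cmult rk_integral_Ck[OF rk_Q0 fj]) auto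
  show a: "pd i (poisson_ext f j) x = 1 / (4 * pi) * (\<integral>\<eta>. Q1 i x \<eta> * f \<eta> $ j \<partial>sphere_measure)" if x: "norm x < 1" for i x
    unfolding poisson_ext_def[abs_def] pd_cmult[OF rk_integral_deriv(1)[OF rk_Q0 fj x]] pd_kernel_integral(1)[OF fj x] ..
  show b: "pd k (pd i (poisson_ext f j)) x = 1 / (4 * pi) * (\<integral>\<eta>. Q2 k i x \<eta> * f \<eta> $ j \<partial>sphere_measure)" if x: "norm x < 1" for i k x
  proof -
    have "pd k (pd i (poisson_ext f j)) x = pd k (\<lambda>x. 1 / (4 * pi) * (\<integral>\<eta>. Q1 i x \<eta> * f \<eta> $ j \<partial>sphere_measure)) x"
      by (rule pd_ball_cong[OF x]) (rule a)
    then show ?thesis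
      unfolding pd_cmult[OF rk_integral_deriv(1)[OF rk_Q1 fj x]] pd_kernel_integral(2)[OF fj x] .
  qed
  show "(\<Sum>k\<in>UNIV. pd k (pd k (poisson_ext f j)) x) = 0" if x: "norm x < 1"
  proof -
    have "(\<Sum>k\<in>UNIV. pd k (pd k (poisson_ext f j)) x) = 1 / (4 * pi) * (\<integral>\<eta>. (\<Sum>k\<in>UNIV. Q2 k k x \<eta> * f \<eta> $ j) \<partial>sphere_measure)"
      unfolding b[OF x] sum_distrib_left[symmetric]
      using rk_integrable[OF rk_Q2 fj x] by simp
    also have "(\<integral>\<eta>. (\<Sum>k\<in>UNIV. Q2 k k x \<eta> * f \<eta> $ j) \<partial>sphere_measure) = (\<integral>\<eta>. 0 \<partial>sphere_measure)"
    proof (rule Bochner_Integration.integral_cong[OF refl])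
      fix \<eta> assume "\<eta> \<in> space sphere_measure"
      then have "norm \<eta> = 1" "x \<noteq> \<eta>" using x by auto
      then show "(\<Sum>k\<in>UNIV. Q2 k k x \<eta> * f \<eta> $ j) = 0"
        using Q0_harmonic[of \<eta> x] unfolding sum_distrib_right[symmetric] by simp
    qed
    finally show ?thesis by simp
  qed
qed

text \<open>Fubini moves the radial average outside the integral over the sphere, and the second
  derivatives of the kernel become those of the scalar Poisson integrals. The result has exactly the
  form treated in \<open>lame_from_harmonic\<close>, with \<open>H = poisson_ext f\<close>.\<close>

lemma elastic_poisson_eq:
  assumes mu: "mu > 0" "2 * mu + la > 0" and x: "norm x < 1" and f: "integrable sphere_measure f"
  shows "elastic_poisson la mu f x $ i = poisson_ext f i x + beta_e la mu * (1 - (norm x)\<^sup>2) *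
     radial_avg (1 - alpha_e la mu) (pd i (\<lambda>x. \<Sum>j\<in>UNIV. pd j (poisson_ext f j) x)) x"
proof -
  define a where "a = 1 - alpha_e la mu"
  define be where "be = beta_e la mu * (1 - (norm x)\<^sup>2)"
  have a: "a > -1" using alpha_e_bounds[OF mu] by (simp add: a_def)
  note fj = integrable_nth[OF f]
  have P: "pd i (\<lambda>x. \<Sum>j\<in>UNIV. pd j (poisson_ext f j) x) y = (\<Sum>j\<in>UNIV. 1 / (4 * pi) * (\<integral>\<eta>. Q2 i j y \<eta> * f \<eta> $ j \<partial>sphere_measure))" if y: "norm y < 1" for y
  proof -
    have "pd j (poisson_ext f j) differentiable (at y)" for j
      using Ck_differentiable[OF Ck_pd[OF poisson_ext_props(1)[OF f, of "Suc 1"]], of y] y by simp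
    then have "pd i (\<lambda>x. \<Sum>j\<in>UNIV. pd j (poisson_ext f j) x) y = (\<Sum>j\<in>UNIV. pd i (pd j (poisson_ext f j)) y)"
      by (intro pd_sum) auto
    then show ?thesis using poisson_ext_props(3)[OF f y] by simp
  qed
  have c: "continuous_on (ball 0 1) (\<lambda>y. \<integral>\<eta>. Q2 i j y \<eta> * f \<eta> $ j \<partial>sphere_measure)" for j
    using rk_integral_Ck[OF rk_Q2 fj, of 0] by simp
  have c4: "continuous_on (ball 0 1) (\<lambda>y. 1 / (4 * pi) * (\<integral>\<eta>. Q2 i j y \<eta> * f \<eta> $ j \<partial>sphere_measure))" for j
    using c by (intro continuous_intros) auto
  have "radial_avg a (pd i (\<lambda>x. \<Sum>j\<in>UNIV. pd j (poisson_ext f j) x)) x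
     = radial_avg a (\<lambda>y. \<Sum>j\<in>UNIV. 1 / (4 * pi) * (\<integral>\<eta>. Q2 i j y \<eta> * f \<eta> $ j \<partial>sphere_measure)) x"
    by (rule radial_avg_cong[OF P x])
  also have "\<dots> = (\<Sum>j\<in>UNIV. radial_avg a (\<lambda>y. 1 / (4 * pi) * (\<integral>\<eta>. Q2 i j y \<eta> * f \<eta> $ j \<partial>sphere_measure)) x)"
    by (rule radial_avg_sum[OF _ c4 x a]) simp
  also have "\<dots> = (\<Sum>j\<in>UNIV. (\<integral>\<eta>. radial_avg a (\<lambda>y. Q2 i j y \<eta>) x * f \<eta> $ j \<partial>sphere_measure) / (4 * pi))"
  proof (rule sum.cong[OF refl])
    fix j
    have "radial_avg a (\<lambda>y. 1 / (4 * pi) * (\<integral>\<eta>. Q2 i j y \<eta> * f \<eta> $ j \<partial>sphere_measure)) x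
       = radial_avg a (\<lambda>y. \<integral>\<eta>. Q2 i j y \<eta> * f \<eta> $ j \<partial>sphere_measure) x / (4 * pi)"
      unfolding radial_avg_def by (subst integral_divide_zero[symmetric]) (simp add: mult_ac)
    then show "radial_avg a (\<lambda>y. 1 / (4 * pi) * (\<integral>\<eta>. Q2 i j y \<eta> * f \<eta> $ j \<partial>sphere_measure)) x = (\<integral>\<eta>. radial_avg a (\<lambda>y. Q2 i j y \<eta>) x * f \<eta> $ j \<partial>sphere_measure) / (4 * pi)"
      using radial_avg_kernel_fubini(2)[OF rk_Q2 fj x a] by simp
  qed
  finally have T: "radial_avg a (pd i (\<lambda>x. \<Sum>j\<in>UNIV. pd j (poisson_ext f j) x)) x
    = (\<Sum>j\<in>UNIV. (\<integral>\<eta>. radial_avg a (\<lambda>y. Q2 i j y \<eta>) x * f \<eta> $ j \<partial>sphere_measure) / (4 * pi))" .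
  have "(\<integral>\<eta>. elastic_entry la mu x i j \<eta> * f \<eta> $ j \<partial>sphere_measure) =
    (if i = j then poisson_ext f j x else 0) + be * ((\<integral>\<eta>. radial_avg a (\<lambda>y. Q2 i j y \<eta>) x * f \<eta> $ j \<partial>sphere_measure) / (4 * pi))" for j
  proof -
    have "(\<integral>\<eta>. elastic_entry la mu x i j \<eta> * f \<eta> $ j \<partial>sphere_measure) =
      (\<integral>\<eta>. (if i = j then 1 / (4 * pi) else 0) * (Q0 x \<eta> * f \<eta> $ j) + be / (4 * pi) * (radial_avg a (\<lambda>y. Q2 i j y \<eta>) x * f \<eta> $ j) \<partial>sphere_measure)"
      by (intro Bochner_Integration.integral_cong refl) (auto simp: elastic_entry_def a_def be_def algebra_simps)
    also have "\<dots> = (if i = j then 1 / (4 * pi) else 0) * (\<integral>\<eta>. Q0 x \<eta> * f \<eta> $ j \<partial>sphere_measure)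
       + be / (4 * pi) * (\<integral>\<eta>. radial_avg a (\<lambda>y. Q2 i j y \<eta>) x * f \<eta> $ j \<partial>sphere_measure)"
      using rk_integrable[OF rk_Q0 fj x] radial_avg_kernel_fubini(1)[OF rk_Q2 fj x a]
      by (subst Bochner_Integration.integral_add) auto
    finally show ?thesis by (simp add: poisson_ext_def)
  qed
  then show ?thesis unfolding elastic_poisson_nth[OF mu x f] a_def[symmetric] be_def[symmetric] T
    by (simp add: sum.distrib sum_distrib_left)
qed

lemma lame_solution_cong:
  assumes u: "lame_solution la mu u" and eq: "\<And>x. norm x < 1 \<Longrightarrow> u x = v x"
  shows "lame_solution la mu v"
proof -
  have C: "C2_on (ball 0 1) (\<lambda>y. v y $ k)" for k
  proof -
    have "C2_on (ball 0 1) (\<lambda>y. u y $ k)" using u by (simp add: lame_solution_def)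
    then show ?thesis unfolding C2_on_iff_Ck by (subst Ck_cong[OF open_ball, symmetric]) (auto simp: eq)
  qed
  have p: "pd i (\<lambda>y. u y $ k) x = pd i (\<lambda>y. v y $ k) x" if "norm x < 1" for i k x
    by (rule pd_ball_cong[OF that]) (simp add: eq)
  have p2: "pd j (pd i (\<lambda>y. u y $ k)) x = pd j (pd i (\<lambda>y. v y $ k)) x" if "norm x < 1" for i j k x
    by (rule pd_ball_cong[OF that]) (rule p)
  have d: "pd k (divg u) x = pd k (divg v) x" if "norm x < 1" for k x
    by (rule pd_ball_cong[OF that]) (simp add: divg_def p)
  have "lame_op la mu v x = lame_op la mu u x" if "norm x < 1" for x
    unfolding lame_op_def using p2[OF that] d[OF that] by simp
  then show ?thesis using u C by (simp add: lame_solution_def)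
qed

theorem elastic_poisson_lame:
  assumes mu: "mu > 0" "2 * mu + la > 0" and f: "integrable sphere_measure f"
  shows "lame_solution la mu (elastic_poisson la mu f)"
  using lame_from_harmonic[where H = "poisson_ext f", OF mu poisson_ext_props(1)[OF f] poisson_ext_props(4)[OF f]]
  by (rule lame_solution_cong) (simp_all add: vec_eq_iff elastic_poisson_eq[OF mu _ f])

section \<open>Differentiation of measures on the sphere\<close>

text \<open>A point of the hull is \<open>(1 - v) xi + v z\<close> with
  \<open>norm z <= 1/2\<close>. Then \<open>1 - norm x >= v / 2\<close>, while
  \<open>norm (x - xi) <= (3/2) v\<close>. The cone enters the estimates only through the aperture
  condition with constant 3.\<close>

lemma Gamma_props:
  assumes "x \<in> Gamma \<xi>" "norm \<xi> = 1"
  shows "norm x < 1" "norm (x - \<xi>) \<le> 3 * (1 - norm x)"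
proof -
  show x1: "norm x < 1" using assms(1) by (simp add: Gamma_def)
  have "x \<in> convex hull (insert \<xi> (cball 0 (1/2)))" using assms(1) by (simp add: Gamma_def)
  then obtain u v z where uv: "u \<ge> 0" "v \<ge> 0" "u + v = 1" "z \<in> convex hull (cball (0::vec3) (1/2))" "x = u *\<^sub>R \<xi> + v *\<^sub>R z"
    by (subst (asm) convex_hull_insert) auto
  then have z: "norm z \<le> 1/2" using convex_hull_eq[of "cball (0::vec3) (1/2)"] by simp
  have u: "u = 1 - v" using uv by simp
  have "norm x \<le> (1 - v) * norm \<xi> + v * norm z"
    unfolding uv(5) u using norm_triangle_ineq[of "(1 - v) *\<^sub>R \<xi>" "v *\<^sub>R z"] uv by simp
  also have "\<dots> \<le> (1 - v) + v * (1/2)"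
    unfolding assms(2) mult_1_right by (intro add_left_mono mult_left_mono z uv(2))
  finally have v: "v \<le> 2 * (1 - norm x)" by simp
  have "x - \<xi> = v *\<^sub>R (z - \<xi>)" unfolding uv(5) u by (simp add: algebra_simps)
  then have "norm (x - \<xi>) = v * norm (z - \<xi>)" using uv by simp
  also have "\<dots> \<le> v * (3/2)"
    using norm_triangle_ineq4[of z \<xi>] z assms(2) uv by (intro mult_left_mono) auto
  finally show "norm (x - \<xi>) \<le> 3 * (1 - norm x)" using v by simp
qed

lemma dyadic_scale:
  fixes c :: real
  assumes "1 \<le> c"
  shows "\<exists>k. 2 ^ k \<le> c \<and> c < 2 ^ Suc k"
proof -
  obtain n where "c < 2 ^ n" using real_arch_pow[of 2 c] by auto
  then have ex: "\<exists>n. c < 2 ^ n" ..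
  define m where "m = (LEAST n. c < 2 ^ n)"
  have m: "c < 2 ^ m" unfolding m_def by (rule LeastI_ex[OF ex])
  then have "m \<noteq> 0" using assms by (intro notI) auto
  then obtain k where k: "m = Suc k" by (cases m) auto
  have "\<not> c < 2 ^ k" using not_less_Least[of k "\<lambda>n. c < 2 ^ n"] k unfolding m_def by simp
  then show ?thesis using m k by (auto simp: not_less)
qed

lemma AE_norm_1:
  fixes \<nu> :: "vec3 measure"
  assumes "sets \<nu> = sets borel" "emeasure \<nu> (- sphere 0 1) = 0"
  shows "AE \<eta> in \<nu>. norm \<eta> = 1"
proof -
  have "- sphere (0::vec3) 1 \<in> sets borel" by (intro borel_open) auto
  then have "- sphere 0 1 \<in> null_sets \<nu>" using assms by (intro null_setsI) simp_all
  from AE_not_in[OF this] show ?thesis by (rule eventually_mono) auto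
qed

text \<open>Put \<open>d = 1 - norm x\<close>. The points \<open>eta\<close> with
  \<open>norm (x - eta)\<close> between \<open>2^k d\<close> and \<open>2^(k+1) d\<close> lie within
  \<open>2^(k+1) d + 3 d <= 5 * 2^k d\<close> of \<open>xi\<close>. On this ring the kernel is at
  most \<open>d^s / (2^k d)^(2+s)\<close>, so its integral is at most \<open>25 L 2^(-k s)\<close>,
  and the geometric series converges for every \<open>s > 0\<close>. The case \<open>s = 1\<close>
  is the majorant of the elastic kernel; \<open>s = 1/4\<close> serves Lipschitz boundary
  data.\<close>

lemma maximal_kernel_bound:
  fixes \<nu> :: "vec3 measure"
  assumes sets: "sets \<nu> = sets borel" and supp: "emeasure \<nu> (- sphere 0 1) = 0"
    and \<xi>: "norm \<xi> = 1" and lam: "0 \<le> L"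
    and M: "\<And>r. 0 < r \<Longrightarrow> emeasure \<nu> (ball \<xi> r) \<le> ennreal (L * r\<^sup>2)"
    and x: "norm x < 1" "norm (x - \<xi>) \<le> 3 * (1 - norm x)" and s: "0 < s"
  shows "(\<integral>\<^sup>+\<eta>. ennreal ((1 - norm x) powr s / norm (x - \<eta>) powr (2 + s)) \<partial>\<nu>) \<le> ennreal (25 / (1 - 2 powr (- s)) * L)"
proof -
  define d where "d = 1 - norm x"
  have d: "d > 0" using x by (simp add: d_def)
  have [measurable_cong]: "sets \<nu> = sets borel" by fact
  define c where "c k = d powr s / (2 ^ k * d) powr (2 + s)" for k :: nat
  define R where "R k = 5 * (2 ^ k * d)" for k :: nat
  have c0: "c k \<ge> 0" for k by (simp add: c_def)
  have R0: "R k > 0" for k using d by (simp add: R_def)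
  have pt: "ennreal (d powr s / norm (x - \<eta>) powr (2 + s)) \<le> (\<Sum>k. ennreal (c k) * indicator (ball \<xi> (R k)) \<eta>)"
    if \<eta>: "norm \<eta> = 1" for \<eta>
  proof -
    define \<rho> where "\<rho> = norm (x - \<eta>)"
    have \<rho>: "d \<le> \<rho>" using norm_triangle_ineq2[of \<eta> x] \<eta> by (simp add: d_def \<rho>_def norm_minus_commute)
    then have "1 \<le> \<rho> / d" using d by simp
    then obtain k where k: "2 ^ k \<le> \<rho> / d" "\<rho> / d < 2 ^ Suc k" using dyadic_scale by blast
    have k1: "2 ^ k * d \<le> \<rho>" "\<rho> < 2 * (2 ^ k * d)" using k d by (auto simp: field_simps)
    have "norm (\<eta> - \<xi>) \<le> \<rho> + norm (x - \<xi>)"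
      using norm_triangle_ineq4[of "x - \<xi>" "x - \<eta>"] by (simp add: \<rho>_def)
    also have "\<dots> < 2 * (2 ^ k * d) + 3 * d" using k1 x by (simp add: d_def)
    also have "\<dots> \<le> R k"
    proof -
      have "1 * d \<le> 2 ^ k * d" using d by (intro mult_right_mono) auto
      then show ?thesis unfolding R_def by linarith
    qed
    finally have \<eta>R: "\<eta> \<in> ball \<xi> (R k)" by (simp add: dist_norm norm_minus_commute)
    have "d powr s / \<rho> powr (2 + s) \<le> c k"
      unfolding c_def using d k1 s by (intro divide_left_mono powr_mono2 mult_pos_pos) auto
    then have "ennreal (d powr s / \<rho> powr (2 + s)) \<le> ennreal (c k) * indicator (ball \<xi> (R k)) \<eta>"
      using \<eta>R by (simp add: ennreal_leI)
    also have "\<dots> \<le> (\<Sum>k. ennreal (c k) * indicator (ball \<xi> (R k)) \<eta>)"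
    proof -
      define F where "F k = ennreal (c k) * indicator (ball \<xi> (R k)) \<eta>" for k
      have "F k \<le> suminf F" using sum_le_suminf[OF summableI, of "{k}" F] by simp
      then show ?thesis by (simp only: F_def[abs_def])
    qed
    finally show ?thesis by (simp add: \<rho>_def)
  qed
  note AE = AE_norm_1[OF sets supp]
  have coeff: "c k * (L * (R k)\<^sup>2) = 25 * L * (2 powr (- s)) ^ k" for k
  proof -
    define w where "w = 2 ^ k * d"
    have w: "w > 0" using d by (simp add: w_def)
    have pw: "(2 ^ k) powr s = 1 / (2 powr (- s)) ^ k"
    proof -
      have "(2 ^ k) powr s = (2 powr real k) powr s" by (simp add: powr_realpow)
      also have "\<dots> = (2 powr s) ^ k" by (simp add: powr_powr powr_power mult.commute)
      finally show ?thesis by (simp add: powr_minus_divide power_divide)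
    qed
    have "w powr (2 + s) = w\<^sup>2 * w powr s"
      using w by (simp add: powr_add)
    also have "w powr s = 1 / (2 powr (- s)) ^ k * d powr s"
      unfolding pw[symmetric] w_def using d by (simp add: powr_mult)
    finally have W: "w powr (2 + s) = w\<^sup>2 * (1 / (2 powr (- s)) ^ k * d powr s)" .
    have alg: "q / (w\<^sup>2 * (1 / p * q)) * (L * (5 * w)\<^sup>2) = 25 * L * p" if "p > 0" "q > 0" for p q :: real
      using that w by (simp add: field_simps power2_eq_square)
    show ?thesis unfolding c_def R_def w_def[symmetric] W by (rule alg) (use d in auto)
  qed
  have "(\<integral>\<^sup>+\<eta>. ennreal (d powr s / norm (x - \<eta>) powr (2 + s)) \<partial>\<nu>) \<le> (\<integral>\<^sup>+\<eta>. (\<Sum>k. ennreal (c k) * indicator (ball \<xi> (R k)) \<eta>) \<partial>\<nu>)"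
    by (rule nn_integral_mono_AE) (use AE pt in auto)
  also have "\<dots> = (\<Sum>k. \<integral>\<^sup>+\<eta>. ennreal (c k) * indicator (ball \<xi> (R k)) \<eta> \<partial>\<nu>)"
    by (rule nn_integral_suminf) (intro borel_measurable_times_ennreal borel_measurable_const borel_measurable_indicator, simp add: sets)
  also have "\<dots> = (\<Sum>k. ennreal (c k) * emeasure \<nu> (ball \<xi> (R k)))"
    using sets by (simp add: nn_integral_cmult_indicator)
  also have "\<dots> \<le> (\<Sum>k. ennreal (25 * L * (2 powr (- s)) ^ k))"
  proof (rule suminf_le)
    fix k
    have "ennreal (c k) * emeasure \<nu> (ball \<xi> (R k)) \<le> ennreal (c k) * ennreal (L * (R k)\<^sup>2)"
      by (intro mult_left_mono M R0) simp
    also have "\<dots> = ennreal (25 * L * (2 powr (- s)) ^ k)"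
      unfolding coeff[symmetric] using c0 by (simp add: ennreal_mult')
    finally show "ennreal (c k) * emeasure \<nu> (ball \<xi> (R k)) \<le> ennreal (25 * L * (2 powr (- s)) ^ k)" .
  qed auto
  also have "\<dots> = ennreal (25 / (1 - 2 powr (- s)) * L)"
  proof (rule suminf_ennreal_eq)
    have "2 powr (- s) < (2::real) powr 0" using s by (intro powr_less_mono) auto
    then have "(\<lambda>k. (2 powr (- s)) ^ k) sums (1 / (1 - 2 powr (- s)))" by (intro geometric_sums) simp
    from sums_mult[OF this, of "25 * L"]
    show "(\<lambda>k. 25 * L * (2 powr (- s)) ^ k) sums (25 / (1 - 2 powr (- s)) * L)" by simp
  qed (use lam in simp)
  finally show ?thesis unfolding d_def .
qed

section \<open>Maximal function and density points\<close>

lemma emeasure_UN_countable_le: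
  assumes C: "countable C" and X: "\<And>j. j \<in> C \<Longrightarrow> X j \<in> sets M"
  shows "emeasure M (\<Union>j\<in>C. X j) \<le> (\<integral>\<^sup>+j. emeasure M (X j) \<partial>count_space C)"
proof (cases "finite C")
  case True
  then have "emeasure M (\<Union>j\<in>C. X j) \<le> (\<Sum>j\<in>C. emeasure M (X j))"
    using X by (intro emeasure_subadditive_finite) auto
  then show ?thesis using True by (simp add: nn_integral_count_space_finite)
next
  case False
  note b = bij_betw_from_nat_into[OF C False]
  have "(\<Union>j\<in>C. X j) = (\<Union>n. X (from_nat_into C n))"
    by (subst (1) bij_betw_imp_surj_on[OF b, symmetric]) simp
  also have "emeasure M \<dots> \<le> (\<Sum>n. emeasure M (X (from_nat_into C n)))"
    using X bij_betwE[OF b] by (intro emeasure_subadditive_countably) auto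
  also have "\<dots> = (\<integral>\<^sup>+n. emeasure M (X (from_nat_into C n)) \<partial>count_space UNIV)"
    by (simp add: nn_integral_count_space_nat)
  also have "\<dots> = (\<integral>\<^sup>+j. emeasure M (X j) \<partial>count_space C)"
    by (rule nn_integral_bij_count_space[OF b])
  finally show ?thesis .
qed

text \<open>Vitali's lemma selects disjoint balls whose fivefold enlargements cover the bad set. The
  surface measure of an enlarged ball is at most \<open>48 * 25 = 1200\<close> times
  \<open>unit_vol * r^2\<close>, and \<open>r^2\<close> is below the mass of the original ball
  divided by \<open>L\<close>. The estimate is phrased with a Borel superset, which sidesteps the
  measurability of the bad set.\<close>

lemma maximal_weak_type:
  assumes sets: "sets \<nu> = sets borel" and fin: "emeasure \<nu> UNIV < \<infinity>" and lam: "0 < L"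
  shows "\<exists>A\<in>sets borel. {\<xi>. norm \<xi> = 1 \<and> (\<exists>r>0. emeasure \<nu> (ball \<xi> r) > ennreal (L * r\<^sup>2))} \<subseteq> A
     \<and> emeasure sphere_borel A \<le> ennreal (1200 * unit_vol / L) * emeasure \<nu> UNIV"
proof -
  define E where "E = {\<xi>. norm \<xi> = 1 \<and> (\<exists>r>0. emeasure \<nu> (ball \<xi> r) > ennreal (L * r\<^sup>2))}"
  have "\<forall>\<xi>\<in>E. \<exists>r. r > 0 \<and> emeasure \<nu> (ball \<xi> r) > ennreal (L * r\<^sup>2)" by (auto simp: E_def)
  then obtain r where r: "\<And>\<xi>. \<xi> \<in> E \<Longrightarrow> r \<xi> > 0 \<and> emeasure \<nu> (ball \<xi> (r \<xi>)) > ennreal (L * (r \<xi>)\<^sup>2)"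
    by metis
  define m where "m = enn2real (emeasure \<nu> UNIV)"
  have m: "emeasure \<nu> UNIV = ennreal m" "m \<ge> 0" using fin by (auto simp: m_def)
  have spc: "space \<nu> = UNIV" using sets_eq_imp_space_eq[OF sets] by simp
  \<comment> \<open>Vitali's lemma wants bounded radii. The total mass bounds \<open>r^2\<close> by
    \<open>m / L\<close>, and \<open>2 r <= r^2 + 1\<close> turns this into a bound for
    \<open>r\<close> free of square roots.\<close>
  have rB: "r \<xi> \<le> m / L + 1" if "\<xi> \<in> E" for \<xi>
  proof -
    have "ennreal (L * (r \<xi>)\<^sup>2) \<le> ennreal m"
      using order_trans[OF less_imp_le[OF conjunct2[OF r[OF that]]] emeasure_space] unfolding spc m(1) .
    then have "L * (r \<xi>)\<^sup>2 \<le> m" using ennreal_le_iff[OF m(2)] by blast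
    then have a: "(r \<xi>)\<^sup>2 \<le> m / L" using lam by (simp add: field_simps)
    have "0 \<le> (r \<xi> - 1)\<^sup>2" by simp
    then have "2 * r \<xi> \<le> (r \<xi>)\<^sup>2 + 1" by (simp add: power2_eq_square algebra_simps)
    then have "2 * r \<xi> \<le> m / L + 1" using a by linarith
    then show ?thesis using r[OF that] by linarith
  qed
  obtain C where C: "countable C" "C \<subseteq> E"
     "pairwise (\<lambda>i j. disjnt (cball i (r i)) (cball j (r j))) C"
     "\<And>i. i \<in> E \<Longrightarrow> \<exists>j. j \<in> C \<and> \<not> disjnt (cball i (r i)) (cball j (r j)) \<and> cball i (r i) \<subseteq> ball j (5 * r j)"
  proof (rule Vitali_covering_lemma_cballs_balls[of E r "m / L + 1" "\<lambda>x. x"])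
    show "i \<in> E \<Longrightarrow> 0 < r i \<and> r i \<le> m / L + 1" for i using r rB by blast
  qed (rule that; blast)
  define A where "A = (\<Union>j\<in>C. ball j (5 * r j))"
  have EA: "E \<subseteq> A"
  proof
    fix \<xi> assume "\<xi> \<in> E"
    then obtain j where "j \<in> C" "cball \<xi> (r \<xi>) \<subseteq> ball j (5 * r j)" using C(4) by blast
    moreover have "\<xi> \<in> cball \<xi> (r \<xi>)" using r[OF \<open>\<xi> \<in> E\<close>] by simp
    ultimately show "\<xi> \<in> A" unfolding A_def by blast
  qed
  have "emeasure sphere_borel A \<le> (\<integral>\<^sup>+j. emeasure sphere_borel (ball j (5 * r j)) \<partial>count_space C)"
    unfolding A_def by (rule emeasure_UN_countable_le) (use C in auto)
  also have "\<dots> \<le> (\<integral>\<^sup>+j. ennreal (1200 * unit_vol / L) * emeasure \<nu> (ball j (r j)) \<partial>count_space C)"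
  proof (rule nn_integral_mono)
    fix j assume "j \<in> space (count_space C)"
    then have j: "j \<in> E" using C by auto
    then have "emeasure sphere_borel (ball j (5 * r j)) \<le> ennreal (48 * unit_vol * (5 * r j)\<^sup>2)"
      using r by (intro sphere_borel_ball_le) (auto simp: E_def)
    also have "48 * unit_vol * (5 * r j)\<^sup>2 = (1200 * unit_vol / L) * (L * (r j)\<^sup>2)"
      using lam by (simp add: power_mult_distrib)
    also have "ennreal \<dots> = ennreal (1200 * unit_vol / L) * ennreal (L * (r j)\<^sup>2)"
      using lam by (intro ennreal_mult') auto
    also have "\<dots> \<le> ennreal (1200 * unit_vol / L) * emeasure \<nu> (ball j (r j))"
      using r[OF j] by (intro mult_left_mono) auto
    finally show "emeasure sphere_borel (ball j (5 * r j)) \<le> ennreal (1200 * unit_vol / L) * emeasure \<nu> (ball j (r j))" .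
  qed
  also have "\<dots> = ennreal (1200 * unit_vol / L) * (\<integral>\<^sup>+j. emeasure \<nu> (ball j (r j)) \<partial>count_space C)"
    by (rule nn_integral_cmult) simp
  also have "(\<integral>\<^sup>+j. emeasure \<nu> (ball j (r j)) \<partial>count_space C) = emeasure \<nu> (\<Union>j\<in>C. ball j (r j))"
  proof (rule emeasure_UN_countable[symmetric])
    show "disjoint_family_on (\<lambda>j. ball j (r j)) C"
      unfolding disjoint_family_on_def
    proof safe
      fix i j x assume "i \<in> C" "j \<in> C" "i \<noteq> j" "x \<in> ball i (r i)" "x \<in> ball j (r j)"
      then have "disjnt (cball i (r i)) (cball j (r j))" using C(3) by (auto simp: pairwise_def)
      then have "\<not> (x \<in> cball i (r i) \<and> x \<in> cball j (r j))" by (simp only: disjnt_iff) blast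
      then show "x \<in> {}" using \<open>x \<in> ball i (r i)\<close> \<open>x \<in> ball j (r j)\<close> by simp
    qed
  qed (use C sets in auto)
  also have "ennreal (1200 * unit_vol / L) * emeasure \<nu> (\<Union>j\<in>C. ball j (r j)) \<le> ennreal (1200 * unit_vol / L) * emeasure \<nu> UNIV"
    using emeasure_space[of \<nu> "\<Union>j\<in>C. ball j (r j)"] spc by (intro mult_left_mono) auto
  finally have "emeasure sphere_borel A \<le> ennreal (1200 * unit_vol / L) * emeasure \<nu> UNIV" .
  moreover have "A \<in> sets borel" unfolding A_def using C(1) by (intro sets.countable_UN') auto
  ultimately show ?thesis using EA unfolding E_def by blast
qed

text \<open>Vanishing density relative to surface measure, for which a small cap of radius
  \<open>r\<close> has mass of order \<open>r^2\<close>.\<close>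

definition zero_density :: "vec3 measure \<Rightarrow> vec3 \<Rightarrow> bool" where
  "zero_density \<nu> \<xi> \<longleftrightarrow> (\<forall>e>0. \<exists>r0>0. \<forall>r. 0 < r \<and> r < r0 \<longrightarrow> emeasure \<nu> (ball \<xi> r) \<le> ennreal (e * r\<^sup>2))"

lemma AE_sphere_borel_norm: "AE \<xi> in sphere_borel. norm \<xi> = 1"
  by (rule AE_norm_1[OF sets_sphere_borel emeasure_sphere_borel_complement])

text \<open>By outer regularity \<open>A\<close> lies in an open set \<open>U\<close> of small mass.
  Around a point of \<open>A\<close> small balls are contained in \<open>U\<close>, so only the
  restriction of the measure to \<open>U\<close> is felt there, and the weak type estimate makes its
  large densities rare. Letting the mass of \<open>U\<close> tend to 0 for fixed \<open>e\<close>,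
  and then \<open>e\<close> run through \<open>1 / (n + 1)\<close>, gives the claim.\<close>

lemma AE_zero_density:
  assumes sets: "sets \<nu> = sets borel" and fin: "emeasure \<nu> UNIV < \<infinity>"
    and A: "A \<in> sets borel" "emeasure \<nu> A = 0"
  shows "AE \<xi> in sphere_borel. \<xi> \<in> A \<longrightarrow> zero_density \<nu> \<xi>"
proof -
  have spc: "space \<nu> = UNIV" using sets_eq_imp_space_eq[OF sets] by simp
  have [measurable_cong]: "sets \<nu> = sets borel" by fact
  have one: "AE \<xi> in sphere_borel. \<xi> \<in> A \<longrightarrow> (\<exists>r0>0. \<forall>r. 0 < r \<and> r < r0 \<longrightarrow> emeasure \<nu> (ball \<xi> r) \<le> ennreal (e * r\<^sup>2))"
    if e: "e > 0" for e :: real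
  proof -
    define Bad where "Bad = {\<xi>. norm \<xi> = 1 \<and> \<xi> \<in> A \<and> \<not> (\<exists>r0>0. \<forall>r. 0 < r \<and> r < r0 \<longrightarrow> emeasure \<nu> (ball \<xi> r) \<le> ennreal (e * r\<^sup>2))}"
    have "\<exists>N\<in>sets borel. Bad \<subseteq> N \<and> emeasure sphere_borel N \<le> ennreal (1 / real (Suc n))" for n
    proof -
      \<comment> \<open>Chosen so that the weak type bound \<open>1200 * unit_vol / e * t\<close> is
        at most \<open>1 / (n + 1)\<close>; the added 1 keeps the denominator positive when only
        \<open>unit_vol >= 0\<close> is at hand.\<close>
      define t where "t = e / (1200 * unit_vol * real (Suc n) + 1)"
      have V: "unit_vol \<ge> 0" by simp
      have t: "t > 0" using e V by (auto simp: t_def intro!: divide_pos_pos add_nonneg_pos)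
      have "(INF U\<in>{U. A \<subseteq> U \<and> open U}. emeasure \<nu> U) < ennreal t"
        using outer_regular[OF sets _ A(1)] A(2) fin spc t by simp
      then obtain U where U: "A \<subseteq> U" "open U" "emeasure \<nu> U < ennreal t"
        by (auto simp: INF_less_iff)
      define \<nu>' where "\<nu>' = density \<nu> (indicator U)"
      have s': "sets \<nu>' = sets borel" by (simp add: \<nu>'_def sets)
      have U': "U \<in> sets \<nu>" using U(2) sets by simp
      have em: "emeasure \<nu>' X = emeasure \<nu> (U \<inter> X)" if "X \<in> sets borel" for X
        unfolding \<nu>'_def using that sets U' by (intro emeasure_restricted) auto
      have tot: "emeasure \<nu>' UNIV = emeasure \<nu> U" using em[of UNIV] by simp
      have fin': "emeasure \<nu>' UNIV < \<infinity>" unfolding tot using less_trans[OF U(3) ennreal_less_top] by simp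
      obtain N where N: "N \<in> sets borel" "{\<xi>. norm \<xi> = 1 \<and> (\<exists>r>0. emeasure \<nu>' (ball \<xi> r) > ennreal (e * r\<^sup>2))} \<subseteq> N"
        "emeasure sphere_borel N \<le> ennreal (1200 * unit_vol / e) * emeasure \<nu>' UNIV"
        using maximal_weak_type[OF s' fin' e] by blast
      have "Bad \<subseteq> N"
      proof
        fix \<xi> assume b: "\<xi> \<in> Bad"
        then have "\<xi> \<in> U" using U by (auto simp: Bad_def)
        then obtain r1 where r1: "r1 > 0" "ball \<xi> r1 \<subseteq> U" using U(2) open_contains_ball by blast
        then obtain r where r: "0 < r" "r < r1" "\<not> emeasure \<nu> (ball \<xi> r) \<le> ennreal (e * r\<^sup>2)"
          using b unfolding Bad_def by blast
        have "U \<inter> ball \<xi> r = ball \<xi> r" using r1 r by (auto intro: subsetD)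
        then have "emeasure \<nu>' (ball \<xi> r) > ennreal (e * r\<^sup>2)" using em[of "ball \<xi> r"] r by (simp add: not_le)
        then show "\<xi> \<in> N" using N(2) b r by (auto simp: Bad_def)
      qed
      moreover have "ennreal (1200 * unit_vol / e) * emeasure \<nu>' UNIV \<le> ennreal (1 / real (Suc n))"
      proof -
        have "ennreal (1200 * unit_vol / e) * emeasure \<nu>' UNIV \<le> ennreal (1200 * unit_vol / e) * ennreal t"
          using U(3) tot by (intro mult_left_mono) auto
        also have "\<dots> = ennreal (1200 * unit_vol / e * t)" using e t by (subst ennreal_mult') auto
        also have "1200 * unit_vol / e * t = 1200 * unit_vol / (1200 * unit_vol * real (Suc n) + 1)"
          using e by (simp add: t_def)
        also have "\<dots> \<le> 1 / real (Suc n)"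
        proof -
          have "0 < 1200 * unit_vol * real (Suc n) + 1" using V by (simp add: add_nonneg_pos)
          then show ?thesis by (subst frac_le_eq) (auto intro!: divide_nonpos_pos mult_pos_pos simp: algebra_simps)
        qed
        finally show ?thesis by (simp add: ennreal_leI)
      qed
      ultimately show ?thesis using N by (intro bexI[of _ N]) (auto intro: order_trans)
    qed
    then obtain N where N: "\<And>n. N n \<in> sets borel" "\<And>n. Bad \<subseteq> N n" "\<And>n. emeasure sphere_borel (N n) \<le> ennreal (1 / real (Suc n))"
      by metis
    define Z where "Z = (\<Inter>n. N n)"
    have Zs: "Z \<in> sets borel" unfolding Z_def using N(1) by auto
    have "emeasure sphere_borel Z \<le> ennreal (1 / real (Suc n))" for n
      using emeasure_mono[of Z "N n" sphere_borel] N(1)[of n] N(3)[of n] by (auto simp: Z_def intro: order_trans)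
    then have "emeasure sphere_borel Z \<le> 0"
    proof (intro LIMSEQ_le_const)
      show "(\<lambda>n. ennreal (1 / real (Suc n))) \<longlonglongrightarrow> 0"
        using tendsto_ennrealI[OF LIMSEQ_inverse_real_of_nat] by (simp only: inverse_eq_divide ennreal_0)
    qed auto
    then have "Z \<in> null_sets sphere_borel" using Zs by (simp add: null_sets_def)
    then have "AE \<xi> in sphere_borel. \<xi> \<notin> Z" by (rule AE_not_in)
    then show ?thesis
      using AE_sphere_borel_norm
    proof eventually_elim
      case (elim \<xi>)
      then have "\<xi> \<notin> Bad" using N(2) by (auto simp: Z_def)
      then show ?case using elim by (auto simp: Bad_def)
    qed
  qed
  have "AE \<xi> in sphere_borel. \<forall>n. \<xi> \<in> A \<longrightarrow> (\<exists>r0>0. \<forall>r. 0 < r \<and> r < r0 \<longrightarrow> emeasure \<nu> (ball \<xi> r) \<le> ennreal (1 / real (Suc n) * r\<^sup>2))"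
    unfolding AE_all_countable by (intro allI one) simp
  then show ?thesis
  proof eventually_elim
    case (elim \<xi>)
    show ?case unfolding zero_density_def
    proof (intro impI allI)
      fix e :: real assume "\<xi> \<in> A" "e > 0"
      then obtain n where n: "1 / real (Suc n) < e" using reals_Archimedean[of e] by (auto simp: inverse_eq_divide)
      obtain r0 where r0: "r0 > 0" "\<And>r. 0 < r \<Longrightarrow> r < r0 \<Longrightarrow> emeasure \<nu> (ball \<xi> r) \<le> ennreal (1 / real (Suc n) * r\<^sup>2)"
        using elim \<open>\<xi> \<in> A\<close> by blast
      have "ennreal (1 / real (Suc n) * r\<^sup>2) \<le> ennreal (e * r\<^sup>2)" for r
        using n by (intro ennreal_leI mult_right_mono) auto
      then show "\<exists>r0>0. \<forall>r. 0 < r \<and> r < r0 \<longrightarrow> emeasure \<nu> (ball \<xi> r) \<le> ennreal (e * r\<^sup>2)"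
        using r0 by (intro exI[of _ r0]) (auto intro: order_trans)
    qed
  qed
qed

lemma measurable_sphere_borel_eq [simp]: "measurable sphere_borel N = measurable borel N"
  by (rule measurable_cong_sets) auto

text \<open>The part of the measure in a small ball about \<open>xi\<close> has small density at
  every scale, so \<open>maximal_kernel_bound\<close> with \<open>s = 1\<close> controls it. The
  remaining part stays at a fixed distance from \<open>x\<close>, where the factor
  \<open>1 - norm x\<close> makes the kernel small.\<close>

lemma zero_density_kernel_small:
  fixes \<nu> :: "vec3 measure"
  assumes sets: "sets \<nu> = sets borel" and supp: "emeasure \<nu> (- sphere 0 1) = 0"
    and fin: "emeasure \<nu> UNIV < \<infinity>" and \<xi>: "norm \<xi> = 1" and d0: "zero_density \<nu> \<xi>" and e: "0 < e"
  shows "\<exists>d>0. \<forall>x. norm x < 1 \<and> norm (x - \<xi>) \<le> 3 * (1 - norm x) \<and> norm (x - \<xi>) < d \<longrightarrow>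
     (\<integral>\<^sup>+\<eta>. ennreal ((1 - norm x) / norm (x - \<eta>) ^ 3) \<partial>\<nu>) \<le> ennreal e"
proof -
  have spc: "space \<nu> = UNIV" using sets_eq_imp_space_eq[OF sets] by simp
  \<comment> \<open>The series constant for \<open>s = 1\<close> is
    \<open>25 / (1 - 1/2) = 50\<close>, so the near part contributes at most
    \<open>e / 2\<close>.\<close>
  define L where "L = e / 100"
  have L: "L > 0" using e by (simp add: L_def)
  obtain r1 where r1: "r1 > 0" "\<And>r. 0 < r \<Longrightarrow> r < r1 \<Longrightarrow> emeasure \<nu> (ball \<xi> r) \<le> ennreal (L * r\<^sup>2)"
    using d0 L unfolding zero_density_def by blast
  define r0 where "r0 = r1 / 2"
  have r0: "r0 > 0" "r0 < r1" using r1 by (auto simp: r0_def)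
  define m where "m = enn2real (emeasure \<nu> UNIV)"
  have m: "emeasure \<nu> UNIV = ennreal m" "m \<ge> 0" using fin by (auto simp: m_def)
  define B where "B = ball \<xi> r0"
  have B: "B \<in> sets borel" "B \<in> sets \<nu>" "- B \<in> sets \<nu>" unfolding sets B_def by (auto intro: borel_closed)
  define \<nu>' where "\<nu>' = density \<nu> (indicator B)"
  have s': "sets \<nu>' = sets borel" by (simp add: \<nu>'_def sets)
  have em: "emeasure \<nu>' X = emeasure \<nu> (B \<inter> X)" if "X \<in> sets borel" for X
    unfolding \<nu>'_def using that B sets by (intro emeasure_restricted) auto
  have S: "- sphere (0::vec3) 1 \<in> sets borel" by (intro borel_open) auto
  have supp': "emeasure \<nu>' (- sphere 0 1) = 0"
  proof -
    have "- sphere 0 1 \<in> sets \<nu>" unfolding sets by (rule S)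
    then have "emeasure \<nu> (B \<inter> - sphere 0 1) \<le> emeasure \<nu> (- sphere 0 1)" by (intro emeasure_mono) auto
    then show ?thesis unfolding em[OF S] supp by simp
  qed
  \<comment> \<open>Below \<open>r0\<close> this is the assumed density; from \<open>r0\<close> on
    the restricted measure has stopped growing, while \<open>L * r^2\<close> has not.\<close>
  have M: "emeasure \<nu>' (ball \<xi> r) \<le> ennreal (L * r\<^sup>2)" if r: "0 < r" for r
  proof (cases "r < r0")
    case True
    have "emeasure \<nu>' (ball \<xi> r) \<le> emeasure \<nu> (ball \<xi> r)"
      unfolding em[OF borel_open[OF open_ball]] by (rule emeasure_mono) (auto simp: sets)
    also have "\<dots> \<le> ennreal (L * r\<^sup>2)" using r True r0 by (intro r1) auto
    finally show ?thesis .
  next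
    case False
    have "emeasure \<nu>' (ball \<xi> r) \<le> emeasure \<nu> (ball \<xi> r0)"
      unfolding em[OF borel_open[OF open_ball]] B_def by (rule emeasure_mono) (auto simp: sets)
    also have "\<dots> \<le> ennreal (L * r0\<^sup>2)" using r0 by (intro r1) auto
    also have "\<dots> \<le> ennreal (L * r\<^sup>2)"
      using False r0 L by (intro ennreal_leI mult_left_mono power_mono) auto
    finally show ?thesis .
  qed
  \<comment> \<open>The first entry keeps \<open>x\<close> at distance at least
    \<open>r0 / 2\<close> from the far part. The second makes its contribution, at most
    \<open>8 d m / r0^3\<close>, no larger than \<open>e / 2\<close>.\<close>
  define d where "d = min (r0 / 2) (e * r0 ^ 3 / (16 * (m + 1)))"
  have d: "d \<le> r0 / 2" "d \<le> e * r0 ^ 3 / (16 * (m + 1))" unfolding d_def by (rule min.cobounded1, rule min.cobounded2)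
  have d0': "d > 0" unfolding d_def by (rule min_less_iff_conj[THEN iffD2]) (use r0 e m in auto)
  have "(\<integral>\<^sup>+\<eta>. ennreal ((1 - norm x) / norm (x - \<eta>) ^ 3) \<partial>\<nu>) \<le> ennreal e"
    if x: "norm x < 1" "norm (x - \<xi>) \<le> 3 * (1 - norm x)" "norm (x - \<xi>) < d" for x
  proof -
    let ?k = "\<lambda>\<eta>. (1 - norm x) / norm (x - \<eta>) ^ 3"
    have mk: "(\<lambda>\<eta>. ennreal (?k \<eta>)) \<in> borel_measurable \<nu>" 
      by (subst measurable_cong_sets[OF sets refl]) measurable
    have mB: "indicator B \<in> borel_measurable \<nu>" using B by simp
    have dx: "1 - norm x < d" using norm_triangle_ineq2[of \<xi> x] x(3) \<xi> by (simp add: norm_minus_commute)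
    have near: "(\<integral>\<^sup>+\<eta>. ennreal (?k \<eta>) * indicator B \<eta> \<partial>\<nu>) \<le> ennreal (e / 2)"
    proof -
      have "(\<integral>\<^sup>+\<eta>. ennreal (?k \<eta>) * indicator B \<eta> \<partial>\<nu>) = (\<integral>\<^sup>+\<eta>. ennreal (?k \<eta>) \<partial>\<nu>')"
        unfolding \<nu>'_def using mk mB by (subst nn_integral_density) (auto simp: mult.commute)
      also have "\<dots> = (\<integral>\<^sup>+\<eta>. ennreal ((1 - norm x) powr 1 / norm (x - \<eta>) powr (2 + 1)) \<partial>\<nu>')"
      proof (rule nn_integral_cong_AE)
        show "AE \<eta> in \<nu>'. ennreal (?k \<eta>) = ennreal ((1 - norm x) powr 1 / norm (x - \<eta>) powr (2 + 1))"
          using AE_norm_1[OF s' supp']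
        proof eventually_elim
          case (elim \<eta>)
          then have "norm (x - \<eta>) > 0" using x by auto
          then show ?case using x by (simp add: powr_numeral)
        qed
      qed
      also have "\<dots> \<le> ennreal (25 / (1 - 2 powr (- 1)) * L)"
        using L by (intro maximal_kernel_bound[OF s' supp' \<xi> _ M x(1,2)]) auto
      also have "25 / (1 - 2 powr (- 1)) * L = e / 2" by (simp add: L_def powr_minus)
      finally show ?thesis .
    qed
    have far: "(\<integral>\<^sup>+\<eta>. ennreal (?k \<eta>) * indicator (- B) \<eta> \<partial>\<nu>) \<le> ennreal (e / 2)"
    proof -
      have "(\<integral>\<^sup>+\<eta>. ennreal (?k \<eta>) * indicator (- B) \<eta> \<partial>\<nu>) \<le> (\<integral>\<^sup>+\<eta>. ennreal (8 * d / r0 ^ 3) \<partial>\<nu>)"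
      proof (rule nn_integral_mono)
        fix \<eta>
        show "ennreal (?k \<eta>) * indicator (- B) \<eta> \<le> ennreal (8 * d / r0 ^ 3)"
        proof (cases "\<eta> \<in> B")
          case False
          then have "r0 \<le> norm (\<eta> - \<xi>)" by (simp add: B_def dist_norm norm_minus_commute)
          also have "\<dots> \<le> norm (x - \<eta>) + norm (x - \<xi>)"
            using norm_triangle_ineq4[of "x - \<xi>" "x - \<eta>"] by simp
          finally have "r0 / 2 \<le> norm (x - \<eta>)" using x d by simp
          then have "(r0 / 2) ^ 3 \<le> norm (x - \<eta>) ^ 3" using r0 by (intro power_mono) auto
          then have "?k \<eta> \<le> d / (r0 / 2) ^ 3" using dx d0' r0 x by (intro frac_le) auto
          also have "d / (r0 / 2) ^ 3 = 8 * d / r0 ^ 3" by (simp add: power_divide)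
          finally show ?thesis using False by (simp add: ennreal_leI)
        qed simp
      qed
      also have "\<dots> = ennreal (8 * d / r0 ^ 3 * m)"
        unfolding nn_integral_const spc m(1) using d0' r0 m by (subst ennreal_mult) auto
      also have "\<dots> \<le> ennreal (e / 2)"
      proof (rule ennreal_leI)
        have "8 * d / r0 ^ 3 * m \<le> 8 * (e * r0 ^ 3 / (16 * (m + 1))) / r0 ^ 3 * m"
          using d r0 m by (intro mult_right_mono divide_right_mono mult_left_mono) auto
        also have "\<dots> = (e / 2) * (m / (m + 1))" using r0 m by (simp add: divide_simps)
        also have "\<dots> \<le> (e / 2) * 1" using e m by (intro mult_left_mono) auto
        finally show "8 * d / r0 ^ 3 * m \<le> e / 2" by simp
      qed
      finally show ?thesis .
    qed
    have "(\<integral>\<^sup>+\<eta>. ennreal (?k \<eta>) \<partial>\<nu>) = (\<integral>\<^sup>+\<eta>. ennreal (?k \<eta>) * indicator B \<eta> + ennreal (?k \<eta>) * indicator (- B) \<eta> \<partial>\<nu>)"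
      by (intro nn_integral_cong) (auto simp: indicator_def)
    also have "\<dots> = (\<integral>\<^sup>+\<eta>. ennreal (?k \<eta>) * indicator B \<eta> \<partial>\<nu>) + (\<integral>\<^sup>+\<eta>. ennreal (?k \<eta>) * indicator (- B) \<eta> \<partial>\<nu>)"
      using mk B(2,3) by (intro nn_integral_add borel_measurable_times_ennreal borel_measurable_indicator) auto
    also have "\<dots> \<le> ennreal (e / 2) + ennreal (e / 2)" using near far by (rule add_mono)
    also have "\<dots> = ennreal e" using e by (subst ennreal_plus[symmetric]) auto
    finally show ?thesis .
  qed
  then show ?thesis using d0' by blast
qed

text \<open>For fixed \<open>q\<close> the measure with density \<open>(f - q)^+\<close> gives no
  mass to the set where \<open>f <= q\<close>, hence has zero density at almost all of its points.
  With \<open>q1\<close> slightly above \<open>f xi\<close> and \<open>q2\<close> slightly above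
  \<open>- f xi\<close>, the function \<open>|f - f xi|\<close> is at most
  \<open>(f - q1)^+ + (- f - q2)^+\<close> plus a small constant. Rational \<open>q\<close> keep the
  exceptional sets countable in number.\<close>

lemma AE_lebesgue_point:
  fixes f :: "vec3 \<Rightarrow> real"
  assumes fm[measurable]: "f \<in> borel_measurable borel" and fi: "integrable sphere_borel f"
  shows "AE \<xi> in sphere_borel. zero_density (density sphere_borel (\<lambda>\<eta>. ennreal \<bar>f \<eta> - f \<xi>\<bar>)) \<xi>"
proof -
  interpret finite_measure sphere_borel by (rule finite_sphere_borel)
  \<comment> \<open>Here \<open>ennreal\<close> sends negative reals to 0, so the density written
    \<open>ennreal (g \<eta> - q)\<close> is the positive part.\<close>
  have half: "AE \<xi> in sphere_borel. \<forall>q\<in>\<rat>. g \<xi> \<le> q \<longrightarrow> zero_density (density sphere_borel (\<lambda>\<eta>. ennreal (g \<eta> - q))) \<xi>"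
    if gm[measurable]: "g \<in> borel_measurable borel" and gi: "integrable sphere_borel g" for g :: "vec3 \<Rightarrow> real"
  proof -
    have "AE \<xi> in sphere_borel. g \<xi> \<le> q \<longrightarrow> zero_density (density sphere_borel (\<lambda>\<eta>. ennreal (g \<eta> - q))) \<xi>" for q
    proof -
      have A: "{\<xi>. g \<xi> \<le> q} \<in> sets borel" by measurable
      have "AE \<xi> in sphere_borel. \<xi> \<in> {\<xi>. g \<xi> \<le> q} \<longrightarrow> zero_density (density sphere_borel (\<lambda>\<eta>. ennreal (g \<eta> - q))) \<xi>"
      proof (rule AE_zero_density[OF _ _ A])
        show "sets (density sphere_borel (\<lambda>\<eta>. ennreal (g \<eta> - q))) = sets borel" by simp
        have "integrable sphere_borel (\<lambda>\<eta>. g \<eta> - q)" using gi by simp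
        then have "(\<integral>\<^sup>+\<eta>. ennreal (norm (g \<eta> - q)) \<partial>sphere_borel) < \<infinity>" by (simp add: integrable_iff_bounded)
        moreover have "(\<integral>\<^sup>+\<eta>. ennreal (g \<eta> - q) \<partial>sphere_borel) \<le> (\<integral>\<^sup>+\<eta>. ennreal (norm (g \<eta> - q)) \<partial>sphere_borel)"
          by (intro nn_integral_mono ennreal_leI) auto
        ultimately show "emeasure (density sphere_borel (\<lambda>\<eta>. ennreal (g \<eta> - q))) UNIV < \<infinity>"
          by (subst emeasure_density) auto
        have "(\<integral>\<^sup>+\<eta>. ennreal (g \<eta> - q) * indicator {\<xi>. g \<xi> \<le> q} \<eta> \<partial>sphere_borel) = (\<integral>\<^sup>+\<eta>. 0 \<partial>sphere_borel)"
          by (intro nn_integral_cong) (auto simp: indicator_def ennreal_neg)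
        then show "emeasure (density sphere_borel (\<lambda>\<eta>. ennreal (g \<eta> - q))) {\<xi>. g \<xi> \<le> q} = 0"
          using A by (subst emeasure_density) auto
      qed
      then show ?thesis by simp
    qed
    then show ?thesis by (subst AE_ball_countable) (auto simp: countable_rat)
  qed
  have h2: "AE \<xi> in sphere_borel. \<forall>q\<in>\<rat>. - f \<xi> \<le> q \<longrightarrow> zero_density (density sphere_borel (\<lambda>\<eta>. ennreal (- f \<eta> - q))) \<xi>"
    by (rule half) (use fi in auto)
  show ?thesis
    using half[OF fm fi] h2 AE_sphere_borel_norm
  proof eventually_elim
    case (elim \<xi>)
    show ?case unfolding zero_density_def
    proof (intro allI impI)
      fix e :: real assume e: "e > 0"
      \<comment> \<open>The leftover constant \<open>e1\<close>, integrated over a ball of surface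
        measure at most \<open>48 * unit_vol * r^2\<close>, must not exceed a third of
        \<open>e * r^2\<close>.\<close>
      define e1 where "e1 = e / (3 * (48 * unit_vol + 1))"
      have e1: "e1 > 0" using e by (auto simp: e1_def intro!: divide_pos_pos add_nonneg_pos)
      obtain q1 where q1: "q1 \<in> \<rat>" "f \<xi> < q1" "q1 < f \<xi> + e1" using Rats_dense_in_real[of "f \<xi>" "f \<xi> + e1"] e1 by auto
      obtain q2 where q2: "q2 \<in> \<rat>" "- f \<xi> < q2" "q2 < - f \<xi> + e1" using Rats_dense_in_real[of "- f \<xi>" "- f \<xi> + e1"] e1 by auto
      let ?\<mu> = "density sphere_borel (\<lambda>\<eta>. ennreal (f \<eta> - q1))" and ?\<nu> = "density sphere_borel (\<lambda>\<eta>. ennreal (- f \<eta> - q2))"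
      let ?\<kappa> = "density sphere_borel (\<lambda>\<eta>. ennreal \<bar>f \<eta> - f \<xi>\<bar>)"
      have d: "zero_density ?\<mu> \<xi>" "zero_density ?\<nu> \<xi>" using elim q1 q2 by auto
      obtain r1 where r1: "r1 > 0" "\<And>r. 0 < r \<Longrightarrow> r < r1 \<Longrightarrow> emeasure ?\<mu> (ball \<xi> r) \<le> ennreal ((e / 3) * r\<^sup>2)"
        using d(1) e unfolding zero_density_def by (metis divide_pos_pos zero_less_numeral)
      obtain r2 where r2: "r2 > 0" "\<And>r. 0 < r \<Longrightarrow> r < r2 \<Longrightarrow> emeasure ?\<nu> (ball \<xi> r) \<le> ennreal ((e / 3) * r\<^sup>2)"
        using d(2) e unfolding zero_density_def by (metis divide_pos_pos zero_less_numeral)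
      have "emeasure ?\<kappa> (ball \<xi> r) \<le> ennreal (e * r\<^sup>2)" if r: "0 < r" "r < min r1 r2" for r
      proof -
        have pt: "ennreal \<bar>f \<eta> - f \<xi>\<bar> \<le> ennreal (f \<eta> - q1) + ennreal (- f \<eta> - q2) + ennreal e1" for \<eta>
        proof -
          have "\<bar>f \<eta> - f \<xi>\<bar> \<le> max 0 (f \<eta> - q1) + max 0 (- f \<eta> - q2) + e1" using q1 q2 by linarith
          then have "ennreal \<bar>f \<eta> - f \<xi>\<bar> \<le> ennreal (max 0 (f \<eta> - q1) + max 0 (- f \<eta> - q2) + e1)" by (rule ennreal_leI)
          also have "\<dots> = ennreal (max 0 (f \<eta> - q1)) + ennreal (max 0 (- f \<eta> - q2)) + ennreal e1"
            using e1 by (subst ennreal_plus, simp, simp, subst ennreal_plus) auto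
          also have "\<dots> = ennreal (f \<eta> - q1) + ennreal (- f \<eta> - q2) + ennreal e1"
            by (simp add: max_def ennreal_neg)
          finally show ?thesis .
        qed
        have "emeasure ?\<kappa> (ball \<xi> r) = (\<integral>\<^sup>+\<eta>. ennreal \<bar>f \<eta> - f \<xi>\<bar> * indicator (ball \<xi> r) \<eta> \<partial>sphere_borel)"
          by (subst emeasure_density) auto
        also have "\<dots> \<le> (\<integral>\<^sup>+\<eta>. (ennreal (f \<eta> - q1) * indicator (ball \<xi> r) \<eta> + ennreal (- f \<eta> - q2) * indicator (ball \<xi> r) \<eta>) + ennreal e1 * indicator (ball \<xi> r) \<eta> \<partial>sphere_borel)"
          using pt by (intro nn_integral_mono) (auto simp: indicator_def)
        also have "\<dots> = emeasure ?\<mu> (ball \<xi> r) + emeasure ?\<nu> (ball \<xi> r) + ennreal e1 * emeasure sphere_borel (ball \<xi> r)"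
        proof -
          have b[measurable]: "ball \<xi> r \<in> sets borel" by simp
          have m: "(\<lambda>\<eta>. ennreal (f \<eta> - q1) * indicator (ball \<xi> r) \<eta>) \<in> borel_measurable sphere_borel"
            "(\<lambda>\<eta>. ennreal (- f \<eta> - q2) * indicator (ball \<xi> r) \<eta>) \<in> borel_measurable sphere_borel"
            "(\<lambda>\<eta>. ennreal e1 * indicator (ball \<xi> r) \<eta>) \<in> borel_measurable sphere_borel"
            unfolding measurable_sphere_borel_eq by measurable
          show ?thesis
            unfolding nn_integral_add[OF borel_measurable_add[OF m(1,2)] m(3)] nn_integral_add[OF m(1,2)]
            by (simp add: emeasure_density nn_integral_cmult_indicator)
        qed
        also have "\<dots> \<le> ennreal ((e / 3) * r\<^sup>2) + ennreal ((e / 3) * r\<^sup>2) + ennreal ((e / 3) * r\<^sup>2)"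
        proof (intro add_mono)
          have "ennreal e1 * emeasure sphere_borel (ball \<xi> r) \<le> ennreal e1 * ennreal (48 * unit_vol * r\<^sup>2)"
            using elim r by (intro mult_left_mono sphere_borel_ball_le) auto
          also have "\<dots> = ennreal (e1 * (48 * unit_vol * r\<^sup>2))" using e1 by (simp add: ennreal_mult')
          also have "\<dots> \<le> ennreal ((e / 3) * r\<^sup>2)"
          proof (rule ennreal_leI)
            have "e1 * (48 * unit_vol * r\<^sup>2) \<le> e1 * ((48 * unit_vol + 1) * r\<^sup>2)"
              using e1 by (intro mult_left_mono mult_right_mono) auto
            also have "\<dots> = (e / 3) * r\<^sup>2"
            proof -
              have "48 * unit_vol + 1 \<noteq> 0" by (smt (verit) measure_nonneg)
              moreover have "e / (3 * w) * (w * r\<^sup>2) = (e / 3) * r\<^sup>2" if "w \<noteq> 0" for w using that by simp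
              ultimately show ?thesis unfolding e1_def by blast
            qed
            finally show "e1 * (48 * unit_vol * r\<^sup>2) \<le> (e / 3) * r\<^sup>2" .
          qed
          finally show "ennreal e1 * emeasure sphere_borel (ball \<xi> r) \<le> ennreal ((e / 3) * r\<^sup>2)" .
        qed (rule r1(2), use r in simp, use r in simp, rule r2(2), use r in simp, use r in simp)
        also have "\<dots> = ennreal ((e / 3) * r\<^sup>2 + (e / 3) * r\<^sup>2 + (e / 3) * r\<^sup>2)"
          using e by (subst ennreal_plus, simp, simp, subst ennreal_plus) auto
        also have "(e / 3) * r\<^sup>2 + (e / 3) * r\<^sup>2 + (e / 3) * r\<^sup>2 = e * r\<^sup>2" by simp
        finally show ?thesis .
      qed
      then show "\<exists>r0>0. \<forall>r. 0 < r \<and> r < r0 \<longrightarrow> emeasure ?\<kappa> (ball \<xi> r) \<le> ennreal (e * r\<^sup>2)"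
        using r1 r2 by (intro exI[of _ "min r1 r2"]) auto
    qed
  qed
qed

section \<open>Reproduction of dilated solutions\<close>

lemma Ck1_lipschitz:
  assumes g: "Ck 1 (ball 0 1) g" and r: "r < 1"
  shows "\<exists>L\<ge>0. \<forall>x y. norm x \<le> r \<longrightarrow> norm y \<le> r \<longrightarrow> \<bar>g x - g y\<bar> \<le> L * norm (x - y)"
proof -
  have gc: "continuous_on (ball 0 1) (pd i g)" for i using g by auto
  have "\<forall>i. \<exists>B\<ge>0. \<forall>y. norm y \<le> r \<longrightarrow> \<bar>pd i g y\<bar> \<le> B" using bounded_on_cball[OF gc r] by blast
  then obtain B where B: "\<And>i. B i \<ge> 0" "\<And>i y. norm y \<le> r \<Longrightarrow> \<bar>pd i g y\<bar> \<le> B i" by metis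
  define L where "L = (\<Sum>i\<in>UNIV. B i)"
  have "\<bar>g x - g y\<bar> \<le> L * norm (x - y)" if xy: "norm x \<le> r" "norm y \<le> r" for x y
  proof -
    have "norm (g x - g y) \<le> L * norm (x - y)"
    proof (rule differentiable_bound[where f' = "\<lambda>z h. (\<chi> i. pd i g z) \<bullet> h" and S = "cball 0 r" and f = g])
      fix z :: vec3 assume z: "z \<in> cball 0 r"
      have "g differentiable (at z)" using g z r by auto
      from pd_has_derivative[OF this]
      show "(g has_derivative (\<lambda>h. (\<chi> i. pd i g z) \<bullet> h)) (at z within cball 0 r)" by (rule has_derivative_at_withinI)
      show "onorm (\<lambda>h. (\<chi> i. pd i g z) \<bullet> h) \<le> L"
      proof (rule onorm_le)
        fix h
        have "norm (\<chi> i. pd i g z) \<le> (\<Sum>i\<in>UNIV. \<bar>(\<chi> i. pd i g z) $ i\<bar>)" by (rule norm_le_l1_cart)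
        also have "\<dots> \<le> L" unfolding L_def using B(2)[of z] z by (intro sum_mono) auto
        finally have n: "norm (\<chi> i. pd i g z) \<le> L" .
        have "norm ((\<chi> i. pd i g z) \<bullet> h) \<le> norm (\<chi> i. pd i g z) * norm h" using Cauchy_Schwarz_ineq2 by simp
        also have "\<dots> \<le> L * norm h" using n by (rule mult_right_mono) simp
        finally show "norm ((\<chi> i. pd i g z) \<bullet> h) \<le> L * norm h" .
      qed
    qed (use xy in auto)
    then show ?thesis by simp
  qed
  moreover have "L \<ge> 0" unfolding L_def by (intro sum_nonneg B)
  ultimately show ?thesis by blast
qed

lemma lame_Ck: "lame_solution la mu u \<Longrightarrow> Ck 2 (ball 0 1) (\<lambda>x. u x $ k)"
  by (simp add: lame_solution_def C2_on_iff_Ck)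

lemma lame_differentiable:
  assumes "lame_solution la mu u" "norm x < 1"
  shows "(\<lambda>x. u x $ k) differentiable (at x)" "pd i (\<lambda>x. u x $ k) differentiable (at x)"
  using Ck_2D[OF lame_Ck[OF assms(1), of k]] assms(2) by (auto intro: Ck_differentiable)

lemma lame_op_C2_nth:
  assumes "\<And>k. Ck 2 (ball 0 1) (\<lambda>x. u x $ k)" "norm x < 1"
  shows "lame_op la mu u x $ k = mu * (\<Sum>i\<in>UNIV. pd i (pd i (\<lambda>y. u y $ k)) x)
     + (la + mu) * (\<Sum>i\<in>UNIV. pd k (pd i (\<lambda>y. u y $ i)) x)"
proof -
  have "pd k (divg u) x = (\<Sum>i\<in>UNIV. pd k (pd i (\<lambda>y. u y $ i)) x)"
    unfolding divg_def[abs_def]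
    by (rule pd_sum) (use Ck_2D(2)[OF assms(1)] assms(2) in \<open>auto intro: Ck_differentiable\<close>)
  then show ?thesis by (simp add: lame_op_def)
qed

lemma lame_diff:
  assumes u: "lame_solution la mu u" and v: "lame_solution la mu v"
  shows "lame_solution la mu (\<lambda>x. u x - v x)"
proof -
  have C: "Ck 2 (ball 0 1) (\<lambda>x. (u x - v x) $ k)" for k
    using Ck_diff[OF open_ball lame_Ck[OF u] lame_Ck[OF v]] by simp
  have p1: "pd i (\<lambda>x. (u x - v x) $ k) x = pd i (\<lambda>x. u x $ k) x - pd i (\<lambda>x. v x $ k) x" if "norm x < 1" for i k x
    using pd_diff[OF lame_differentiable(1)[OF u that] lame_differentiable(1)[OF v that]] by simp
  have p2: "pd j (pd i (\<lambda>x. (u x - v x) $ k)) x = pd j (pd i (\<lambda>x. u x $ k)) x - pd j (pd i (\<lambda>x. v x $ k)) x"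
    if x: "norm x < 1" for i j k x
  proof -
    have "pd j (pd i (\<lambda>x. (u x - v x) $ k)) x = pd j (\<lambda>x. pd i (\<lambda>x. u x $ k) x - pd i (\<lambda>x. v x $ k) x) x"
      by (rule pd_ball_cong[OF x]) (rule p1)
    then show ?thesis using pd_diff[OF lame_differentiable(2)[OF u x] lame_differentiable(2)[OF v x]] by simp
  qed
  have "lame_op la mu (\<lambda>x. u x - v x) x $ k = lame_op la mu u x $ k - lame_op la mu v x $ k" if x: "norm x < 1" for x k
    unfolding lame_op_C2_nth[OF C x] lame_op_C2_nth[OF lame_Ck[OF u] x] lame_op_C2_nth[OF lame_Ck[OF v] x] p2[OF x]
    by (simp add: sum_subtractf algebra_simps)
  then show ?thesis using C u v by (simp add: lame_solution_def C2_on_iff_Ck vec_eq_iff)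
qed

lemma lame_scale:
  assumes u: "lame_solution la mu u" and r: "0 < r" "r \<le> 1"
  shows "lame_solution la mu (\<lambda>x. u (r *\<^sub>R x))"
proof -
  have rx: "norm (r *\<^sub>R x) < 1" if "norm x < 1" for x :: vec3
    using that r mult_left_le_one_le[of "norm x" r] by simp
  have C: "Ck 2 (ball 0 1) (\<lambda>x. u (r *\<^sub>R x) $ k)" for k
    by (rule Ck_scale[OF open_ball _ lame_Ck[OF u]]) (use rx in simp)
  have p1: "pd i (\<lambda>x. u (r *\<^sub>R x) $ k) x = r * pd i (\<lambda>x. u x $ k) (r *\<^sub>R x)" if "norm x < 1" for i k x
    using pd_scale(1)[OF lame_differentiable(1)[OF u rx[OF that]]] .
  have p2: "pd j (pd i (\<lambda>x. u (r *\<^sub>R x) $ k)) x = r * (r * pd j (pd i (\<lambda>x. u x $ k)) (r *\<^sub>R x))" if x: "norm x < 1" for i j k x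
  proof -
    have "pd j (pd i (\<lambda>x. u (r *\<^sub>R x) $ k)) x = pd j (\<lambda>x. r * pd i (\<lambda>x. u x $ k) (r *\<^sub>R x)) x"
      by (rule pd_ball_cong[OF x]) (rule p1)
    also have "\<dots> = r * (r * pd j (pd i (\<lambda>x. u x $ k)) (r *\<^sub>R x))"
      using pd_scale[OF lame_differentiable(2)[OF u rx[OF x]]] by (subst pd_cmult) auto
    finally show ?thesis .
  qed
  have "lame_op la mu (\<lambda>x. u (r *\<^sub>R x)) x $ k = r * (r * lame_op la mu u (r *\<^sub>R x) $ k)" if x: "norm x < 1" for x k
    unfolding lame_op_C2_nth[OF C x] lame_op_C2_nth[OF lame_Ck[OF u] rx[OF x]] p2[OF x]
    by (simp add: sum_distrib_left[symmetric] algebra_simps)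
  moreover have "lame_op la mu u (r *\<^sub>R x) = 0" if "norm x < 1" for x
    using u rx[OF that] by (simp add: lame_solution_def)
  ultimately show ?thesis using C by (simp add: lame_solution_def C2_on_iff_Ck vec_eq_iff)
qed

lemma lame_const: "lame_solution la mu (\<lambda>x. c)"
proof -
  have "lame_op la mu (\<lambda>x. c) x $ k = 0" for x k
  proof -
    have "pd i (\<lambda>y. c $ k) = (\<lambda>y. 0)" for i k by auto
    then show ?thesis by (simp add: lame_op_def divg_def[abs_def])
  qed
  then show ?thesis by (simp add: lame_solution_def C2_on_iff_Ck vec_eq_iff)
qed

section \<open>Normalization of the kernels\<close>

lemma Q0_orthogonal:
  assumes "orthogonal_transformation T"
  shows "Q0 (T x) (T e) = Q0 x e"
proof -
  have "norm (T x - T e) = norm (x - e)"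
    using assms by (metis linear_diff orthogonal_transformation_linear orthogonal_transformation_norm)
  then show ?thesis using assms by (simp add: Q0_def orthogonal_transformation_norm)
qed

lemma integrable_const_sphere: "integrable sphere_measure (\<lambda>_. c)"
  by (rule finite_measure.integrable_const[OF finite_sphere_measure])

text \<open>The integral is harmonic in the point and invariant under rotations, hence constant on
  each sphere about the origin. Uniqueness then makes it constant inside, and at the origin the
  kernel is 1, so the constant is the total mass.\<close>

theorem poisson_normalization:
  assumes x0: "norm x0 < 1"
  shows "(\<integral>\<eta>. Q0 x0 \<eta> \<partial>sphere_measure) = 4 * pi"
proof -
  define h where "h x = (\<integral>\<eta>. Q0 x \<eta> * 1 \<partial>sphere_measure)" for x
  have i1: "integrable sphere_measure (\<lambda>_. 1::real)" by (rule integrable_const_sphere)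
  have hC: "Ck n (ball 0 1) h" for n unfolding h_def[abs_def] by (rule rk_integral_Ck[OF rk_Q0 i1])
  have pH: "poisson_ext (\<lambda>_. 1) j = (\<lambda>x. 1 / (4 * pi) * h x)" for j by (simp add: poisson_ext_def[abs_def] h_def)
  have hd: "h differentiable (at x)" "pd i h differentiable (at x)" if "norm x < 1" for i x
    using Ck_differentiable[OF hC[of 1]] Ck_differentiable[OF Ck_pd[OF hC[of "Suc 1"]]] that by auto
  have lap: "(\<Sum>k\<in>UNIV. pd k (pd k h) x) = 0" if x: "norm x < 1" for x
  proof -
    have "pd k (pd k (\<lambda>x. 1 / (4 * pi) * h x)) x = 1 / (4 * pi) * pd k (pd k h) x" for k
    proof -
      have "pd k (pd k (\<lambda>x. 1 / (4 * pi) * h x)) x = pd k (\<lambda>x. 1 / (4 * pi) * pd k h x) x"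
        by (rule pd_ball_cong[OF x]) (rule pd_cmult[OF hd(1)])
      then show ?thesis unfolding pd_cmult[OF hd(2)[OF x]] .
    qed
    moreover have "integrable sphere_measure (\<lambda>_. 1::vec3)" by (rule integrable_const_sphere)
    from poisson_ext_props(4)[OF this x, of 1] have "(\<Sum>k\<in>UNIV. pd k (pd k (\<lambda>x. 1 / (4 * pi) * h x)) x) = 0"
      unfolding pH .
    ultimately show ?thesis by (simp add: sum_divide_distrib[symmetric])
  qed
  have rad: "h x = h y" if xy: "norm x = norm y" for x y
  proof -
    obtain T where T: "orthogonal_transformation T" "T x = y"
      using orthogonal_transformation_exists[OF xy] by blast
    have "h (T x) = (\<integral>\<eta>. Q0 (T x) (T \<eta>) \<partial>sphere_measure)"
      unfolding h_def using sphere_measure_orthogonal_invariant[OF T(1) rk_measurable_snd[OF rk_Q0, of "T x"]] by simp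
    also have "\<dots> = h x" by (simp add: Q0_orthogonal[OF T(1)] h_def)
    finally show ?thesis using T(2) by simp
  qed
  \<comment> \<open>After dilation by \<open>R < 1\<close> the function is Lipschitz up to the unit
    sphere, so its difference from the boundary constant decays like \<open>1 - norm x\<close>,
    which is more than \<open>lame_uniqueness\<close> requires.\<close>
  define R where "R = (1 + norm x0) / 2"
  have R: "0 < R" "R < 1" "norm x0 < R" using x0 by (auto simp: R_def intro: add_pos_nonneg)
  obtain L where L: "L \<ge> 0" "\<And>x y. norm x \<le> R \<Longrightarrow> norm y \<le> R \<Longrightarrow> \<bar>h x - h y\<bar> \<le> L * norm (x - y)"
    using Ck1_lipschitz[OF hC R(2)] by blast
  define e1 where "e1 = (axis 1 1 :: vec3)"
  have e1: "norm e1 = 1" by (simp add: e1_def)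
  define c where "c = h (R *\<^sub>R e1)"
  \<comment> \<open>With \<open>la + mu = 0\<close> and \<open>mu = 1\<close> the Lame operator is
    the Laplacian in each component, and \<open>2 * mu + la = 1\<close> is positive. This makes the
    uniqueness theorem available for harmonic functions.\<close>
  have "lame_solution (-1) 1 (\<lambda>x. (\<chi> i. h x) :: vec3)"
    using hC[of 2] lap by (simp add: lame_solution_def C2_on_iff_Ck lame_op_def vec_eq_iff)
  from lame_scale[OF this R(1)] have "lame_solution (-1) 1 (\<lambda>x. (\<chi> i. h (R *\<^sub>R x)) :: vec3)" using R by simp
  from lame_diff[OF this lame_const[of _ _ "\<chi> i. c"]]
  have sol: "lame_solution (-1) 1 (\<lambda>x. (\<chi> i. h (R *\<^sub>R x)) - (\<chi> i. c) :: vec3)" .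
  have bound: "norm ((\<chi> i. h (R *\<^sub>R x)) - (\<chi> i. c) :: vec3) \<le> 3 * L * (1 - norm x) powr (3/4)"
    if x: "norm x < 1" for x
  proof -
    define \<xi> where "\<xi> = (if x = 0 then e1 else x /\<^sub>R norm x)"
    have \<xi>: "norm \<xi> = 1" "x = norm x *\<^sub>R \<xi>" using e1 by (auto simp: \<xi>_def)
    have "c = h (R *\<^sub>R \<xi>)" unfolding c_def by (rule rad) (simp add: \<xi> e1)
    then have "\<bar>h (R *\<^sub>R x) - c\<bar> \<le> L * norm (R *\<^sub>R x - R *\<^sub>R \<xi>)"
      using L(2)[of "R *\<^sub>R x" "R *\<^sub>R \<xi>"] R \<xi> x by (simp add: mult_left_le)
    also have "norm (R *\<^sub>R x - R *\<^sub>R \<xi>) = R * (1 - norm x)"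
    proof -
      have "R *\<^sub>R x - R *\<^sub>R \<xi> = (R * (norm x - 1)) *\<^sub>R \<xi>" by (subst \<xi>(2)) (simp add: algebra_simps)
      then show ?thesis using \<xi> R x by (simp add: abs_mult)
    qed
    also have "L * (R * (1 - norm x)) \<le> L * (1 - norm x) powr (3/4)"
    proof (rule mult_left_mono[OF _ L(1)])
      have "R * (1 - norm x) \<le> (1 - norm x) powr 1" using R x by (simp add: mult_left_le_one_le)
      also have "\<dots> \<le> (1 - norm x) powr (3/4)" using x by (intro powr_mono') auto
      finally show "R * (1 - norm x) \<le> (1 - norm x) powr (3/4)" .
    qed
    finally have "\<bar>h (R *\<^sub>R x) - c\<bar> \<le> L * (1 - norm x) powr (3/4)" .
    moreover have "norm ((\<chi> i. h (R *\<^sub>R x)) - (\<chi> i. c) :: vec3) \<le> 3 * \<bar>h (R *\<^sub>R x) - c\<bar>"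
      using norm_le_l1_cart[of "(\<chi> i. h (R *\<^sub>R x)) - (\<chi> i. c) :: vec3"] by simp
    ultimately show ?thesis by simp
  qed
  have hc: "h (R *\<^sub>R x) = c" if "norm x < 1" for x
    using lame_uniqueness[OF _ _ sol bound that] by (simp add: vec_eq_iff)
  have "h x0 = h (R *\<^sub>R (x0 /\<^sub>R R))" using R by simp
  also have "\<dots> = c" by (rule hc) (use R in \<open>simp add: field_simps\<close>)
  also have "c = h (R *\<^sub>R 0)" by (rule hc[symmetric]) simp
  also have "\<dots> = (\<integral>\<eta>. 1 \<partial>sphere_measure)"
    unfolding h_def by (intro Bochner_Integration.integral_cong refl) (auto simp: Q0_def)
  also have "\<dots> = 4 * pi"
    using emeasure_sphere_measure_UNIV by (simp add: measure_def)
  finally show ?thesis by (simp add: h_def)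
qed

lemma elastic_poisson_const:
  assumes mu: "mu > 0" "2 * mu + la > 0" and x: "norm x < 1"
  shows "elastic_poisson la mu (\<lambda>_. c) x = c"
proof -
  have P: "poisson_ext (\<lambda>_. c) j y = c $ j" if "norm y < 1" for y j
    using poisson_normalization[OF that] by (simp add: poisson_ext_def)
  have P1: "pd j (poisson_ext (\<lambda>_. c) j) y = 0" if "norm y < 1" for y j
    using pd_ball_cong[OF that, of "poisson_ext (\<lambda>_. c) j" "\<lambda>_. c $ j" j] P by simp
  have P2: "pd i (\<lambda>x. \<Sum>j\<in>UNIV. pd j (poisson_ext (\<lambda>_. c) j) x) y = 0" if "norm y < 1" for y i
    using pd_ball_cong[OF that, of "\<lambda>x. \<Sum>j\<in>UNIV. pd j (poisson_ext (\<lambda>_. c) j) x" "\<lambda>_. 0" i] P1 by simp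
  have "radial_avg (1 - alpha_e la mu) (pd i (\<lambda>x. \<Sum>j\<in>UNIV. pd j (poisson_ext (\<lambda>_. c) j) x)) x = 0" for i
    using radial_avg_cong[OF P2 x] by simp
  then show ?thesis
    unfolding vec_eq_iff elastic_poisson_eq[OF mu x integrable_const_sphere] using P[OF x] by simp
qed

text \<open>Since the kernel reproduces constants, only the oscillation of \<open>f\<close> about
  \<open>c\<close> enters the error. It is applied with \<open>c\<close> the boundary value at the
  point approached.\<close>

lemma elastic_poisson_minus_const:
  assumes mu: "mu > 0" "2 * mu + la > 0" and x: "norm x < 1" and f: "integrable sphere_measure f"
  shows "ennreal (norm (elastic_poisson la mu f x - c))
    \<le> (\<integral>\<^sup>+\<eta>. ennreal (ker_const la mu * ((1 - norm x) / norm (x - \<eta>) ^ 3) * norm (f \<eta> - c)) \<partial>sphere_measure)"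
proof -
  note i = elastic_poisson_integrable[OF mu x f] elastic_poisson_integrable[OF mu x integrable_const_sphere[of c]]
  have eq: "elastic_poisson la mu f x - c = (\<integral>\<eta>. elastic_kernel la mu x \<eta> *v (f \<eta> - c) \<partial>sphere_measure)"
    using Bochner_Integration.integral_diff[OF i] elastic_poisson_const[OF mu x, of c]
    by (simp add: elastic_poisson_def matrix_vector_mult_diff_distrib)
  have "integrable sphere_measure (\<lambda>\<eta>. elastic_kernel la mu x \<eta> *v (f \<eta> - c))"
    using Bochner_Integration.integrable_diff[OF i] by (simp add: matrix_vector_mult_diff_distrib)
  then have "ennreal (norm (elastic_poisson la mu f x - c)) \<le> (\<integral>\<^sup>+\<eta>. ennreal (norm (elastic_kernel la mu x \<eta> *v (f \<eta> - c))) \<partial>sphere_measure)"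
    unfolding eq by (rule integral_norm_bound_ennreal)
  also have "\<dots> \<le> (\<integral>\<^sup>+\<eta>. ennreal (ker_const la mu * ((1 - norm x) / norm (x - \<eta>) ^ 3) * norm (f \<eta> - c)) \<partial>sphere_measure)"
    by (intro nn_integral_mono ennreal_leI elastic_kernel_bound[OF mu _ x]) simp
  finally show ?thesis .
qed

lemma ker_const_nonneg: "ker_const la mu \<ge> 0"
  by (simp add: ker_const_def)

text \<open>The dilate is Lipschitz on the closed ball, so the Poisson integral of its boundary
  values approaches them at a definite rate. The difference between this Poisson integral and the
  dilate solves the system and decays like \<open>(1 - norm x)^(3/4)\<close>, hence vanishes by
  uniqueness.\<close>

theorem poisson_representation:
  assumes mu: "mu > 0" "2 * mu + la > 0" and u: "lame_solution la mu u" and r: "0 < r" "r < 1" and x: "norm x < 1"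
  shows "integrable sphere_measure (\<lambda>\<eta>. u (r *\<^sub>R \<eta>))"
    and "u (r *\<^sub>R x) = elastic_poisson la mu (\<lambda>\<eta>. u (r *\<^sub>R \<eta>)) x"
proof -
  define w where "w x = u (r *\<^sub>R x)" for x
  have weq: "w = (\<lambda>x. u (r *\<^sub>R x))" by (auto simp: w_def)
  have "\<forall>k. \<exists>L\<ge>0. \<forall>x y. norm x \<le> r \<longrightarrow> norm y \<le> r \<longrightarrow> \<bar>u x $ k - u y $ k\<bar> \<le> L * norm (x - y)"
    using Ck1_lipschitz[OF Ck_2D(1)[OF lame_Ck[OF u]] r(2)] by blast
  then obtain B where B: "\<And>k. B k \<ge> 0" "\<And>k x y. norm x \<le> r \<Longrightarrow> norm y \<le> r \<Longrightarrow> \<bar>u x $ k - u y $ k\<bar> \<le> B k * norm (x - y)"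
    by metis
  define L where "L = (\<Sum>k\<in>UNIV. B k)"
  have L0: "L \<ge> 0" unfolding L_def by (intro sum_nonneg B)
  have lip: "norm (w x - w y) \<le> L * norm (x - y)" if xy: "norm x \<le> 1" "norm y \<le> 1" for x y
  proof -
    have "norm (w x - w y) \<le> (\<Sum>k\<in>UNIV. \<bar>(w x - w y) $ k\<bar>)" by (rule norm_le_l1_cart)
    also have "\<dots> \<le> (\<Sum>k\<in>UNIV. B k * norm (x - y))"
    proof (rule sum_mono)
      fix k
      have "\<bar>(w x - w y) $ k\<bar> \<le> B k * norm (r *\<^sub>R x - r *\<^sub>R y)"
        unfolding w_def using B(2)[of "r *\<^sub>R x" "r *\<^sub>R y" k] r xy by (simp add: mult_left_le)
      also have "norm (r *\<^sub>R x - r *\<^sub>R y) = r * norm (x - y)"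
        using r by (simp flip: scaleR_diff_right)
      also have "B k * (r * norm (x - y)) \<le> B k * norm (x - y)"
        using r B(1) by (intro mult_left_mono) (auto simp: mult_left_le_one_le)
      finally show "\<bar>(w x - w y) $ k\<bar> \<le> B k * norm (x - y)" .
    qed
    finally show ?thesis by (simp add: L_def sum_distrib_right)
  qed
  have wc: "continuous_on (cball 0 1) w"
    by (rule lipschitz_on_continuous_on[of L], rule lipschitz_onI) (use lip L0 in \<open>auto simp: dist_norm\<close>)
  have wi: "integrable sphere_measure w"
  proof (rule finite_measure.integrable_const_bound[OF finite_sphere_measure, of _ "norm (w 0) + L"])
    show "AE \<eta> in sphere_measure. norm (w \<eta>) \<le> norm (w 0) + L"
    proof (rule AE_I2)
      fix \<eta> :: vec3 assume "\<eta> \<in> space sphere_measure"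
      then show "norm (w \<eta>) \<le> norm (w 0) + L"
        using lip[of \<eta> 0] norm_triangle_sub[of "w \<eta>" "w 0"] by simp
    qed
    have "continuous_on (sphere 0 1) w" by (rule continuous_on_subset[OF wc]) auto
    then show "w \<in> borel_measurable sphere_measure"
      by (subst measurable_cong_sets[OF sets_sphere_measure refl]) (rule borel_measurable_continuous_on_restrict)
  qed
  then show "integrable sphere_measure (\<lambda>\<eta>. u (r *\<^sub>R \<eta>))" by (simp only: weq)
  define C1 where "C1 = 25 / (1 - 2 powr (- (1/4))) * (48 * unit_vol)"
  have "2 powr (- (1/4)) < (2::real) powr 0" by (intro powr_less_mono) auto
  then have C1: "C1 \<ge> 0" by (simp add: C1_def)
  define v where "v = elastic_poisson la mu w"
  have solv: "lame_solution la mu (\<lambda>x. v x - w x)"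
    unfolding v_def by (rule lame_diff[OF elastic_poisson_lame[OF mu wi]], unfold weq, rule lame_scale[OF u]) (use r in auto)
  define M where "M = ker_const la mu * (4 * L) * C1 + L"
  have bound: "norm (v x - w x) \<le> M * (1 - norm x) powr (3/4)" if x: "norm x < 1" for x
  proof -
    define d where "d = 1 - norm x"
    have d: "0 < d" "d \<le> 1" using x by (auto simp: d_def)
    \<comment> \<open>The nearest boundary point, at distance exactly \<open>d = 1 - norm x\<close>;
      at the origin every boundary point is nearest and an arbitrary one is taken.\<close>
    define \<xi> where "\<xi> = (if x = 0 then axis 1 1 else x /\<^sub>R norm x)"
    have \<xi>: "norm \<xi> = 1" "x = norm x *\<^sub>R \<xi>" by (auto simp: \<xi>_def)
    have x\<xi>: "norm (x - \<xi>) = d"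
    proof -
      have "x - \<xi> = (norm x - 1) *\<^sub>R \<xi>" by (subst \<xi>(2)) (simp add: algebra_simps)
      then show ?thesis using \<xi> x by (simp add: d_def)
    qed
    define c where "c = ker_const la mu * (4 * L) * d powr (3/4)"
    have c: "c \<ge> 0" using ker_const_nonneg L0 by (simp add: c_def)
    have "ennreal (norm (v x - w \<xi>)) \<le> (\<integral>\<^sup>+\<eta>. ennreal (ker_const la mu * (d / norm (x - \<eta>) ^ 3) * norm (w \<eta> - w \<xi>)) \<partial>sphere_measure)"
      unfolding v_def d_def by (rule elastic_poisson_minus_const[OF mu x wi])
    also have "\<dots> \<le> (\<integral>\<^sup>+\<eta>. ennreal c * ennreal (d powr (1/4) / norm (x - \<eta>) powr (2 + 1/4)) \<partial>sphere_measure)"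
    proof (rule nn_integral_mono)
      fix \<eta> :: vec3 assume "\<eta> \<in> space sphere_measure"
      then have \<eta>: "norm \<eta> = 1" by simp
      define \<rho> where "\<rho> = norm (x - \<eta>)"
      have \<rho>: "d \<le> \<rho>" using norm_triangle_ineq2[of \<eta> x] \<eta> by (simp add: d_def \<rho>_def norm_minus_commute)
      have \<rho>2: "\<rho> \<le> 2" using norm_triangle_ineq4[of x \<eta>] x \<eta> by (simp add: \<rho>_def)
      have \<rho>0: "\<rho> > 0" using \<rho> d by simp
      have "norm (\<eta> - \<xi>) \<le> \<rho> + norm (x - \<xi>)" using norm_triangle_ineq4[of "x - \<xi>" "x - \<eta>"] by (simp add: \<rho>_def)
      then have "norm (\<eta> - \<xi>) \<le> 2 * \<rho>" using \<rho> x\<xi> by simp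
      then have "norm (w \<eta> - w \<xi>) \<le> L * (2 * \<rho>)"
        using order_trans[OF lip[of \<eta> \<xi>] mult_left_mono[OF _ L0]] \<eta> \<xi> by simp
      then have "d / \<rho> ^ 3 * norm (w \<eta> - w \<xi>) \<le> d / \<rho> ^ 3 * (L * (2 * \<rho>))"
        using d \<rho>0 by (intro mult_left_mono) auto
      also have "\<dots> = 2 * L * (d / \<rho>\<^sup>2)" using \<rho>0 by (simp add: power2_eq_square power3_eq_cube)
      \<comment> \<open>Integrating \<open>d / rho^2\<close> over the sphere would cost a logarithm
        of \<open>d\<close>. Since \<open>rho <= 2\<close>, a factor \<open>rho^(1/4) <= 2\<close>
        can be inserted in the numerator, which leaves \<open>d^(3/4)\<close> times the kernel of
        \<open>maximal_kernel_bound\<close> with \<open>s = 1/4\<close>.\<close>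
      also have "d / \<rho>\<^sup>2 \<le> 2 * (d powr (3/4) * (d powr (1/4) / \<rho> powr (2 + 1/4)))"
      proof -
        have "d powr (3/4) * d powr (1/4) = d" using d by (simp flip: powr_add)
        moreover have "\<rho> powr (2 + 1/4) = \<rho>\<^sup>2 * \<rho> powr (1/4)"
          using powr_add[of \<rho> 2 "1/4"] powr_numeral[OF less_imp_le[OF \<rho>0], of "num.Bit0 num.One"] by simp
        moreover have "\<rho> powr (1/4) \<le> 2"
        proof -
          have "\<rho> powr (1/4) \<le> 2 powr (1/4)" using \<rho>0 \<rho>2 by (intro powr_mono2) auto
          also have "\<dots> \<le> 2 powr 1" by (intro powr_mono) auto
          finally show ?thesis by simp
        qed
        ultimately show ?thesis using \<rho>0 d by (simp add: field_simps)
      qed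
      finally have "d / \<rho> ^ 3 * norm (w \<eta> - w \<xi>) \<le> 2 * L * (2 * (d powr (3/4) * (d powr (1/4) / \<rho> powr (2 + 1/4))))"
        using L0 by (simp add: mult_left_mono)
      from mult_left_mono[OF this ker_const_nonneg[of la mu]]
      have "ker_const la mu * (d / \<rho> ^ 3) * norm (w \<eta> - w \<xi>) \<le> c * (d powr (1/4) / \<rho> powr (2 + 1/4))"
        by (simp add: c_def mult_ac)
      then show "ennreal (ker_const la mu * (d / norm (x - \<eta>) ^ 3) * norm (w \<eta> - w \<xi>)) \<le> ennreal c * ennreal (d powr (1/4) / norm (x - \<eta>) powr (2 + 1/4))"
        using c by (simp add: \<rho>_def ennreal_leI flip: ennreal_mult')
    qed
    also have "\<dots> = (\<integral>\<^sup>+\<eta>. ennreal c * ennreal (d powr (1/4) / norm (x - \<eta>) powr (2 + 1/4)) \<partial>sphere_borel)"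
      by (rule nn_integral_sphere_borel[symmetric]) measurable
    also have "\<dots> = ennreal c * (\<integral>\<^sup>+\<eta>. ennreal (d powr (1/4) / norm (x - \<eta>) powr (2 + 1/4)) \<partial>sphere_borel)"
      by (rule nn_integral_cmult) (simp, measurable)
    also have "\<dots> \<le> ennreal c * ennreal C1"
      unfolding C1_def d_def
      by (intro mult_left_mono maximal_kernel_bound[OF sets_sphere_borel emeasure_sphere_borel_complement \<xi>(1)] sphere_borel_ball_le \<xi>(1))
        (use x x\<xi> d in \<open>auto simp: d_def\<close>)
    also have "\<dots> = ennreal (c * C1)" using c by (simp add: ennreal_mult')
    finally have "norm (v x - w \<xi>) \<le> c * C1" using c C1 by (simp add: ennreal_le_iff)
    moreover have "norm (w \<xi> - w x) \<le> L * d powr (3/4)"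
    proof -
      have "norm (w \<xi> - w x) \<le> L * d" using lip[of \<xi> x] \<xi> x x\<xi> by (simp add: norm_minus_commute)
      also have "L * d \<le> L * d powr (3/4)"
        using powr_mono'[of "3/4" 1 d] d L0 by (intro mult_left_mono) auto
      finally show ?thesis .
    qed
    ultimately have "norm (v x - w x) \<le> c * C1 + L * d powr (3/4)"
      using norm_triangle_ineq[of "v x - w \<xi>" "w \<xi> - w x"] by simp
    then show ?thesis by (simp add: M_def c_def d_def algebra_simps)
  qed
  have "v x - w x = 0" by (rule lame_uniqueness[OF mu solv bound x])
  then show "u (r *\<^sub>R x) = elastic_poisson la mu (\<lambda>\<eta>. u (r *\<^sub>R \<eta>)) x" by (simp add: v_def weq)
qed

section \<open>Nontangential limits of Poisson integrals\<close>

lemma tendsto_within_Gamma: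
  fixes g :: "vec3 \<Rightarrow> 'b::real_normed_vector"
  assumes \<xi>: "norm \<xi> = 1"
    and "\<And>e. e > 0 \<Longrightarrow> \<exists>d>0. \<forall>x. norm x < 1 \<and> norm (x - \<xi>) \<le> 3 * (1 - norm x) \<and> norm (x - \<xi>) < d \<longrightarrow> norm (g x - L) \<le> e"
  shows "(g \<longlongrightarrow> L) (at \<xi> within Gamma \<xi>)"
  unfolding Lim_within
proof (intro allI impI)
  fix e :: real assume "e > 0"
  then obtain d where d: "d > 0" "\<And>x. norm x < 1 \<Longrightarrow> norm (x - \<xi>) \<le> 3 * (1 - norm x) \<Longrightarrow> norm (x - \<xi>) < d \<Longrightarrow> norm (g x - L) \<le> e / 2"
    using assms(2)[of "e / 2"] by auto
  then show "\<exists>d>0. \<forall>x\<in>Gamma \<xi>. 0 < dist x \<xi> \<and> dist x \<xi> < d \<longrightarrow> dist (g x) L < e"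
    using Gamma_props[OF _ \<xi>] \<open>e > 0\<close> by (intro exI[of _ d]) (force simp: dist_norm)
qed

text \<open>At a point where every component of \<open>f\<close> has a Lebesgue point, the measures
  with densities given by the oscillations of the components about their values at \<open>xi\<close>
  have zero density there. The integral of the majorant against them therefore tends to 0 in the
  cone.\<close>

theorem elastic_poisson_converges:
  assumes mu: "mu > 0" "2 * mu + la > 0" and f: "integrable sphere_measure f"
  shows "AE \<xi> in sphere_borel. \<xi> \<in> sphere 0 1 \<and> (elastic_poisson la mu f \<longlongrightarrow> f \<xi>) (at \<xi> within Gamma \<xi>)"
proof -
  \<comment> \<open>\<open>f\<close> is measurable on the sphere only. Its extension by 0 is Borel
    on the whole space, where the density lemmas live.\<close>
  define F where "F \<eta> = indicator (sphere 0 1) \<eta> *\<^sub>R f \<eta>" for \<eta>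
  have Fm: "F \<in> borel_measurable borel"
    using borel_measurable_integrable[OF f] unfolding borel_measurable_sphere_measure_iff F_def .
  have Ff: "F \<eta> = f \<eta>" if "norm \<eta> = 1" for \<eta> using that by (simp add: F_def)
  have "integrable sphere_measure F"
    using f by (rule Bochner_Integration.integrable_cong[THEN iffD1, rotated -1]) (auto simp: Ff)
  then have Fi: "integrable sphere_borel F" using integrable_sphere_borel[OF Fm] by simp
  have Fmi[measurable]: "(\<lambda>\<eta>. F \<eta> $ i) \<in> borel_measurable borel" for i
  proof -
    have "(\<lambda>x::vec3. x $ i) \<in> borel_measurable borel" by (intro borel_measurable_continuous_onI continuous_intros)
    from measurable_compose[OF Fm this] show ?thesis .
  qed
  define \<nu> where "\<nu> i \<xi> = density sphere_borel (\<lambda>\<eta>. ennreal \<bar>F \<eta> $ i - F \<xi> $ i\<bar>)" for i \<xi>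
  have "AE \<xi> in sphere_borel. \<forall>i\<in>(UNIV::3 set). zero_density (\<nu> i \<xi>) \<xi>"
    unfolding \<nu>_def by (rule AE_finite_allI) (auto intro: AE_lebesgue_point[OF Fmi integrable_nth[OF Fi]])
  then show ?thesis using AE_sphere_borel_norm
  proof eventually_elim
    case (elim \<xi>)
    define kc where "kc = ker_const la mu"
    have kc: "kc \<ge> 0" using ker_const_nonneg by (simp add: kc_def)
    have "(elastic_poisson la mu f \<longlongrightarrow> f \<xi>) (at \<xi> within Gamma \<xi>)"
    proof (rule tendsto_within_Gamma[OF elim(2)])
      fix e :: real assume e: "e > 0"
      define e1 where "e1 = e / (3 * (kc + 1))"
      have e1: "e1 > 0" using e kc by (simp add: e1_def)
      have fin: "emeasure (\<nu> i \<xi>) UNIV < \<infinity>" for i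
      proof -
        interpret finite_measure sphere_borel by (rule finite_sphere_borel)
        have "integrable sphere_borel (\<lambda>\<eta>. F \<eta> $ i - F \<xi> $ i)" using integrable_nth[OF Fi] by simp
        then show ?thesis unfolding \<nu>_def by (subst emeasure_density) (auto simp: integrable_iff_bounded)
      qed
      have supp: "emeasure (\<nu> i \<xi>) (- sphere 0 1) = 0" for i
      proof -
        have S: "- sphere (0::vec3) 1 \<in> sets borel" by (intro borel_open) auto
        have "AE \<eta> in sphere_borel. ennreal \<bar>F \<eta> $ i - F \<xi> $ i\<bar> * indicator (- sphere 0 1) \<eta> = 0"
          using AE_sphere_borel_norm by eventually_elim auto
        then have "(\<integral>\<^sup>+\<eta>. ennreal \<bar>F \<eta> $ i - F \<xi> $ i\<bar> * indicator (- sphere 0 1) \<eta> \<partial>sphere_borel) = (\<integral>\<^sup>+\<eta>. 0 \<partial>sphere_borel)"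
          by (rule nn_integral_cong_AE)
        then show ?thesis unfolding \<nu>_def using S by (subst emeasure_density) auto
      qed
      have "\<exists>d>0. \<forall>x. norm x < 1 \<and> norm (x - \<xi>) \<le> 3 * (1 - norm x) \<and> norm (x - \<xi>) < d \<longrightarrow>
          (\<integral>\<^sup>+\<eta>. ennreal ((1 - norm x) / norm (x - \<eta>) ^ 3) \<partial>\<nu> i \<xi>) \<le> ennreal e1" for i
        using elim(1) by (intro zero_density_kernel_small[OF _ supp fin elim(2) _ e1]) (auto simp: \<nu>_def)
      then obtain d where d: "\<And>i. d i > 0" "\<And>i x. norm x < 1 \<Longrightarrow> norm (x - \<xi>) \<le> 3 * (1 - norm x) \<Longrightarrow> norm (x - \<xi>) < d i \<Longrightarrow>
          (\<integral>\<^sup>+\<eta>. ennreal ((1 - norm x) / norm (x - \<eta>) ^ 3) \<partial>\<nu> i \<xi>) \<le> ennreal e1"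
        by metis
      define d0 where "d0 = Min (range d)"
      have d0: "d0 > 0" "\<And>i. d0 \<le> d i" using d(1) by (auto simp: d0_def)
      have "norm (elastic_poisson la mu f x - f \<xi>) \<le> e"
        if x: "norm x < 1" "norm (x - \<xi>) \<le> 3 * (1 - norm x)" "norm (x - \<xi>) < d0" for x
      proof -
        define k where "k \<eta> = (1 - norm x) / norm (x - \<eta>) ^ 3" for \<eta>
        have k0: "k \<eta> \<ge> 0" for \<eta> using x by (simp add: k_def)
        have km[measurable]: "k \<in> borel_measurable borel" unfolding k_def[abs_def] by measurable
        have "ennreal (norm (elastic_poisson la mu f x - f \<xi>)) \<le> (\<integral>\<^sup>+\<eta>. ennreal (kc * k \<eta> * norm (f \<eta> - f \<xi>)) \<partial>sphere_measure)"
          unfolding kc_def k_def by (rule elastic_poisson_minus_const[OF mu x(1) f])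
        also have "\<dots> \<le> (\<integral>\<^sup>+\<eta>. ennreal kc * (\<Sum>i\<in>UNIV. ennreal \<bar>F \<eta> $ i - F \<xi> $ i\<bar> * ennreal (k \<eta>)) \<partial>sphere_measure)"
        proof (rule nn_integral_mono)
          fix \<eta> :: vec3 assume "\<eta> \<in> space sphere_measure"
          then have "norm (f \<eta> - f \<xi>) \<le> (\<Sum>i\<in>UNIV. \<bar>F \<eta> $ i - F \<xi> $ i\<bar>)"
            using norm_le_l1_cart[of "F \<eta> - F \<xi>"] Ff elim(2) by simp
          then have "kc * k \<eta> * norm (f \<eta> - f \<xi>) \<le> kc * k \<eta> * (\<Sum>i\<in>UNIV. \<bar>F \<eta> $ i - F \<xi> $ i\<bar>)"
            using kc k0 by (intro mult_left_mono) auto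
          also have "\<dots> = kc * (\<Sum>i\<in>UNIV. \<bar>F \<eta> $ i - F \<xi> $ i\<bar> * k \<eta>)" by (simp add: sum_distrib_left mult_ac)
          finally have "ennreal (kc * k \<eta> * norm (f \<eta> - f \<xi>)) \<le> ennreal (kc * (\<Sum>i\<in>UNIV. \<bar>F \<eta> $ i - F \<xi> $ i\<bar> * k \<eta>))"
            by (rule ennreal_leI)
          also have "\<dots> = ennreal kc * (\<Sum>i\<in>UNIV. ennreal (\<bar>F \<eta> $ i - F \<xi> $ i\<bar> * k \<eta>))"
            unfolding ennreal_mult'[OF kc] by (subst sum_ennreal) (use k0 in auto)
          also have "\<dots> = ennreal kc * (\<Sum>i\<in>UNIV. ennreal \<bar>F \<eta> $ i - F \<xi> $ i\<bar> * ennreal (k \<eta>))"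
            by (simp add: ennreal_mult')
          finally show "ennreal (kc * k \<eta> * norm (f \<eta> - f \<xi>)) \<le> ennreal kc * (\<Sum>i\<in>UNIV. ennreal \<bar>F \<eta> $ i - F \<xi> $ i\<bar> * ennreal (k \<eta>))" .
        qed
        also have "\<dots> = (\<integral>\<^sup>+\<eta>. ennreal kc * (\<Sum>i\<in>UNIV. ennreal \<bar>F \<eta> $ i - F \<xi> $ i\<bar> * ennreal (k \<eta>)) \<partial>sphere_borel)"
          by (rule nn_integral_sphere_borel[symmetric]) measurable
        also have "\<dots> = ennreal kc * (\<integral>\<^sup>+\<eta>. (\<Sum>i\<in>UNIV. ennreal \<bar>F \<eta> $ i - F \<xi> $ i\<bar> * ennreal (k \<eta>)) \<partial>sphere_borel)"
          by (rule nn_integral_cmult) (unfold measurable_sphere_borel_eq, measurable)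
        also have "(\<integral>\<^sup>+\<eta>. (\<Sum>i\<in>UNIV. ennreal \<bar>F \<eta> $ i - F \<xi> $ i\<bar> * ennreal (k \<eta>)) \<partial>sphere_borel)
            = (\<Sum>i\<in>UNIV. \<integral>\<^sup>+\<eta>. ennreal \<bar>F \<eta> $ i - F \<xi> $ i\<bar> * ennreal (k \<eta>) \<partial>sphere_borel)"
          by (rule nn_integral_sum) (unfold measurable_sphere_borel_eq, measurable)
        also have "\<dots> = (\<Sum>i\<in>UNIV. \<integral>\<^sup>+\<eta>. ennreal (k \<eta>) \<partial>\<nu> i \<xi>)"
          unfolding \<nu>_def by (intro sum.cong refl nn_integral_density[symmetric]; unfold measurable_sphere_borel_eq; measurable)
        also have "\<dots> \<le> (\<Sum>i\<in>(UNIV::3 set). ennreal e1)"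
          unfolding k_def using x d0 by (intro sum_mono d(2)) (auto intro: less_le_trans)
        also have "\<dots> = ennreal (3 * e1)"
          using e1 by (subst sum_ennreal) auto
        also have "ennreal kc * ennreal (3 * e1) = ennreal (kc * (3 * e1))"
          using kc by (simp add: ennreal_mult')
        finally have "norm (elastic_poisson la mu f x - f \<xi>) \<le> kc * (3 * e1)"
          using kc e1 by (simp add: ennreal_le_iff mult_left_mono)
        also have "\<dots> = e * (kc / (kc + 1))" unfolding e1_def using kc by (simp add: divide_simps)
        also have "\<dots> \<le> e * 1" using e kc by (intro mult_left_mono) auto
        finally show ?thesis by simp
      qed
      then show "\<exists>d>0. \<forall>x. norm x < 1 \<and> norm (x - \<xi>) \<le> 3 * (1 - norm x) \<and> norm (x - \<xi>) < d \<longrightarrow> norm (elastic_poisson la mu f x - f \<xi>) \<le> e"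
        using d0(1) by blast
    qed
    then show ?case using elim(2) by simp
  qed
qed

section \<open>Limits of Poisson integrals of measures\<close>

lemma elastic_entry_bound:
  assumes "mu > 0" "2 * mu + la > 0" "norm e = 1" "norm x < 1"
  shows "\<bar>elastic_entry la mu x i j e\<bar> \<le> ker_const la mu * ((1 - norm x) / norm (x - e) ^ 3)"
proof -
  have "\<bar>elastic_entry la mu x i j e\<bar> \<le> (1 + 1404 * \<bar>beta_e la mu\<bar>) * ((1 - norm x) / norm (x - e) ^ 3)"
    using elastic_kernel_entry_bound[OF assms] elastic_kernel_eq[OF assms] by (simp add: elastic_entry_def)
  also have "\<dots> \<le> ker_const la mu * ((1 - norm x) / norm (x - e) ^ 3)"
    using assms by (intro mult_right_mono) (auto simp: ker_const_def)
  finally show ?thesis .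
qed

lemma elastic_entry_integrable_measure:
  fixes \<nu> :: "vec3 measure"
  assumes mu: "mu > 0" "2 * mu + la > 0" and x: "norm x < 1"
    and sets: "sets \<nu> = sets borel" and supp: "emeasure \<nu> (- sphere 0 1) = 0" and fin: "emeasure \<nu> UNIV < \<infinity>"
  shows "integrable \<nu> (elastic_entry la mu x i j)"
proof -
  have spc: "space \<nu> = UNIV" using sets_eq_imp_space_eq[OF sets] by simp
  interpret finite_measure \<nu> by (rule finite_measureI) (use fin spc in auto)
  show ?thesis
  proof (rule integrable_const_bound)
    show "AE e in \<nu>. norm (elastic_entry la mu x i j e) \<le> ker_const la mu * ((1 - norm x) / (1 - norm x) ^ 3)"
      using AE_norm_1[OF sets supp]
    proof eventually_elim
      case (elim e)
      have "1 - norm x \<le> norm (x - e)" using norm_triangle_ineq2[of e x] elim by (simp add: norm_minus_commute)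
      then have "(1 - norm x) / norm (x - e) ^ 3 \<le> (1 - norm x) / (1 - norm x) ^ 3"
        using x by (intro frac_le power_mono) auto
      then show ?case using elastic_entry_bound[OF mu elim x, of i j] ker_const_nonneg[of la mu]
        by (smt (verit) mult_left_mono real_norm_def)
    qed
    show "elastic_entry la mu x i j \<in> borel_measurable \<nu>"
      by (subst measurable_cong_sets[OF sets refl]) (rule elastic_entry_measurable)
  qed
qed

lemma zero_density_elastic_entry_limit:
  fixes \<nu> :: "vec3 measure"
  assumes mu: "mu > 0" "2 * mu + la > 0"
    and sets: "sets \<nu> = sets borel" and supp: "emeasure \<nu> (- sphere 0 1) = 0" and fin: "emeasure \<nu> UNIV < \<infinity>"
    and \<xi>: "norm \<xi> = 1" and d: "zero_density \<nu> \<xi>"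
  shows "((\<lambda>x. \<integral>\<eta>. elastic_entry la mu x i j \<eta> \<partial>\<nu>) \<longlongrightarrow> 0) (at \<xi> within Gamma \<xi>)"
proof (rule tendsto_within_Gamma[OF \<xi>])
  fix e :: real assume e: "e > 0"
  define kc where "kc = ker_const la mu"
  have kc: "kc \<ge> 0" using ker_const_nonneg by (simp add: kc_def)
  define e1 where "e1 = e / (kc + 1)"
  have e1: "e1 > 0" using e kc by (simp add: e1_def)
  obtain r where r: "r > 0" "\<And>x. norm x < 1 \<Longrightarrow> norm (x - \<xi>) \<le> 3 * (1 - norm x) \<Longrightarrow> norm (x - \<xi>) < r \<Longrightarrow>
     (\<integral>\<^sup>+\<eta>. ennreal ((1 - norm x) / norm (x - \<eta>) ^ 3) \<partial>\<nu>) \<le> ennreal e1"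
    using zero_density_kernel_small[OF sets supp fin \<xi> d e1] by blast
  have "norm ((\<integral>\<eta>. elastic_entry la mu x i j \<eta> \<partial>\<nu>) - 0) \<le> e"
    if x: "norm x < 1" "norm (x - \<xi>) \<le> 3 * (1 - norm x)" "norm (x - \<xi>) < r" for x
  proof -
    have "ennreal (norm (\<integral>\<eta>. elastic_entry la mu x i j \<eta> \<partial>\<nu>)) \<le> (\<integral>\<^sup>+\<eta>. ennreal (norm (elastic_entry la mu x i j \<eta>)) \<partial>\<nu>)"
      by (rule integral_norm_bound_ennreal[OF elastic_entry_integrable_measure[OF mu x(1) sets supp fin]])
    also have "\<dots> \<le> (\<integral>\<^sup>+\<eta>. ennreal kc * ennreal ((1 - norm x) / norm (x - \<eta>) ^ 3) \<partial>\<nu>)"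
    proof (rule nn_integral_mono_AE)
      show "AE \<eta> in \<nu>. ennreal (norm (elastic_entry la mu x i j \<eta>)) \<le> ennreal kc * ennreal ((1 - norm x) / norm (x - \<eta>) ^ 3)"
        using AE_norm_1[OF sets supp]
      proof eventually_elim
        case (elim \<eta>)
        have "ennreal (norm (elastic_entry la mu x i j \<eta>)) \<le> ennreal (kc * ((1 - norm x) / norm (x - \<eta>) ^ 3))"
          using elastic_entry_bound[OF mu elim x(1), of i j] by (intro ennreal_leI) (simp add: kc_def)
        then show ?case using kc by (simp only: ennreal_mult')
      qed
    qed
    also have "\<dots> = ennreal kc * (\<integral>\<^sup>+\<eta>. ennreal ((1 - norm x) / norm (x - \<eta>) ^ 3) \<partial>\<nu>)"
      by (rule nn_integral_cmult) (subst measurable_cong_sets[OF sets refl], measurable)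
    also have "\<dots> \<le> ennreal kc * ennreal e1" by (intro mult_left_mono r(2) x) simp
    also have "\<dots> = ennreal (kc * e1)" using kc by (simp add: ennreal_mult')
    finally have "norm (\<integral>\<eta>. elastic_entry la mu x i j \<eta> \<partial>\<nu>) \<le> kc * e1" using kc e1 by (simp add: ennreal_le_iff)
    also have "\<dots> = e * (kc / (kc + 1))" by (simp add: e1_def)
    also have "\<dots> \<le> e * 1" using e kc by (intro mult_left_mono) auto
    finally show ?thesis by simp
  qed
  then show "\<exists>d>0. \<forall>x. norm x < 1 \<and> norm (x - \<xi>) \<le> 3 * (1 - norm x) \<and> norm (x - \<xi>) < d \<longrightarrow> norm ((\<integral>\<eta>. elastic_entry la mu x i j \<eta> \<partial>\<nu>) - 0) \<le> e"
    using r(1) by blast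
qed

text \<open>The Radon-Nikodym density is finite almost everywhere because the total mass is finite;
  \<open>enn2real\<close> then makes it a real function that is nonnegative everywhere.\<close>

lemma finite_abs_continuous_density:
  fixes \<nu> :: "vec3 measure"
  assumes sets: "sets \<nu> = sets borel" and fin: "emeasure \<nu> UNIV < \<infinity>"
    and ac: "\<And>N. N \<in> null_sets sphere_borel \<Longrightarrow> emeasure \<nu> N = 0"
  shows "\<exists>g::vec3 \<Rightarrow> real. g \<in> borel_measurable borel \<and> (\<forall>x. 0 \<le> g x) \<and> integrable sphere_borel g \<and> \<nu> = density sphere_borel (\<lambda>x. ennreal (g x))"
proof -
  interpret finite_measure sphere_borel by (rule finite_sphere_borel)
  have "absolutely_continuous sphere_borel \<nu>"
    unfolding absolutely_continuous_def using ac sets by (auto simp: null_sets_def)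
  then obtain h where h: "h \<in> borel_measurable sphere_borel" "density sphere_borel h = \<nu>"
    using Radon_Nikodym[of \<nu>] sets by auto
  have hm: "h \<in> borel_measurable borel" using h(1) by simp
  have tot: "(\<integral>\<^sup>+x. h x \<partial>sphere_borel) = emeasure \<nu> UNIV"
    unfolding h(2)[symmetric] using h(1) by (subst emeasure_density) auto
  then have AEh: "AE x in sphere_borel. h x \<noteq> \<infinity>"
    using fin h(1) by (intro nn_integral_PInf_AE) auto
  define g where "g x = enn2real (h x)" for x
  have gm: "g \<in> borel_measurable borel" unfolding g_def[abs_def] using hm by measurable
  have AEg: "AE x in sphere_borel. h x = ennreal (g x)"
    using AEh by eventually_elim (simp add: g_def less_top)
  have "density sphere_borel (\<lambda>x. ennreal (g x)) = density sphere_borel h"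
    by (rule density_cong) (use gm hm AEg in \<open>auto elim: eventually_mono\<close>)
  moreover have "integrable sphere_borel g"
  proof (rule integrableI_nonneg)
    have "(\<integral>\<^sup>+x. ennreal (g x) \<partial>sphere_borel) = (\<integral>\<^sup>+x. h x \<partial>sphere_borel)"
      using AEg by (intro nn_integral_cong_AE) (auto elim: eventually_mono)
    then show "(\<integral>\<^sup>+x. ennreal (g x) \<partial>sphere_borel) < \<infinity>" using tot fin by simp
  qed (use gm in \<open>auto simp: g_def\<close>)
  ultimately show ?thesis using gm h(2) by (intro exI[of _ g]) (auto simp: g_def)
qed

lemma elastic_entry_density_integral:
  assumes mu: "mu > 0" "2 * mu + la > 0" and x: "norm x < 1"
    and g: "g \<in> borel_measurable borel" "\<And>x. 0 \<le> g x"
  shows "(\<integral>\<eta>. elastic_entry la mu x i j \<eta> \<partial>density sphere_borel (\<lambda>x. ennreal (g x))) = (\<integral>\<eta>. elastic_entry la mu x i j \<eta> * g \<eta> \<partial>sphere_measure)"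
proof -
  have "(\<integral>\<eta>. elastic_entry la mu x i j \<eta> \<partial>density sphere_borel (\<lambda>x. ennreal (g x))) = (\<integral>\<eta>. g \<eta> *\<^sub>R elastic_entry la mu x i j \<eta> \<partial>sphere_borel)"
    using g by (intro integral_density) auto
  also have "\<dots> = (\<integral>\<eta>. g \<eta> *\<^sub>R elastic_entry la mu x i j \<eta> \<partial>sphere_measure)"
    using g elastic_entry_measurable by (intro integral_sphere_borel) measurable
  finally show ?thesis by (simp add: mult.commute)
qed

text \<open>Exhaustion: \<open>N\<close> is a countable union of surface null sets along which the
  mass approaches its supremum over all such sets. A null set with positive mass outside
  \<open>N\<close> would exceed that supremum, which is finite. The measure thus splits into a part
  on \<open>N\<close>, singular to surface measure, and an absolutely continuous part off
  \<open>N\<close>.\<close>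

lemma maximal_null_set:
  fixes \<nu> :: "vec3 measure"
  assumes sets: "sets \<nu> = sets borel" and fin: "emeasure \<nu> UNIV < \<infinity>"
  shows "\<exists>N\<in>null_sets sphere_borel. \<forall>A\<in>null_sets sphere_borel. emeasure \<nu> (A - N) = 0"
proof -
  define s where "s = (SUP A\<in>null_sets sphere_borel. emeasure \<nu> A)"
  have ne: "null_sets sphere_borel \<noteq> {}" by auto
  obtain X :: "nat \<Rightarrow> ennreal" where X: "range X \<subseteq> emeasure \<nu> ` null_sets sphere_borel" "s = (SUP i. X i)"
    using ennreal_SUP_countable_SUP[OF ne, of "emeasure \<nu>"] unfolding s_def by auto
  have "\<forall>i. \<exists>A\<in>null_sets sphere_borel. X i = emeasure \<nu> A" using X(1) by auto
  then obtain A where A: "\<And>i. A i \<in> null_sets sphere_borel" "\<And>i. X i = emeasure \<nu> (A i)" by metis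
  define N where "N = (\<Union>i. A i)"
  have N: "N \<in> null_sets sphere_borel" unfolding N_def using A(1) by auto
  have Nb: "B \<in> sets \<nu>" if "B \<in> null_sets sphere_borel" for B using that sets by (simp add: null_sets_def)
  have spc: "space \<nu> = UNIV" using sets_eq_imp_space_eq[OF sets] by simp
  have "emeasure \<nu> (B - N) = 0" if B: "B \<in> null_sets sphere_borel" for B
  proof -
    have "s \<le> emeasure \<nu> N"
      unfolding X(2) A(2) by (intro SUP_least emeasure_mono Nb[OF N]) (auto simp: N_def)
    moreover have BN: "B - N \<in> null_sets sphere_borel" using B N by (intro null_set_Diff) (auto simp: null_sets_def)
    moreover have "emeasure \<nu> (N \<union> (B - N)) \<le> s"
      unfolding s_def using N BN by (intro SUP_upper null_sets.Un)
    moreover have "emeasure \<nu> (N \<union> (B - N)) = emeasure \<nu> N + emeasure \<nu> (B - N)"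
      using Nb[OF N] Nb[OF BN] by (intro plus_emeasure[symmetric]) auto
    ultimately have "emeasure \<nu> N + emeasure \<nu> (B - N) \<le> emeasure \<nu> N + 0"
      unfolding add_0_right by (metis order_trans)
    moreover have "emeasure \<nu> N < top" using fin emeasure_space[of \<nu> N] unfolding spc by (auto intro: le_less_trans)
    ultimately show ?thesis using ennreal_add_left_cancel_le[of "emeasure \<nu> N" "emeasure \<nu> (B - N)" 0] by auto
  qed
  then show ?thesis using N by blast
qed

text \<open>The absolutely continuous part of the measure yields the Poisson integral of an
  integrable function, which converges by \<open>elastic_poisson_converges\<close>. The singular
  part has zero density almost everywhere and its integral tends to 0.\<close>

theorem elastic_entry_measure_limit:
  fixes \<nu> :: "vec3 measure"
  assumes mu: "mu > 0" "2 * mu + la > 0"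
    and sets: "sets \<nu> = sets borel" and supp: "emeasure \<nu> (- sphere 0 1) = 0" and fin: "emeasure \<nu> UNIV < \<infinity>"
  shows "AE \<xi> in sphere_borel. \<exists>L. ((\<lambda>x. \<integral>\<eta>. elastic_entry la mu x i j \<eta> \<partial>\<nu>) \<longlongrightarrow> L) (at \<xi> within Gamma \<xi>)"
proof -
  have spc: "space \<nu> = UNIV" using sets_eq_imp_space_eq[OF sets] by simp
  obtain N where N: "N \<in> null_sets sphere_borel" "\<And>A. A \<in> null_sets sphere_borel \<Longrightarrow> emeasure \<nu> (A - N) = 0"
    using maximal_null_set[OF sets fin] by blast
  have Nb: "N \<in> sets borel" using N(1) by (simp add: null_sets_def)
  define \<nu>1 where "\<nu>1 = density \<nu> (indicator (- N))"
  define \<nu>2 where "\<nu>2 = density \<nu> (indicator N)"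
  have st: "N \<in> sets \<nu>" "- N \<in> sets \<nu>" using Nb sets by auto
  have s12: "sets \<nu>1 = sets borel" "sets \<nu>2 = sets borel" by (auto simp: \<nu>1_def \<nu>2_def sets)
  have em1: "emeasure \<nu>1 A = emeasure \<nu> (- N \<inter> A)" if "A \<in> sets borel" for A
    unfolding \<nu>1_def by (rule emeasure_restricted[OF st(2)]) (simp only: sets that)
  have em2: "emeasure \<nu>2 A = emeasure \<nu> (N \<inter> A)" if "A \<in> sets borel" for A
    unfolding \<nu>2_def by (rule emeasure_restricted[OF st(1)]) (simp only: sets that)
  have le12: "emeasure \<nu>1 A \<le> emeasure \<nu> A" "emeasure \<nu>2 A \<le> emeasure \<nu> A" if "A \<in> sets borel" for A
    unfolding em1[OF that] em2[OF that] by (rule emeasure_mono; simp only: sets that Int_lower2)+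
  have S: "- sphere (0::vec3) 1 \<in> sets borel" by (intro borel_open) auto
  have supp12: "emeasure \<nu>1 (- sphere 0 1) = 0" "emeasure \<nu>2 (- sphere 0 1) = 0" using le12[OF S] supp by auto
  have fin12: "emeasure \<nu>1 UNIV < \<infinity>" "emeasure \<nu>2 UNIV < \<infinity>"
    using le12[of UNIV] fin by (auto intro: le_less_trans)
  have "emeasure \<nu>1 A = 0" if "A \<in> null_sets sphere_borel" for A
    using N(2)[OF that] em1[of A] that by (simp add: null_sets_def Diff_eq Int_commute)
  then obtain g where g: "g \<in> borel_measurable borel" "\<And>x. 0 \<le> g x" "integrable sphere_borel g" "\<nu>1 = density sphere_borel (\<lambda>x. ennreal (g x))"
    using finite_abs_continuous_density[OF s12(1) fin12(1)] by auto
  \<comment> \<open>Placing the density in the single component \<open>j\<close> makes the integral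
    of one kernel entry equal to component \<open>i\<close> of an elastic Poisson integral.\<close>
  define f where "f \<eta> = axis j (g \<eta>)" for \<eta>
  have gi: "integrable sphere_measure g" using g integrable_sphere_borel[OF g(1)] by simp
  have fi: "integrable sphere_measure f"
  proof (rule integrable_vec3I)
    fix k show "integrable sphere_measure (\<lambda>x. f x $ k)" using gi by (cases "k = j") (simp_all add: f_def axis_def)
  qed
  have split: "(\<integral>\<eta>. elastic_entry la mu x i j \<eta> \<partial>\<nu>) = elastic_poisson la mu f x $ i + (\<integral>\<eta>. elastic_entry la mu x i j \<eta> \<partial>\<nu>2)" if x: "norm x < 1" for x
  proof -
    have KI: "integrable \<nu> (elastic_entry la mu x i j)" by (rule elastic_entry_integrable_measure[OF mu x sets supp fin])
    have KIn: "integrable \<nu> (\<lambda>\<eta>. indicator A \<eta> *\<^sub>R elastic_entry la mu x i j \<eta>)" if "A \<in> sets \<nu>" for A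
      by (rule integrable_mult_indicator[OF that KI])
    have D: "(\<integral>\<eta>. elastic_entry la mu x i j \<eta> \<partial>density \<nu> (indicator A)) = (\<integral>\<eta>. indicator A \<eta> *\<^sub>R elastic_entry la mu x i j \<eta> \<partial>\<nu>)" if "A \<in> sets \<nu>" for A
      using integral_density[of "elastic_entry la mu x i j" \<nu> "indicator A"] KI that by (simp add: ennreal_indicator)
    have "(\<integral>\<eta>. elastic_entry la mu x i j \<eta> \<partial>\<nu>) = (\<integral>\<eta>. indicator (- N) \<eta> *\<^sub>R elastic_entry la mu x i j \<eta> + indicator N \<eta> *\<^sub>R elastic_entry la mu x i j \<eta> \<partial>\<nu>)"
      by (intro Bochner_Integration.integral_cong refl) (auto simp: indicator_def)
    also have "\<dots> = (\<integral>\<eta>. elastic_entry la mu x i j \<eta> \<partial>\<nu>1) + (\<integral>\<eta>. elastic_entry la mu x i j \<eta> \<partial>\<nu>2)"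
      unfolding \<nu>1_def \<nu>2_def D[OF st(1)] D[OF st(2)] using KIn[OF st(1)] KIn[OF st(2)] by simp
    also have "(\<integral>\<eta>. elastic_entry la mu x i j \<eta> \<partial>\<nu>1) = (\<integral>\<eta>. elastic_entry la mu x i j \<eta> * g \<eta> \<partial>sphere_measure)"
      unfolding g(4) by (rule elastic_entry_density_integral[OF mu x g(1,2)])
    also have "\<dots> = (\<Sum>k\<in>UNIV. if k = j then (\<integral>\<eta>. elastic_entry la mu x i j \<eta> * g \<eta> \<partial>sphere_measure) else 0)" by simp
    also have "\<dots> = elastic_poisson la mu f x $ i"
      unfolding elastic_poisson_nth[OF mu x fi] by (intro sum.cong refl) (auto simp: f_def axis_def)
    finally show ?thesis .
  qed
  have "emeasure \<nu>2 (- N) = 0" using em2[of "- N"] Nb by simp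
  \<comment> \<open>The singular part gives no mass to the complement of \<open>N\<close>, and this
    complement carries all of the surface measure.\<close>
  then have "AE \<xi> in sphere_borel. \<xi> \<in> - N \<longrightarrow> zero_density \<nu>2 \<xi>" by (intro AE_zero_density[OF s12(2) fin12(2)]) (use Nb in auto)
  then show ?thesis using elastic_poisson_converges[OF mu fi] AE_not_in[OF N(1)]
  proof eventually_elim
    case (elim \<xi>)
    then have \<xi>: "norm \<xi> = 1" "zero_density \<nu>2 \<xi>" by auto
    have a: "((\<lambda>x. elastic_poisson la mu f x $ i) \<longlongrightarrow> f \<xi> $ i) (at \<xi> within Gamma \<xi>)"
      using elim by (intro tendsto_vec_nth) auto
    have "((\<lambda>x. elastic_poisson la mu f x $ i + (\<integral>\<eta>. elastic_entry la mu x i j \<eta> \<partial>\<nu>2)) \<longlongrightarrow> f \<xi> $ i + 0) (at \<xi> within Gamma \<xi>)"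
      by (rule tendsto_add[OF a zero_density_elastic_entry_limit[OF mu s12(2) supp12(2) fin12(2) \<xi>]])
    moreover have "\<forall>\<^sub>F x in at \<xi> within Gamma \<xi>. elastic_poisson la mu f x $ i + (\<integral>\<eta>. elastic_entry la mu x i j \<eta> \<partial>\<nu>2) = (\<integral>\<eta>. elastic_entry la mu x i j \<eta> \<partial>\<nu>)"
      unfolding eventually_at_filter by (rule always_eventually) (auto simp: Gamma_props(1)[OF _ \<xi>(1)] split)
    ultimately have "((\<lambda>x. \<integral>\<eta>. elastic_entry la mu x i j \<eta> \<partial>\<nu>) \<longlongrightarrow> f \<xi> $ i + 0) (at \<xi> within Gamma \<xi>)"
      by (rule Lim_transform_eventually)
    then show ?case by blast
  qed
qed

section \<open>Weak compactness of measures on the sphere\<close>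

definition zigzag :: "real \<Rightarrow> real" where
  "zigzag t = max 0 (min 1 (1 / 2 - cos (pi * t)))"

lemma zigzag_bounds: "0 \<le> zigzag t" "zigzag t \<le> 1"
  by (auto simp: zigzag_def)

lemma zigzag_periodic: "zigzag (2 * real n + s) = zigzag s"
proof -
  have "cos (pi * (2 * real n + s)) = cos (pi * s)"
    using cos.plus_of_nat[of "pi * s" n] by (simp add: algebra_simps)
  then show ?thesis by (simp add: zigzag_def)
qed

text \<open>The clipped cosine is 0 where \<open>cos (pi t) >= 1/2\<close>, in particular for
  \<open>t\<close> between 0 and \<open>1/3\<close>, and 1 where \<open>cos (pi t) <= -1/2\<close>,
  in particular between \<open>2/3\<close> and 1. It therefore reads off a leading ternary digit 0
  or 2, whatever digits follow.\<close>

lemma zigzag_digit: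
  assumes "a = 0 \<or> a = (1::nat)" "0 \<le> s" "s \<le> 1 / 3"
  shows "zigzag (2 * real a / 3 + s) = real a"
proof -
  have c: "cos (pi * s) \<ge> 1 / 2" if "0 \<le> s" "s \<le> 1 / 3" for s
  proof -
    have "cos (pi / 3) \<le> cos (pi * s)"
      using that by (intro cos_monotone_0_pi_le) (auto simp: mult_left_le_one_le field_simps)
    then show ?thesis by (simp add: cos_60)
  qed
  show ?thesis
  proof (cases "a = 0")
    case True
    then show ?thesis using c[OF assms(2,3)] by (simp add: zigzag_def)
  next
    case False
    then have a: "a = 1" using assms by simp
    have "cos (pi * (2 / 3 + s)) = - cos (pi * (1 / 3 - s))"
      using cos_pi_minus[of "pi * (1 / 3 - s)"] by (simp add: algebra_simps)
    then have "cos (pi * (2 / 3 + s)) \<le> - (1 / 2)" using c[of "1 / 3 - s"] assms by simp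
    then show ?thesis using a by (simp add: zigzag_def)
  qed
qed

text \<open>If all ternary digits of \<open>t\<close> are 0 or 2, coordinate \<open>i\<close> takes
  the digits in the positions congruent to \<open>i\<close> modulo 3, halves them, and uses them as
  binary digits. Between such parameters the continuity of \<open>zigzag\<close>
  interpolates.\<close>

definition schoenberg :: "nat \<Rightarrow> real \<Rightarrow> real" where
  "schoenberg i t = (\<Sum>n. zigzag (3 ^ (3 * n + i) * t) / 2 ^ Suc n)"

lemma summable_half: "summable (\<lambda>n. (1::real) / 2 ^ Suc n)"
  using power_half_series sums_summable by (simp add: power_divide)

lemma schoenberg_continuous: "continuous_on UNIV (schoenberg i)"
proof -
  have z: "continuous_on UNIV zigzag" unfolding zigzag_def[abs_def] by (intro continuous_intros)
  have "uniform_limit UNIV (\<lambda>N t. \<Sum>n<N. zigzag (3 ^ (3 * n + i) * t) / 2 ^ Suc n) (schoenberg i) sequentially"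
    unfolding schoenberg_def[abs_def]
    by (rule Weierstrass_m_test[OF _ summable_half]) (use zigzag_bounds in \<open>auto simp: divide_right_mono\<close>)
  then show ?thesis
  proof (rule uniform_limit_theorem[rotated])
    show "\<forall>\<^sub>F N in sequentially. continuous_on UNIV (\<lambda>t. \<Sum>n<N. zigzag (3 ^ (3 * n + i) * t) / 2 ^ Suc n)"
      by (intro always_eventually allI continuous_intros continuous_on_compose2[OF z]) auto
  qed simp
qed

text \<open>The digit is the excess of the integer part of \<open>2^(n+1) y\<close> over twice that
  of \<open>2^n y\<close>. The partial sums telescope to the integer part of \<open>2^N y\<close>
  divided by \<open>2^N\<close>.\<close>

lemma binary_digits:
  fixes y :: real
  assumes "0 \<le> y" "y < 1"
  shows "\<exists>a::nat \<Rightarrow> nat. (\<forall>n. a n = 0 \<or> a n = 1) \<and> (\<lambda>n. real (a n) / 2 ^ Suc n) sums y"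
proof -
  define F where "F n = nat \<lfloor>2 ^ n * y\<rfloor>" for n
  define a where "a n = F (Suc n) - 2 * F n" for n
  have F: "real (F n) \<le> 2 ^ n * y" "2 ^ n * y < real (F n) + 1" for n
  proof -
    have "0 \<le> \<lfloor>2 ^ n * y\<rfloor>" using assms by simp
    then have "real (F n) = of_int \<lfloor>2 ^ n * y\<rfloor>" by (simp add: F_def)
    then show "real (F n) \<le> 2 ^ n * y" "2 ^ n * y < real (F n) + 1" by linarith+
  qed
  have step: "2 * F n \<le> F (Suc n)" "F (Suc n) \<le> 2 * F n + 1" for n
  proof -
    have s: "(2::real) ^ Suc n * y = 2 * (2 ^ n * y)" by simp
    have "real (2 * F n) < real (F (Suc n) + 1)" using F[of n] F(2)[of "Suc n"] unfolding s by simp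
    then show "2 * F n \<le> F (Suc n)" by linarith
    have "real (F (Suc n)) < real (2 * F n + 2)" using F[of n] F(1)[of "Suc n"] unfolding s by simp
    then show "F (Suc n) \<le> 2 * F n + 1" by linarith
  qed
  have a01: "a n = 0 \<or> a n = 1" for n using step[of n] by (auto simp: a_def)
  have ar: "real (a n) = real (F (Suc n)) - 2 * real (F n)" for n using step[of n] by (simp add: a_def)
  have F0: "F 0 = 0" using assms by (simp add: F_def floor_eq_iff)
  have S: "(\<Sum>n<N. real (a n) / 2 ^ Suc n) = real (F N) / 2 ^ N" for N
  proof (induction N)
    case (Suc N)
    then show ?case by (simp add: ar field_simps)
  qed (simp add: F0)
  have "(\<lambda>N. real (F N) / 2 ^ N) \<longlonglongrightarrow> y"
  proof (rule LIMSEQ_I)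
    fix r :: real assume "r > 0"
    then obtain n0 where n0: "1 / r < 2 ^ n0" using real_arch_pow[of 2 "1 / r"] by auto
    have "norm (real (F N) / 2 ^ N - y) < r" if "N \<ge> n0" for N
    proof -
      have "\<bar>real (F N) - 2 ^ N * y\<bar> \<le> 1" using F[of N] by linarith
      moreover have "real (F N) / 2 ^ N - y = (real (F N) - 2 ^ N * y) / 2 ^ N" by (simp add: field_simps)
      ultimately have "\<bar>real (F N) / 2 ^ N - y\<bar> \<le> 1 / 2 ^ N" by (simp add: divide_right_mono)
      also have "\<dots> \<le> 1 / 2 ^ n0" using that by (intro divide_left_mono power_increasing) auto
      also have "\<dots> < r" using n0 \<open>r > 0\<close> by (simp add: field_simps)
      finally show ?thesis by simp
    qed
    then show "\<exists>no. \<forall>N\<ge>no. norm (real (F N) / 2 ^ N - y) < r" by blast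
  qed
  then have "(\<lambda>n. real (a n) / 2 ^ Suc n) sums y" unfolding sums_def S .
  then show ?thesis using a01 by blast
qed

text \<open>The point of the Cantor set with ternary digits \<open>2 * A n\<close>. Multiplication
  by \<open>3^m\<close> produces an even integer, which periodicity removes, then
  \<open>2 * A m / 3\<close>, and a tail between 0 and \<open>1/3\<close>.\<close>

lemma ternary_point:
  fixes A :: "nat \<Rightarrow> nat"
  assumes A: "\<And>n. A n = 0 \<or> A n = 1"
  shows "\<exists>t. 0 \<le> t \<and> t \<le> 1 \<and> (\<forall>m. zigzag (3 ^ m * t) = real (A m))"
proof -
  define c where "c n = 2 * real (A n) / 3 ^ Suc n" for n
  have A1: "real (A n) \<le> 1" for n using A[of n] by auto
  have g: "(\<lambda>n. 2 / 3 ^ Suc (n + k)) sums ((1::real) / 3 ^ k)" for k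
  proof -
    have "(\<lambda>n. (2 / 3 ^ Suc k) * (1 / 3) ^ n) sums ((2 / 3 ^ Suc k) * (1 / (1 - 1 / 3 :: real)))"
      by (intro sums_mult geometric_sums) simp
    moreover have "(2 / 3 ^ Suc k) * (1 / (1 - 1 / 3 :: real)) = 1 / 3 ^ k" by simp
    moreover have "(2 / 3 ^ Suc k) * (1 / 3) ^ n = (2::real) / 3 ^ Suc (n + k)" for n
      by (simp add: power_add power_divide)
    ultimately show ?thesis by simp
  qed
  have c0: "0 \<le> c n" "c n \<le> 2 / 3 ^ Suc n" for n using A1[of n] by (auto simp: c_def divide_right_mono)
  have cs: "summable (\<lambda>n. c (n + k))" for k
    by (rule summable_comparison_test'[OF sums_summable[OF g[of k]], of 0]) (use c0 in auto)
  have tail: "0 \<le> (\<Sum>n. c (n + k))" "(\<Sum>n. c (n + k)) \<le> 1 / 3 ^ k" for k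
  proof -
    show "0 \<le> (\<Sum>n. c (n + k))" by (intro suminf_nonneg cs c0)
    have "(\<Sum>n. c (n + k)) \<le> (\<Sum>n. 2 / 3 ^ Suc (n + k))"
      by (intro suminf_le cs sums_summable[OF g] c0)
    then show "(\<Sum>n. c (n + k)) \<le> 1 / 3 ^ k" using sums_unique[OF g[of k]] by simp
  qed
  define t where "t = (\<Sum>n. c n)"
  have "zigzag (3 ^ m * t) = real (A m)" for m
  proof -
    have "t = (\<Sum>n. c (n + Suc m)) + (\<Sum>n<Suc m. c n)"
      unfolding t_def by (rule suminf_split_initial_segment) (use cs[of 0] in simp)
    then have "3 ^ m * t = 3 ^ m * (\<Sum>n<m. c n) + 3 ^ m * c m + 3 ^ m * (\<Sum>n. c (n + Suc m))"
      by (simp add: algebra_simps)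
    also have "3 ^ m * (\<Sum>n<m. c n) = 2 * real (\<Sum>n<m. A n * 3 ^ (m - Suc n))"
    proof -
      have "3 ^ m * c n = 2 * real (A n * 3 ^ (m - Suc n))" if "n < m" for n
      proof -
        have "(3::real) ^ m = 3 ^ (m - Suc n) * 3 ^ Suc n" using that unfolding power_add[symmetric] by simp
        then show ?thesis by (simp add: c_def)
      qed
      then show ?thesis by (simp add: sum_distrib_left)
    qed
    also have "3 ^ m * c m = 2 * real (A m) / 3" by (simp add: c_def)
    finally have e: "3 ^ m * t = 2 * real (\<Sum>n<m. A n * 3 ^ (m - Suc n)) + (2 * real (A m) / 3 + 3 ^ m * (\<Sum>n. c (n + Suc m)))"
      by (simp add: algebra_simps)
    have "3 ^ m * (\<Sum>n. c (n + Suc m)) \<le> 3 ^ m * (1 / 3 ^ Suc m)" by (intro mult_left_mono tail) simp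
    then have "3 ^ m * (\<Sum>n. c (n + Suc m)) \<le> 1 / 3" by simp
    then show ?thesis unfolding e zigzag_periodic
      using tail(1)[of "Suc m"] by (intro zigzag_digit A) auto
  qed
  moreover have "0 \<le> t" "t \<le> 1" using tail[of 0] by (auto simp: t_def)
  ultimately show ?thesis by blast
qed

text \<open>Schoenberg's space-filling curve: the coordinates read off the ternary digits of the parameter.\<close>
lemma sphere_parametrization:
  obtains h :: "real \<Rightarrow> vec3" and T :: "vec3 \<Rightarrow> real" where
    "continuous_on UNIV h" "T \<in> borel_measurable borel" "\<And>x. norm x = 1 \<Longrightarrow> h (T x) = x \<and> 0 \<le> T x \<and> T x \<le> 1"
proof -
  define idx :: "3 \<Rightarrow> nat" where "idx k = (if k = 1 then 0 else if k = 2 then 1 else 2)" for k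
  have idx: "idx k < 3" "idx k = idx l \<Longrightarrow> k = l" for k l
    using exhaust_3[of k] exhaust_3[of l] by (auto simp: idx_def split: if_splits)
  \<comment> \<open>Stretching to the interval from -2 to 2 places coordinates of unit vectors at
    parameters between \<open>1/4\<close> and \<open>3/4\<close>, away from the value 1 that
    \<open>binary_digits\<close> excludes.\<close>
  define h where "h t = (\<chi> k. 4 * schoenberg (idx k) t - 2)" for t
  have hc: "continuous_on UNIV h" unfolding h_def[abs_def]
    by (intro continuous_on_vec_lambda continuous_intros schoenberg_continuous)
  have surj: "\<exists>t. 0 \<le> t \<and> t \<le> 1 \<and> h t = x" if x: "norm x = 1" for x
  proof -
    have y: "0 \<le> (x $ k + 2) / 4 \<and> (x $ k + 2) / 4 < 1" for k
      using component_le_norm_cart[of x k] x by auto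
    have "\<forall>k. \<exists>a::nat \<Rightarrow> nat. (\<forall>n. a n = 0 \<or> a n = 1) \<and> (\<lambda>n. real (a n) / 2 ^ Suc n) sums ((x $ k + 2) / 4)"
      using binary_digits y by blast
    then obtain a :: "3 \<Rightarrow> nat \<Rightarrow> nat" where a: "\<And>k n. a k n = 0 \<or> a k n = 1" "\<And>k. (\<lambda>n. real (a k n) / 2 ^ Suc n) sums ((x $ k + 2) / 4)"
      by metis
    define A where "A m = a (THE k. idx k = m mod 3) (m div 3)" for m
    have Aa: "A (3 * n + idx k) = a k n" for k n
    proof -
      have "(THE l. idx l = idx k) = k" using idx(2) by blast
      then show ?thesis using idx(1)[of k] by (simp add: A_def)
    qed
    obtain t where t: "0 \<le> t" "t \<le> 1" "\<And>m. zigzag (3 ^ m * t) = real (A m)"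
      using ternary_point[of A] a(1) unfolding A_def by blast
    have "4 * schoenberg (idx k) t - 2 = x $ k" for k
    proof -
      have "schoenberg (idx k) t = (x $ k + 2) / 4" unfolding schoenberg_def t(3) Aa using sums_unique[OF a(2)[of k]] by simp
      then show ?thesis by (simp only:) (simp add: field_simps)
    qed
    then have "h t = x" by (simp add: h_def vec_eq_iff)
    then show ?thesis using t by blast
  qed
  \<comment> \<open>The least parameter of a point of the curve, attained because the fibre is
    compact; the value 2 marks points off the curve.\<close>
  define T where "T x = (if x \<in> h ` {0..1} then Inf {t \<in> {0..1}. h t = x} else 2)" for x
  have T_min: "T x \<in> {0..1} \<and> h (T x) = x \<and> (\<forall>t\<in>{0..1}. h t = x \<longrightarrow> T x \<le> t)" if x: "x \<in> h ` {0..1}" for x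
  proof -
    let ?S = "{t \<in> {0..1}. h t = x}"
    have "closed ({0..1} \<inter> {t. h t = x})"
      by (intro closed_Int closed_atLeastAtMost closed_Collect_eq hc continuous_on_const)
    then have "closed ?S" by (simp add: Int_def)
    moreover have ne: "?S \<noteq> {}" using x by auto
    moreover have bb: "bdd_below ?S" by (intro bdd_belowI[of _ 0]) auto
    ultimately have "Inf ?S \<in> ?S" by (intro closed_contains_Inf)
    moreover have "Inf ?S \<le> t" if "t \<in> ?S" for t using cInf_lower[OF that bb] .
    ultimately show ?thesis using x by (simp add: T_def)
  qed
  have Tm: "T \<in> borel_measurable borel"
    unfolding borel_measurable_iff_le
  proof
    fix a :: real
    \<comment> \<open>Taking the least parameter makes each sublevel set below 2 the image of a
      compact interval, or empty, hence compact. This is what makes \<open>T\<close> Borel.\<close>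
    have "{x. T x \<le> a} = (if a < 2 then h ` ({0..1} \<inter> {..a}) else UNIV)"
    proof (cases "a < 2")
      case True
      have "T x \<le> a \<longleftrightarrow> x \<in> h ` ({0..1} \<inter> {..a})" for x
      proof
        assume "T x \<le> a"
        then have "x \<in> h ` {0..1}" using True by (auto simp: T_def split: if_splits)
        from T_min[OF this] \<open>T x \<le> a\<close> show "x \<in> h ` ({0..1} \<inter> {..a})" by (intro image_eqI[of _ _ "T x"]) auto
      next
        assume "x \<in> h ` ({0..1} \<inter> {..a})"
        then obtain t where t: "t \<in> {0..1}" "t \<le> a" "x = h t" by auto
        then have "T x \<le> t" using T_min[of x] by auto
        then show "T x \<le> a" using t by simp
      qed
      then show ?thesis using True by auto
    next
      case False
      have "T x \<le> 2" for x using T_min[of x] by (cases "x \<in> h ` {0..1}") (auto simp: T_def)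
      then have "T x \<le> a" for x using False by (meson not_less order_trans)
      then show ?thesis using False by auto
    qed
    moreover have "compact (h ` ({0..1} \<inter> {..a}))"
      by (intro compact_continuous_image continuous_on_subset[OF hc] compact_Int_closed) auto
    ultimately show "{w \<in> space borel. T w \<le> a} \<in> sets borel" by (auto intro: borel_compact)
  qed
  show ?thesis
  proof (rule that[OF hc Tm])
    fix x :: vec3 assume "norm x = 1"
    then have "x \<in> h ` {0..1}" using surj[of x] by force
    from T_min[OF this] show "h (T x) = x \<and> 0 \<le> T x \<and> T x \<le> 1" by simp
  qed
qed

text \<open>The measures are normalized, transported to the line by \<open>T\<close>, subjected to
  Helly's theorem there, and the limit is carried back by \<open>h\<close>. Since
  \<open>h (T x) = x\<close> on the sphere, integrating \<open>g\<close> against a measure is the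
  same as integrating the composition of \<open>g\<close> and \<open>h\<close> against its
  transport. Only \<open>h\<close> meets the test function, so it suffices that \<open>T\<close> is
  Borel.\<close>

theorem weak_compactness:
  fixes \<phi> :: "nat \<Rightarrow> vec3 \<Rightarrow> real"
  assumes \<phi>m: "\<And>n. \<phi> n \<in> borel_measurable borel" and \<phi>0: "\<And>n x. 0 \<le> \<phi> n x"
    and \<phi>i: "\<And>n. integrable sphere_borel (\<phi> n)"
    and lo: "0 < c" "\<And>n. c \<le> (\<integral>x. \<phi> n x \<partial>sphere_borel)" and up: "\<And>n. (\<integral>x. \<phi> n x \<partial>sphere_borel) \<le> C"
  shows "\<exists>s \<nu>. strict_mono (s::nat \<Rightarrow> nat) \<and> sets \<nu> = sets borel \<and> emeasure \<nu> UNIV < \<infinity> \<and> emeasure \<nu> (- sphere 0 1) = 0 \<and>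
    (\<forall>g. continuous_on (sphere 0 1) g \<and> g \<in> borel_measurable borel \<longrightarrow>
       (\<lambda>n. \<integral>x. g x * \<phi> (s n) x \<partial>sphere_borel) \<longlonglongrightarrow> (\<integral>x. g x \<partial>\<nu>))"
proof -
  obtain h :: "real \<Rightarrow> vec3" and T :: "vec3 \<Rightarrow> real" where hc: "continuous_on UNIV h" and Tm[measurable]: "T \<in> borel_measurable borel"
    and hT: "\<And>x. norm x = 1 \<Longrightarrow> h (T x) = x \<and> 0 \<le> T x \<and> T x \<le> 1"
    using sphere_parametrization by blast
  have hm[measurable]: "h \<in> borel_measurable borel" by (rule borel_measurable_continuous_onI[OF hc])
  note \<phi>m[measurable]
  define m where "m n = (\<integral>x. \<phi> n x \<partial>sphere_borel)" for n
  have m: "m n > 0" "m n \<le> C" for n using lo(1) lo(2)[of n] up[of n] by (auto simp: m_def)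
  define \<mu> where "\<mu> n = density sphere_borel (\<lambda>x. ennreal (\<phi> n x / m n))" for n
  have tot: "emeasure (\<mu> n) UNIV = 1" for n
  proof -
    have "emeasure (\<mu> n) UNIV = (\<integral>\<^sup>+x. ennreal (\<phi> n x / m n) \<partial>sphere_borel)"
      unfolding \<mu>_def by (subst emeasure_density) auto
    also have "\<dots> = ennreal (\<integral>x. \<phi> n x / m n \<partial>sphere_borel)"
      using \<phi>i[of n] \<phi>0 m(1)[of n] by (intro nn_integral_eq_integral) (auto intro: less_imp_le)
    also have "(\<integral>x. \<phi> n x / m n \<partial>sphere_borel) = 1" using m(1)[of n] by (simp add: m_def)
    finally show ?thesis by simp
  qed
  define P where "P n = distr (\<mu> n) borel T" for n
  have Tm': "T \<in> borel_measurable (\<mu> n)" for n unfolding \<mu>_def by simp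
  have pm: "prob_space (\<mu> n)" for n by (rule prob_spaceI) (simp add: tot \<mu>_def[THEN arg_cong[where f = space]])
  have rd: "real_distribution (P n)" for n
    unfolding P_def real_distribution_def real_distribution_axioms_def
    using prob_space.prob_space_distr[OF pm Tm'] by simp
  have AE1: "AE x in \<mu> n. norm x = 1" for n
    unfolding \<mu>_def using AE_sphere_borel_norm by (subst AE_density) (auto elim: eventually_mono)
  have tight: "tight P"
    unfolding tight_def
  proof (intro conjI allI impI rd)
    fix e :: real assume "e > 0"
    \<comment> \<open>\<open>T\<close> sends the sphere into the unit interval, so one half-open
      interval carries the full mass of all the transported measures.\<close>
    have "measure (P n) {-1<..2} = 1" for n
    proof -
      have "measure (P n) {-1<..2} = measure (\<mu> n) (T -` {-1<..2} \<inter> space (\<mu> n))"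
        unfolding P_def by (rule measure_distr[OF Tm']) simp
      also have "\<dots> = 1"
      proof (rule prob_space.prob_eq_1[OF pm, THEN iffD2])
        show "AE x in \<mu> n. x \<in> T -` {-1<..2} \<inter> space (\<mu> n)"
          using AE1[of n] by eventually_elim (use hT in \<open>force simp: \<mu>_def\<close>)
        show "T -` {-1<..2} \<inter> space (\<mu> n) \<in> prob_space.events (\<mu> n)"
          using measurable_sets[OF Tm'] by simp
      qed
      finally show ?thesis .
    qed
    then show "\<exists>a b. a < b \<and> (\<forall>n. 1 - e < measure (P n) {a<..b})"
      using \<open>e > 0\<close> by (intro exI[of _ "-1"] exI[of _ 2]) auto
  qed
  \<comment> \<open>The masses divided out by the normalization must converge too; this is arranged
    first, and Helly's theorem is then applied along that subsequence.\<close>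
  have "bounded (range m)" unfolding bounded_iff using m by (intro exI[of _ C]) (auto simp: less_imp_le abs_of_pos)
  then obtain M0 s1 where s1: "strict_mono s1" "(m \<circ> s1) \<longlonglongrightarrow> M0"
    using bounded_imp_convergent_subsequence by blast
  obtain r M where r: "strict_mono r" "real_distribution M" "weak_conv_m (P \<circ> s1 \<circ> r) M"
    using tight_imp_convergent_subsubsequence[OF tight s1(1)] by blast
  define s where "s = s1 \<circ> r"
  have s: "strict_mono s" unfolding s_def using s1 r by (intro strict_mono_o)
  have ms: "(\<lambda>n. m (s n)) \<longlonglongrightarrow> M0"
    using LIMSEQ_subseq_LIMSEQ[OF s1(2) r(1)] by (simp add: s_def o_def)
  have M0: "M0 \<ge> 0" using ms m(1) by (intro LIMSEQ_le_const[OF ms]) (auto intro: less_imp_le)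
  have sM: "sets M = sets borel" using r(2) by (simp add: real_distribution.events_eq_borel)
  have hM: "h \<in> borel_measurable M" by (subst measurable_cong_sets[OF sM refl]) (rule hm)
  have pM: "prob_space M" using r(2) by (simp add: real_distribution_def)
  \<comment> \<open>The limit on the line is carried back by \<open>h\<close> and given the limiting
    mass \<open>M0\<close>.\<close>
  define \<nu> where "\<nu> = density (distr M borel h) (\<lambda>_. ennreal M0)"
  have s\<nu>: "sets \<nu> = sets borel" by (simp add: \<nu>_def)
  have int\<nu>: "(\<integral>x. g x \<partial>\<nu>) = M0 * (\<integral>t. g (h t) \<partial>M)" if [measurable]: "g \<in> borel_measurable borel" for g :: "vec3 \<Rightarrow> real"
  proof -
    have "(\<integral>x. g x \<partial>\<nu>) = (\<integral>x. M0 *\<^sub>R g x \<partial>distr M borel h)"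
      unfolding \<nu>_def using M0 by (intro integral_density) auto
    also have "\<dots> = (\<integral>t. M0 *\<^sub>R g (h t) \<partial>M)" by (rule integral_distr[OF hM]) simp
    finally show ?thesis by simp
  qed
  have fin: "emeasure \<nu> UNIV < \<infinity>"
  proof -
    have "emeasure \<nu> UNIV = ennreal M0 * emeasure M (space M)"
      unfolding \<nu>_def using hM by (subst emeasure_density) (auto simp: nn_integral_cmult emeasure_distr)
    then show ?thesis using prob_space.emeasure_space_1[OF pM] by simp
  qed
  have lim0: "(\<lambda>n. \<integral>x. g x * \<phi> (s n) x \<partial>sphere_borel) \<longlonglongrightarrow> (\<integral>x. g x \<partial>\<nu>)"
    if g: "continuous_on UNIV g" "\<And>x. \<bar>g x\<bar> \<le> B" for g :: "vec3 \<Rightarrow> real" and B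
  proof -
    have gm[measurable]: "g \<in> borel_measurable borel" by (rule borel_measurable_continuous_onI[OF g(1)])
    have "isCont (\<lambda>t. g (h t)) t" for t
      using continuous_on_compose2[OF g(1) hc] by (simp add: continuous_on_eq_continuous_within)
    then have "(\<lambda>n. \<integral>t. g (h t) \<partial>(P \<circ> s1 \<circ> r) n) \<longlonglongrightarrow> (\<integral>t. g (h t) \<partial>M)"
      by (intro weak_conv_imp_integral_bdd_continuous_conv[OF _ r(2,3), of _ B]) (use rd g(2) in auto)
    then have a: "(\<lambda>n. \<integral>t. g (h t) \<partial>P (s n)) \<longlonglongrightarrow> (\<integral>t. g (h t) \<partial>M)" by (simp add: s_def)
    have "m n * (\<integral>t. g (h t) \<partial>P n) = (\<integral>x. g x * \<phi> n x \<partial>sphere_borel)" for n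
    proof -
      have "(\<integral>t. g (h t) \<partial>P n) = (\<integral>x. g (h (T x)) \<partial>\<mu> n)"
        unfolding P_def by (rule integral_distr[OF Tm']) simp
      also have "\<dots> = (\<integral>x. g x \<partial>\<mu> n)"
      proof (rule integral_cong_AE)
        show "(\<lambda>x. g (h (T x))) \<in> borel_measurable (\<mu> n)" "g \<in> borel_measurable (\<mu> n)"
          unfolding \<mu>_def by simp_all
        show "AE x in \<mu> n. g (h (T x)) = g x" using AE1[of n] by eventually_elim (simp add: hT)
      qed
      also have "\<dots> = (\<integral>x. (\<phi> n x / m n) *\<^sub>R g x \<partial>sphere_borel)"
        unfolding \<mu>_def using \<phi>0 m(1)[of n] by (intro integral_density) (auto intro: less_imp_le)
      also have "\<dots> = (\<integral>x. (g x * \<phi> n x) / m n \<partial>sphere_borel)" by (simp add: mult.commute)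
      also have "\<dots> = (\<integral>x. g x * \<phi> n x \<partial>sphere_borel) / m n" by simp
      finally show ?thesis using m(1)[of n] by simp
    qed
    then have "(\<lambda>n. \<integral>x. g x * \<phi> (s n) x \<partial>sphere_borel) = (\<lambda>n. m (s n) * (\<integral>t. g (h t) \<partial>P (s n)))" by simp
    then show ?thesis unfolding int\<nu>[OF gm] using tendsto_mult[OF ms a] by simp
  qed
  have supp: "emeasure \<nu> (- sphere 0 1) = 0"
  proof -
    \<comment> \<open>A bounded continuous function vanishing exactly on the sphere. Its integrals
      along the sequence are 0, so the limit measure lives on the sphere.\<close>
    define g where "g x = min 1 \<bar>norm x - 1\<bar>" for x :: vec3
    have gc: "continuous_on UNIV g" unfolding g_def[abs_def] by (intro continuous_intros)
    have gm[measurable]: "g \<in> borel_measurable borel" by (rule borel_measurable_continuous_onI[OF gc])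
    have "(\<integral>x. g x * \<phi> n x \<partial>sphere_borel) = (\<integral>x. 0 \<partial>sphere_borel)" for n
      by (rule integral_cong_AE) (use AE_sphere_borel_norm in \<open>auto simp: g_def elim: eventually_mono\<close>)
    then have "(\<lambda>n. 0) \<longlonglongrightarrow> (\<integral>x. g x \<partial>\<nu>)" using lim0[OF gc, of 1] by (simp add: g_def)
    then have z: "(\<integral>x. g x \<partial>\<nu>) = 0" using LIMSEQ_unique tendsto_const by blast
    have sp: "space \<nu> = UNIV" by (simp add: \<nu>_def)
    interpret finite_measure \<nu> by (rule finite_measureI) (use fin sp in auto)
    have gm\<nu>: "g \<in> borel_measurable \<nu>" by (subst measurable_cong_sets[OF s\<nu> refl]) (rule gm)
    have "integrable \<nu> g" by (rule integrable_const_bound[of _ 1]) (auto simp: g_def gm\<nu>)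
    moreover have "AE x in \<nu>. 0 \<le> g x" by (simp add: g_def)
    ultimately have "AE x in \<nu>. g x = 0"
      using z integral_nonneg_eq_0_iff_AE[of \<nu> g] by blast
    then have "AE x in \<nu>. x \<notin> - sphere 0 1"
      by eventually_elim (auto simp: g_def min_def split: if_splits)
    moreover have "- sphere (0::vec3) 1 \<in> sets \<nu>" unfolding s\<nu> by (intro borel_open) auto
    ultimately have "- sphere 0 1 \<in> null_sets \<nu>" using AE_iff_null_sets by blast
    then show ?thesis by (rule null_setsD1)
  qed
  have "(\<lambda>n. \<integral>x. g x * \<phi> (s n) x \<partial>sphere_borel) \<longlonglongrightarrow> (\<integral>x. g x \<partial>\<nu>)"
    if g: "continuous_on (sphere 0 1) g" and gm: "g \<in> borel_measurable borel" for g :: "vec3 \<Rightarrow> real"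
  proof -
    have "bounded (g ` sphere 0 1)" by (intro compact_imp_bounded compact_continuous_image g) auto
    then obtain B where B: "B > 0" "\<And>x. x \<in> sphere 0 1 \<Longrightarrow> norm (g x) \<le> B" unfolding bounded_pos by blast
    \<comment> \<open>Convergence is known for functions continuous on the whole space, while the
      test functions are continuous on the sphere only. All measures involved live on the sphere, so
      the extension by Tietze changes no integral.\<close>
    obtain g' where g': "continuous_on UNIV g'" "\<And>x. x \<in> sphere 0 1 \<Longrightarrow> g' x = g x" "\<And>x. norm (g' x) \<le> B"
      using Tietze[of "sphere 0 1" g UNIV B] g B by auto
    have g'm: "g' \<in> borel_measurable borel" by (rule borel_measurable_continuous_onI[OF g'(1)])
    have "(\<integral>x. g x * \<phi> n x \<partial>sphere_borel) = (\<integral>x. g' x * \<phi> n x \<partial>sphere_borel)" for n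
      by (rule integral_cong_AE) (use AE_sphere_borel_norm gm g'm g'(2) in \<open>auto elim: eventually_mono\<close>)
    moreover have "(\<integral>x. g x \<partial>\<nu>) = (\<integral>x. g' x \<partial>\<nu>)"
    proof (rule integral_cong_AE)
      show "g \<in> borel_measurable \<nu>" "g' \<in> borel_measurable \<nu>"
        using gm g'm by (auto simp: measurable_cong_sets[OF s\<nu> refl])
      show "AE x in \<nu>. g x = g' x" using AE_norm_1[OF s\<nu> supp] by eventually_elim (simp add: g'(2))
    qed
    ultimately show ?thesis using lim0[OF g'(1), of B] g'(3) by simp
  qed
  then show ?thesis using s s\<nu> fin supp by blast
qed

section \<open>Boundary values\<close>

text \<open>Subsequences are extracted one index at a time, and limits already obtained survive a
  further extraction. One common subsequence is wanted because the representation of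
  \<open>u\<close> combines the limits for all three components and both signs.\<close>

lemma common_weak_limit:
  fixes \<phi> :: "'k \<Rightarrow> nat \<Rightarrow> vec3 \<Rightarrow> real"
  assumes "finite K"
    and \<phi>: "\<And>k n. \<phi> k n \<in> borel_measurable borel" "\<And>k n x. 0 \<le> \<phi> k n x" "\<And>k n. integrable sphere_borel (\<phi> k n)"
    and lo: "0 < c" "\<And>k n. c \<le> (\<integral>x. \<phi> k n x \<partial>sphere_borel)" and up: "\<And>k n. (\<integral>x. \<phi> k n x \<partial>sphere_borel) \<le> C"
  shows "\<exists>s \<nu>. strict_mono (s::nat \<Rightarrow> nat) \<and> (\<forall>k\<in>K. sets (\<nu> k) = sets borel \<and> emeasure (\<nu> k) UNIV < \<infinity> \<and> emeasure (\<nu> k) (- sphere 0 1) = 0 \<and>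
    (\<forall>g. continuous_on (sphere 0 1) g \<and> g \<in> borel_measurable borel \<longrightarrow>
       (\<lambda>n. \<integral>x. g x * \<phi> k (s n) x \<partial>sphere_borel) \<longlonglongrightarrow> (\<integral>x. g x \<partial>\<nu> k)))"
  using \<open>finite K\<close>
proof (induction K rule: finite_induct)
  case empty
  show ?case by (rule exI[of _ id]) (auto simp: strict_mono_def)
next
  case (insert k K)
  then obtain s \<nu> where s: "strict_mono (s::nat \<Rightarrow> nat)" and \<nu>: "\<And>k. k \<in> K \<Longrightarrow> sets (\<nu> k) = sets borel \<and> emeasure (\<nu> k) UNIV < \<infinity> \<and> emeasure (\<nu> k) (- sphere 0 1) = 0 \<and>
    (\<forall>g. continuous_on (sphere 0 1) g \<and> g \<in> borel_measurable borel \<longrightarrow>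
       (\<lambda>n. \<integral>x. g x * \<phi> k (s n) x \<partial>sphere_borel) \<longlonglongrightarrow> (\<integral>x. g x \<partial>\<nu> k))" by blast
  obtain r \<nu>0 where r: "strict_mono (r::nat \<Rightarrow> nat)" and \<nu>0: "sets \<nu>0 = sets borel" "emeasure \<nu>0 UNIV < \<infinity>" "emeasure \<nu>0 (- sphere 0 1) = 0"
    "\<And>g. continuous_on (sphere 0 1) g \<and> g \<in> borel_measurable borel \<Longrightarrow>
       (\<lambda>n. \<integral>x. g x * \<phi> k (s (r n)) x \<partial>sphere_borel) \<longlonglongrightarrow> (\<integral>x. g x \<partial>\<nu>0)"
    using weak_compactness[of "\<lambda>n. \<phi> k (s n)" c C] \<phi> lo up by blast
  have "(\<lambda>n. \<integral>x. g x * \<phi> l (s (r n)) x \<partial>sphere_borel) \<longlonglongrightarrow> (\<integral>x. g x \<partial>\<nu> l)"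
    if "l \<in> K" "continuous_on (sphere 0 1) g \<and> g \<in> borel_measurable borel" for l g
    using LIMSEQ_subseq_LIMSEQ[OF _ r, of "\<lambda>n. \<integral>x. g x * \<phi> l (s n) x \<partial>sphere_borel"] \<nu>[OF that(1)] that(2)
    by (simp add: o_def)
  then show ?case
    using s r \<nu> \<nu>0 insert.hyps
    by (intro exI[of _ "s \<circ> r"] exI[of _ "\<nu>(k := \<nu>0)"]) (auto simp: strict_mono_def)
qed

text \<open>The shift by 2 makes the first radius \<open>1/2\<close>, so every radius is admissible
  in \<open>poisson_representation\<close>.\<close>

definition rad :: "nat \<Rightarrow> real" where "rad n = 1 - 1 / real (n + 2)"

lemma rad: "0 < rad n" "rad n < 1" "rad \<longlonglongrightarrow> 1"
proof -
  show "0 < rad n" "rad n < 1" by (auto simp: rad_def)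
  have "(\<lambda>n. 1 / real (n + 2)) \<longlonglongrightarrow> 0"
    using LIMSEQ_ignore_initial_segment[OF lim_1_over_n, of 2] by simp
  from tendsto_diff[OF tendsto_const[of 1] this] show "rad \<longlonglongrightarrow> 1" by (simp add: rad_def[abs_def])
qed

definition bd_part :: "(vec3 \<Rightarrow> vec3) \<Rightarrow> 3 \<times> bool \<Rightarrow> nat \<Rightarrow> vec3 \<Rightarrow> real" where
  "bd_part u k n \<eta> = indicator (sphere 0 1) \<eta> * (max 0 ((if snd k then 1 else -1) * u (rad n *\<^sub>R \<eta>) $ fst k) + 1)"

text \<open>Adding the constant 1 to both the positive and the negative bd_part keeps their masses away
  from 0 (so that they can be normalized) and does not change their difference.\<close>
lemma bd_part_diff: "norm \<eta> = 1 \<Longrightarrow> bd_part u (j, True) n \<eta> - bd_part u (j, False) n \<eta> = u (rad n *\<^sub>R \<eta>) $ j"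
  by (simp add: bd_part_def max_def)

lemma bd_part_nonneg: "0 \<le> bd_part u k n \<eta>"
  by (simp add: bd_part_def)

lemma bd_part_le: "bd_part u k n \<eta> \<le> norm (u (rad n *\<^sub>R \<eta>)) + 1"
  using component_le_norm_cart[of "u (rad n *\<^sub>R \<eta>)" "fst k"] by (auto simp: bd_part_def indicator_def)

lemma lame_continuous: "lame_solution la mu u \<Longrightarrow> continuous_on (ball 0 1) u"
proof -
  assume u: "lame_solution la mu u"
  have "continuous_on (ball 0 1) (\<lambda>x. \<chi> k. u x $ k)"
    by (rule continuous_on_vec_lambda) (rule Ck_continuous[OF lame_Ck[OF u]])
  then show ?thesis by (simp only: vec_lambda_eta)
qed

lemma rad_in_ball: "norm \<eta> = 1 \<Longrightarrow> norm (rad n *\<^sub>R \<eta>) < 1"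
  using rad(1,2)[of n] by simp

lemma lame_dilate_continuous:
  assumes "lame_solution la mu u"
  shows "continuous_on (sphere 0 1) (\<lambda>\<eta>. u (rad n *\<^sub>R \<eta>))"
  by (rule continuous_on_compose2[OF lame_continuous[OF assms]]) (use rad(1,2)[of n] in \<open>auto intro!: continuous_intros\<close>)

lemma bd_part_measurable:
  assumes u: "lame_solution la mu u"
  shows "bd_part u k n \<in> borel_measurable borel"
proof -
  have "continuous_on (sphere 0 1) (\<lambda>\<eta>. u (rad n *\<^sub>R \<eta>) $ fst k)"
    by (intro continuous_intros lame_dilate_continuous[OF u])
  then have "continuous_on (sphere 0 1) (\<lambda>\<eta>. max 0 ((if snd k then 1 else -1) * u (rad n *\<^sub>R \<eta>) $ fst k) + 1)"
    by (intro continuous_on_add continuous_on_max continuous_on_mult continuous_on_const)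
  from borel_measurable_continuous_on_indicator[OF _ this] show ?thesis by (simp add: bd_part_def[abs_def])
qed

lemma dilate_measurable:
  assumes u: "lame_solution la mu u"
  shows "(\<lambda>\<eta>. u (rad n *\<^sub>R \<eta>)) \<in> borel_measurable sphere_measure"
  by (subst measurable_cong_sets[OF sets_sphere_measure refl])
    (rule borel_measurable_continuous_on_restrict[OF lame_dilate_continuous[OF u]])

text \<open>The elementary inequality \<open>t <= t^p + 1\<close> and the finite mass of the sphere
  turn bounded means of order \<open>p\<close> into bounded first means, which is what weak
  compactness takes as input. One constant serves both.\<close>

lemma hpe_L1_bound:
  assumes u: "u \<in> hpe la mu p" and p: "1 \<le> p"
  shows "\<exists>C\<ge>0. \<forall>n. (\<integral>\<^sup>+\<eta>. ennreal (norm (u (rad n *\<^sub>R \<eta>)) powr p) \<partial>sphere_measure) \<le> ennreal C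
     \<and> (\<integral>\<^sup>+\<eta>. ennreal (norm (u (rad n *\<^sub>R \<eta>))) \<partial>sphere_measure) \<le> ennreal C"
proof -
  have lu: "lame_solution la mu u" using u by (simp add: hpe_def)
  obtain C where C: "\<And>r. r \<in> {0..<1} \<Longrightarrow> (\<integral>\<^sup>+\<eta>. ennreal (norm (u (r *\<^sub>R \<eta>)) powr p) \<partial>sphere_measure) \<le> ennreal C"
    using u unfolding hpe_def by blast
  have le: "t \<le> t powr p + 1" if "0 \<le> t" for t :: real
  proof (cases "t \<le> 1")
    case False
    then have "t powr 1 \<le> t powr p" using p by (intro powr_mono) auto
    then show ?thesis using False by simp
  qed (use powr_ge_zero[of t p] in linarith)
  have C1: "(\<integral>\<^sup>+\<eta>. ennreal (norm (u (rad n *\<^sub>R \<eta>)) powr p) \<partial>sphere_measure) \<le> ennreal C" for n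
    using rad(1,2)[of n] by (intro C) auto
  have "(\<integral>\<^sup>+\<eta>. ennreal (norm (u (rad n *\<^sub>R \<eta>))) \<partial>sphere_measure) \<le> ennreal (max 0 C + 4 * pi)" for n
  proof -
    note dilate_measurable[OF lu, of n, measurable]
    have "(\<integral>\<^sup>+\<eta>. ennreal (norm (u (rad n *\<^sub>R \<eta>))) \<partial>sphere_measure) \<le> (\<integral>\<^sup>+\<eta>. ennreal (norm (u (rad n *\<^sub>R \<eta>)) powr p) + 1 \<partial>sphere_measure)"
    proof (rule nn_integral_mono)
      fix \<eta>
      have "ennreal (norm (u (rad n *\<^sub>R \<eta>))) \<le> ennreal (norm (u (rad n *\<^sub>R \<eta>)) powr p + 1)"
        by (intro ennreal_leI le) simp
      then show "ennreal (norm (u (rad n *\<^sub>R \<eta>))) \<le> ennreal (norm (u (rad n *\<^sub>R \<eta>)) powr p) + 1"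
        by (simp add: ennreal_plus)
    qed
    also have "\<dots> = (\<integral>\<^sup>+\<eta>. ennreal (norm (u (rad n *\<^sub>R \<eta>)) powr p) \<partial>sphere_measure) + ennreal (4 * pi)"
      using emeasure_sphere_measure_UNIV by (subst nn_integral_add) auto
    also have "\<dots> \<le> ennreal (max 0 C) + ennreal (4 * pi)"
      using order_trans[OF C1[of n] ennreal_leI[of C "max 0 C"]] by (intro add_mono) auto
    also have "\<dots> = ennreal (max 0 C + 4 * pi)" by (subst ennreal_plus) auto
    finally show ?thesis .
  qed
  moreover have "ennreal C \<le> ennreal (max 0 C + 4 * pi)"
    using pi_gt_zero by (intro ennreal_leI) linarith
  then have "(\<integral>\<^sup>+\<eta>. ennreal (norm (u (rad n *\<^sub>R \<eta>)) powr p) \<partial>sphere_measure) \<le> ennreal (max 0 C + 4 * pi)" for n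
    using order_trans[OF C1] by blast
  moreover have "max 0 C + 4 * pi \<ge> 0" by simp
  ultimately show ?thesis by blast
qed

text \<open>For fixed \<open>x\<close> the value \<open>u (rad n * x)\<close> is an integral of
  kernel entries against the dilated boundary values, split into \<open>bd_part\<close> differences.
  The entries are continuous in the boundary variable, so weak convergence handles the integrals,
  and continuity of \<open>u\<close> handles the left side.\<close>

theorem boundary_measures:
  assumes mu: "mu > 0" "2 * mu + la > 0" and u: "u \<in> hpe la mu p" and p: "1 \<le> p"
  shows "\<exists>s \<nu>. strict_mono (s::nat \<Rightarrow> nat) \<and>
    (\<forall>k. sets (\<nu> k) = sets borel \<and> emeasure (\<nu> k) UNIV < \<infinity> \<and> emeasure (\<nu> k) (- sphere 0 1) = 0 \<and>
      (\<forall>g. continuous_on (sphere 0 1) g \<and> g \<in> borel_measurable borel \<longrightarrow>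
       (\<lambda>n. \<integral>x. g x * bd_part u k (s n) x \<partial>sphere_borel) \<longlonglongrightarrow> (\<integral>x. g x \<partial>\<nu> k))) \<and>
    (\<forall>x i. norm x < 1 \<longrightarrow> u x $ i = (\<Sum>j\<in>UNIV. (\<integral>\<eta>. elastic_entry la mu x i j \<eta> \<partial>\<nu> (j, True)) - (\<integral>\<eta>. elastic_entry la mu x i j \<eta> \<partial>\<nu> (j, False))))"
proof -
  have lu: "lame_solution la mu u" using u by (simp add: hpe_def)
  obtain C where C: "C \<ge> 0" "\<And>n. (\<integral>\<^sup>+\<eta>. ennreal (norm (u (rad n *\<^sub>R \<eta>))) \<partial>sphere_measure) \<le> ennreal C"
    using hpe_L1_bound[OF u p] by blast
  have wi: "integrable sphere_measure (\<lambda>\<eta>. u (rad n *\<^sub>R \<eta>))" for n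
    using poisson_representation(1)[OF mu lu rad(1,2), of 0 n] by simp
  have i1: "integrable sphere_measure (\<lambda>\<eta>. norm (u (rad n *\<^sub>R \<eta>)) + 1)" for n
    using integrable_const_sphere[of "1::real"] integrable_norm[OF wi[of n]] by (intro Bochner_Integration.integrable_add)
  have pi_m: "integrable sphere_measure (bd_part u k n)" for k n
    by (rule Bochner_Integration.integrable_bound[OF i1[of n] borel_measurable_sphere_borelI[OF bd_part_measurable[OF lu]]])
      (use bd_part_le bd_part_nonneg in \<open>auto intro!: AE_I2 simp: abs_of_nonneg\<close>)
  have pi: "integrable sphere_borel (bd_part u k n)" for k n
    using pi_m integrable_sphere_borel[OF bd_part_measurable[OF lu]] by blast
  have to_m: "(\<integral>\<eta>. bd_part u k n \<eta> \<partial>sphere_borel) = (\<integral>\<eta>. bd_part u k n \<eta> \<partial>sphere_measure)" for k n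
    by (rule integral_sphere_borel[OF bd_part_measurable[OF lu]])
  have one: "(\<integral>\<eta>. 1 \<partial>sphere_measure) = 4 * pi"
    using emeasure_sphere_measure_UNIV by (simp add: measure_def)
  have lo: "4 * pi \<le> (\<integral>\<eta>. bd_part u k n \<eta> \<partial>sphere_borel)" for k n
    unfolding to_m one[symmetric]
    by (intro integral_mono pi_m integrable_const_sphere) (auto simp: bd_part_def)
  have up: "(\<integral>\<eta>. bd_part u k n \<eta> \<partial>sphere_borel) \<le> C + 4 * pi" for k n
  proof -
    have "(\<integral>\<eta>. bd_part u k n \<eta> \<partial>sphere_borel) \<le> (\<integral>\<eta>. norm (u (rad n *\<^sub>R \<eta>)) + 1 \<partial>sphere_measure)"
      unfolding to_m by (intro integral_mono pi_m i1 bd_part_le)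
    also have "\<dots> = (\<integral>\<eta>. norm (u (rad n *\<^sub>R \<eta>)) \<partial>sphere_measure) + 4 * pi"
      unfolding one[symmetric] by (intro Bochner_Integration.integral_add integrable_norm wi integrable_const_sphere)
    also have "(\<integral>\<eta>. norm (u (rad n *\<^sub>R \<eta>)) \<partial>sphere_measure) \<le> C"
    proof -
      have "ennreal (\<integral>\<eta>. norm (u (rad n *\<^sub>R \<eta>)) \<partial>sphere_measure) = (\<integral>\<^sup>+\<eta>. ennreal (norm (u (rad n *\<^sub>R \<eta>))) \<partial>sphere_measure)"
        by (intro nn_integral_eq_integral[symmetric] integrable_norm wi) auto
      then show ?thesis using C(2)[of n] C(1) ennreal_le_iff by metis
    qed
    finally show ?thesis by simp
  qed
  have "\<exists>s \<nu>. strict_mono (s::nat \<Rightarrow> nat) \<and> (\<forall>k\<in>(UNIV::(3 \<times> bool) set). sets (\<nu> k) = sets borel \<and> emeasure (\<nu> k) UNIV < \<infinity> \<and> emeasure (\<nu> k) (- sphere 0 1) = 0 \<and>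
    (\<forall>g. continuous_on (sphere 0 1) g \<and> g \<in> borel_measurable borel \<longrightarrow>
       (\<lambda>n. \<integral>x. g x * bd_part u k (s n) x \<partial>sphere_borel) \<longlonglongrightarrow> (\<integral>x. g x \<partial>\<nu> k)))"
    by (rule common_weak_limit[OF finite bd_part_measurable[OF lu] bd_part_nonneg pi _ lo up]) simp
  then obtain s \<nu> where s: "strict_mono (s::nat \<Rightarrow> nat)" and \<nu>: "\<And>k. sets (\<nu> k) = sets borel \<and> emeasure (\<nu> k) UNIV < \<infinity> \<and> emeasure (\<nu> k) (- sphere 0 1) = 0 \<and>
      (\<forall>g. continuous_on (sphere 0 1) g \<and> g \<in> borel_measurable borel \<longrightarrow>
       (\<lambda>n. \<integral>x. g x * bd_part u k (s n) x \<partial>sphere_borel) \<longlonglongrightarrow> (\<integral>x. g x \<partial>\<nu> k))" for k :: "3 \<times> bool"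
    unfolding ball_UNIV by blast
  have "u x $ i = (\<Sum>j\<in>UNIV. (\<integral>\<eta>. elastic_entry la mu x i j \<eta> \<partial>\<nu> (j, True)) - (\<integral>\<eta>. elastic_entry la mu x i j \<eta> \<partial>\<nu> (j, False)))"
    if x: "norm x < 1" for x i
  proof -
    have eq: "u (rad n *\<^sub>R x) $ i = (\<Sum>j\<in>UNIV. (\<integral>\<eta>. elastic_entry la mu x i j \<eta> * bd_part u (j, True) n \<eta> \<partial>sphere_borel)
        - (\<integral>\<eta>. elastic_entry la mu x i j \<eta> * bd_part u (j, False) n \<eta> \<partial>sphere_borel))" for n
    proof -
      have mKp: "(\<lambda>\<eta>. elastic_entry la mu x i j \<eta> * bd_part u k n \<eta>) \<in> borel_measurable borel" for j k
        by (intro borel_measurable_times elastic_entry_measurable bd_part_measurable[OF lu])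
      have "u (rad n *\<^sub>R x) $ i = elastic_poisson la mu (\<lambda>\<eta>. u (rad n *\<^sub>R \<eta>)) x $ i"
        using poisson_representation(2)[OF mu lu rad(1,2) x, of n] by simp
      also have "\<dots> = (\<Sum>j\<in>UNIV. \<integral>\<eta>. elastic_entry la mu x i j \<eta> * u (rad n *\<^sub>R \<eta>) $ j \<partial>sphere_measure)"
        by (rule elastic_poisson_nth[OF mu x wi])
      also have "\<dots> = (\<Sum>j\<in>UNIV. \<integral>\<eta>. elastic_entry la mu x i j \<eta> * bd_part u (j, True) n \<eta> - elastic_entry la mu x i j \<eta> * bd_part u (j, False) n \<eta> \<partial>sphere_measure)"
        by (intro sum.cong refl Bochner_Integration.integral_cong)
          (auto simp: right_diff_distrib[symmetric] bd_part_diff)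
      also have "\<dots> = (\<Sum>j\<in>UNIV. (\<integral>\<eta>. elastic_entry la mu x i j \<eta> * bd_part u (j, True) n \<eta> \<partial>sphere_measure)
        - (\<integral>\<eta>. elastic_entry la mu x i j \<eta> * bd_part u (j, False) n \<eta> \<partial>sphere_measure))"
        by (intro sum.cong refl Bochner_Integration.integral_diff elastic_entry_integrable[OF mu x] pi_m)
      finally show ?thesis unfolding integral_sphere_borel[OF mKp] .
    qed
    have rx: "(\<lambda>n. rad (s n) *\<^sub>R x) \<longlonglongrightarrow> 1 *\<^sub>R x"
      using LIMSEQ_subseq_LIMSEQ[OF rad(3) s] by (intro tendsto_scaleR tendsto_const) (simp add: o_def)
    have "isCont u x" using lame_continuous[OF lu] x by (simp add: continuous_on_eq_continuous_at)
    from isCont_tendsto_compose[OF this] rx have "(\<lambda>n. u (rad (s n) *\<^sub>R x)) \<longlonglongrightarrow> u x" by simp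
    then have l1: "(\<lambda>n. u (rad (s n) *\<^sub>R x) $ i) \<longlonglongrightarrow> u x $ i" by (rule tendsto_vec_nth)
    have "(\<lambda>n. \<integral>\<eta>. elastic_entry la mu x i j \<eta> * bd_part u k (s n) \<eta> \<partial>sphere_borel) \<longlonglongrightarrow> (\<integral>\<eta>. elastic_entry la mu x i j \<eta> \<partial>\<nu> k)" for j k
      using \<nu>[of k] elastic_entry_continuous[OF mu x] elastic_entry_measurable by blast
    then have "(\<lambda>n. u (rad (s n) *\<^sub>R x) $ i) \<longlonglongrightarrow> (\<Sum>j\<in>UNIV. (\<integral>\<eta>. elastic_entry la mu x i j \<eta> \<partial>\<nu> (j, True)) - (\<integral>\<eta>. elastic_entry la mu x i j \<eta> \<partial>\<nu> (j, False)))"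
      unfolding eq by (intro tendsto_sum tendsto_diff)
    with l1 show ?thesis by (rule LIMSEQ_unique)
  qed
  then show ?thesis by (intro exI[of _ s] exI[of _ \<nu>] conjI allI impI s) (use \<nu> in simp_all)
qed

theorem h1_limits:
  assumes mu: "mu > 0" "2 * mu + la > 0" and u: "u \<in> hpe la mu 1"
  shows "AE \<xi> in sphere_measure. \<exists>L. (u \<longlongrightarrow> L) (at \<xi> within Gamma \<xi>)"
proof (rule AE_sphere_borelD)
  obtain \<nu> :: "3 \<times> bool \<Rightarrow> vec3 measure" where \<nu>: "\<And>k. sets (\<nu> k) = sets borel" "\<And>k. emeasure (\<nu> k) UNIV < \<infinity>" "\<And>k. emeasure (\<nu> k) (- sphere 0 1) = 0"
    and rep: "\<And>x i. norm x < 1 \<Longrightarrow> u x $ i = (\<Sum>j\<in>UNIV. (\<integral>\<eta>. elastic_entry la mu x i j \<eta> \<partial>\<nu> (j, True)) - (\<integral>\<eta>. elastic_entry la mu x i j \<eta> \<partial>\<nu> (j, False)))"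
    using boundary_measures[OF mu u order_refl] by (elim exE conjE) (use that in blast)
  have "AE \<xi> in sphere_borel. \<forall>i\<in>(UNIV::3 set). \<forall>j\<in>(UNIV::3 set). \<forall>b\<in>(UNIV::bool set).
      \<exists>L. ((\<lambda>x. \<integral>\<eta>. elastic_entry la mu x i j \<eta> \<partial>\<nu> (j, b)) \<longlongrightarrow> L) (at \<xi> within Gamma \<xi>)"
    by (intro AE_finite_allI finite elastic_entry_measure_limit[OF mu \<nu>(1,3,2)])
  then show "AE \<xi> in sphere_borel. \<exists>L. (u \<longlongrightarrow> L) (at \<xi> within Gamma \<xi>)"
    using AE_sphere_borel_norm
  proof eventually_elim
    case (elim \<xi>)
    then have "\<forall>i j b. \<exists>L. ((\<lambda>x. \<integral>\<eta>. elastic_entry la mu x i j \<eta> \<partial>\<nu> (j, b)) \<longlongrightarrow> L) (at \<xi> within Gamma \<xi>)" by blast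
    then obtain L where L: "\<And>i j b. ((\<lambda>x. \<integral>\<eta>. elastic_entry la mu x i j \<eta> \<partial>\<nu> (j, b)) \<longlongrightarrow> L i j b) (at \<xi> within Gamma \<xi>)"
      by metis
    have "((\<lambda>x. u x $ i) \<longlongrightarrow> (\<Sum>j\<in>UNIV. L i j True - L i j False)) (at \<xi> within Gamma \<xi>)" for i
    proof (rule Lim_transform_eventually)
      show "((\<lambda>x. \<Sum>j\<in>UNIV. (\<integral>\<eta>. elastic_entry la mu x i j \<eta> \<partial>\<nu> (j, True)) - (\<integral>\<eta>. elastic_entry la mu x i j \<eta> \<partial>\<nu> (j, False))) \<longlongrightarrow> (\<Sum>j\<in>UNIV. L i j True - L i j False)) (at \<xi> within Gamma \<xi>)"
        by (intro tendsto_sum tendsto_diff L)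
      show "\<forall>\<^sub>F x in at \<xi> within Gamma \<xi>. (\<Sum>j\<in>UNIV. (\<integral>\<eta>. elastic_entry la mu x i j \<eta> \<partial>\<nu> (j, True)) - (\<integral>\<eta>. elastic_entry la mu x i j \<eta> \<partial>\<nu> (j, False))) = u x $ i"
        unfolding eventually_at_filter by (rule always_eventually) (auto simp: Gamma_props(1)[OF _ elim(2)] rep)
    qed
    then have "(u \<longlongrightarrow> (\<chi> i. \<Sum>j\<in>UNIV. L i j True - L i j False)) (at \<xi> within Gamma \<xi>)"
      by (intro vec_tendstoI) simp
    then show ?case by blast
  qed
qed

text \<open>For \<open>p > 1\<close> the boundary parts are uniformly integrable: apart from an
  amount at most \<open>t^(1-p) C\<close> they are bounded by \<open>t + 1\<close>. The limit
  measure of a compact null set is then at most \<open>t^(1-p) C\<close> for every \<open>t\<close>.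
  Inner regularity extends this from compact sets to all null sets.\<close>

lemma boundary_measure_abs_continuous:
  assumes u: "u \<in> hpe la mu p" and p: "1 < p"
    and \<nu>: "sets \<nu> = sets borel" "emeasure \<nu> UNIV < \<infinity>"
    and wc: "\<And>g. continuous_on (sphere 0 1) g \<Longrightarrow> g \<in> borel_measurable borel \<Longrightarrow>
       (\<lambda>n. \<integral>x. g x * bd_part u k (s n) x \<partial>sphere_borel) \<longlonglongrightarrow> (\<integral>x. g x \<partial>\<nu>)"
    and N: "N \<in> null_sets sphere_borel"
  shows "emeasure \<nu> N = 0"
proof -
  have lu: "lame_solution la mu u" using u by (simp add: hpe_def)
  have spc: "space \<nu> = UNIV" using sets_eq_imp_space_eq[OF \<nu>(1)] by simp
  interpret n: finite_measure \<nu> by (rule finite_measureI) (use \<nu>(2) spc in auto)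
  interpret sb: finite_measure sphere_borel by (rule finite_sphere_borel)
  obtain C where C: "C \<ge> 0" "\<And>n. (\<integral>\<^sup>+\<eta>. ennreal (norm (u (rad n *\<^sub>R \<eta>)) powr p) \<partial>sphere_measure) \<le> ennreal C"
    using hpe_L1_bound[OF u] p by (meson less_imp_le)
  define W where "W n \<eta> = indicator (sphere 0 1) \<eta> * norm (u (rad n *\<^sub>R \<eta>)) powr p" for n \<eta>
  have Wm[measurable]: "W n \<in> borel_measurable borel" for n
  proof -
    have "continuous_on (sphere 0 1) (\<lambda>\<eta>. norm (u (rad n *\<^sub>R \<eta>)) powr p)"
      using lame_dilate_continuous[OF lu] p by (intro continuous_on_powr' continuous_on_norm continuous_on_const) auto
    from borel_measurable_continuous_on_indicator[OF _ this] show ?thesis by (simp add: W_def[abs_def])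
  qed
  have W0: "0 \<le> W n \<eta>" for n \<eta> by (simp add: W_def)
  have Wint: "(\<integral>\<^sup>+\<eta>. ennreal (W n \<eta>) \<partial>sphere_borel) \<le> ennreal C" for n
  proof -
    have "(\<integral>\<^sup>+\<eta>. ennreal (W n \<eta>) \<partial>sphere_borel) = (\<integral>\<^sup>+\<eta>. ennreal (W n \<eta>) \<partial>sphere_measure)"
      by (rule nn_integral_sphere_borel) measurable
    also have "\<dots> = (\<integral>\<^sup>+\<eta>. ennreal (norm (u (rad n *\<^sub>R \<eta>)) powr p) \<partial>sphere_measure)"
      by (intro nn_integral_cong) (simp add: W_def)
    finally show ?thesis using C(2) by simp
  qed
  have Wi: "integrable sphere_borel (W n)" for n
    using Wint[of n] W0 by (intro integrableI_nonneg) (auto intro: le_less_trans)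
  have WC: "(\<integral>\<eta>. W n \<eta> \<partial>sphere_borel) \<le> C" for n
  proof -
    have "ennreal (\<integral>\<eta>. W n \<eta> \<partial>sphere_borel) \<le> ennreal C"
      using nn_integral_eq_integral[OF Wi] W0 Wint[of n] by simp
    then show ?thesis using ennreal_le_iff[OF C(1)] by blast
  qed
  \<comment> \<open>Where \<open>a > t\<close>, the factor \<open>(t / a)^(1-p)\<close> is at least
    1 because \<open>1 - p\<close> is negative, so multiplying \<open>a\<close> by it can only
    enlarge it.\<close>
  have young: "a \<le> t + t powr (1 - p) * a powr p" if "t > 0" "a \<ge> 0" for t a :: real
  proof (cases "a \<le> t")
    case False
    then have a: "a > t" "a > 0" using that by auto
    have "t powr (1 - p) \<ge> a powr (1 - p)" using that a p by (intro powr_mono2') auto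
    then have "t powr (1 - p) * a powr p \<ge> a powr (1 - p) * a powr p" by (intro mult_right_mono) auto
    also have "a powr (1 - p) * a powr p = a" using a by (simp flip: powr_add)
    finally show ?thesis using that by simp
  qed (use powr_ge_zero in \<open>auto intro: add_increasing2\<close>)
  have "emeasure \<nu> K = 0" if K: "compact K" "K \<subseteq> N" for K
  proof (cases "K = {}")
    case False
    have Ks: "K \<in> sets borel" using K by (intro borel_compact)
    have K0: "emeasure sphere_borel K = 0"
      using emeasure_mono[of K N sphere_borel] N K by (simp add: null_sets_def)
    \<comment> \<open>Continuous functions decreasing to the indicator of \<open>K\<close>: weak
      convergence gives information about continuous test functions only.\<close>
    define g where "g m x = max 0 (1 - real m * infdist x K)" for m :: nat and x :: vec3
    have gc: "continuous_on A (g m)" for A m unfolding g_def[abs_def] by (intro continuous_intros)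
    have gm[measurable]: "g m \<in> borel_measurable borel" for m by (rule borel_measurable_continuous_onI[OF gc])
    have g01: "0 \<le> g m x" "g m x \<le> 1" for m x by (auto simp: g_def infdist_nonneg)
    have gK: "indicator K x \<le> g m x" for m x by (auto simp: g_def indicator_def)
    have glim: "(\<lambda>m. g m x) \<longlonglongrightarrow> indicator K x" for x
    proof (cases "x \<in> K")
      case False
      then have "infdist x K > 0" using K \<open>K \<noteq> {}\<close> by (simp add: infdist_pos_not_in_closed compact_imp_closed)
      then obtain M where M: "1 < real M * infdist x K" using reals_Archimedean3 by blast
      have "g m x = 0" if "m \<ge> M" for m
      proof -
        have "real M * infdist x K \<le> real m * infdist x K" using that by (intro mult_right_mono infdist_nonneg) auto
        then show ?thesis using M by (simp add: g_def)
      qed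
      then have "eventually (\<lambda>m. g m x = 0) sequentially" by (auto simp: eventually_sequentially)
      then show ?thesis using False by (simp add: tendsto_eventually)
    qed (simp add: g_def)
    have gi: "integrable sphere_borel (g m)" "integrable \<nu> (g m)" for m
    proof -
      show "integrable sphere_borel (g m)" by (rule sb.integrable_const_bound[of _ 1]) (use g01 in auto)
      have "g m \<in> borel_measurable \<nu>" by (subst measurable_cong_sets[OF \<nu>(1) refl]) (rule gm)
      then show "integrable \<nu> (g m)" by (intro n.integrable_const_bound[of _ 1]) (use g01 in auto)
    qed
    \<comment> \<open>In the coefficient \<open>t + 1\<close> the 1 is the constant built into
      \<open>bd_part\<close>. First the index of the weak limit tends to infinity with
      \<open>m\<close> fixed, then \<open>m\<close>; the integral of \<open>g m\<close> tends to the
      surface measure of \<open>K\<close>, which is 0.\<close>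
    have bound: "measure \<nu> K \<le> t powr (1 - p) * C" if t: "t > 0" for t
    proof -
      have "measure \<nu> K \<le> (t + 1) * (\<integral>x. g m x \<partial>sphere_borel) + t powr (1 - p) * C" for m
      proof -
        have "measure \<nu> K = (\<integral>x. indicator K x \<partial>\<nu>)" using Ks \<nu>(1) by simp
        also have "\<dots> \<le> (\<integral>x. g m x \<partial>\<nu>)"
          using Ks \<nu>(1) gK gi(2) by (intro integral_mono) (auto simp: n.emeasure_finite less_top[symmetric])
        also have "\<dots> \<le> (t + 1) * (\<integral>x. g m x \<partial>sphere_borel) + t powr (1 - p) * C"
        proof (rule LIMSEQ_le_const2[OF wc[OF gc gm]], intro exI allI impI)
          fix n
          have le: "g m x * bd_part u k (s n) x \<le> (t + 1) * g m x + t powr (1 - p) * W (s n) x" for x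
          proof (cases "norm x = 1")
            case True
            have "bd_part u k (s n) x \<le> (t + 1) + t powr (1 - p) * W (s n) x"
              using bd_part_le[of u k "s n" x] young[OF t norm_ge_zero[of "u (rad (s n) *\<^sub>R x)"]] True by (simp add: W_def)
            then have "g m x * bd_part u k (s n) x \<le> g m x * ((t + 1) + t powr (1 - p) * W (s n) x)"
              using g01 by (intro mult_left_mono) auto
            also have "\<dots> = (t + 1) * g m x + g m x * (t powr (1 - p) * W (s n) x)" by (simp add: algebra_simps)
            also have "g m x * (t powr (1 - p) * W (s n) x) \<le> 1 * (t powr (1 - p) * W (s n) x)"
              using g01 W0 by (intro mult_right_mono) auto
            finally show ?thesis by simp
          qed (use g01 t in \<open>simp add: bd_part_def W_def\<close>)
          have "(\<integral>x. g m x * bd_part u k (s n) x \<partial>sphere_borel) \<le> (\<integral>x. (t + 1) * g m x + t powr (1 - p) * W (s n) x \<partial>sphere_borel)"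
            using gi(1) Wi le g01 bd_part_nonneg t W0 by (intro Bochner_Integration.integral_mono') auto
          also have "\<dots> = (t + 1) * (\<integral>x. g m x \<partial>sphere_borel) + t powr (1 - p) * (\<integral>x. W (s n) x \<partial>sphere_borel)"
            using gi(1) Wi by simp
          also have "\<dots> \<le> (t + 1) * (\<integral>x. g m x \<partial>sphere_borel) + t powr (1 - p) * C"
            using WC by (intro add_left_mono mult_left_mono) auto
          finally show "(\<integral>x. g m x * bd_part u k (s n) x \<partial>sphere_borel) \<le> (t + 1) * (\<integral>x. g m x \<partial>sphere_borel) + t powr (1 - p) * C" .
        qed
        finally show ?thesis .
      qed
      moreover have "(\<lambda>m. (t + 1) * (\<integral>x. g m x \<partial>sphere_borel) + t powr (1 - p) * C) \<longlonglongrightarrow> (t + 1) * (\<integral>x. indicator K x \<partial>sphere_borel) + t powr (1 - p) * C"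
      proof (intro tendsto_intros integral_dominated_convergence[where w = "\<lambda>_. 1"])
        show "AE x in sphere_borel. norm (g m x) \<le> 1" for m using g01 by auto
      qed (use Ks glim in auto)
      moreover have "(\<integral>x. indicator K x \<partial>sphere_borel) = (0::real)" using K0 Ks by (simp add: measure_def)
      ultimately show ?thesis by (intro LIMSEQ_le_const[where X = "\<lambda>m. (t + 1) * (\<integral>x. g m x \<partial>sphere_borel) + t powr (1 - p) * C"]) auto
    qed
    \<comment> \<open>The exponent \<open>1 - p\<close> is negative, so letting \<open>t\<close>
      grow removes the last term.\<close>
    have "((\<lambda>t. t powr (1 - p) * C) \<longlongrightarrow> 0 * C) at_top"
      using p by (intro tendsto_intros tendsto_neg_powr filterlim_ident) auto
    moreover have "eventually (\<lambda>t. measure \<nu> K \<le> t powr (1 - p) * C) at_top"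
      using eventually_gt_at_top[of "0::real"] by eventually_elim (rule bound)
    ultimately have "measure \<nu> K \<le> 0 * C" by (intro tendsto_lowerbound) auto
    then have "measure \<nu> K = 0" using measure_nonneg[of \<nu> K] by simp
    then show ?thesis by (simp add: n.emeasure_eq_measure)
  qed simp
  then have "(SUP K\<in>{K. K \<subseteq> N \<and> compact K}. emeasure \<nu> K) = 0"
    by (intro antisym SUP_least) auto
  moreover have "N \<in> sets borel" using N by (simp add: null_sets_def)
  then have "emeasure \<nu> N = (SUP K\<in>{K. K \<subseteq> N \<and> compact K}. emeasure \<nu> K)"
    using \<nu> spc by (intro inner_regular) auto
  ultimately show ?thesis by (rule trans[rotated])
qed

section \<open>Exponents above 1: representing functions and their integrability\<close>

lemma radial_in_Gamma: "norm \<xi> = 1 \<Longrightarrow> rad n *\<^sub>R \<xi> \<in> Gamma \<xi> - {\<xi>}"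
proof -
  assume \<xi>: "norm \<xi> = 1"
  have "(1 - rad n) *\<^sub>R 0 + rad n *\<^sub>R \<xi> \<in> convex hull (insert \<xi> (cball 0 (1/2)))"
    using rad(1,2)[of n] by (intro convexD[OF convex_convex_hull] hull_inc) auto
  moreover have "rad n *\<^sub>R \<xi> \<noteq> \<xi>"
  proof
    assume "rad n *\<^sub>R \<xi> = \<xi>"
    then have "norm (rad n *\<^sub>R \<xi>) = norm \<xi>" by simp
    then show False using \<xi> rad(1,2)[of n] by simp
  qed
  ultimately show ?thesis using rad_in_ball[OF \<xi>, of n] by (simp add: Gamma_def)
qed

lemma radial_limit:
  assumes "norm \<xi> = 1" "(u \<longlongrightarrow> L) (at \<xi> within Gamma \<xi>)"
  shows "(\<lambda>n. u (rad n *\<^sub>R \<xi>)) \<longlonglongrightarrow> L"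
proof -
  have "(\<lambda>n. rad n *\<^sub>R \<xi>) \<longlonglongrightarrow> 1 *\<^sub>R \<xi>" by (intro tendsto_intros rad)
  then show ?thesis
    using assms(2) radial_in_Gamma[OF assms(1)] unfolding tendsto_at_iff_sequentially by (auto simp: o_def)
qed

text \<open>Each boundary measure now has an integrable density. Component \<open>j\<close> of
  \<open>f\<close> is the density of the positive part minus that of the negative part, where the
  constants added in \<open>bd_part\<close> cancel.\<close>

theorem hp_representation:
  assumes mu: "mu > 0" "2 * mu + la > 0" and u: "u \<in> hpe la mu p" and p: "1 < p"
  shows "\<exists>f. integrable sphere_measure f \<and> (\<forall>x\<in>ball 0 1. u x = elastic_poisson la mu f x) \<and>
     (AE \<xi> in sphere_measure. (u \<longlongrightarrow> f \<xi>) (at \<xi> within Gamma \<xi>))"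
proof -
  obtain s \<nu> where \<nu>: "\<And>k. sets (\<nu> k) = sets borel" "\<And>k. emeasure (\<nu> k) UNIV < \<infinity>"
    and wc: "\<And>k g. continuous_on (sphere 0 1) g \<Longrightarrow> g \<in> borel_measurable borel \<Longrightarrow>
       (\<lambda>n. \<integral>x. g x * bd_part u k (s n) x \<partial>sphere_borel) \<longlonglongrightarrow> (\<integral>x. g x \<partial>\<nu> k)"
    and rep: "\<And>x i. norm x < 1 \<Longrightarrow> u x $ i = (\<Sum>j\<in>UNIV. (\<integral>\<eta>. elastic_entry la mu x i j \<eta> \<partial>\<nu> (j, True)) - (\<integral>\<eta>. elastic_entry la mu x i j \<eta> \<partial>\<nu> (j, False)))"
    using boundary_measures[OF mu u less_imp_le[OF p]] by (elim exE conjE) (use that in blast)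
  have "\<forall>k. \<exists>g::vec3 \<Rightarrow> real. g \<in> borel_measurable borel \<and> (\<forall>x. 0 \<le> g x) \<and> integrable sphere_borel g \<and> \<nu> k = density sphere_borel (\<lambda>x. ennreal (g x))"
    using finite_abs_continuous_density[OF \<nu>] boundary_measure_abs_continuous[OF u p \<nu> wc] by blast
  then obtain g where g: "\<And>k. g k \<in> borel_measurable borel" "\<And>k x. 0 \<le> g k x" "\<And>k. integrable sphere_borel (g k)"
    "\<And>k. \<nu> k = density sphere_borel (\<lambda>x. ennreal (g k x))" by metis
  have gi: "integrable sphere_measure (g k)" for k using g(3) integrable_sphere_borel[OF g(1)] by blast
  define f where "f \<eta> = (\<chi> j. g (j, True) \<eta> - g (j, False) \<eta>)" for \<eta>
  have fi: "integrable sphere_measure f"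
    by (rule integrable_vec3I) (simp add: f_def gi)
  have uf: "u x = elastic_poisson la mu f x" if x: "norm x < 1" for x
  proof -
    have "u x $ i = elastic_poisson la mu f x $ i" for i
    proof -
      have "u x $ i = (\<Sum>j\<in>UNIV. (\<integral>\<eta>. elastic_entry la mu x i j \<eta> * g (j, True) \<eta> \<partial>sphere_measure) - (\<integral>\<eta>. elastic_entry la mu x i j \<eta> * g (j, False) \<eta> \<partial>sphere_measure))"
        unfolding rep[OF x] g(4) elastic_entry_density_integral[OF mu x g(1,2)] ..
      also have "\<dots> = (\<Sum>j\<in>UNIV. \<integral>\<eta>. elastic_entry la mu x i j \<eta> * f \<eta> $ j \<partial>sphere_measure)"
        using elastic_entry_integrable[OF mu x gi] by (simp add: f_def right_diff_distrib)
      finally show ?thesis unfolding elastic_poisson_nth[OF mu x fi] .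
    qed
    then show ?thesis by (simp add: vec_eq_iff)
  qed
  have "AE \<xi> in sphere_measure. (u \<longlongrightarrow> f \<xi>) (at \<xi> within Gamma \<xi>)"
    using AE_sphere_borelD[OF elastic_poisson_converges[OF mu fi]]
  proof eventually_elim
    case (elim \<xi>)
    have "\<forall>\<^sub>F x in at \<xi> within Gamma \<xi>. elastic_poisson la mu f x = u x"
      unfolding eventually_at_filter by (rule always_eventually) (use elim in \<open>auto simp: Gamma_props(1) uf\<close>)
    then show ?case using elim Lim_transform_eventually by blast
  qed
  then show ?thesis using fi uf by auto
qed

text \<open>The radii \<open>rad n\<close> approach each boundary point inside its cone, so
  \<open>f\<close> is almost everywhere a radial limit of \<open>u\<close>, and Fatou's lemma
  transfers the bound on the means.\<close>

theorem hp_limit_in_Lp: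
  assumes u: "u \<in> hpe la mu p" and p: "1 < p" and f: "f \<in> borel_measurable sphere_measure"
    and lim: "AE \<xi> in sphere_measure. (u \<longlongrightarrow> f \<xi>) (at \<xi> within Gamma \<xi>)"
  shows "f \<in> Lp_sphere p"
proof -
  have lu: "lame_solution la mu u" using u by (simp add: hpe_def)
  obtain C where C: "\<And>n. (\<integral>\<^sup>+\<eta>. ennreal (norm (u (rad n *\<^sub>R \<eta>)) powr p) \<partial>sphere_measure) \<le> ennreal C"
    using hpe_L1_bound[OF u] p by (meson less_imp_le)
  note dilate_measurable[OF lu, measurable]
  have "(\<integral>\<^sup>+\<eta>. ennreal (norm (f \<eta>) powr p) \<partial>sphere_measure) \<le> (\<integral>\<^sup>+\<eta>. liminf (\<lambda>n. ennreal (norm (u (rad n *\<^sub>R \<eta>)) powr p)) \<partial>sphere_measure)"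
  proof (rule nn_integral_mono_AE)
    show "AE \<eta> in sphere_measure. ennreal (norm (f \<eta>) powr p) \<le> liminf (\<lambda>n. ennreal (norm (u (rad n *\<^sub>R \<eta>)) powr p))"
      using lim AE_space
    proof eventually_elim
      case (elim \<eta>)
      then have "(\<lambda>n. u (rad n *\<^sub>R \<eta>)) \<longlonglongrightarrow> f \<eta>" by (intro radial_limit) auto
      then have "(\<lambda>n. norm (u (rad n *\<^sub>R \<eta>)) powr p) \<longlonglongrightarrow> norm (f \<eta>) powr p"
        using p by (intro tendsto_powr' tendsto_norm tendsto_const) auto
      then have "(\<lambda>n. ennreal (norm (u (rad n *\<^sub>R \<eta>)) powr p)) \<longlonglongrightarrow> ennreal (norm (f \<eta>) powr p)"
        by (rule tendsto_ennrealI)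
      from lim_imp_Liminf[OF sequentially_bot this] show ?case by (rule eq_refl[OF sym])
    qed
  qed
  also have "\<dots> \<le> liminf (\<lambda>n. \<integral>\<^sup>+\<eta>. ennreal (norm (u (rad n *\<^sub>R \<eta>)) powr p) \<partial>sphere_measure)"
    by (rule nn_integral_liminf) measurable
  also have "\<dots> \<le> ennreal C"
    using C by (intro Liminf_le) (auto intro: always_eventually)
  finally show ?thesis using f by (auto simp: Lp_sphere_def intro: le_less_trans)
qed

text \<open>The exponent 2 stands for any finite exponent above 1. It gives bounded solutions a
  representing function, whose essential bound is then read off from the radial limits.\<close>

lemma hinfe_subset_hpe: "hinfe la mu \<subseteq> hpe la mu 2"
proof
  fix u assume u: "u \<in> hinfe la mu"
  then obtain B where B: "B > 0" "\<And>x. x \<in> ball 0 1 \<Longrightarrow> norm (u x) \<le> B"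
    unfolding hinfe_def bounded_pos by auto
  have "(\<integral>\<^sup>+\<eta>. ennreal (norm (u (r *\<^sub>R \<eta>)) powr 2) \<partial>sphere_measure) \<le> ennreal (B powr 2 * (4 * pi))" if r: "r \<in> {0..<1}" for r
  proof -
    have "(\<integral>\<^sup>+\<eta>. ennreal (norm (u (r *\<^sub>R \<eta>)) powr 2) \<partial>sphere_measure) \<le> (\<integral>\<^sup>+\<eta>. ennreal (B powr 2) \<partial>sphere_measure)"
    proof (rule nn_integral_mono)
      fix \<eta> :: vec3 assume "\<eta> \<in> space sphere_measure"
      then have "norm (u (r *\<^sub>R \<eta>)) \<le> B" using r by (intro B) simp
      then show "ennreal (norm (u (r *\<^sub>R \<eta>)) powr 2) \<le> ennreal (B powr 2)" by (intro ennreal_leI powr_mono2) auto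
    qed
    also have "\<dots> = ennreal (B powr 2) * ennreal (4 * pi)"
      unfolding nn_integral_const space_sphere_measure emeasure_sphere_measure_UNIV ..
    also have "\<dots> = ennreal (B powr 2 * (4 * pi))" by (rule ennreal_mult'[symmetric]) simp
    finally show ?thesis .
  qed
  then show "u \<in> hpe la mu 2" using u unfolding hpe_def hinfe_def by blast
qed

theorem mainTheorem6:
  fixes la mu :: real
  assumes "mu > 0" and "2 * mu + la > 0"
  shows "(\<forall>f. integrable sphere_measure f \<longrightarrow>
            (AE \<xi> in sphere_measure.
               (elastic_poisson la mu f \<longlongrightarrow> f \<xi>) (at \<xi> within Gamma \<xi>)))
       \<and> (\<forall>p u. 1 < p \<and> u \<in> hpe la mu p \<longrightarrow>
            (\<exists>f \<in> Lp_sphere p. (\<forall>x\<in>ball 0 1. u x = elastic_poisson la mu f x) \<and>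
               (AE \<xi> in sphere_measure. (u \<longlongrightarrow> f \<xi>) (at \<xi> within Gamma \<xi>))))
       \<and> (\<forall>u \<in> hinfe la mu.
            (\<exists>f \<in> Linf_sphere. (\<forall>x\<in>ball 0 1. u x = elastic_poisson la mu f x) \<and>
               (AE \<xi> in sphere_measure. (u \<longlongrightarrow> f \<xi>) (at \<xi> within Gamma \<xi>))))
       \<and> (\<forall>u \<in> hpe la mu 1.
            (AE \<xi> in sphere_measure. \<exists>L. (u \<longlongrightarrow> L) (at \<xi> within Gamma \<xi>)))"
proof (intro conjI allI impI ballI)
  fix f :: "vec3 \<Rightarrow> vec3" assume "integrable sphere_measure f"
  from AE_sphere_borelD[OF elastic_poisson_converges[OF assms this]]
  show "AE \<xi> in sphere_measure. (elastic_poisson la mu f \<longlongrightarrow> f \<xi>) (at \<xi> within Gamma \<xi>)"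
    by (rule eventually_mono) blast
next
  fix p :: real and u assume pu: "1 < p \<and> u \<in> hpe la mu p"
  then obtain f where f: "integrable sphere_measure f" "\<forall>x\<in>ball 0 1. u x = elastic_poisson la mu f x"
    "AE \<xi> in sphere_measure. (u \<longlongrightarrow> f \<xi>) (at \<xi> within Gamma \<xi>)"
    using hp_representation[OF assms] by blast
  then have "f \<in> Lp_sphere p" using pu by (intro hp_limit_in_Lp[OF _ _ borel_measurable_integrable]) auto
  with f show "\<exists>f \<in> Lp_sphere p. (\<forall>x\<in>ball 0 1. u x = elastic_poisson la mu f x) \<and>
     (AE \<xi> in sphere_measure. (u \<longlongrightarrow> f \<xi>) (at \<xi> within Gamma \<xi>))" by blast
next
  fix u assume u: "u \<in> hinfe la mu"
  then have u2: "u \<in> hpe la mu 2" using hinfe_subset_hpe by blast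
  obtain B where B: "\<And>x. x \<in> ball 0 1 \<Longrightarrow> norm (u x) \<le> B"
    using u unfolding hinfe_def bounded_iff by blast
  obtain f where f: "integrable sphere_measure f" "\<forall>x\<in>ball 0 1. u x = elastic_poisson la mu f x"
    "AE \<xi> in sphere_measure. (u \<longlongrightarrow> f \<xi>) (at \<xi> within Gamma \<xi>)"
    using hp_representation[OF assms u2] by auto
  have "AE \<xi> in sphere_measure. norm (f \<xi>) \<le> B"
    using f(3) AE_space
  proof eventually_elim
    case (elim \<xi>)
    then have n: "norm \<xi> = 1" by simp
    have "(\<lambda>n. norm (u (rad n *\<^sub>R \<xi>))) \<longlonglongrightarrow> norm (f \<xi>)" using radial_limit[OF n elim(1)] by (rule tendsto_norm)
    then show ?case by (rule LIMSEQ_le_const2) (use B rad_in_ball[OF n] in auto)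
  qed
  then have "f \<in> Linf_sphere" using f(1) unfolding Linf_sphere_def by auto
  with f show "\<exists>f \<in> Linf_sphere. (\<forall>x\<in>ball 0 1. u x = elastic_poisson la mu f x) \<and>
     (AE \<xi> in sphere_measure. (u \<longlongrightarrow> f \<xi>) (at \<xi> within Gamma \<xi>))" by blast
next
  fix u assume "u \<in> hpe la mu 1"
  then show "AE \<xi> in sphere_measure. \<exists>L. (u \<longlongrightarrow> L) (at \<xi> within Gamma \<xi>)" by (rule h1_limits[OF assms])
qed

end
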